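(* Let $\gamma\in\mathbb{R}$ and let $z_0=\begin{pmatrix}u_0\\ \rho_0\end{pmatrix}\in W^{1,\infty}(\mathbb{S})\times L^{\infty}(\mathbb{S})$. If there exists $\alpha>0$ such that $\rho_0(x)\ge \alpha$ for a.e. $x\in\mathbb{S}$, then the periodic two-component $\mu$-Hunter-Saxton system with initial data $z_0$ has an admissible weak solution $$z=\begin{pmatrix}u\\ \rho\end{pmatrix}\in C(\mathbb{R}_+;H^1(\mathbb{S})\times L^2(\mathbb{S}))\cap L^{\infty}(\mathbb{R}_+;H^1(\mathbb{S})\times L^2(\mathbb{S})).$$ Furthermore, $$u\in L^{\infty}_{loc}(\mathbb{R}_+;W^{1,\infty}(\mathbb{S}))\quad\text{and}\quad \rho\in L^{\infty}_{loc}(\mathbb{R}_+;L^{\infty}(\mathbb{S})).$$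
   Context: Notation: $\mathbb{S}=\mathbb{R}/\mathbb{Z}$; functions on $\mathbb{S}$ are identified with $1$-periodic functions on $\mathbb{R}$; $\mathbb{R}_+=[0,\infty)$; $\mu(u)=\int_{\mathbb{S}}u\,dx$. The periodic two-component $\mu$-Hunter-Saxton system is $$-u_{txx}=2\mu(u)u_x-2u_xu_{xx}-uu_{xxx}+\rho\rho_x-\gamma u_{xxx},\qquad \rho_t=(\rho u)_x+\gamma\rho_x,\qquad t>0,\ x\in\mathbb{R},$$ with $u(0,x)=u_0(x)$, $\rho(0,x)=\rho_0(x)$, $u(t,x+1)=u(t,x)$, $\rho(t,x+1)=\rho(t,x)$. It is studied under the standing assumption $\mu(u_t)=\mu(u)_t=0$, so that $\mu(u(t,\cdot))=\mu_0:=\mu(u_0)$ for all $t$. Under this assumption it is written in the equivalent form $$u_t-(u+\gamma)u_x=\partial_x g*\Big(2\mu_0u+\tfrac12u_x^2+\tfrac12\rho^2\Big),\qquad \rho_t-(\rho u)_x=\gamma\rho_x,$$ where $*$ is convolution on $\mathbb{S}$ in the variable $x$ and $g$ is the $1$-periodic function with $g(x)=\frac12x(x-1)+\frac{13}{12}$ for $x\in[0,1)$ (the Green's function of $A=\mu-\partial_x^2$ on $\mathbb{S}$). A weak solution satisfies the system in this form in the sense of distributions. Admissible weak solution: $z=\begin{pmatrix}u\\ \rho\end{pmatrix}$ is an admissible weak solution with initial data $z_0=\begin{pmatrix}u_0\\ \rho_0\end{pmatrix}$ if $z\in L^{\infty}_{loc}((0,\infty);H^1(\mathbb{S})\times L^2(\mathbb{S}))$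 satisfies the system (in the form above) in the sense of distributions on $\mathbb{R}_+\times\mathbb{R}$, $z(t,\cdot)\to z_0$ as $t\to0^+$ in the sense of distributions, and moreover $$\|u_x(t,\cdot)\|_{L^2(\mathbb{S})}^2+\|\rho(t,\cdot)\|_{L^2(\mathbb{S})}^2\le\|u_{0,x}\|_{L^2(\mathbb{S})}^2+\|\rho_0\|_{L^2(\mathbb{S})}^2 .$$ *)

theory Defs
  imports "HOL-Analysis.Analysis" "HOL-Probability.Essential_Supremum"
    "HOL-Library.Function_Algebras" "HOL-Library.Periodic_Fun"
begin

section \<open>Function spaces on the circle\<close>

text \<open>
  Functions on the circle are 1-periodic functions on the real line, and elements of Lebesgue
  and Sobolev spaces are given by periodic representatives; the norms below do not depend on the
  representative. The predicate of the locale \<^locale>\<open>periodic_fun_simple'\<close> is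
  \<open>\<forall>x. f (x + 1) = f x\<close>.
\<close>

abbreviation circle :: "real measure" where
  "circle \<equiv> lebesgue_on {0..1}"

definition mean :: "(real \<Rightarrow> real) \<Rightarrow> real" where
  "mean f = (LINT x|circle. f x)"

definition L1 :: "(real \<Rightarrow> real) set" where
  "L1 = {f. periodic_fun_simple' f \<and> integrable circle f}"

definition L2 :: "(real \<Rightarrow> real) set" where
  "L2 = {f. periodic_fun_simple' f \<and> f \<in> borel_measurable circle
            \<and> integrable circle (\<lambda>x. (f x)\<^sup>2)}"

definition Linf :: "(real \<Rightarrow> real) set" where
  "Linf = {f. periodic_fun_simple' f \<and> f \<in> borel_measurable circle
              \<and> esssup circle (\<lambda>x. ereal \<bar>f x\<bar>) < \<infinity>}"

definition norm_L2 :: "(real \<Rightarrow> real) \<Rightarrow> real" where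
  "norm_L2 f = sqrt (LINT x|circle. (f x)\<^sup>2)"

definition norm_Linf :: "(real \<Rightarrow> real) \<Rightarrow> real" where
  "norm_Linf f = real_of_ereal (esssup circle (\<lambda>x. ereal \<bar>f x\<bar>))"

primrec Ck :: "nat \<Rightarrow> ('a::real_normed_vector \<Rightarrow> real) \<Rightarrow> bool" where
  "Ck 0 f \<longleftrightarrow> continuous_on UNIV f"
| "Ck (Suc k) f \<longleftrightarrow> (\<forall>x. f differentiable (at x))
                    \<and> (\<forall>v. Ck k (\<lambda>x. frechet_derivative f (at x) v))"

definition smooth :: "('a::real_normed_vector \<Rightarrow> real) \<Rightarrow> bool" where
  "smooth f \<longleftrightarrow> (\<forall>k. Ck k f)"

definition test_fun :: "'a::real_normed_vector set \<Rightarrow> ('a \<Rightarrow> real) \<Rightarrow> bool" where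
  "test_fun \<Omega> \<phi> \<longleftrightarrow> smooth \<phi> \<and> compact (closure {p. \<phi> p \<noteq> 0}) \<and> closure {p. \<phi> p \<noteq> 0} \<subseteq> \<Omega>"

definition is_weak_deriv :: "(real \<Rightarrow> real) \<Rightarrow> (real \<Rightarrow> real) \<Rightarrow> bool" where
  "is_weak_deriv f g \<longleftrightarrow> f \<in> L1 \<and> g \<in> L1 \<and>
     (\<forall>\<phi>. smooth \<phi> \<and> periodic_fun_simple' \<phi> \<longrightarrow>
        (LINT x|circle. f x * deriv \<phi> x) = - (LINT x|circle. g x * \<phi> x))"

text \<open>
  The weak derivative is unique up to a null set; \<open>weak_deriv f\<close> is some representative, and it
  is only ever used under integrals in \<open>x\<close> or in essential suprema.
\<close>

definition weak_deriv :: "(real \<Rightarrow> real) \<Rightarrow> real \<Rightarrow> real" where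
  "weak_deriv f = (SOME g. is_weak_deriv f g)"

definition H1 :: "(real \<Rightarrow> real) set" where
  "H1 = {f \<in> L2. \<exists>g \<in> L2. is_weak_deriv f g}"

definition W1inf :: "(real \<Rightarrow> real) set" where
  "W1inf = {f \<in> Linf. \<exists>g \<in> Linf. is_weak_deriv f g}"

definition norm_H1 :: "(real \<Rightarrow> real) \<Rightarrow> real" where
  "norm_H1 f = sqrt ((norm_L2 f)\<^sup>2 + (norm_L2 (weak_deriv f))\<^sup>2)"

definition norm_W1inf :: "(real \<Rightarrow> real) \<Rightarrow> real" where
  "norm_W1inf f = norm_Linf f + norm_Linf (weak_deriv f)"

definition norm_H1_L2 :: "(real \<Rightarrow> real) \<times> (real \<Rightarrow> real) \<Rightarrow> real" where
  "norm_H1_L2 z = sqrt ((norm_H1 (fst z))\<^sup>2 + (norm_L2 (snd z))\<^sup>2)"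

section \<open>Functions of time with values in a function space\<close>

text \<open>
  A normed space is given by its set \<open>X\<close> of representatives and its norm \<open>N\<close>, and \<open>I\<close> is an
  interval of times.
\<close>

definition C_into ::
  "real set \<Rightarrow> 'a::ab_group_add set \<Rightarrow> ('a \<Rightarrow> real) \<Rightarrow> (real \<Rightarrow> 'a) set" where
  "C_into I X N = {z. \<forall>t\<in>I. z t \<in> X \<and> ((\<lambda>s. N (z s - z t)) \<longlongrightarrow> 0) (at t within I)}"

definition strongly_measurable ::
  "real set \<Rightarrow> 'a::ab_group_add set \<Rightarrow> ('a \<Rightarrow> real) \<Rightarrow> (real \<Rightarrow> 'a) \<Rightarrow> bool" where
  "strongly_measurable I X N z \<longleftrightarrow>
     (\<exists>s :: nat \<Rightarrow> real \<Rightarrow> 'a.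
        (\<forall>n. finite (s n ` I) \<and> s n ` I \<subseteq> X \<and> (\<forall>a. {t \<in> I. s n t = a} \<in> sets lebesgue)) \<and>
        (AE t in lebesgue_on I. (\<lambda>n. N (s n t - z t)) \<longlonglongrightarrow> 0))"

definition Linf_into ::
  "real set \<Rightarrow> 'a::ab_group_add set \<Rightarrow> ('a \<Rightarrow> real) \<Rightarrow> (real \<Rightarrow> 'a) set" where
  "Linf_into I X N = {z. (\<forall>t\<in>I. z t \<in> X) \<and> strongly_measurable I X N z \<and>
     (\<exists>M. AE t in lebesgue_on I. N (z t) \<le> M)}"

definition locally_ess_bounded :: "real set \<Rightarrow> (real \<Rightarrow> real) \<Rightarrow> bool" where
  "locally_ess_bounded I h \<longleftrightarrow> (\<forall>K. compact K \<and> K \<subseteq> I \<longrightarrow> (\<exists>M. AE t in lebesgue_on K. h t \<le> M))"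

definition Linf_loc_into ::
  "real set \<Rightarrow> 'a::ab_group_add set \<Rightarrow> ('a \<Rightarrow> real) \<Rightarrow> (real \<Rightarrow> 'a) set" where
  "Linf_loc_into I X N = {z. (\<forall>t\<in>I. z t \<in> X) \<and> strongly_measurable I X N z \<and>
     locally_ess_bounded I (\<lambda>t. N (z t))}"

text \<open>
  The spaces \<open>Linf\<close> and \<open>W1inf\<close> are duals of separable spaces but not separable themselves, so
  for functions of time with values in them measurability is, as usual, meant in the weak-*
  sense. (Strong measurability would already exclude a jump discontinuity in \<open>x\<close> that is
  transported in time.)
\<close>

definition weakstar_measurable :: "real set \<Rightarrow> (real \<Rightarrow> real \<Rightarrow> real) \<Rightarrow> bool" where
  "weakstar_measurable I f \<longleftrightarrow>
     (\<forall>\<phi>\<in>L1. (\<lambda>t. LINT x|circle. f t x * \<phi> x) \<in> borel_measurable (lebesgue_on I))"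

definition Linf_loc_Linf :: "real set \<Rightarrow> (real \<Rightarrow> real \<Rightarrow> real) set" where
  "Linf_loc_Linf I = {f. (\<forall>t\<in>I. f t \<in> Linf) \<and> weakstar_measurable I f \<and>
     locally_ess_bounded I (\<lambda>t. norm_Linf (f t))}"

definition Linf_loc_W1inf :: "real set \<Rightarrow> (real \<Rightarrow> real \<Rightarrow> real) set" where
  "Linf_loc_W1inf I = {f. (\<forall>t\<in>I. f t \<in> W1inf) \<and>
     weakstar_measurable I f \<and> weakstar_measurable I (\<lambda>t. weak_deriv (f t)) \<and>
     locally_ess_bounded I (\<lambda>t. norm_W1inf (f t))}"

section \<open>The two-component \<open>\<mu>\<close>-Hunter-Saxton system\<close>

definition green :: "real \<Rightarrow> real" where
  "green x = 1/2 * frac x * (frac x - 1) + 13/12"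

definition conv :: "(real \<Rightarrow> real) \<Rightarrow> (real \<Rightarrow> real) \<Rightarrow> real \<Rightarrow> real" where
  "conv k f x = (LINT y|circle. k (x - y) * f y)"

text \<open>
  \<open>green\<close> is Lipschitz and differentiable off the integers, so its distributional derivative is
  represented by \<open>deriv green\<close>, whose unspecified values at the integers do not matter here.

  In the weak formulation the function \<open>z = (u, \<rho>)\<close> belongs to \<open>Linf_loc_into {0<..} (H1 \<times> L2)\<close>,
  hence the inner integrals do not depend on the representatives of \<open>u t\<close>, \<open>\<rho> t\<close> and
  \<open>weak_deriv (u t)\<close>, and they are integrable functions of \<open>t\<close>.
\<close>

definition source :: "real \<Rightarrow> (real \<Rightarrow> real) \<Rightarrow> (real \<Rightarrow> real) \<Rightarrow> real \<Rightarrow> real" where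
  "source \<mu>\<^sub>0 u \<rho> x = 2 * \<mu>\<^sub>0 * u x + 1/2 * (weak_deriv u x)\<^sup>2 + 1/2 * (\<rho> x)\<^sup>2"

definition dt :: "(real \<times> real \<Rightarrow> real) \<Rightarrow> real \<times> real \<Rightarrow> real" where
  "dt \<phi> p = frechet_derivative \<phi> (at p) (1, 0)"

definition dx :: "(real \<times> real \<Rightarrow> real) \<Rightarrow> real \<times> real \<Rightarrow> real" where
  "dx \<phi> p = frechet_derivative \<phi> (at p) (0, 1)"

definition solves_distributionally ::
  "real \<Rightarrow> real \<Rightarrow> (real \<Rightarrow> real \<Rightarrow> real) \<Rightarrow> (real \<Rightarrow> real \<Rightarrow> real) \<Rightarrow> bool" where
  "solves_distributionally \<gamma> \<mu>\<^sub>0 u \<rho> \<longleftrightarrow>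
     (\<forall>\<phi>. test_fun ({0<..} \<times> UNIV) \<phi> \<longrightarrow>
        (LINT t|lebesgue. LINT x|lebesgue.
            - u t x * dt \<phi> (t, x) - (u t x + \<gamma>) * weak_deriv (u t) x * \<phi> (t, x))
        = (LINT t|lebesgue. LINT x|lebesgue.
            conv (deriv green) (source \<mu>\<^sub>0 (u t) (\<rho> t)) x * \<phi> (t, x))
      \<and> (LINT t|lebesgue. LINT x|lebesgue.
            - \<rho> t x * dt \<phi> (t, x) + \<rho> t x * u t x * dx \<phi> (t, x))
        = (LINT t|lebesgue. LINT x|lebesgue. - \<gamma> * \<rho> t x * dx \<phi> (t, x)))"

definition tends_distributionally ::
  "(real \<Rightarrow> real \<Rightarrow> real) \<Rightarrow> (real \<Rightarrow> real) \<Rightarrow> bool" where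
  "tends_distributionally f f\<^sub>0 \<longleftrightarrow>
     (\<forall>\<phi>. test_fun UNIV \<phi> \<longrightarrow>
        ((\<lambda>t. LINT x|lebesgue. f t x * \<phi> x) \<longlongrightarrow> (LINT x|lebesgue. f\<^sub>0 x * \<phi> x)) (at_right 0))"

text \<open>
  The clause on \<open>mean (u t)\<close> is the standing assumption under which the system takes the
  nonlocal form used here.
\<close>

definition admissible_weak_solution ::
  "real \<Rightarrow> (real \<Rightarrow> real) \<Rightarrow> (real \<Rightarrow> real) \<Rightarrow>
   (real \<Rightarrow> real \<Rightarrow> real) \<Rightarrow> (real \<Rightarrow> real \<Rightarrow> real) \<Rightarrow> bool" where
  "admissible_weak_solution \<gamma> u\<^sub>0 \<rho>\<^sub>0 u \<rho> \<longleftrightarrow>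
     (\<lambda>t. (u t, \<rho> t)) \<in> Linf_loc_into {0<..} (H1 \<times> L2) norm_H1_L2 \<and>
     (\<forall>t>0. mean (u t) = mean u\<^sub>0) \<and>
     solves_distributionally \<gamma> (mean u\<^sub>0) u \<rho> \<and>
     tends_distributionally u u\<^sub>0 \<and> tends_distributionally \<rho> \<rho>\<^sub>0 \<and>
     (\<forall>t>0. (norm_L2 (weak_deriv (u t)))\<^sup>2 + (norm_L2 (\<rho> t))\<^sup>2
             \<le> (norm_L2 (weak_deriv u\<^sub>0))\<^sup>2 + (norm_L2 \<rho>\<^sub>0)\<^sup>2)"

end

theory Submission
  imports Defs
begin

text \<open>
  The solution is constructed in Lagrangian coordinates, in which the system turns into a linear
  oscillator at every label, coupled by one scalar coefficient.

  Let \<open>\<phi>\<close> be the flow of \<open>- (u + \<gamma>)\<close>, so that \<open>u \<circ> \<phi> = U\<close> and \<open>\<phi>\<^sub>t = - (U + \<gamma>)\<close>, and let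
  \<open>J = \<phi>\<^sub>\<xi>\<close> and \<open>N = J\<^sub>t\<close>. Then \<open>u\<^sub>x \<circ> \<phi> = - N / J\<close>, and the continuity equation says that
  \<open>(\<rho> \<circ> \<phi>) J = \<rho>\<^sub>0\<close> does not depend on time. For smooth solutions with mean velocity \<open>\<mu>\<close> and conserved
  energy \<open>\<integral> u\<^sub>x\<^sup>2 + \<rho>\<^sup>2 = 4 e0\<close> the momentum equation amounts to the following: \<open>J = \<bar>y\<bar>\<^sup>2\<close>, where the
  complex function \<open>y\<close> solves
  \<open>y'' = (\<mu> U - c / 2) y\<close> with \<open>y(0) = 1\<close>, \<open>y'(0) = (\<rho>\<^sub>0 \<i> - u\<^sub>0\<^sub>x) / 2\<close>, \<open>c = 2 \<mu>\<^sup>2 + 2 e0\<close>.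
  At each label this is linear with a real coefficient. The coefficient is recovered from \<open>y\<close>, because
  \<open>U\<^sub>\<xi> = - N\<close> and the mean of \<open>U J\<close> is \<open>\<mu>\<close>; so \<open>U\<close> is continuous in the label even if the data are not.

  Existence. Discontinuous data enter the solution through a real-linear map at each label, which is
  applied to the pair of solutions with initial values \<open>1\<close> and \<open>\<i>\<close> (\<open>lag\<close>). That pair is a
  continuous function of the label, so the coupled equations form an ordinary differential equation in
  the Banach space of bounded continuous functions. A truncation of the coefficient makes its vector
  field locally Lipschitz with linear growth, and \<open>ode_global\<close> gives a solution for all times. The
  means of \<open>J\<close>, \<open>N\<close> and \<open>\<bar>y'\<bar>\<^sup>2\<close> keep their initial values \<open>1\<close>, \<open>0\<close> and \<open>e0\<close>, by Gronwall's
  inequality (\<open>constraints\<close>), and then the truncation was never active (\<open>drift_bound\<close>).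

  Nondegeneracy. The Wronskian \<open>Im (cnj y * y')\<close> is conserved and equals \<open>\<rho>\<^sub>0 / 2 \<ge> \<alpha> / 2\<close>, so \<open>y\<close> cannot
  vanish: \<open>J\<close> is bounded below on bounded time intervals (\<open>J_ge_low\<close>), and \<open>\<phi>\<close> is a
  bi-Lipschitz change of variables. This is what the positivity of the density is for.

  Return to Eulerian coordinates. With \<open>X\<close> the inverse of \<open>\<phi>\<close>, set \<open>u = U \<circ> X\<close> and
  \<open>\<rho> = (\<rho>\<^sub>0 / J) \<circ> X\<close>. The weak derivative of \<open>u\<close> is \<open>w = - (N / J) \<circ> X\<close>, and all three are bounded on
  bounded time intervals. The time derivative of \<open>U\<close> at fixed label is the nonlocal force
  (\<open>conv_eq_G\<close>). Integrated against a test function that is transported by the flow, both equations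
  then reduce to integrals of total derivatives (\<open>momentum_equation\<close>, \<open>continuity_equation\<close>). Since
  \<open>(w\<^sup>2 + \<rho>\<^sup>2) J = 4 \<bar>y'\<bar>\<^sup>2\<close> in Lagrangian coordinates, the energy is conserved exactly (\<open>energy\<close>). Fields that are
  Lipschitz in time at fixed label are continuous in time with values in \<open>L2\<close> after transport by the flow
  (\<open>transported_L2_continuous\<close>); this gives strong continuity of \<open>u\<close>, \<open>w\<close> and \<open>\<rho>\<close>.

  Elements of the function spaces are representatives modulo null sets, so the given data and the
  constructed initial values have to be compared: a function orthogonal to all trigonometric polynomials
  vanishes almost everywhere (\<open>orthogonal_to_trig_imp_zero\<close>), hence weak derivatives are
  unique, and a function is determined by its weak derivative and its mean.
\<close>

section \<open>Indefinite integrals of locally bounded Borel functions\<close>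

definition locally_bounded :: "(real \<Rightarrow> real) \<Rightarrow> bool" where
  "locally_bounded f \<longleftrightarrow> (\<forall>R. \<exists>C. \<forall>x. \<bar>x\<bar> \<le> R \<longrightarrow> \<bar>f x\<bar> \<le> C)"

text \<open>
  The pairs of an absolutely continuous function with locally bounded derivative and a Borel version
  of that derivative. The flow map, the fluid velocity and the acceleration are functions of this
  kind, and they are differentiated only in this integrated sense, because their derivatives inherit
  the jumps of the initial data. Intervals with \<open>a \<le> b\<close> suffice, since increments are
  antisymmetric.
\<close>

definition primitive :: "(real \<Rightarrow> real) \<Rightarrow> (real \<Rightarrow> real) \<Rightarrow> bool" where
  "primitive F f \<longleftrightarrow> f \<in> borel_measurable borel \<and> locally_bounded f \<and>
     (\<forall>a b. a \<le> b \<longrightarrow> (f has_integral (F b - F a)) {a..b})"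

lemma locally_boundedI: "(\<And>x. \<bar>f x\<bar> \<le> C) \<Longrightarrow> locally_bounded f"
  unfolding locally_bounded_def by blast

lemma locally_boundedE:
  assumes "locally_bounded f"
  obtains C where "C > 0" "\<And>x. \<bar>x\<bar> \<le> R \<Longrightarrow> \<bar>f x\<bar> \<le> C"
proof -
  obtain C where "\<forall>x. \<bar>x\<bar> \<le> R \<longrightarrow> \<bar>f x\<bar> \<le> C" using assms unfolding locally_bounded_def by blast
  then show ?thesis using that[of "\<bar>C\<bar> + 1"] by fastforce
qed

lemma locally_bounded_continuous:
  assumes "continuous_on UNIV f"
  shows "locally_bounded f"
  unfolding locally_bounded_def
proof
  fix R :: real
  have "compact (f ` {-R..R})"
    using assms compact_continuous_image continuous_on_subset by blast
  then obtain C where "\<forall>y \<in> f ` {-R..R}. norm y \<le> C"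
    using compact_imp_bounded bounded_iff by blast
  then show "\<exists>C. \<forall>x. \<bar>x\<bar> \<le> R \<longrightarrow> \<bar>f x\<bar> \<le> C" by (intro exI[of _ C]) (auto simp: abs_le_iff)
qed

lemma locally_bounded_mult:
  assumes "locally_bounded f" "locally_bounded g"
  shows "locally_bounded (\<lambda>x. f x * g x)"
  unfolding locally_bounded_def
proof
  fix R
  obtain C where C: "C > 0" "\<And>x. \<bar>x\<bar> \<le> R \<Longrightarrow> \<bar>f x\<bar> \<le> C" using locally_boundedE[OF assms(1)] by metis
  obtain D where D: "D > 0" "\<And>x. \<bar>x\<bar> \<le> R \<Longrightarrow> \<bar>g x\<bar> \<le> D" using locally_boundedE[OF assms(2)] by metis
  show "\<exists>C. \<forall>x. \<bar>x\<bar> \<le> R \<longrightarrow> \<bar>f x * g x\<bar> \<le> C"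
    using C D by (intro exI[of _ "C * D"]) (auto simp: abs_mult intro!: mult_mono)
qed

lemma locally_bounded_add:
  assumes "locally_bounded f" "locally_bounded g"
  shows "locally_bounded (\<lambda>x. f x + g x)"
  unfolding locally_bounded_def
proof
  fix R
  obtain C where C: "C > 0" "\<And>x. \<bar>x\<bar> \<le> R \<Longrightarrow> \<bar>f x\<bar> \<le> C" using locally_boundedE[OF assms(1)] by metis
  obtain D where D: "D > 0" "\<And>x. \<bar>x\<bar> \<le> R \<Longrightarrow> \<bar>g x\<bar> \<le> D" using locally_boundedE[OF assms(2)] by metis
  show "\<exists>C. \<forall>x. \<bar>x\<bar> \<le> R \<longrightarrow> \<bar>f x + g x\<bar> \<le> C"
    using C D by (intro exI[of _ "C + D"]) (smt (verit))
qed

lemma primitive_borel: "primitive F f \<Longrightarrow> f \<in> borel_measurable borel"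
  and primitive_locally_bounded: "primitive F f \<Longrightarrow> locally_bounded f"
  and primitive_has_integral: "primitive F f \<Longrightarrow> a \<le> b \<Longrightarrow> (f has_integral (F b - F a)) {a..b}"
  unfolding primitive_def by auto

lemma integrable_on_locally_bounded:
  assumes "f \<in> borel_measurable borel" "locally_bounded f"
  shows "f integrable_on {a..b::real}"
proof -
  obtain C where C: "\<And>x. \<bar>x\<bar> \<le> max \<bar>a\<bar> \<bar>b\<bar> \<Longrightarrow> \<bar>f x\<bar> \<le> C"
    using locally_boundedE[OF assms(2)] by metis
  show ?thesis
  proof (rule measurable_bounded_by_integrable_imp_integrable[where g="\<lambda>_. C"])
    show "f \<in> borel_measurable (lebesgue_on {a..b})"
      using assms(1) by (simp add: measurable_completion measurable_restrict_space1)
    show "\<And>x. x \<in> {a..b} \<Longrightarrow> norm (f x) \<le> C" using C by fastforce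
  qed auto
qed

lemma primitive_exists:
  assumes "f \<in> borel_measurable borel" "locally_bounded f"
  obtains F where "primitive F f"
proof
  define F where "F x = (if 0 \<le> x then integral {0..x} f else - integral {x..0} f)" for x
  note int = integrable_on_locally_bounded[OF assms]
  have "(f has_integral (F b - F a)) {a..b}" if "a \<le> b" for a b
  proof -
    have "integral {a..b} f = F b - F a"
      using Henstock_Kurzweil_Integration.integral_combine[of a 0 b f]
        Henstock_Kurzweil_Integration.integral_combine[of 0 a b f]
        Henstock_Kurzweil_Integration.integral_combine[of a b 0 f] that int
      by (cases "0 \<le> a"; cases "0 \<le> b") (auto simp: F_def)
    then show ?thesis using int by (metis integrable_integral)
  qed
  then show "primitive F f" unfolding primitive_def using assms by auto
qed

lemma primitive_bound:
  assumes "primitive F f" "a \<le> b" "\<And>x. x \<in> {a..b} \<Longrightarrow> \<bar>f x\<bar> \<le> C"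
  shows "\<bar>F b - F a\<bar> \<le> C * (b - a)"
proof -
  have "0 \<le> C" using assms(2) assms(3)[of a] by force
  from has_integral_bound_real[OF this finite.emptyI primitive_has_integral[OF assms(1,2)]] show ?thesis
    using assms(2,3) by simp
qed

lemma primitive_lipschitz:
  assumes "primitive F f" "\<And>x. \<bar>f x\<bar> \<le> C"
  shows "\<bar>F b - F a\<bar> \<le> C * \<bar>b - a\<bar>"
  using primitive_bound[OF assms(1), of a b C] primitive_bound[OF assms(1), of b a C] assms(2)
  by (cases "a \<le> b") (auto simp: abs_minus_commute)

lemma primitive_continuous:
  assumes "primitive F f"
  shows "continuous_on A F"
proof -
  have "isCont F x" for x
  proof -
    obtain C where C: "C > 0" "\<And>y. \<bar>y\<bar> \<le> \<bar>x\<bar> + 1 \<Longrightarrow> \<bar>f y\<bar> \<le> C"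
      using locally_boundedE[OF primitive_locally_bounded[OF assms]] by metis
    have le: "\<bar>F b - F a\<bar> \<le> C * (b - a)" if "a \<le> b" "\<bar>a\<bar> \<le> \<bar>x\<bar> + 1" "\<bar>b\<bar> \<le> \<bar>x\<bar> + 1" for a b
      by (rule primitive_bound[OF assms]) (use that C(2) in auto)
    have near: "\<bar>F y - F x\<bar> \<le> C * \<bar>y - x\<bar>" if "\<bar>y - x\<bar> \<le> 1" for y
      using le[of x y] le[of y x] that by (cases "x \<le> y") (auto simp: abs_minus_commute)
    have "(\<lambda>y. F y - F x) \<midarrow>x\<rightarrow> 0"
    proof (rule Lim_null_comparison)
      show "\<forall>\<^sub>F y in at x. norm (F y - F x) \<le> C * \<bar>y - x\<bar>"
        unfolding eventually_at using near by (intro exI[of _ 1]) (auto simp: dist_real_def)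
      show "((\<lambda>y. C * \<bar>y - x\<bar>) \<longlongrightarrow> 0) (at x)" by (auto intro!: tendsto_eq_intros)
    qed
    then show ?thesis using LIM_zero_iff isCont_def by blast
  qed
  then show ?thesis by (simp add: continuous_at_imp_continuous_on)
qed

lemma primitive_borel_fun:
  assumes "primitive F f"
  shows "F \<in> borel_measurable borel"
  using primitive_continuous[OF assms] borel_measurable_continuous_onI by blast

lemma primitive_const: "primitive (\<lambda>_. c) (\<lambda>_. 0)"
  unfolding primitive_def by (auto intro: locally_boundedI[of _ 0])

lemma primitive_ident: "primitive (\<lambda>x. x) (\<lambda>_. 1)"
proof -
  have "((\<lambda>_. 1) has_integral (b - a)) {a..b}" if "a \<le> b" for a b :: real
    using has_integral_const_real[of "1::real" a b] that by simp
  then show ?thesis unfolding primitive_def by (auto intro: locally_boundedI[of _ 1])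
qed

lemma primitive_add:
  assumes "primitive F f" "primitive G g"
  shows "primitive (\<lambda>x. F x + G x) (\<lambda>x. f x + g x)"
proof -
  have "((\<lambda>x. f x + g x) has_integral (F b + G b - (F a + G a))) {a..b}" if "a \<le> b" for a b
    using has_integral_add[OF primitive_has_integral[OF assms(1) that] primitive_has_integral[OF assms(2) that]]
    by (simp add: algebra_simps)
  then show ?thesis
    using assms unfolding primitive_def by (simp add: locally_bounded_add borel_measurable_add)
qed

lemma primitive_cmult:
  assumes "primitive F f"
  shows "primitive (\<lambda>x. c * F x) (\<lambda>x. c * f x)"
proof -
  have "((\<lambda>x. c * f x) has_integral (c * F b - c * F a)) {a..b}" if "a \<le> b" for a b
    using has_integral_mult_right[OF primitive_has_integral[OF assms that], of c]
    by (simp add: algebra_simps)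
  moreover have "locally_bounded (\<lambda>x. c * f x)"
    by (rule locally_bounded_mult) (use assms locally_boundedI[of "\<lambda>_. c" "\<bar>c\<bar>"] primitive_locally_bounded in auto)
  ultimately show ?thesis
    using primitive_borel[OF assms] unfolding primitive_def by (simp add: borel_measurable_times)
qed

lemma primitive_diff:
  "primitive F f \<Longrightarrow> primitive G g \<Longrightarrow> primitive (\<lambda>x. F x - G x) (\<lambda>x. f x - g x)"
  using primitive_add[of F f "\<lambda>x. -1 * G x" "\<lambda>x. -1 * g x"] primitive_cmult[of G g "-1"] by simp

lemma primitive_uminus: "primitive F f \<Longrightarrow> primitive (\<lambda>x. - F x) (\<lambda>x. - f x)"
  using primitive_cmult[of F f "-1"] by simp

lemma primitive_cong:
  assumes "primitive F f" "\<And>x. F x = G x" "\<And>x. f x = g x"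
  shows "primitive G g"
proof -
  have "F = G" "f = g" using assms(2,3) by auto
  then show ?thesis using assms(1) by simp
qed

lemma primitive_unique:
  assumes "primitive F f" "primitive G f"
  shows "F x - G x = F y - G y"
proof -
  have "F b - F a = G b - G a" if "a \<le> b" for a b
    using primitive_has_integral[OF assms(1) that] primitive_has_integral[OF assms(2) that]
    by (rule has_integral_unique)
  from this[of x y] this[of y x] show ?thesis by (cases "x \<le> y") auto
qed

text \<open>
  The function \<open>\<Phi> \<circ> F\<close> may fail to be differentiable on a null set, so the classical chain
  rule does not apply. But its difference with an indefinite integral of \<open>(\<Phi>' \<circ> F) f\<close>
  is differentiable at \<^emph>\<open>every\<close> point, with derivative zero, because \<open>\<Phi>' \<circ> F\<close> is continuous.
\<close>

lemma primitive_chain: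
  assumes F: "primitive F f" and \<Phi>: "\<And>y. (\<Phi> has_real_derivative \<Phi>' y) (at y)"
    and cont: "continuous_on UNIV \<Phi>'"
  shows "primitive (\<lambda>x. \<Phi> (F x)) (\<lambda>x. \<Phi>' (F x) * f x)"
proof -
  define h where "h x = \<Phi>' (F x) * f x" for x
  have contF: "continuous_on UNIV F" using primitive_continuous[OF F] .
  have contPF: "continuous_on UNIV (\<lambda>x. \<Phi>' (F x))"
    by (rule continuous_on_compose2[OF cont contF]) simp
  have h_borel: "h \<in> borel_measurable borel"
    unfolding h_def using borel_measurable_continuous_onI[OF contPF] primitive_borel[OF F] by measurable
  have h_bdd: "locally_bounded h"
    unfolding h_def
    by (intro locally_bounded_mult locally_bounded_continuous contPF primitive_locally_bounded[OF F])
  obtain H where H: "primitive H h" using primitive_exists[OF h_borel h_bdd] .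
  define D where "D x = \<Phi> (F x) - H x" for x
  have D0: "(D has_real_derivative 0) (at x)" for x
  proof -
    obtain C where C: "C > 0" "\<And>y. \<bar>y\<bar> \<le> \<bar>x\<bar> + 1 \<Longrightarrow> \<bar>f y\<bar> \<le> C"
      using locally_boundedE[OF primitive_locally_bounded[OF F]] by metis
    have small: "\<exists>\<delta>>0. \<forall>y. \<bar>y - x\<bar> < \<delta> \<longrightarrow> \<bar>D y - D x\<bar> \<le> \<epsilon> * \<bar>y - x\<bar>" if "\<epsilon> > 0" for \<epsilon>
    proof -
      have "isCont (\<lambda>x. \<Phi>' (F x)) x" using contPF by (simp add: continuous_on_eq_continuous_at)
      moreover have "\<epsilon> / (2 * C) > 0" using C that by simp
      ultimately obtain \<delta> where \<delta>: "\<delta> > 0"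
        "\<And>s. \<bar>s - x\<bar> < \<delta> \<Longrightarrow> \<bar>\<Phi>' (F s) - \<Phi>' (F x)\<bar> < \<epsilon> / (2 * C)"
        unfolding continuous_at_eps_delta dist_real_def by metis
      have key: "\<bar>D b - D a\<bar> \<le> \<epsilon> * (b - a)"
        if ab: "a \<le> b" "\<bar>a - x\<bar> < min \<delta> 1" "\<bar>b - x\<bar> < min \<delta> 1" for a b
      proof -
        \<comment> \<open>Mean value theorem for \<open>\<Phi>\<close>; the intermediate value is taken by the continuous \<open>F\<close>
          between \<open>a\<close> and \<open>b\<close>, hence close to \<open>x\<close>.\<close>
        have "\<exists>s\<in>{a..b}. \<Phi> (F b) - \<Phi> (F a) = \<Phi>' (F s) * (F b - F a)"
        proof (cases "F a = F b")
          case True then show ?thesis using ab by auto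
        next
          case False
          obtain \<eta> where \<eta>: "\<eta> \<in> closed_segment (F a) (F b)"
              "\<Phi> (F b) - \<Phi> (F a) = \<Phi>' \<eta> * (F b - F a)"
          proof (cases "F a < F b")
            case True
            from MVT2[OF this, of \<Phi> \<Phi>'] \<Phi> obtain z where "F a < z" "z < F b"
              "\<Phi> (F b) - \<Phi> (F a) = (F b - F a) * \<Phi>' z" by auto
            then show ?thesis using that[of z] True by (auto simp: closed_segment_eq_real_ivl mult.commute)
          next
            case F2: False
            then have "F b < F a" using False by simp
            from MVT2[OF this, of \<Phi> \<Phi>'] \<Phi> obtain z where "F b < z" "z < F a"
              "\<Phi> (F a) - \<Phi> (F b) = (F a - F b) * \<Phi>' z" by auto
            then show ?thesis using that[of z] F2
              by (auto simp: closed_segment_eq_real_ivl algebra_simps)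
          qed
          have "\<exists>s\<in>{a..b}. F s = \<eta>"
          proof -
            have "connected (F ` {a..b})" using primitive_continuous[OF F] 
              by (simp add: connected_continuous_image)
            then have "closed_segment (F a) (F b) \<subseteq> F ` {a..b}"
              using ab by (intro closed_segment_subset) (auto simp: is_interval_connected_1[symmetric] is_interval_convex_1)
            then show ?thesis using \<eta> by auto
          qed
          then show ?thesis using \<eta> by auto
        qed
        then obtain s where s: "s \<in> {a..b}" "\<Phi> (F b) - \<Phi> (F a) = \<Phi>' (F s) * (F b - F a)" by blast
        have "((\<lambda>r. \<Phi>' (F s) * f r - h r) has_integral
             (\<Phi>' (F s) * (F b - F a) - (H b - H a))) {a..b}"
          by (intro has_integral_diff has_integral_mult_right primitive_has_integral ab F H)
        moreover have "\<bar>\<Phi>' (F s) * f r - h r\<bar> \<le> \<epsilon>" if "r \<in> {a..b}" for r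
        proof -
          have "\<bar>\<Phi>' (F s) - \<Phi>' (F r)\<bar> \<le> \<epsilon> / (2 * C) + \<epsilon> / (2 * C)"
            using \<delta>(2)[of s] \<delta>(2)[of r] s that ab by (smt (verit) atLeastAtMost_iff)
          moreover have "\<bar>f r\<bar> \<le> C" using C(2)[of r] that ab by force
          ultimately have "\<bar>\<Phi>' (F s) - \<Phi>' (F r)\<bar> * \<bar>f r\<bar> \<le> (\<epsilon> / (2 * C) + \<epsilon> / (2 * C)) * C"
            by (intro mult_mono) auto
          also have "\<dots> = \<epsilon>" using C by (simp add: field_simps)
          finally show ?thesis unfolding h_def by (simp add: abs_mult[symmetric] left_diff_distrib)
        qed
        ultimately have "\<bar>\<Phi>' (F s) * (F b - F a) - (H b - H a)\<bar> \<le> \<epsilon> * (b - a)"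
          using has_integral_bound_real[of \<epsilon> "{}" "\<lambda>r. \<Phi>' (F s) * f r - h r" _ a b] ab \<open>\<epsilon> > 0\<close> by simp
        then show ?thesis using s unfolding D_def by (simp add: algebra_simps)
      qed
      show ?thesis
      proof (intro exI[of _ "min \<delta> 1"] conjI allI impI)
        fix y assume y: "\<bar>y - x\<bar> < min \<delta> 1"
        show "\<bar>D y - D x\<bar> \<le> \<epsilon> * \<bar>y - x\<bar>"
          using key[of x y] key[of y x] y \<delta>(1) by (cases "x \<le> y") (auto simp: abs_minus_commute)
      qed (use \<delta> in auto)
    qed
    have "((\<lambda>y. (D y - D x) / (y - x)) \<longlongrightarrow> 0) (at x)"
    proof (rule tendstoI)
      fix e :: real assume "e > 0"
      then obtain \<delta> where \<delta>: "\<delta> > 0" "\<And>y. \<bar>y - x\<bar> < \<delta> \<Longrightarrow> \<bar>D y - D x\<bar> \<le> e/2 * \<bar>y - x\<bar>"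
        using small[of "e/2"] by auto
      have "dist ((D y - D x) / (y - x)) 0 < e" if "y \<noteq> x" "dist y x < \<delta>" for y
      proof -
        have "\<bar>D y - D x\<bar> / \<bar>y - x\<bar> \<le> e / 2"
          using \<delta>(2)[of y] that by (subst divide_le_eq) (auto simp: dist_real_def)
        then have "\<bar>D y - D x\<bar> / \<bar>y - x\<bar> < e" using \<open>e > 0\<close> by linarith
        then show ?thesis by (simp add: dist_real_def)
      qed
      then show "\<forall>\<^sub>F y in at x. dist ((D y - D x) / (y - x)) 0 < e"
        unfolding eventually_at using \<delta> by auto
    qed
    then show ?thesis unfolding has_field_derivative_iff by simp
  qed
  have "D b = D a" for a b using DERIV_const_ratio_const[of a b] D0 
    by (metis DERIV_isconst_all)
  then have "\<Phi> (F b) - \<Phi> (F a) = H b - H a" for a b unfolding D_def by (smt (verit))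
  then show ?thesis using H unfolding primitive_def h_def by simp
qed

text \<open>
  The chain rule for the square, polarised: \<open>F G = ((F + G)\<^sup>2 - (F - G)\<^sup>2) / 4\<close>.
\<close>

lemma primitive_mult:
  assumes F: "primitive F f" and G: "primitive G g"
  shows "primitive (\<lambda>x. F x * G x) (\<lambda>x. f x * G x + F x * g x)"
proof -
  have sq: "primitive (\<lambda>x. (K x)\<^sup>2) (\<lambda>x. 2 * K x * k x)" if "primitive K k" for K k
    by (rule primitive_chain[OF that, of "\<lambda>y. y\<^sup>2" "\<lambda>y. 2 * y"])
       (auto intro!: derivative_eq_intros continuous_intros)
  show ?thesis
    by (rule primitive_cong[OF primitive_cmult[OF primitive_diff[OF
          sq[OF primitive_add[OF F G]] sq[OF primitive_diff[OF F G]]], of "1/4"]])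
       (auto simp: power2_eq_square algebra_simps)
qed

lemma primitive_shift:
  assumes "primitive F f"
  shows "primitive (\<lambda>x. F (x + c)) (\<lambda>x. f (x + c))"
  unfolding primitive_def
proof (intro conjI allI impI)
  show "(\<lambda>x. f (x + c)) \<in> borel_measurable borel"
    using primitive_borel[OF assms] by measurable
  show "locally_bounded (\<lambda>x. f (x + c))"
    unfolding locally_bounded_def
  proof
    fix R
    obtain C where "\<And>x. \<bar>x\<bar> \<le> R + \<bar>c\<bar> \<Longrightarrow> \<bar>f x\<bar> \<le> C"
      using locally_boundedE[OF primitive_locally_bounded[OF assms]] by metis
    then have "\<forall>x. \<bar>x\<bar> \<le> R \<longrightarrow> \<bar>f (x + c)\<bar> \<le> C" by auto
    then show "\<exists>C. \<forall>x. \<bar>x\<bar> \<le> R \<longrightarrow> \<bar>f (x + c)\<bar> \<le> C" ..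
  qed
  show "((\<lambda>x. f (x + c)) has_integral F (b + c) - F (a + c)) {a..b}" if "a \<le> b" for a b
    using has_integral_shift_real_ivl[OF primitive_has_integral[OF assms, of "a + c" "b + c"], of c] that by simp
qed

lemma primitive_integral_lborel:
  assumes "primitive F f" "a \<le> b"
  shows "integrable lborel (\<lambda>x. indicator {a..b} x * f x)"
    and "(LINT x|lborel. indicator {a..b} x * f x) = F b - F a"
proof -
  obtain C where C: "\<And>y. \<bar>y\<bar> \<le> max \<bar>a\<bar> \<bar>b\<bar> \<Longrightarrow> \<bar>f y\<bar> \<le> C"
    using locally_boundedE[OF primitive_locally_bounded[OF assms(1)]] by metis
  have m: "f \<in> borel_measurable borel" using primitive_borel[OF assms(1)] .
  have "C \<ge> 0" using C[of a] by fastforce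
  show I: "integrable lborel (\<lambda>x. indicator {a..b} x * f x)"
  proof (rule Bochner_Integration.integrable_bound[where f="\<lambda>x. indicator {a..b} x * C"])
    show "AE x in lborel. norm (indicator {a..b} x * f x) \<le> norm (indicator {a..b} x * C)"
      using C \<open>C \<ge> 0\<close> by (intro AE_I2) (fastforce simp: indicator_def)
    show "integrable lborel (\<lambda>x. indicator {a..b} x * C)"
      using assms(2) by (intro integrable_mult_left integrable_real_indicator) auto
  qed (use m in measurable)
  have "((\<lambda>x. indicator {a..b} x * f x) has_integral (LINT x|lborel. indicator {a..b} x * f x)) UNIV"
    using has_integral_integral_lborel[OF I] .
  moreover have "((\<lambda>x. indicator {a..b} x * f x) has_integral (F b - F a)) UNIV"
  proof -
    have "((\<lambda>x. if x \<in> {a..b} then f x else 0) has_integral (F b - F a)) UNIV"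
      using primitive_has_integral[OF assms] has_integral_restrict_UNIV by blast
    then show ?thesis by (rule has_integral_eq[rotated]) (auto simp: indicator_def)
  qed
  ultimately show "(LINT x|lborel. indicator {a..b} x * f x) = F b - F a"
    using has_integral_unique by blast
qed

section \<open>Integrals over a period\<close>

lemma mean_lborel:
  assumes "f \<in> borel_measurable borel"
  shows "mean f = (LINT x|lborel. indicator {0..1} x * f x)"
proof -
  have "mean f = (LINT x|lebesgue. indicator {0..1} x *\<^sub>R f x)"
    unfolding mean_def by (subst integral_restrict_space) auto
  also have "\<dots> = (LINT x|lborel. indicator {0..1} x *\<^sub>R f x)"
    by (rule integral_completion) (use assms in measurable)
  finally show ?thesis by simp
qed

lemma mean_primitive: "primitive F f \<Longrightarrow> mean f = F 1 - F 0"
  using mean_lborel primitive_borel primitive_integral_lborel(2)[of F f 0 1] by simp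

lemma borel_measurable_circle: "f \<in> borel_measurable borel \<Longrightarrow> f \<in> borel_measurable circle"
  by (simp add: measurable_completion measurable_restrict_space1)

lemma finite_measure_circle: "finite_measure circle"
  by (rule finite_measureI) (simp add: emeasure_restrict_space)

lemma integrable_circle:
  fixes f :: "real \<Rightarrow> real"
  assumes "f \<in> borel_measurable borel" "\<And>x. x \<in> {0..1} \<Longrightarrow> \<bar>f x\<bar> \<le> C"
  shows "integrable circle f"
  by (rule finite_measure.integrable_const_bound[OF finite_measure_circle, of _ C])
     (use assms borel_measurable_circle in auto)

lemma mean_const [simp]: "mean (\<lambda>_. c) = c"
  using mean_primitive[OF primitive_cmult[OF primitive_ident, of c]] by simp

text \<open>
  The translate of \<open>F\<close> by a period is another primitive of \<open>f\<close>, so the two differ by a constant.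
\<close>

lemma primitive_period:
  assumes F: "primitive F f" and per: "\<And>x. f (x + 1) = f x"
  shows "F (x + 1) = F x + mean f"
proof -
  have "primitive (\<lambda>x. F (x + 1)) f"
  proof -
    have "(f has_integral (F (b + 1) - F (a + 1))) {a..b}" if "a \<le> b" for a b
      using has_integral_shift_real_ivl[OF primitive_has_integral[OF F, of "a + 1" "b + 1"], of 1] that per by simp
    then show ?thesis using F unfolding primitive_def by auto
  qed
  from primitive_unique[OF this F, of x 0] show ?thesis using mean_primitive[OF F] by simp
qed

lemma mean_shift:
  assumes "f \<in> borel_measurable borel" "locally_bounded f" and per: "\<And>x. f (x + 1) = f x"
  shows "(LINT x|lborel. indicator {a..a + 1} x * f x) = mean f"
proof -
  obtain F where F: "primitive F f" using primitive_exists assms by blast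
  show ?thesis using primitive_integral_lborel(2)[OF F, of a "a + 1"] primitive_period[OF F per, of a] by simp
qed


lemma mean_cong: "(\<And>x. x \<in> {0..1} \<Longrightarrow> f x = g x) \<Longrightarrow> mean f = mean g"
  unfolding mean_def by (rule Bochner_Integration.integral_cong) auto

lemma mean_bound:
  assumes "\<And>x. x \<in> {0..1} \<Longrightarrow> \<bar>f x\<bar> \<le> C"
  shows "\<bar>mean f\<bar> \<le> C"
proof (cases "integrable circle f")
  case i: True
  have "\<bar>mean f\<bar> \<le> (LINT x|circle. \<bar>f x\<bar>)" unfolding mean_def by (rule integral_abs_bound)
  also have "\<dots> \<le> (LINT x|circle. C)"
    by (rule integral_mono) (use i assms integrable_circle[of "\<lambda>_. C" "\<bar>C\<bar>"] in auto)
  also have "\<dots> = C" using mean_const[of C] by (simp only: mean_def)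
  finally show ?thesis .
next
  case False
  then show ?thesis using assms[of 0] by (simp add: mean_def not_integrable_integral_eq)
qed

lemma mean_mono:
  assumes "f \<in> borel_measurable borel" "g \<in> borel_measurable borel"
    "\<And>x. x \<in> {0..1} \<Longrightarrow> \<bar>f x\<bar> \<le> C" "\<And>x. x \<in> {0..1} \<Longrightarrow> \<bar>g x\<bar> \<le> D"
    "\<And>x. x \<in> {0..1} \<Longrightarrow> f x \<le> g x"
  shows "mean f \<le> mean g"
  unfolding mean_def
  by (rule integral_mono) (use assms integrable_circle[OF assms(1,3)] integrable_circle[OF assms(2,4)] in auto)

lemma mean_add:
  assumes "f \<in> borel_measurable borel" "g \<in> borel_measurable borel"
    "\<And>x. x \<in> {0..1} \<Longrightarrow> \<bar>f x\<bar> \<le> C" "\<And>x. x \<in> {0..1} \<Longrightarrow> \<bar>g x\<bar> \<le> D"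
  shows "mean (\<lambda>x. f x + g x) = mean f + mean g" "mean (\<lambda>x. f x - g x) = mean f - mean g"
  unfolding mean_def using integrable_circle[OF assms(1,3)] integrable_circle[OF assms(2,4)] by simp_all

lemma mean_cmult: "mean (\<lambda>x. c * f x) = c * mean f"
  by (simp add: mean_def)

lemma mean_diff_bound:
  assumes "f \<in> borel_measurable borel" "g \<in> borel_measurable borel"
    "\<And>x. x \<in> {0..1} \<Longrightarrow> \<bar>f x\<bar> \<le> C" "\<And>x. x \<in> {0..1} \<Longrightarrow> \<bar>g x\<bar> \<le> D"
    "\<And>x. x \<in> {0..1} \<Longrightarrow> \<bar>f x - g x\<bar> \<le> K"
  shows "\<bar>mean f - mean g\<bar> \<le> K"
proof -
  have "\<bar>mean (\<lambda>x. f x - g x)\<bar> \<le> K"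
    by (rule mean_bound) (use assms(5) in auto)
  then show ?thesis using mean_add(2)[OF assms(1-4)] by simp
qed

lemma frac_measurable [measurable (raw)]:
  fixes f :: "'a \<Rightarrow> real"
  assumes [measurable]: "f \<in> borel_measurable M"
  shows "(\<lambda>\<omega>. frac (f \<omega>)) \<in> borel_measurable M"
  unfolding frac_def by measurable

text \<open>
  On the unit interval \<open>frac\<close> is the identity except at the end point \<open>1\<close>.
\<close>

lemma mean_frac:
  assumes "f \<in> borel_measurable borel"
  shows "mean (\<lambda>x. f (frac x)) = mean f"
  unfolding mean_def
proof (rule integral_cong_AE)
  have "(\<lambda>x::real. frac x) \<in> borel_measurable borel" unfolding frac_def by measurable
  then have "(\<lambda>x. f (frac x)) \<in> borel_measurable borel" using assms by measurable
  then show "(\<lambda>x. f (frac x)) \<in> borel_measurable circle" by (rule borel_measurable_circle)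
  show "f \<in> borel_measurable circle" by (rule borel_measurable_circle[OF assms])
  have "AE x in lebesgue. x \<noteq> (1::real)" using AE_lborel_singleton AE_completion by blast
  then have "AE x in lebesgue. x \<in> {0..1} \<longrightarrow> f (frac x) = f x"
  proof eventually_elim
    case (elim x)
    then have "frac x = x" if "x \<in> {0..1}" using that by (simp add: frac_eq)
    then show ?case by simp
  qed
  then show "AE x in circle. f (frac x) = f x" by (subst AE_restrict_space_iff) auto
qed

lemma primitive_integral_on:
  assumes "primitive F f" "a \<le> b"
  shows "(LINT x|lebesgue_on {a..b}. f x) = F b - F a"
proof -
  have [measurable]: "f \<in> borel_measurable borel" by (rule primitive_borel[OF assms(1)])
  have "(LINT x|lebesgue_on {a..b}. f x) = (LINT x|lebesgue. indicator {a..b} x *\<^sub>R f x)"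
    by (subst integral_restrict_space) auto
  also have "\<dots> = (LINT x|lborel. indicator {a..b} x *\<^sub>R f x)"
    by (rule integral_completion) measurable
  finally show ?thesis using primitive_integral_lborel(2)[OF assms] by simp
qed

section \<open>Change of variables\<close>

lemma inverse_bi_lipschitz:
  fixes \<phi> :: "real \<Rightarrow> real"
  assumes \<phi>: "primitive \<phi> J" and J: "\<And>x. \<delta> \<le> J x" "\<And>x. J x \<le> C" and "\<delta> > 0"
  shows "strict_mono \<phi>" "bij \<phi>" "\<delta> * \<bar>x - y\<bar> \<le> \<bar>\<phi> x - \<phi> y\<bar>"
proof -
  have low: "\<delta> * (b - a) \<le> \<phi> b - \<phi> a" if "a \<le> b" for a b
  proof -
    have "((\<lambda>_. \<delta>) has_integral \<delta> * (b - a)) {a..b}"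
      using has_integral_const_real[of \<delta> a b] that by (simp add: mult.commute)
    from has_integral_le[OF this primitive_has_integral[OF \<phi> that]] J(1) show ?thesis by simp
  qed
  show sm: "strict_mono \<phi>"
  proof (rule strict_monoI)
    fix x y :: real assume "x < y"
    then have "\<delta> * (y - x) > 0" using \<open>\<delta> > 0\<close> by simp
    then show "\<phi> x < \<phi> y" using low[of x y] \<open>x < y\<close> by simp
  qed
  show "\<delta> * \<bar>x - y\<bar> \<le> \<bar>\<phi> x - \<phi> y\<bar>"
    using low[of x y] low[of y x] by (cases "x \<le> y") (auto simp: abs_if algebra_simps)
  have "\<exists>x. \<phi> x = y" for y
  proof -
    define R where "R = \<bar>y - \<phi> 0\<bar> / \<delta>"
    have R: "R \<ge> 0" "\<delta> * R = \<bar>y - \<phi> 0\<bar>" using \<open>\<delta> > 0\<close> by (auto simp: R_def)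
    have "\<phi> (- R) \<le> y" "y \<le> \<phi> R" using low[of 0 R] low[of "-R" 0] R by auto
    then show ?thesis using IVT'[of \<phi> "-R" y R] primitive_continuous[OF \<phi>] R by auto
  qed
  then have "surj \<phi>" by (metis surj_def)
  then show "bij \<phi>" using strict_mono_imp_inj_on[OF sm] by (simp add: bij_def)
qed

text \<open>
  The two measures agree on open intervals, because \<open>\<phi>\<close> is an increasing bijection and
  the \<open>J\<close>-mass of an interval is the length of its image.
\<close>

lemma lborel_change_of_variables:
  assumes \<phi>: "primitive \<phi> J" and J: "\<And>x. \<delta> \<le> J x" "\<And>x. J x \<le> C" and "\<delta> > 0"
  shows "lborel = distr (density lborel J) borel \<phi>"
proof (rule lborel_eqI)
  note bi = inverse_bi_lipschitz[OF assms]
  have J0: "0 \<le> J x" for x using J(1)[of x] \<open>\<delta> > 0\<close> by linarith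
  have [measurable]: "\<phi> \<in> borel_measurable borel" "J \<in> borel_measurable borel"
    using primitive_borel_fun[OF \<phi>] primitive_borel[OF \<phi>] by auto
  fix l u :: real
  assume "\<And>b. b \<in> Basis \<Longrightarrow> l \<bullet> b \<le> u \<bullet> b"
  then have lu: "l \<le> u" by simp
  obtain a b where ab: "\<phi> a = l" "\<phi> b = u" using bi(2) by (metis bij_pointE)
  have "a \<le> b" using lu strict_mono_less_eq[OF bi(1), of a b] by (simp add: ab)
  have pre: "\<phi> -` {l<..<u} = {a<..<b}"
    using ab bi(1) by (auto simp: strict_mono_less)
  have "emeasure (distr (density lborel J) borel \<phi>) (box l u) = emeasure (density lborel J) {a<..<b}"
    by (subst emeasure_distr) (auto simp: pre box_real)
  also have "\<dots> = (\<integral>\<^sup>+x. ennreal (J x) * indicator {a<..<b} x \<partial>lborel)"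
    by (subst emeasure_density) auto
  also have "\<dots> = (\<integral>\<^sup>+x. ennreal (indicator {a..b} x * J x) \<partial>lborel)"
  proof (rule nn_integral_cong_AE)
    have "AE x in lborel. x \<noteq> a \<and> x \<noteq> b"
      using AE_lborel_singleton[of a] AE_lborel_singleton[of b] by eventually_elim auto
    then show "AE x in lborel. ennreal (J x) * indicator {a<..<b} x = ennreal (indicator {a..b} x * J x)"
      by eventually_elim (auto simp: indicator_def)
  qed
  also have "\<dots> = ennreal (\<phi> b - \<phi> a)"
  proof (subst nn_integral_eq_integral)
    show "AE x in lborel. 0 \<le> indicat_real {a..b} x * J x"
      using J0 by (intro AE_I2) (simp add: indicator_def)
  qed (use primitive_integral_lborel[OF \<phi> \<open>a \<le> b\<close>] in auto)
  finally show "emeasure (distr (density lborel J) borel \<phi>) (box l u) = (\<Prod>b\<in>Basis. (u - l) \<bullet> b)"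
    using ab by simp
qed simp

lemma integral_change_of_variables:
  fixes f :: "real \<Rightarrow> real"
  assumes \<phi>: "primitive \<phi> J" and J: "\<And>x. \<delta> \<le> J x" "\<And>x. J x \<le> C" and "\<delta> > 0"
    and f: "f \<in> borel_measurable borel"
  shows "(LINT x|lborel. f x) = (LINT x|lborel. J x * f (\<phi> x))"
proof -
  have J0: "0 \<le> J x" for x using J(1)[of x] \<open>\<delta> > 0\<close> by linarith
  have [measurable]: "\<phi> \<in> borel_measurable borel" "J \<in> borel_measurable borel"
    using primitive_borel_fun[OF \<phi>] primitive_borel[OF \<phi>] by auto
  have "(LINT x|lborel. f x) = (LINT x|distr (density lborel J) borel \<phi>. f x)"
    using lborel_change_of_variables[OF assms(1-4)] by simp
  also have "\<dots> = (LINT x|density lborel J. f (\<phi> x))"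
    by (rule integral_distr) (use f in auto)
  also have "\<dots> = (LINT x|lborel. J x * f (\<phi> x))"
    using J0 f by (subst integral_density) auto
  finally show ?thesis .
qed

text \<open>
  Since \<open>mean J = 1\<close>, the image of the unit interval is again an interval of length one, over which
  \<open>f\<close> has the same integral.
\<close>

lemma mean_change_of_variables:
  fixes f :: "real \<Rightarrow> real"
  assumes \<phi>: "primitive \<phi> J" and J: "\<And>x. \<delta> \<le> J x" "\<And>x. J x \<le> C" and "\<delta> > 0"
    and perJ: "\<And>x. J (x + 1) = J x" and "mean J = 1"
    and f: "f \<in> borel_measurable borel" "locally_bounded f" and per: "\<And>x. f (x + 1) = f x"
  shows "mean f = mean (\<lambda>x. J x * f (\<phi> x))"
proof -
  have [measurable]: "\<phi> \<in> borel_measurable borel" "J \<in> borel_measurable borel"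
    using primitive_borel_fun[OF \<phi>] primitive_borel[OF \<phi>] by auto
  note sm = inverse_bi_lipschitz(1)[OF assms(1-4)]
  have \<phi>1: "\<phi> 1 = \<phi> 0 + 1" using primitive_period[OF \<phi> perJ, of 0] \<open>mean J = 1\<close> by simp
  have "mean f = (LINT x|lborel. indicator {\<phi> 0..\<phi> 1} x * f x)"
    using mean_shift[OF f per, of "\<phi> 0"] by (simp add: \<phi>1)
  also have "\<dots> = (LINT x|lborel. J x * (indicator {\<phi> 0..\<phi> 1} (\<phi> x) * f (\<phi> x)))"
    by (rule integral_change_of_variables[OF assms(1-4)]) (use f in measurable)
  also have "\<dots> = (LINT x|lborel. indicator {0..1} x * (J x * f (\<phi> x)))"
    using sm by (intro Bochner_Integration.integral_cong) (auto simp: indicator_def strict_mono_less_eq)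
  also have "\<dots> = mean (\<lambda>x. J x * f (\<phi> x))"
    by (subst mean_lborel) (use f(1) in measurable)
  finally show ?thesis .
qed

section \<open>Differentiation under the integral\<close>

text \<open>
  The difference quotients are bounded by the mean value theorem, so that dominated convergence
  applies. The dependence on the integration variable may be as rough as that of the initial data.
\<close>

lemma has_real_derivative_integral:
  fixes f f' :: "real \<Rightarrow> 'a \<Rightarrow> real"
  assumes fin: "finite_measure M" and "t \<ge> 0"
    and meas: "\<And>s. s \<ge> 0 \<Longrightarrow> f s \<in> borel_measurable M"
    and deriv: "\<And>s x. s \<ge> 0 \<Longrightarrow> ((\<lambda>s. f s x) has_real_derivative f' s x) (at s within {0..})"
    and bound0: "\<And>s. s \<ge> 0 \<Longrightarrow> \<exists>C. \<forall>x. \<bar>f s x\<bar> \<le> C"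
    and bound: "\<exists>C. \<forall>s x. 0 \<le> s \<longrightarrow> s \<le> t + 1 \<longrightarrow> \<bar>f' s x\<bar> \<le> C"
  shows "((\<lambda>s. LINT x|M. f s x) has_real_derivative (LINT x|M. f' t x)) (at t within {0..})"
proof -
  interpret finite_measure M by fact
  obtain C where C: "\<And>s x. 0 \<le> s \<Longrightarrow> s \<le> t + 1 \<Longrightarrow> \<bar>f' s x\<bar> \<le> C" using bound by blast
  have int: "integrable M (f s)" if "s \<ge> 0" for s
  proof -
    obtain D where "\<And>x. \<bar>f s x\<bar> \<le> D" using bound0[OF \<open>s \<ge> 0\<close>] by blast
    then show ?thesis using meas[OF \<open>s \<ge> 0\<close>] by (intro integrable_const_bound[of _ D]) auto
  qed
  have lip: "\<bar>f s x - f t x\<bar> \<le> C * \<bar>s - t\<bar>" if "0 \<le> s" "s \<le> t + 1" for s x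
  proof -
    have "norm (f s x - f t x) \<le> C * norm (s - t)"
      by (rule field_differentiable_bound[where S="{0..t+1}" and f'="\<lambda>s. f' s x"])
         (use that \<open>t \<ge> 0\<close> C in \<open>auto intro: DERIV_subset[OF deriv]\<close>)
    then show ?thesis by simp
  qed
  have "((\<lambda>s. LINT x|M. (f s x - f t x) / (s - t)) \<longlongrightarrow> (LINT x|M. f' t x)) (at t within {0..})"
  proof (subst tendsto_at_iff_sequentially, intro allI impI)
    fix X :: "nat \<Rightarrow> real" assume X: "\<forall>i. X i \<in> {0..} - {t}" "X \<longlonglongrightarrow> t"
    have "eventually (\<lambda>i. X i < t + 1) sequentially" using X(2) by (rule order_tendstoD) simp
    then obtain n where n: "\<And>i. i \<ge> n \<Longrightarrow> X i < t + 1" unfolding eventually_sequentially by blast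
    let ?g = "\<lambda>s x. (f s x - f t x) / (s - t)"
    have X': "(\<lambda>i. X (i + n)) \<longlonglongrightarrow> t" using X(2) LIMSEQ_ignore_initial_segment by blast
    have conv: "(\<lambda>i. ?g (X (i + n)) x) \<longlonglongrightarrow> f' t x" for x
      using deriv[OF \<open>t \<ge> 0\<close>, of x] X X' unfolding has_field_derivative_iff tendsto_at_iff_sequentially
      by (auto simp: o_def)
    have "(\<lambda>i. LINT x|M. ?g (X (i + n)) x) \<longlonglongrightarrow> (LINT x|M. f' t x)"
    proof (rule integral_dominated_convergence[where w="\<lambda>_. C"])
      show "\<And>i. ?g (X (i + n)) \<in> borel_measurable M"
        using X(1) \<open>t \<ge> 0\<close> by (intro borel_measurable_divide borel_measurable_diff meas borel_measurable_const) auto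
      then show "f' t \<in> borel_measurable M"
        by (rule borel_measurable_LIMSEQ_real[where u="\<lambda>i. ?g (X (i + n))", rotated]) (rule conv)
      show "AE x in M. norm (?g (X (i + n)) x) \<le> C" for i
      proof (rule AE_I2)
        fix x
        have "\<bar>X (i + n) - t\<bar> > 0" using X(1) by simp
        then show "norm (?g (X (i + n)) x) \<le> C"
          using lip[of "X (i + n)" x] X(1) n[of "i + n"] by (simp add: divide_le_eq less_imp_le)
      qed
    qed (use conv in auto)
    then have "(\<lambda>i. LINT x|M. ?g (X i) x) \<longlonglongrightarrow> (LINT x|M. f' t x)"
      by (rule LIMSEQ_offset)
    then show "((\<lambda>s. LINT x|M. ?g s x) \<circ> X) \<longlonglongrightarrow> (LINT x|M. f' t x)" by (simp add: o_def)
  qed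
  moreover have "\<forall>\<^sub>F s in at t within {0..}. (LINT x|M. (f s x - f t x) / (s - t)) =
      ((LINT x|M. f s x) - (LINT x|M. f t x)) / (s - t)"
    unfolding eventually_at_filter using int \<open>t \<ge> 0\<close> by (intro always_eventually) auto
  ultimately show ?thesis
    unfolding has_field_derivative_iff
    by (rule Lim_transform_eventually)
qed

lemma has_real_derivative_mean:
  assumes "t \<ge> 0"
    and "\<And>s. s \<ge> 0 \<Longrightarrow> f s \<in> borel_measurable borel"
    and "\<And>s x. s \<ge> 0 \<Longrightarrow> ((\<lambda>s. f s x) has_real_derivative f' s x) (at s within {0..})"
    and "\<And>s x. s \<ge> 0 \<Longrightarrow> \<bar>f s x\<bar> \<le> C s"
    and "\<And>s x. 0 \<le> s \<Longrightarrow> s \<le> t + 1 \<Longrightarrow> \<bar>f' s x\<bar> \<le> C'"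
  shows "((\<lambda>s. mean (f s)) has_real_derivative mean (f' t)) (at t within {0..})"
  unfolding mean_def
proof (rule has_real_derivative_integral[OF finite_measure_circle assms(1)])
  show "f s \<in> borel_measurable circle" if "s \<ge> 0" for s
    by (rule borel_measurable_circle[OF assms(2)[OF that]])
  show "\<exists>C. \<forall>x. \<bar>f s x\<bar> \<le> C" if "s \<ge> 0" for s using assms(4)[OF that] by blast
  show "\<exists>C. \<forall>s x. 0 \<le> s \<longrightarrow> s \<le> t + 1 \<longrightarrow> \<bar>f' s x\<bar> \<le> C" using assms(5) by blast
qed (use assms(3) in auto)

section \<open>Fubini's theorem for bounded functions with bounded support\<close>

lemma fubini_bounded:
  fixes G :: "real \<Rightarrow> real \<Rightarrow> real"
  assumes m: "case_prod G \<in> borel_measurable borel"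
    and bound: "\<And>t x. \<bar>G t x\<bar> \<le> C"
    and supp: "\<And>t x. G t x \<noteq> 0 \<Longrightarrow> t \<in> {a..b} \<and> x \<in> {c..d}"
  shows "integrable lborel (\<lambda>t. LINT x|lborel. G t x)"
    and "(LINT t|lborel. LINT x|lborel. G t x) = (LINT x|lborel. LINT t|lborel. G t x)"
    and "\<And>t. integrable lborel (G t)"
proof -
  have m': "case_prod G \<in> borel_measurable (lborel \<Otimes>\<^sub>M lborel)" using m by (simp add: lborel_prod)
  have C: "C \<ge> 0" using bound[of 0 0] by simp
  have "integrable (lborel \<Otimes>\<^sub>M lborel) (\<lambda>z. indicator ({a..b} \<times> {c..d}) z * C)"
  proof (intro integrable_mult_left integrable_real_indicator)
    show "emeasure (lborel \<Otimes>\<^sub>M lborel) ({a..b} \<times> {c..d}) < \<infinity>"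
      by (subst lborel.emeasure_pair_measure_Times)
         (auto simp: emeasure_lborel_Icc_eq ennreal_mult_less_top)
  qed auto
  then have I: "integrable (lborel \<Otimes>\<^sub>M lborel) (case_prod G)"
  proof (rule Bochner_Integration.integrable_bound[OF _ m'])
    show "AE z in lborel \<Otimes>\<^sub>M lborel. norm (case_prod G z) \<le> norm (indicat_real ({a..b} \<times> {c..d}) z * C)"
      using bound supp C by (intro AE_I2) (fastforce simp: indicator_def split: prod.splits)
  qed
  show "integrable lborel (\<lambda>t. LINT x|lborel. G t x)" using lborel_pair.integrable_fst'[OF I] by simp
  show "(LINT t|lborel. LINT x|lborel. G t x) = (LINT x|lborel. LINT t|lborel. G t x)"
    using lborel_pair.Fubini_integral[OF I] by simp
  show "integrable lborel (G t)" for t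
  proof (rule Bochner_Integration.integrable_bound[where f="\<lambda>x. indicator {c..d} x * C"])
    show "integrable lborel (\<lambda>x. indicator {c..d} x * C)"
      by (intro integrable_mult_left integrable_real_indicator) (auto simp: emeasure_lborel_Icc_eq)
    show "G t \<in> borel_measurable lborel"
      using measurable_compose[OF measurable_Pair1' m', of t] by simp
    show "AE x in lborel. norm (G t x) \<le> norm (indicat_real {c..d} x * C)"
      using bound[of t] supp[of t] C by (intro AE_I2) (fastforce simp: indicator_def)
  qed
qed

section \<open>Trigonometric polynomials as test functions\<close>

text \<open>
  A class of smooth periodic functions that is closed under differentiation by construction, which
  makes smoothness a simple induction, and that contains the restrictions of all polynomials on the
  plane to the unit circle.
\<close>

inductive trig :: "(real \<Rightarrow> real) \<Rightarrow> bool" where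
  const: "trig (\<lambda>x. c)"
| cos: "trig (\<lambda>x. cos (2 * pi * x))"
| sin: "trig (\<lambda>x. sin (2 * pi * x))"
| add: "trig f \<Longrightarrow> trig g \<Longrightarrow> trig (\<lambda>x. f x + g x)"
| mult: "trig f \<Longrightarrow> trig g \<Longrightarrow> trig (\<lambda>x. f x * g x)"

lemma trig_deriv: "trig f \<Longrightarrow> \<exists>g. trig g \<and> (\<forall>x. (f has_real_derivative g x) (at x))"
proof (induction rule: trig.induct)
  case (const c)
  show ?case by (intro exI[of _ "\<lambda>x. 0"]) (auto intro: trig.const)
next
  case cos
  have "trig (\<lambda>x. (- (2 * pi)) * sin (2 * pi * x))" by (intro trig.mult trig.const trig.sin)
  moreover have "((\<lambda>x. cos (2 * pi * x)) has_real_derivative (- (2 * pi)) * sin (2 * pi * x)) (at x)" for x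
    by (auto intro!: derivative_eq_intros)
  ultimately show ?case by blast
next
  case sin
  have "trig (\<lambda>x. (2 * pi) * cos (2 * pi * x))" by (intro trig.mult trig.const trig.cos)
  moreover have "((\<lambda>x. sin (2 * pi * x)) has_real_derivative (2 * pi) * cos (2 * pi * x)) (at x)" for x
    by (auto intro!: derivative_eq_intros)
  ultimately show ?case by blast
next
  case (add f g)
  then obtain f' g' where "trig f'" "trig g'" "\<forall>x. (f has_real_derivative f' x) (at x)"
    "\<forall>x. (g has_real_derivative g' x) (at x)" by blast
  then show ?case
    by (intro exI[of _ "\<lambda>x. f' x + g' x"]) (auto intro!: trig.add derivative_eq_intros)
next
  case (mult f g)
  then obtain f' g' where *: "trig f'" "trig g'" "\<forall>x. (f has_real_derivative f' x) (at x)"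
    "\<forall>x. (g has_real_derivative g' x) (at x)" by blast
  show ?case
    by (intro exI[of _ "\<lambda>x. f' x * g x + f x * g' x"])
       (use * mult.hyps in \<open>auto intro!: trig.add trig.mult derivative_eq_intros\<close>)
qed

lemma trig_continuous: "trig f \<Longrightarrow> continuous_on A f"
  by (induction rule: trig.induct) (auto intro!: continuous_intros)

lemma trig_periodic: "trig f \<Longrightarrow> f (x + 1) = f x"
  by (induction rule: trig.induct) (auto simp: ring_distribs)

lemma trig_bounded: "trig f \<Longrightarrow> \<exists>C. \<forall>x. \<bar>f x\<bar> \<le> C"
proof (induction rule: trig.induct)
  case (add f g)
  then obtain C D where "\<forall>x. \<bar>f x\<bar> \<le> C" "\<forall>x. \<bar>g x\<bar> \<le> D" by blast
  then show ?case by (intro exI[of _ "C + D"]) (meson abs_triangle_ineq add_mono order_trans)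
next
  case (mult f g)
  then obtain C D where *: "\<forall>x. \<bar>f x\<bar> \<le> C" "\<forall>x. \<bar>g x\<bar> \<le> D" by blast
  then show ?case
    by (intro exI[of _ "C * D"]) (auto simp: abs_mult intro!: mult_mono intro: order_trans[OF abs_ge_zero])
qed (auto intro: exI[of _ 1] abs_cos_le_one abs_sin_le_one)

lemma Ck_Suc_real:
  fixes f :: "real \<Rightarrow> real"
  assumes "\<And>x. (f has_real_derivative g x) (at x)" "\<And>v. Ck k (\<lambda>x. v * g x)"
  shows "Ck (Suc k) f"
proof -
  have "frechet_derivative f (at x) v = v * g x" for x v
  proof -
    have "(f has_derivative (*) (g x)) (at x)" using assms(1) by (simp add: has_field_derivative_def)
    from frechet_derivative_at[OF this] show ?thesis by (metis mult.commute)
  qed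
  moreover have "f differentiable at x" for x
    using assms(1)[of x] by (auto simp: real_differentiable_def)
  ultimately show ?thesis using assms(2) by simp
qed

lemma trig_Ck: "trig f \<Longrightarrow> Ck k f"
proof (induction k arbitrary: f)
  case 0 then show ?case using trig_continuous by simp
next
  case (Suc k)
  obtain g where g: "trig g" "\<And>x. (f has_real_derivative g x) (at x)" using trig_deriv[OF Suc.prems] by blast
  show ?case by (rule Ck_Suc_real[OF g(2)]) (intro Suc.IH trig.mult trig.const g(1))
qed

lemma trig_cis_polynomial:
  "real_polynomial_function g \<Longrightarrow> trig (\<lambda>x. g (cis (2 * pi * x)))"
proof (induction rule: real_polynomial_function.induct)
  case (linear h)
  interpret bounded_linear h by fact
  have "h (cis \<theta>) = cos \<theta> * h 1 + sin \<theta> * h \<i>" for \<theta>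
  proof -
    have "cis \<theta> = cos \<theta> *\<^sub>R 1 + sin \<theta> *\<^sub>R \<i>" by (simp add: complex_eq_iff)
    then show ?thesis by (simp only: add scaleR real_scaleR_def)
  qed
  then show ?case by (auto intro!: trig.intros)
qed (auto intro: trig.intros)

lemma cis_eq_on_period:
  assumes "cis (2 * pi * x) = cis (2 * pi * y)" "0 \<le> x" "x \<le> 1" "0 < y" "y < 1"
  shows "x = y"
proof -
  obtain n :: int where
    "\<i> * of_real (2 * pi * x) = \<i> * of_real (2 * pi * y) + complex_of_real (of_int (2 * n) * pi) * \<i>"
    using assms(1) unfolding cis_conv_exp exp_eq by blast
  from arg_cong[OF this, of Im] have "2 * pi * x = 2 * pi * y + of_int (2 * n) * pi" by simp
  then have "2 * pi * x = 2 * pi * (y + of_int n)" by (simp add: ring_distribs)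
  then have xy: "x = y + of_int n" by simp
  then have "\<bar>of_int n :: real\<bar> < 1" using assms by linarith
  then have "n = 0" by linarith
  then show ?thesis using xy by simp
qed

lemma integrable_mult_bounded:
  fixes v f :: "'a \<Rightarrow> real"
  assumes "integrable M v" "f \<in> borel_measurable M" "\<And>x. x \<in> space M \<Longrightarrow> \<bar>f x\<bar> \<le> C"
  shows "integrable M (\<lambda>x. v x * f x)"
proof (rule Bochner_Integration.integrable_bound[where f="\<lambda>x. C * v x"])
  show "AE x in M. norm (v x * f x) \<le> norm (C * v x)"
  proof (rule AE_I2)
    fix x assume "x \<in> space M"
    then have "\<bar>f x\<bar> \<le> \<bar>C\<bar>" using assms(3)[of x] by linarith
    then show "norm (v x * f x) \<le> norm (C * v x)" by (simp add: abs_mult mult.commute mult_right_mono)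
  qed
qed (use assms in auto)

text \<open>
  The end points of the period are a null set, so it is enough to approximate the part of a set that
  lies in the open interval, where \<open>cis (2 * pi * x)\<close> is injective.
\<close>

lemma AE_circle_inner:
  fixes v :: "real \<Rightarrow> real" and C T A :: "real set"
  assumes T: "T \<in> null_sets lebesgue" and C: "C \<union> T = A \<inter> {0<..<1}"
  shows "AE x in circle. indicat_real A x *\<^sub>R v x = v x * indicat_real C x"
proof -
  have "negligible T" using T by (rule negligible_iff_null_sets[THEN iffD2])
  then have "negligible (insert 0 (insert 1 T))" by (intro negligible_insert[THEN iffD2])
  moreover have "{x. \<not> (x \<in> {0..1} \<longrightarrow> indicat_real A x *\<^sub>R v x = v x * indicat_real C x)} \<subseteq> insert 0 (insert 1 T)"
  proof
    fix x assume "x \<in> {x. \<not> (x \<in> {0..1} \<longrightarrow> indicat_real A x *\<^sub>R v x = v x * indicat_real C x)}"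
    then have x: "0 \<le> x" "x \<le> 1" "indicat_real A x *\<^sub>R v x \<noteq> v x * indicat_real C x" by auto
    then have "\<not> (x \<in> A \<longleftrightarrow> x \<in> C)" by (metis indicator_simps mult.commute real_scaleR_def)
    moreover have "x \<in> A \<and> 0 < x \<and> x < 1 \<longleftrightarrow> x \<in> C \<or> x \<in> T"
      using arg_cong[OF C, of "\<lambda>S. x \<in> S"] by simp
    ultimately show "x \<in> insert 0 (insert 1 T)" using x(1,2) by (simp, linarith)
  qed
  ultimately have "AE x in lebesgue. x \<in> {0..1} \<longrightarrow> indicat_real A x *\<^sub>R v x = v x * indicat_real C x"
    unfolding eventually_ae_filter_negligible by blast
  then show ?thesis by (subst AE_restrict_space_iff) auto
qed

text \<open>
  By the Stone--Weierstrass theorem on the unit circle, \<open>v\<close> is orthogonal to every continuous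
  periodic function. The indicator of a compact subset of \<open>(0,1)\<close> is a bounded limit of such
  functions, and every measurable set is a countable union of compact sets up to a null set.
\<close>

lemma orthogonal_to_trig_imp_zero:
  assumes v: "integrable circle v" and orth: "\<And>f. trig f \<Longrightarrow> (LINT x|circle. v x * f x) = 0"
  shows "AE x in circle. v x = 0"
proof -
  let ?e = "\<lambda>x. cis (2 * pi * x)"
  have e_cont: "continuous_on A ?e" for A by (intro continuous_intros)
  have cont: "(LINT x|circle. v x * h (?e x)) = 0" if h: "continuous_on UNIV h" for h :: "complex \<Rightarrow> real"
  proof -
    have hm: "(\<lambda>x. h (?e x)) \<in> borel_measurable circle"
      by (intro borel_measurable_circle borel_measurable_continuous_onI
          continuous_on_compose2[OF h e_cont]) auto
    define V where "V = (LINT x|circle. \<bar>v x\<bar>)"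
    have "\<bar>LINT x|circle. v x * h (?e x)\<bar> \<le> \<epsilon> * V" if "\<epsilon> > 0" for \<epsilon>
    proof -
      obtain g where g: "real_polynomial_function g" "\<And>z. z \<in> sphere 0 1 \<Longrightarrow> \<bar>h z - g z\<bar> < \<epsilon>"
        using Stone_Weierstrass_real_polynomial_function[OF compact_sphere
            continuous_on_subset[OF h subset_UNIV] \<open>\<epsilon> > 0\<close>, of 0 1] by blast
      let ?g = "\<lambda>x. g (?e x)"
      have tg: "trig ?g" by (rule trig_cis_polynomial[OF g(1)])
      have gm: "?g \<in> borel_measurable circle"
        by (intro borel_measurable_circle borel_measurable_continuous_onI trig_continuous tg)
      have close: "\<bar>h (?e x) - ?g x\<bar> \<le> \<epsilon>" for x using g(2)[of "?e x"] by simp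
      obtain C where C: "\<And>x. \<bar>?g x\<bar> \<le> C" using trig_bounded[OF tg] by blast
      have i1: "integrable circle (\<lambda>x. v x * ?g x)" by (rule integrable_mult_bounded[OF v gm C])
      have i2: "integrable circle (\<lambda>x. v x * (h (?e x) - ?g x))"
        by (rule integrable_mult_bounded[OF v _ close]) (use gm hm in auto)
      have "(LINT x|circle. v x * h (?e x)) = (LINT x|circle. v x * (h (?e x) - ?g x) + v x * ?g x)"
        by (simp add: algebra_simps)
      also have "\<dots> = (LINT x|circle. v x * (h (?e x) - ?g x))" using i1 i2 orth[OF tg] by simp
      also have "\<bar>\<dots>\<bar> \<le> (LINT x|circle. \<bar>v x * (h (?e x) - ?g x)\<bar>)" by (rule integral_abs_bound)
      also have "\<dots> \<le> (LINT x|circle. \<epsilon> * \<bar>v x\<bar>)"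
      proof (rule integral_mono)
        show "\<bar>v x * (h (?e x) - ?g x)\<bar> \<le> \<epsilon> * \<bar>v x\<bar>" for x
          unfolding abs_mult by (subst mult.commute, rule mult_right_mono[OF close]) simp
      qed (use i2 v in auto)
      finally show ?thesis using v by (simp add: V_def)
    qed
    note small = this
    show ?thesis
    proof (rule ccontr)
      assume "(LINT x|circle. v x * h (?e x)) \<noteq> 0" (is "?I \<noteq> 0")
      then have "\<bar>?I\<bar> > 0" by simp
      have "V \<ge> 0" by (simp add: V_def)
      have "\<bar>?I\<bar> \<le> \<bar>?I\<bar> / (2 * (V + 1)) * V"
        by (rule small) (use \<open>\<bar>?I\<bar> > 0\<close> \<open>V \<ge> 0\<close> in \<open>auto intro!: divide_pos_pos\<close>)
      also have "\<dots> = \<bar>?I\<bar> * (V / (2 * (V + 1)))" by simp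
      also have "\<dots> < \<bar>?I\<bar> * 1"
        using \<open>V \<ge> 0\<close> by (intro mult_strict_left_mono \<open>\<bar>?I\<bar> > 0\<close>) (simp add: divide_less_eq)
      finally show False by simp
    qed
  qed
  \<comment> \<open>The indicator of \<open>K\<close> is the decreasing limit of the cut-offs \<open>1 - n * dist\<close> to its image on the
    unit circle; \<open>K\<close> avoids the end points, whose images coincide.\<close>
  have comp: "(LINT x|circle. v x * indicator K x) = 0" if K: "compact K" "K \<subseteq> {0<..<1}" for K
  proof (cases "K = {}")
    case False
    define E where "E = ?e ` K"
    have E: "closed E" "E \<noteq> {}"
      using K False e_cont compact_continuous_image compact_imp_closed unfolding E_def by blast+
    define h where "h n z = max 0 (1 - real n * infdist z E)" for n z
    have h0: "(LINT x|circle. v x * h n (?e x)) = 0" for n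
      unfolding h_def by (rule cont) (intro continuous_intros)
    have "(\<lambda>n. LINT x|circle. v x * h n (?e x)) \<longlonglongrightarrow> (LINT x|circle. v x * indicator K x)"
    proof (rule integral_dominated_convergence[where w="\<lambda>x. \<bar>v x\<bar>"])
      have [measurable]: "v \<in> borel_measurable circle" using v by auto
      have "K \<in> sets borel" using K(1) by (simp add: borel_compact)
      then have "indicator K \<in> borel_measurable circle" by (intro borel_measurable_circle) auto
      then show "(\<lambda>x. v x * indicator K x) \<in> borel_measurable circle" by measurable
      have hm: "(\<lambda>x. h n (?e x)) \<in> borel_measurable circle" for n
        unfolding h_def
        by (intro borel_measurable_circle borel_measurable_continuous_onI continuous_intros e_cont)
      then show "(\<lambda>x. v x * h n (?e x)) \<in> borel_measurable circle" for n by measurable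
      show "integrable circle (\<lambda>x. \<bar>v x\<bar>)" using v by simp
      have "0 \<le> h n z" "h n z \<le> 1" for n z by (auto simp: h_def infdist_nonneg)
      then show "AE x in circle. norm (v x * h n (?e x)) \<le> \<bar>v x\<bar>" for n
        by (intro AE_I2) (simp add: abs_mult mult_left_le)
      show "AE x in circle. (\<lambda>n. v x * h n (?e x)) \<longlonglongrightarrow> v x * indicator K x"
      proof (rule AE_I2)
        fix x assume "x \<in> space circle"
        then have x: "0 \<le> x" "x \<le> 1" by auto
        have "(\<lambda>n. h n (?e x)) \<longlonglongrightarrow> indicator K x"
        proof (cases "x \<in> K")
          case True
          then have "infdist (?e x) E = 0" by (simp add: E_def)
          then show ?thesis using True by (simp add: h_def)
        next
          case F: False
          have "?e x \<notin> E" using cis_eq_on_period[OF _ x] K(2) F unfolding E_def by fastforce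
          then have d: "infdist (?e x) E > 0"
            using E in_closed_iff_infdist_zero[of E] infdist_nonneg[of "?e x" E] by fastforce
          obtain N :: nat where N: "1 / infdist (?e x) E < N" using reals_Archimedean2 by blast
          have "h n (?e x) = 0" if "n \<ge> N" for n
          proof -
            have "1 < real N * infdist (?e x) E" using N d by (simp add: divide_less_eq)
            also have "\<dots> \<le> real n * infdist (?e x) E" using that d by (intro mult_right_mono) auto
            finally show ?thesis by (simp add: h_def)
          qed
          then have "eventually (\<lambda>n. h n (?e x) = 0) sequentially"
            unfolding eventually_sequentially by blast
          then show ?thesis using F by (simp add: tendsto_eventually)
        qed
        then show "(\<lambda>n. v x * h n (?e x)) \<longlonglongrightarrow> v x * indicator K x" by (intro tendsto_intros)
      qed
    qed
    then show ?thesis unfolding h0 by (simp add: LIMSEQ_const_iff)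
  qed simp
  interpret finite_measure circle by (rule finite_measure_circle)
  show ?thesis
  proof (rule density_zero[OF v])
    fix A assume A: "A \<in> sets circle"
    then have "A \<in> sets lebesgue" by (subst (asm) sets_restrict_space_iff) auto
    then have "A \<inter> {0<..<1} \<in> sets lebesgue" by (intro sets.Int) auto
    then obtain C T where CT: "fsigma C" "T \<in> null_sets lebesgue" "C \<union> T = A \<inter> {0<..<1}"
      using lebesgue_set_almost_fsigma by metis
    obtain F :: "nat \<Rightarrow> real set" where F: "range F \<subseteq> Collect compact" "C = \<Union>(range F)"
      using CT(1) fsigma_Union_compact by metis
    let ?K = "\<lambda>n. \<Union>i\<le>n. F i"
    have K: "compact (?K n)" "?K n \<subseteq> {0<..<1}" for n
    proof -
      show "compact (?K n)" using F by (intro compact_UN) auto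
      show "?K n \<subseteq> {0<..<1}" using F CT(3) by auto
    qed
    have mK: "?K n \<in> sets borel" for n using K(1) borel_compact by blast
    have "(\<lambda>n. LINT x|circle. v x * indicator (?K n) x) \<longlonglongrightarrow> (LINT x|circle. v x * indicator C x)"
    proof (rule integral_dominated_convergence[where w="\<lambda>x. \<bar>v x\<bar>"])
      have [measurable]: "v \<in> borel_measurable circle" using v by auto
      have ind: "(\<lambda>x. v x * indicator S x) \<in> borel_measurable circle" if "S \<in> sets borel" for S
      proof -
        have "indicator S \<in> borel_measurable circle"
          using that by (intro borel_measurable_circle) auto
        then show ?thesis by measurable
      qed
      have "C \<in> sets borel" using F borel_compact by (auto intro!: sets.countable_UN)
      then show "(\<lambda>x. v x * indicator C x) \<in> borel_measurable circle" by (rule ind)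
      show "(\<lambda>x. v x * indicator (?K n) x) \<in> borel_measurable circle" for n by (rule ind[OF mK])
      show "integrable circle (\<lambda>x. \<bar>v x\<bar>)" using v by simp
      show "AE x in circle. norm (v x * indicator (?K n) x) \<le> \<bar>v x\<bar>" for n
        by (intro AE_I2) (simp add: abs_mult indicator_def)
      show "AE x in circle. (\<lambda>n. v x * indicator (?K n) x) \<longlonglongrightarrow> v x * indicator C x"
      proof (intro AE_I2 tendsto_intros)
        fix x
        show "(\<lambda>n. indicator (?K n) x) \<longlonglongrightarrow> (indicator C x :: real)"
        proof (cases "x \<in> C")
          case True
          then obtain i where "x \<in> F i" using F by auto
          then have "eventually (\<lambda>n. indicator (?K n) x = (1::real)) sequentially"
            unfolding eventually_sequentially by (intro exI[of _ i]) (auto simp: indicator_def)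
          then show ?thesis using True by (simp add: tendsto_eventually)
        next
          case False
          then have "x \<notin> ?K n" for n using F by auto
          then show ?thesis using False by simp
        qed
      qed
    qed
    then have C0: "(LINT x|circle. v x * indicator C x) = 0"
      unfolding comp[OF K] by (simp add: LIMSEQ_const_iff)
    note ae = AE_circle_inner[OF CT(2,3), of v]
    have "set_lebesgue_integral circle A v = (LINT x|circle. v x * indicator C x)"
      unfolding set_lebesgue_integral_def
    proof (rule integral_cong_AE[OF _ _ ae])
      show "(\<lambda>x. indicator A x *\<^sub>R v x) \<in> borel_measurable circle" using A v by measurable
      have "C \<in> sets borel" using F borel_compact by (auto intro!: sets.countable_UN)
      then have "indicator C \<in> borel_measurable circle" by (intro borel_measurable_circle) auto
      then show "(\<lambda>x. v x * indicator C x) \<in> borel_measurable circle" using v by measurable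
    qed
    then show "set_lebesgue_integral circle A v = 0" using C0 by simp
  qed
qed


section \<open>Weak derivatives on the circle\<close>

lemma periodic_plus_int:
  fixes f :: "real \<Rightarrow> 'a"
  assumes "\<And>x. f (x + 1) = f x"
  shows "f (x + of_int n) = f x"
proof -
  interpret periodic_fun_simple' f by standard (rule assms)
  show ?thesis by (rule plus_of_int)
qed

lemma periodic_frac:
  fixes f :: "real \<Rightarrow> 'a"
  assumes "\<And>x. f (x + 1) = f x"
  shows "f (frac x) = f x"
  using periodic_plus_int[of f "frac x" "\<lfloor>x\<rfloor>", OF assms] by (simp add: frac_def)

text \<open>
  The line is a countable union of integer translates of the unit interval.
\<close>

lemma AE_circle_imp_AE_lebesgue:
  assumes ae: "AE x in circle. P x" and per: "\<And>x. P (x + 1) = P x"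
  shows "AE x in lebesgue. P x"
proof -
  have "AE x in lebesgue. x \<in> {0..1} \<longrightarrow> P x"
    using ae by (subst (asm) AE_restrict_space_iff) auto
  then obtain N where N: "negligible N" "{x. \<not> (x \<in> {0..1} \<longrightarrow> P x)} \<subseteq> N"
    unfolding eventually_ae_filter_negligible by blast
  have "negligible (\<Union>n::int. (+) (of_int n) ` N)"
    by (intro negligible_countable_Union) (auto intro: negligible_translation N(1))
  moreover have "{x. \<not> P x} \<subseteq> (\<Union>n::int. (+) (of_int n) ` N)"
  proof
    fix x assume "x \<in> {x. \<not> P x}"
    then have "\<not> P (frac x)" using periodic_frac[of P x, OF per] by simp
    then have "frac x \<in> N" using N(2) by (auto simp: frac_ge_0 frac_lt_1 less_imp_le)
    moreover have "x = of_int \<lfloor>x\<rfloor> + frac x" by (simp add: frac_def)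
    ultimately show "x \<in> (\<Union>n::int. (+) (of_int n) ` N)" by blast
  qed
  ultimately show ?thesis unfolding eventually_ae_filter_negligible by blast
qed

lemma periodicD: "periodic_fun_simple' f \<Longrightarrow> f (x + 1) = f x"
  by (simp add: periodic_fun_simple'_def)

lemma trig_smooth: "trig f \<Longrightarrow> smooth f"
  using trig_Ck by (auto simp: smooth_def)

lemma is_weak_derivD:
  assumes "is_weak_deriv f g" "smooth \<phi>" "periodic_fun_simple' \<phi>"
  shows "(LINT x|circle. f x * deriv \<phi> x) = - (LINT x|circle. g x * \<phi> x)"
  using assms unfolding is_weak_deriv_def by blast

text \<open>
  The difference of two weak derivatives annihilates all smooth periodic functions, in particular the
  trigonometric polynomials.
\<close>

lemma weak_deriv_unique:
  assumes "is_weak_deriv f g" "is_weak_deriv f h"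
  shows "AE x in circle. g x = h x"
proof -
  have int: "integrable circle g" "integrable circle h"
    using assms by (auto simp: is_weak_deriv_def L1_def)
  have "AE x in circle. g x - h x = 0"
  proof (rule orthogonal_to_trig_imp_zero)
    fix \<phi> assume \<phi>: "trig \<phi>"
    obtain C where C: "\<And>x. \<bar>\<phi> x\<bar> \<le> C" using trig_bounded[OF \<phi>] by blast
    have m: "\<phi> \<in> borel_measurable circle"
      by (intro borel_measurable_circle borel_measurable_continuous_onI trig_continuous \<phi>)
    have "periodic_fun_simple' \<phi>" by (simp add: periodic_fun_simple'_def trig_periodic[OF \<phi>])
    then have "(LINT x|circle. g x * \<phi> x) = (LINT x|circle. h x * \<phi> x)"
      using is_weak_derivD[OF assms(1) trig_smooth[OF \<phi>]] is_weak_derivD[OF assms(2) trig_smooth[OF \<phi>]]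
      by simp
    then show "(LINT x|circle. (g x - h x) * \<phi> x) = 0"
      using integrable_mult_bounded[OF int(1) m C] integrable_mult_bounded[OF int(2) m C]
      by (simp add: left_diff_distrib)
  qed (use int in auto)
  then show ?thesis by eventually_elim simp
qed

lemma weak_deriv_works: "is_weak_deriv f g \<Longrightarrow> is_weak_deriv f (weak_deriv f)"
  unfolding weak_deriv_def by (rule someI[where P="is_weak_deriv f"])

lemma weak_deriv_AE: "is_weak_deriv f g \<Longrightarrow> AE x in circle. weak_deriv f x = g x"
  by (rule weak_deriv_unique[OF weak_deriv_works])

lemma weak_deriv_AE_lebesgue:
  assumes "is_weak_deriv f g"
  shows "AE x in lebesgue. weak_deriv f x = g x"
proof (rule AE_circle_imp_AE_lebesgue[OF weak_deriv_AE[OF assms]])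
  have "periodic_fun_simple' (weak_deriv f)" "periodic_fun_simple' g"
    using weak_deriv_works[OF assms] assms by (auto simp: is_weak_deriv_def L1_def)
  then show "(weak_deriv f (x + 1) = g (x + 1)) = (weak_deriv f x = g x)" for x
    by (simp add: periodicD)
qed

lemma is_weak_deriv_integrable:
  "is_weak_deriv f g \<Longrightarrow> integrable circle f" "is_weak_deriv f g \<Longrightarrow> integrable circle g"
  by (auto simp: is_weak_deriv_def L1_def)

lemma weak_deriv_circle: "is_weak_deriv f g \<Longrightarrow> weak_deriv f \<in> borel_measurable circle"
  using weak_deriv_works[of f g] by (auto simp: is_weak_deriv_def L1_def)

lemma smooth_real_deriv:
  fixes \<phi> :: "real \<Rightarrow> real"
  assumes "smooth \<phi>"
  shows "(\<phi> has_real_derivative deriv \<phi> x) (at x)" "continuous_on UNIV (deriv \<phi>)"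
proof -
  have "Ck 1 \<phi>" using assms by (simp only: smooth_def)
  then have diff: "\<And>x. \<phi> differentiable at x"
    and c: "continuous_on UNIV (\<lambda>x. frechet_derivative \<phi> (at x) 1)" by auto
  show d: "(\<phi> has_real_derivative deriv \<phi> x) (at x)" for x
    using diff[of x] DERIV_deriv_iff_real_differentiable by blast
  have "deriv \<phi> x = frechet_derivative \<phi> (at x) 1" for x
  proof -
    have "(\<phi> has_derivative (*) (deriv \<phi> x)) (at x)" using d[of x] by (simp add: has_field_derivative_def)
    from frechet_derivative_at[OF this, symmetric] show ?thesis by simp
  qed
  then show "continuous_on UNIV (deriv \<phi>)" using c by (simp cong: continuous_on_cong)
qed

lemma is_weak_deriv_diff:
  assumes "is_weak_deriv f f'" "is_weak_deriv g g'"
  shows "is_weak_deriv (f - g) (f' - g')"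
  unfolding is_weak_deriv_def
proof (intro conjI allI impI)
  note int = is_weak_deriv_integrable[OF assms(1)] is_weak_deriv_integrable[OF assms(2)]
  have "periodic_fun_simple' f" "periodic_fun_simple' g" "periodic_fun_simple' f'" "periodic_fun_simple' g'"
    using assms by (simp_all add: is_weak_deriv_def L1_def)
  then have "periodic_fun_simple' (f - g)" "periodic_fun_simple' (f' - g')"
    by (simp_all add: periodic_fun_simple'_def)
  then show "f - g \<in> L1" "f' - g' \<in> L1"
    using Bochner_Integration.integrable_diff[OF int(1,3)] Bochner_Integration.integrable_diff[OF int(2,4)]
    by (simp_all add: L1_def fun_diff_def)
  fix \<phi> :: "real \<Rightarrow> real" assume "smooth \<phi> \<and> periodic_fun_simple' \<phi>"
  then have \<phi>: "smooth \<phi>" "periodic_fun_simple' \<phi>" by auto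
  have c: "continuous_on UNIV \<phi>" using \<phi>(1) unfolding smooth_def by (metis Ck.simps(1))
  note c' = smooth_real_deriv(2)[OF \<phi>(1)]
  have I: "integrable circle (\<lambda>x. h x * k x)" if hk: "integrable circle h" "continuous_on UNIV k" for h k :: "real \<Rightarrow> real"
  proof -
    obtain C where C: "\<And>x. \<bar>x\<bar> \<le> 1 \<Longrightarrow> \<bar>k x\<bar> \<le> C"
      using locally_boundedE[OF locally_bounded_continuous[OF hk(2)]] by metis
    show ?thesis
      using C by (intro integrable_mult_bounded[OF hk(1), of _ C] borel_measurable_circle
          borel_measurable_continuous_onI hk(2)) auto
  qed
  show "(LINT x|circle. (f - g) x * deriv \<phi> x) = - (LINT x|circle. (f' - g') x * \<phi> x)"
    using is_weak_derivD[OF assms(1) \<phi>] is_weak_derivD[OF assms(2) \<phi>]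
      I[OF int(1) c'] I[OF int(2) c] I[OF int(3) c'] I[OF int(4) c]
    by (simp add: left_diff_distrib)
qed

lemma continuous_antiderivative:
  fixes f :: "real \<Rightarrow> real"
  assumes "continuous_on UNIV f"
  obtains F where "\<And>x. (F has_real_derivative f x) (at x)" "primitive F f"
proof -
  have "\<exists>F. \<forall>x. (-\<infinity>::ereal) < ereal x \<longrightarrow> ereal x < \<infinity> \<longrightarrow> (F has_vector_derivative f x) (at x)"
    by (rule einterval_antiderivative) (use assms in \<open>auto simp: continuous_on_eq_continuous_at\<close>)
  then obtain F where F: "\<And>x. (F has_real_derivative f x) (at x)"
    by (auto simp: has_real_derivative_iff_has_vector_derivative)
  moreover have "primitive F f"
    unfolding primitive_def
  proof (intro conjI allI impI)
    show "f \<in> borel_measurable borel" "locally_bounded f"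
      using assms borel_measurable_continuous_onI locally_bounded_continuous by auto
    show "(f has_integral F b - F a) {a..b}" if "a \<le> b" for a b
      using that F by (intro fundamental_theorem_of_calculus)
        (auto simp flip: has_real_derivative_iff_has_vector_derivative intro: DERIV_subset)
  qed
  ultimately show ?thesis using that by blast
qed

text \<open>
  A trigonometric polynomial of mean zero is the derivative of a smooth periodic function, so equal
  weak derivatives make \<open>f - g\<close> orthogonal to it; equal means settle the remaining constant.
\<close>

lemma weak_deriv_mean_unique:
  assumes "is_weak_deriv f h" "is_weak_deriv g k" "AE x in circle. h x = k x" "mean f = mean g"
  shows "AE x in circle. f x = g x"
proof -
  note int = is_weak_deriv_integrable[OF assms(1)] is_weak_deriv_integrable[OF assms(2)]
  have int_fg: "integrable circle (\<lambda>x. f x - g x)" using int by simp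
  have "AE x in circle. f x - g x = 0"
  proof (rule orthogonal_to_trig_imp_zero[OF int_fg])
    fix \<psi> assume \<psi>: "trig \<psi>"
    define m where "m = mean \<psi>"
    have t: "trig (\<lambda>x. \<psi> x + - m)" by (intro trig.add trig.const \<psi>)
    obtain \<phi> where \<phi>: "\<And>x. (\<phi> has_real_derivative \<psi> x + - m) (at x)" "primitive \<phi> (\<lambda>x. \<psi> x + - m)"
      using continuous_antiderivative[OF trig_continuous[OF t]] by blast
    obtain \<Psi> where \<Psi>: "primitive \<Psi> \<psi>" using continuous_antiderivative[OF trig_continuous[OF \<psi>]] by blast
    have mean0: "mean (\<lambda>x. \<psi> x + - m) = 0"
      using mean_primitive[OF primitive_add[OF \<Psi> primitive_cmult[OF primitive_ident, of "-m"]]]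
        mean_primitive[OF \<Psi>] by (simp add: m_def)
    have "\<phi> (x + 1) = \<phi> x" for x
      using primitive_period[OF \<phi>(2), of x] mean0 trig_periodic[OF \<psi>] by simp
    then have per: "periodic_fun_simple' \<phi>" by (simp add: periodic_fun_simple'_def)
    have sm: "smooth \<phi>"
      unfolding smooth_def
    proof
      fix k show "Ck k \<phi>"
      proof (cases k)
        case 0
        then show ?thesis using primitive_continuous[OF \<phi>(2)] by simp
      next
        case (Suc k)
        show ?thesis unfolding Suc
          by (rule Ck_Suc_real[OF \<phi>(1)]) (intro trig_Ck trig.mult trig.const t)
      qed
    qed
    have deriv: "deriv \<phi> x = \<psi> x - m" for x using DERIV_imp_deriv[OF \<phi>(1)[of x]] by simp
    obtain C where C: "\<And>x. \<bar>\<psi> x\<bar> \<le> C" using trig_bounded[OF \<psi>] by blast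
    have m\<psi>: "\<psi> \<in> borel_measurable circle"
      by (intro borel_measurable_circle borel_measurable_continuous_onI trig_continuous \<psi>)
    have I: "integrable circle (\<lambda>x. w x * \<psi> x)" if "integrable circle w" for w
      by (rule integrable_mult_bounded[OF that m\<psi> C])
    have "(LINT x|circle. f x * deriv \<phi> x) = (LINT x|circle. g x * deriv \<phi> x)"
    proof -
      have "(LINT x|circle. h x * \<phi> x) = (LINT x|circle. k x * \<phi> x)"
      proof (rule integral_cong_AE)
        have "\<phi> \<in> borel_measurable circle"
          by (rule borel_measurable_circle[OF primitive_borel_fun[OF \<phi>(2)]])
        then show "(\<lambda>x. h x * \<phi> x) \<in> borel_measurable circle" "(\<lambda>x. k x * \<phi> x) \<in> borel_measurable circle"
          using int by (auto intro!: borel_measurable_times)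
        show "AE x in circle. h x * \<phi> x = k x * \<phi> x" using assms(3) by eventually_elim simp
      qed
      then show ?thesis
        using is_weak_derivD[OF assms(1) sm per] is_weak_derivD[OF assms(2) sm per] by simp
    qed
    then have "(LINT x|circle. f x * \<psi> x) - m * mean f = (LINT x|circle. g x * \<psi> x) - m * mean g"
      using int I[OF int(1)] I[OF int(3)] unfolding deriv mean_def
      by (simp add: right_diff_distrib mult.commute[of _ m])
    then show "(LINT x|circle. (f x - g x) * \<psi> x) = 0"
      using assms(4) I[OF int(1)] I[OF int(3)] by (simp add: left_diff_distrib)
  qed
  then show ?thesis by eventually_elim simp
qed

section \<open>Bounded Borel functions on the circle\<close>

lemma bounded_periodic_spaces:
  assumes "f \<in> borel_measurable borel" "\<And>x. \<bar>f x\<bar> \<le> C" "\<And>x. f (x + 1) = f x"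
  shows "f \<in> L1" "f \<in> L2" "f \<in> Linf" "norm_Linf f \<le> C" "norm_L2 f \<le> C"
proof -
  have m: "f \<in> borel_measurable circle" by (rule borel_measurable_circle[OF assms(1)])
  have per: "periodic_fun_simple' f" using assms(3) by (simp add: periodic_fun_simple'_def)
  have C: "C \<ge> 0" using assms(2)[of 0] by linarith
  have sq: "(f x)\<^sup>2 \<le> C\<^sup>2" for x using assms(2)[of x] by (metis power2_abs power_mono abs_ge_zero)
  have isq: "integrable circle (\<lambda>x. (f x)\<^sup>2)"
    by (rule integrable_circle[of _ "C\<^sup>2"]) (use assms(1) sq in auto)
  show "f \<in> L1" using integrable_circle[OF assms(1), of C] assms(2) per by (simp add: L1_def)
  show "f \<in> L2" using m per isq by (simp add: L2_def)
  have "esssup circle (\<lambda>x. ereal \<bar>f x\<bar>) \<le> ereal C"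
    by (rule esssup_I) (use m assms(2) in auto)
  moreover have "esssup circle (\<lambda>x. ereal \<bar>f x\<bar>) \<ge> ereal 0"
  proof -
    have "esssup circle (\<lambda>x. ereal 0) = ereal 0"
      by (rule esssup_const) (simp add: emeasure_restrict_space)
    moreover have "esssup circle (\<lambda>x. ereal 0) \<le> esssup circle (\<lambda>x. ereal \<bar>f x\<bar>)"
      by (rule esssup_mono) auto
    ultimately show ?thesis by simp
  qed
  ultimately show "f \<in> Linf" "norm_Linf f \<le> C"
    using m per unfolding Linf_def norm_Linf_def
    by (cases "esssup circle (\<lambda>x. ereal \<bar>f x\<bar>)"; simp)+
  have "(LINT x|circle. (f x)\<^sup>2) \<le> (LINT x|circle. C\<^sup>2)"
    by (rule integral_mono[OF isq]) (use sq integrable_circle[of "\<lambda>_. C\<^sup>2" "C\<^sup>2"] in auto)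
  also have "\<dots> = C\<^sup>2" using mean_const[of "C\<^sup>2"] by (simp only: mean_def)
  finally show "norm_L2 f \<le> C" unfolding norm_L2_def using C by (simp add: real_le_lsqrt)
qed

lemma norm_L2_cong_AE:
  assumes "f \<in> borel_measurable circle" "g \<in> borel_measurable circle" "AE x in circle. f x = g x"
  shows "norm_L2 f = norm_L2 g"
proof -
  have "(LINT x|circle. (f x)\<^sup>2) = (LINT x|circle. (g x)\<^sup>2)"
    by (rule integral_cong_AE) (use assms in \<open>auto elim: eventually_mono\<close>)
  then show ?thesis by (simp add: norm_L2_def)
qed

lemma norm_Linf_cong_AE:
  assumes "f \<in> borel_measurable circle" "g \<in> borel_measurable circle" "AE x in circle. f x = g x"
  shows "norm_Linf f = norm_Linf g"
proof -
  have "esssup circle (\<lambda>x. ereal \<bar>f x\<bar>) = esssup circle (\<lambda>x. ereal \<bar>g x\<bar>)"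
    by (rule esssup_AE_cong) (use assms in \<open>auto elim: eventually_mono\<close>)
  then show ?thesis by (simp add: norm_Linf_def)
qed

text \<open>Integration by parts against a smooth periodic function, whose boundary terms cancel.\<close>

lemma is_weak_deriv_primitive:
  assumes F: "primitive F f" and f: "\<And>x. \<bar>f x\<bar> \<le> C" "\<And>x. f (x + 1) = f x"
    and F_per: "\<And>x. F (x + 1) = F x"
  shows "is_weak_deriv F f"
  unfolding is_weak_deriv_def
proof (intro conjI allI impI)
  have "f \<in> borel_measurable borel" using primitive_borel[OF F] .
  then show "f \<in> L1" by (rule bounded_periodic_spaces(1)) (use f in auto)
  obtain D where D: "\<And>x. \<bar>x\<bar> \<le> 1 \<Longrightarrow> \<bar>F x\<bar> \<le> D"
    using locally_boundedE[OF locally_bounded_continuous[OF primitive_continuous[OF F]]] by metis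
  have "\<bar>F x\<bar> \<le> D" for x
    using D[of "frac x"] periodic_frac[of F x, OF F_per] frac_ge_0[of x] frac_lt_1[of x] by simp
  then show "F \<in> L1" by (intro bounded_periodic_spaces(1)[OF primitive_borel_fun[OF F]] F_per)
  fix \<phi> :: "real \<Rightarrow> real" assume \<phi>: "smooth \<phi> \<and> periodic_fun_simple' \<phi>"
  have "primitive \<phi> (\<lambda>x. deriv \<phi> x * 1)"
    by (rule primitive_chain[OF primitive_ident]) (use smooth_real_deriv \<phi> in auto)
  then have p: "primitive \<phi> (deriv \<phi>)" by simp
  have prod: "primitive (\<lambda>x. F x * \<phi> x) (\<lambda>x. f x * \<phi> x + F x * deriv \<phi> x)"
    by (rule primitive_mult[OF F p])
  have int: "integrable circle h" if h: "h \<in> borel_measurable borel" "locally_bounded h" for h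
  proof -
    obtain K where K: "\<And>x. \<bar>x\<bar> \<le> 1 \<Longrightarrow> \<bar>h x\<bar> \<le> K" using locally_boundedE[OF h(2)] by metis
    show ?thesis using K by (intro integrable_circle[OF h(1), of K]) auto
  qed
  have i: "integrable circle (\<lambda>x. f x * \<phi> x)" "integrable circle (\<lambda>x. F x * deriv \<phi> x)"
    using primitive_borel[OF F] primitive_borel_fun[OF F] primitive_borel[OF p] primitive_borel_fun[OF p]
      primitive_locally_bounded[OF F] primitive_locally_bounded[OF p]
      locally_bounded_continuous[OF primitive_continuous[OF F]]
      locally_bounded_continuous[OF primitive_continuous[OF p]]
    by (auto intro!: int locally_bounded_mult borel_measurable_times)
  have "mean (\<lambda>x. f x * \<phi> x + F x * deriv \<phi> x) = 0"
    using mean_primitive[OF prod] F_per[of 0] periodicD[of \<phi> 0] \<phi> by simp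
  then show "(LINT x|circle. F x * deriv \<phi> x) = - (LINT x|circle. f x * \<phi> x)"
    using i by (simp add: mean_def)
qed

text \<open>
  Pass to a Borel function that agrees almost everywhere, clamp its values, and repeat those on
  \<open>[0,1)\<close> periodically.
\<close>

lemma bounded_borel_representative:
  fixes f :: "real \<Rightarrow> real"
  assumes "f \<in> borel_measurable circle" "AE x in circle. lo \<le> f x \<and> f x \<le> hi" "lo \<le> hi"
  obtains g where "g \<in> borel_measurable borel" "\<And>x. g (x + 1) = g x" "\<And>x. lo \<le> g x" "\<And>x. g x \<le> hi"
    "AE x in circle. f x = g x"
proof -
  have "(\<lambda>x. if x \<in> {0..1} then f x else 0) \<in> borel_measurable lebesgue"
    using assms(1) by (subst borel_measurable_if) auto
  then obtain h where h: "h \<in> borel_measurable lborel" "AE x in lborel. (if x \<in> {0..1} then f x else 0) = h x"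
    using completion_ex_borel_measurable_real by blast
  define g where "g x = max lo (min hi (h (frac x)))" for x
  show ?thesis
  proof
    have "(\<lambda>x::real. frac x) \<in> borel_measurable borel" unfolding frac_def by measurable
    then show "g \<in> borel_measurable borel" using h(1) unfolding g_def by measurable
    show "g (x + 1) = g x" for x by (simp add: g_def frac_1_eq)
    show "lo \<le> g x" "g x \<le> hi" for x using assms(3) by (auto simp: g_def)
    have "AE x in lebesgue. x \<noteq> (1::real)" using AE_lborel_singleton[of 1] AE_completion by blast
    moreover have "AE x in lebesgue. (if x \<in> {0..1} then f x else 0) = h x" using h(2) AE_completion by blast
    moreover have "AE x in lebesgue. x \<in> {0..1} \<longrightarrow> lo \<le> f x \<and> f x \<le> hi"
      using assms(2) by (subst (asm) AE_restrict_space_iff) auto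
    ultimately have "AE x in lebesgue. x \<in> {0..1} \<longrightarrow> f x = g x"
    proof eventually_elim
      case (elim x)
      show ?case
      proof
        assume x: "x \<in> {0..1}"
        then have "frac x = x" using elim(1) by (simp add: frac_eq)
        then show "f x = g x" using elim x by (simp add: g_def)
      qed
    qed
    then show "AE x in circle. f x = g x" by (subst AE_restrict_space_iff) auto
  qed
qed

section \<open>Differential equations on the half-line of times\<close>

lemma at_within_ray: "t < T \<Longrightarrow> at t within {0..T} = at t within {0::real..}"
  by (rule at_within_nhd[of t "{..<T}"]) auto

lemma has_vector_derivative_integral_ray:
  fixes g :: "real \<Rightarrow> 'a::banach"
  assumes "continuous_on {0..} g" "t \<ge> 0"
  shows "((\<lambda>t. integral {0..t} g) has_vector_derivative g t) (at t within {0..})"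
proof -
  have "((\<lambda>t. integral {0..t} g) has_vector_derivative g t) (at t within {0..t + 1})"
    by (rule integral_has_vector_derivative[OF continuous_on_subset[OF assms(1)]]) (use assms(2) in auto)
  then show ?thesis using at_within_ray[of t "t + 1"] by simp
qed

lemma inner_deriv:
  fixes f g :: "real \<Rightarrow> 'a::real_inner"
  assumes "(f has_vector_derivative f') (at t within S)" "(g has_vector_derivative g') (at t within S)"
  shows "((\<lambda>t. f t \<bullet> g t) has_real_derivative (f t \<bullet> g' + f' \<bullet> g t)) (at t within S)"
  using bounded_bilinear.has_vector_derivative[OF bounded_bilinear_inner assms]
  by (simp add: has_real_derivative_iff_has_vector_derivative)

lemma deriv_ray_cong:
  assumes "(f has_real_derivative d) (at t within {0..})" "t \<ge> 0" "\<And>s. s \<ge> 0 \<Longrightarrow> f s = g s"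
  shows "(g has_real_derivative d) (at t within {0..})"
  by (rule has_field_derivative_transform_within[OF assms(1), of 1]) (use assms in auto)

lemma deriv_ray_unique:
  fixes f :: "real \<Rightarrow> real"
  assumes "(f has_real_derivative a) (at t within {0..})" "(f has_real_derivative b) (at t within {0..})" "t \<ge> 0"
  shows "a = b"
proof -
  have "at_right t \<le> at t within {0..}" using assms(3) by (intro at_le) auto
  then have "at t within {0..} \<noteq> bot"
    using trivial_limit_at_right_real[of t] by (metis bot.extremum_uniqueI)
  then show ?thesis using assms(1,2) unfolding has_field_derivative_iff by (rule tendsto_unique)
qed

lemma DERIV_zero_ray_const:
  fixes f :: "real \<Rightarrow> real"
  assumes "\<And>s. s \<ge> 0 \<Longrightarrow> (f has_real_derivative 0) (at s within {0..})" "t \<ge> 0"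
  shows "f t = f 0"
proof -
  obtain C where "\<And>s. s \<in> {0..} \<Longrightarrow> f s = C"
    using has_field_derivative_zero_constant[of "{0..}" f] assms(1) by auto
  then show ?thesis using assms(2) by simp
qed

lemma lipschitz_ray:
  fixes f f' :: "real \<Rightarrow> real"
  assumes "\<And>r. r \<ge> 0 \<Longrightarrow> (f has_real_derivative f' r) (at r within {0..})"
    and "\<And>r. 0 \<le> r \<Longrightarrow> r \<le> T \<Longrightarrow> \<bar>f' r\<bar> \<le> C" and "0 \<le> s" "s \<le> T" "0 \<le> t" "t \<le> T"
  shows "\<bar>f s - f t\<bar> \<le> C * \<bar>s - t\<bar>"
proof -
  have "norm (f s - f t) \<le> C * norm (s - t)"
    by (rule field_differentiable_bound[where S="{0..T}" and f'=f'])
       (use assms(2-6) in \<open>auto intro: DERIV_subset[OF assms(1)]\<close>)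
  then show ?thesis by simp
qed

text \<open>
  The product \<open>u t * exp (- C * t)\<close> is nonincreasing.
\<close>

lemma gronwall:
  fixes u u' :: "real \<Rightarrow> real"
  assumes deriv: "\<And>t. t \<ge> 0 \<Longrightarrow> (u has_real_derivative u' t) (at t within {0..})"
    and le: "\<And>t. t \<ge> 0 \<Longrightarrow> u' t \<le> C * u t" and "t \<ge> 0"
  shows "u t \<le> u 0 * exp (C * t)"
proof -
  define w where "w t = u t * exp (- C * t)" for t
  have w': "(w has_real_derivative (u' s - C * u s) * exp (- C * s)) (at s within {0..})" if "s \<ge> 0" for s
    unfolding w_def
    by (rule derivative_eq_intros deriv[OF that] refl | simp)+ (simp add: algebra_simps)
  have "w t \<le> w 0"
  proof (rule DERIV_nonpos_imp_decreasing_open[OF \<open>t \<ge> 0\<close>])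
    fix s assume s: "0 < s" "s < t"
    have "at s within {0..} = at s" using s by (intro at_within_interior) simp
    then have "(w has_real_derivative (u' s - C * u s) * exp (- C * s)) (at s)" using w'[of s] s by simp
    moreover have "(u' s - C * u s) * exp (- C * s) \<le> 0"
      using le[of s] s by (intro mult_nonpos_nonneg) auto
    ultimately show "\<exists>y. (w has_real_derivative y) (at s) \<and> y \<le> 0" by blast
  next
    show "continuous_on {0..t} w"
    proof (rule DERIV_continuous_on)
      fix s assume "s \<in> {0..t}"
      then show "(w has_real_derivative (u' s - C * u s) * exp (- C * s)) (at s within {0..t})"
        by (intro DERIV_subset[OF w']) auto
    qed
  qed
  then have "u t * exp (- C * t) \<le> u 0" by (simp add: w_def)
  then have "u t * exp (- C * t) * exp (C * t) \<le> u 0 * exp (C * t)" by (intro mult_right_mono) auto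
  then show ?thesis by (simp add: mult.assoc exp_add[symmetric])
qed

text \<open>
  Picard iteration. The differences of consecutive iterates are measured with the weight
  \<open>exp (2 * L * t)\<close>, for which the integral operator is a contraction with factor \<open>1/2\<close> on
  every bounded time interval.
\<close>

lemma picard_global:
  fixes f :: "real \<Rightarrow> 'a::banach \<Rightarrow> 'a"
  assumes cont: "\<And>y. continuous_on {0..} y \<Longrightarrow> continuous_on {0..} (\<lambda>t. f t (y t))"
    and lip: "\<And>T. \<exists>L>0. \<forall>t x y. 0 \<le> t \<longrightarrow> t \<le> T \<longrightarrow> norm (f t x - f t y) \<le> L * norm (x - y)"
  obtains y where "continuous_on {0..} y" "\<And>t. t \<ge> 0 \<Longrightarrow> y t = x0 + integral {0..t} (\<lambda>s. f s (y s))"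
    "\<And>t. t \<ge> 0 \<Longrightarrow> (y has_vector_derivative f t (y t)) (at t within {0..})"
proof -
  define \<P> where "\<P> y t = x0 + integral {0..t} (\<lambda>s. f s (y s))" for y t
  define Y where "Y n = (\<P> ^^ n) (\<lambda>_. x0)" for n
  have Y0: "Y 0 = (\<lambda>_. x0)" and YS: "Y (Suc n) = \<P> (Y n)" for n by (auto simp: Y_def)
  have \<P>_cont: "continuous_on {0..} (\<P> y)" if "continuous_on {0..} y" for y
  proof -
    have "(\<P> y has_vector_derivative f t (y t)) (at t within {0..})" if "t \<ge> 0" for t
      using has_vector_derivative_add[OF has_vector_derivative_const
          has_vector_derivative_integral_ray[OF cont[OF \<open>continuous_on {0..} y\<close>] that], of x0]
      by (simp add: \<P>_def[abs_def])
    then show ?thesis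
      by (metis atLeast_iff continuous_on_eq_continuous_within has_vector_derivative_continuous)
  qed
  have Y_cont: "continuous_on {0..} (Y n)" for n
    by (induction n) (auto simp: Y0 YS intro: \<P>_cont)
  have int: "(\<lambda>s. f s (y s)) integrable_on {0..t}" if "continuous_on {0..} y" for y t
    using continuous_on_subset[OF cont[OF that], of "{0..t}"] by (intro integrable_continuous_real) auto
  have \<P>_diff: "\<P> y t - \<P> z t = integral {0..t} (\<lambda>s. f s (y s) - f s (z s))"
    if "continuous_on {0..} y" "continuous_on {0..} z" for y z t
    using Henstock_Kurzweil_Integration.integral_diff[OF int[OF that(1)] int[OF that(2)]] by (simp add: \<P>_def)
  define y where "y t = x0 + (\<Sum>n. Y (Suc n) t - Y n t)" for t
  have Y_sum: "Y n t = x0 + (\<Sum>i<n. Y (Suc i) t - Y i t)" for n t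
    by (induction n) (auto simp: Y0)
  have unif: "uniform_limit {0..T} Y y sequentially" for T
  proof -
    obtain L where L: "L > 0" "\<And>t x y. 0 \<le> t \<Longrightarrow> t \<le> T \<Longrightarrow> norm (f t x - f t y) \<le> L * norm (x - y)"
      using lip[of T] by blast
    have "continuous_on {0..T} (Y 1)" by (rule continuous_on_subset[OF Y_cont]) auto
    then have "compact (Y 1 ` {0..T})" by (intro compact_continuous_image) auto
    then have "bounded (Y 1 ` {0..T})" by (rule compact_imp_bounded)
    then obtain M where "\<forall>x \<in> Y 1 ` {0..T}. norm x \<le> M" unfolding bounded_iff by blast
    then have M: "norm (Y 1 t) \<le> M" if "t \<in> {0..T}" for t using that by blast
    define D where "D = \<bar>M\<bar> + norm x0"
    have bound: "norm (Y (Suc n) t - Y n t) \<le> D * (1/2)^n * exp (2 * L * t)" if "t \<in> {0..T}" for n t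
      using that
    proof (induction n arbitrary: t)
      case 0
      have "norm (Y (Suc 0) t - Y 0 t) \<le> M + norm x0"
        using M[OF 0] norm_triangle_ineq4[of "Y 1 t" x0] by (simp add: Y0)
      also have "\<dots> \<le> D * 1" by (simp add: D_def)
      also have "\<dots> \<le> D * exp (2 * L * t)"
        using 0 L(1) by (intro mult_left_mono) (auto simp: D_def)
      finally show ?case by simp
    next
      case (Suc n)
      let ?b = "\<lambda>s. L * (D * (1/2)^n * exp (2 * L * s))"
      have "(?b has_integral (D * (1/2)^(Suc n) * exp (2 * L * t) - D * (1/2)^(Suc n) * exp (2 * L * 0))) {0..t}"
        using Suc.prems
        by (intro fundamental_theorem_of_calculus)
           (auto intro!: derivative_eq_intros simp flip: has_real_derivative_iff_has_vector_derivative)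
      note b = has_integral_integrable[OF this] integral_unique[OF this]
      have "Y (Suc (Suc n)) t - Y (Suc n) t = integral {0..t} (\<lambda>s. f s (Y (Suc n) s) - f s (Y n s))"
        using \<P>_diff[OF Y_cont[of "Suc n"] Y_cont[of n], of t] by (simp only: YS[symmetric])
      also have "norm \<dots> \<le> integral {0..t} ?b"
      proof (rule integral_norm_bound_integral)
        show "(\<lambda>s. f s (Y (Suc n) s) - f s (Y n s)) integrable_on {0..t}"
          by (intro integrable_diff int Y_cont)
        show "norm (f s (Y (Suc n) s) - f s (Y n s)) \<le> ?b s" if "s \<in> {0..t}" for s
          using order_trans[OF L(2) mult_left_mono[OF Suc.IH]] that Suc.prems L(1) by auto
      qed (rule b(1))
      also have "\<dots> \<le> D * (1/2)^(Suc n) * exp (2 * L * t)" unfolding b(2) by (simp add: D_def)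
      finally show ?case .
    qed
    have "uniform_limit {0..T} (\<lambda>n t. \<Sum>i<n. Y (Suc i) t - Y i t) (\<lambda>t. \<Sum>n. Y (Suc n) t - Y n t) sequentially"
    proof (rule Weierstrass_m_test)
      show "norm (Y (Suc n) t - Y n t) \<le> D * exp (2 * L * T) * (1/2)^n" if "t \<in> {0..T}" for n t
      proof -
        have "D * (1/2)^n * exp (2 * L * t) \<le> D * (1/2)^n * exp (2 * L * T)"
          using that L(1) by (intro mult_left_mono) (auto simp: D_def)
        then show ?thesis using bound[OF that, of n] by (simp add: mult_ac)
      qed
      show "summable (\<lambda>n. D * exp (2 * L * T) * (1/2::real)^n)"
        by (intro summable_mult summable_geometric) simp
    qed
    then have "uniform_limit {0..T} (\<lambda>n t. x0 + (\<Sum>i<n. Y (Suc i) t - Y i t)) y sequentially"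
      unfolding y_def[abs_def] by (intro uniform_limit_intros)
    then show ?thesis unfolding Y_sum[abs_def, symmetric] .
  qed
  have y_cont: "continuous_on {0..} y"
  proof -
    have "continuous_on {0..T} y" for T
      by (rule uniform_limit_theorem[OF _ unif])
         (auto intro!: always_eventually continuous_on_subset[OF Y_cont])
    then have "continuous (at t within {0..t + 1}) y" if "t \<ge> 0" for t
      using that by (auto simp: continuous_on_eq_continuous_within)
    then show ?thesis
      using at_within_ray[of _ "_ + 1"] by (auto simp: continuous_on_eq_continuous_within)
  qed
  have fix_pt: "y t = \<P> y t" if "t \<ge> 0" for t
  proof -
    obtain L where L: "L > 0" "\<And>s x y. 0 \<le> s \<Longrightarrow> s \<le> t \<Longrightarrow> norm (f s x - f s y) \<le> L * norm (x - y)"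
      using lip[of t] by blast
    have "(\<lambda>n. Y (Suc n) t) \<longlonglongrightarrow> y t"
      using tendsto_uniform_limitI[OF unif[of t], of t] that LIMSEQ_Suc by auto
    moreover have "(\<lambda>n. Y (Suc n) t) \<longlonglongrightarrow> \<P> y t"
    proof (rule LIMSEQ_I)
      fix e :: real assume "e > 0"
      \<comment> \<open>Integrating \<open>L * e'\<close> over \<open>[0, t]\<close> gives at most \<open>e / 2\<close>.\<close>
      define e' where "e' = e / (2 * L * (t + 1))"
      have "e' > 0" using \<open>e > 0\<close> L(1) that by (simp add: e'_def)
      then obtain N where N: "\<And>n s. n \<ge> N \<Longrightarrow> s \<in> {0..t} \<Longrightarrow> dist (Y n s) (y s) < e'"
        using unif[of t] unfolding uniform_limit_iff eventually_sequentially by blast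
      have "norm (Y (Suc n) t - \<P> y t) < e" if "n \<ge> N" for n
      proof -
        have "Y (Suc n) t - \<P> y t = integral {0..t} (\<lambda>s. f s (Y n s) - f s (y s))"
          using \<P>_diff[OF Y_cont[of n] y_cont, of t] by (simp only: YS[symmetric])
        also have "norm \<dots> \<le> integral {0..t} (\<lambda>s. L * e')"
        proof (rule integral_norm_bound_integral)
          show "(\<lambda>s. f s (Y n s) - f s (y s)) integrable_on {0..t}"
            by (intro integrable_diff int Y_cont y_cont)
          show "norm (f s (Y n s) - f s (y s)) \<le> L * e'" if "s \<in> {0..t}" for s
          proof -
            have "norm (f s (Y n s) - f s (y s)) \<le> L * norm (Y n s - y s)" using L(2) that by auto
            also have "\<dots> \<le> L * e'"
              using N[OF \<open>n \<ge> N\<close> that] L(1) by (intro mult_left_mono) (auto simp: dist_norm)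
            finally show ?thesis .
          qed
        qed auto
        also have "\<dots> = L * e' * t" using \<open>t \<ge> 0\<close> by simp
        also have "\<dots> = e * (t / (2 * (t + 1)))" using L(1) by (simp add: e'_def)
        also have "\<dots> < e * 1"
          using \<open>e > 0\<close> \<open>t \<ge> 0\<close> by (intro mult_strict_left_mono) (auto simp: divide_less_eq)
        finally show ?thesis by simp
      qed
      then show "\<exists>N. \<forall>n\<ge>N. norm (Y (Suc n) t - \<P> y t) < e" by blast
    qed
    ultimately show ?thesis by (rule LIMSEQ_unique)
  qed
  show ?thesis
  proof
    show "continuous_on {0..} y" by (rule y_cont)
    show "y t = x0 + integral {0..t} (\<lambda>s. f s (y s))" if "t \<ge> 0" for t
      using fix_pt[OF that] by (simp add: \<P>_def)
    show "(y has_vector_derivative f t (y t)) (at t within {0..})" if "t \<ge> 0" for t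
    proof -
      have "(\<P> y has_vector_derivative f t (y t)) (at t within {0..})"
        using has_vector_derivative_add[OF has_vector_derivative_const
            has_vector_derivative_integral_ray[OF cont[OF y_cont] that], of x0]
        by (simp add: \<P>_def[abs_def])
      then show ?thesis
        by (rule has_vector_derivative_transform[rotated 2]) (use fix_pt that in auto)
    qed
  qed
qed

text \<open>
  The retraction onto the closed ball of radius \<open>R\<close> along rays from the origin, written so that it is
  visibly continuous in \<open>R\<close> and \<open>x\<close> jointly. In a general normed space it is Lipschitz with
  constant \<open>2\<close>.
\<close>

definition radial :: "real \<Rightarrow> 'a::real_normed_vector \<Rightarrow> 'a" where
  "radial R x = (R / max R (norm x)) *\<^sub>R x"

lemma radial_id: "R > 0 \<Longrightarrow> norm x \<le> R \<Longrightarrow> radial R x = x"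
  by (simp add: radial_def max_absorb1)

lemma norm_radial:
  assumes "R > 0"
  shows "norm (radial R x) \<le> R" "norm (radial R x) \<le> norm x"
  using assms unfolding radial_def by (auto simp: max_def divide_simps mult_right_mono)

lemma radial_lipschitz:
  fixes x y :: "'a::real_normed_vector"
  assumes "R > 0"
  shows "norm (radial R x - radial R y) \<le> 2 * norm (x - y)"
proof -
  define a b where "a = max R (norm x)" and "b = max R (norm y)"
  have ab: "a > 0" "b > 0" "R \<le> a" "R \<le> b" "norm y \<le> b" using assms by (auto simp: a_def b_def)
  have "radial R x - radial R y = (R / a) *\<^sub>R (x - y) + ((R / a) * ((b - a) / b)) *\<^sub>R y"
  proof -
    have "(R / a) * ((b - a) / b) = R / a - R / b" using ab by (simp add: field_simps)
    then show ?thesis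
      unfolding radial_def a_def[symmetric] b_def[symmetric]
      by (simp only: scaleR_diff_left scaleR_diff_right) simp
  qed
  also have "norm \<dots> \<le> norm ((R / a) *\<^sub>R (x - y)) + norm (((R / a) * ((b - a) / b)) *\<^sub>R y)"
    by (rule norm_triangle_ineq)
  also have "norm ((R / a) *\<^sub>R (x - y)) \<le> norm (x - y)"
    using mult_right_mono[of "R / a" 1 "norm (x - y)"] ab assms by simp
  also have "norm (((R / a) * ((b - a) / b)) *\<^sub>R y) \<le> norm (x - y)"
  proof -
    have "norm (((R / a) * ((b - a) / b)) *\<^sub>R y) = (R / a) * (norm y / b) * \<bar>b - a\<bar>"
      using ab assms by (simp add: abs_mult)
    also have "\<dots> \<le> 1 * 1 * \<bar>b - a\<bar>"
      using ab assms by (intro mult_mono mult_right_mono) auto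
    also have "\<dots> \<le> norm (x - y)"
      using norm_triangle_ineq3[of x y] by (auto simp: a_def b_def max_def)
    finally show ?thesis .
  qed
  finally show ?thesis by simp
qed

text \<open>
  A vector field of linear growth cannot blow up, so local Lipschitz continuity suffices: retract
  radially onto a ball whose radius grows like the a priori bound. The solution of the modified
  equation obeys the same bound, hence never notices the retraction.
\<close>

theorem ode_global:
  fixes f :: "'a::banach \<Rightarrow> 'a"
  assumes lip: "\<And>R. \<exists>L. \<forall>x y. norm x \<le> R \<longrightarrow> norm y \<le> R \<longrightarrow> norm (f x - f y) \<le> L * norm (x - y)"
    and growth: "\<And>x. norm (f x) \<le> C * norm x" and C: "C \<ge> 0"
  obtains y where "y 0 = x0" "\<And>t. t \<ge> 0 \<Longrightarrow> (y has_vector_derivative f (y t)) (at t within {0..})"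
    "\<And>t. t \<ge> 0 \<Longrightarrow> norm (y t) \<le> norm x0 * exp (C * t)"
proof -
  \<comment> \<open>The summand \<open>1\<close> keeps the radius positive when \<open>x0 = 0\<close>.\<close>
  define R where "R t = (norm x0 + 1) * exp (C * t)" for t
  have R: "R t > 0" for t unfolding R_def by (intro mult_pos_pos) (auto simp: add_nonneg_pos)
  have R_cont: "continuous_on A R" for A unfolding R_def[abs_def] by (intro continuous_intros)
  have f_cont: "continuous_on UNIV f"
  proof -
    have "isCont f x" for x
    proof -
      obtain L where L: "\<And>u v. norm u \<le> norm x + 1 \<Longrightarrow> norm v \<le> norm x + 1 \<Longrightarrow> norm (f u - f v) \<le> L * norm (u - v)"
        using lip[of "norm x + 1"] by blast
      have "((\<lambda>y. f y - f x) \<longlongrightarrow> 0) (at x)"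
      proof (rule Lim_null_comparison)
        have "\<forall>\<^sub>F y in at x. dist y x < 1" by (rule eventually_at_ball'[of 1, simplified, THEN eventually_mono]) (auto simp: dist_commute)
        then show "\<forall>\<^sub>F y in at x. norm (f y - f x) \<le> L * norm (y - x)"
        proof eventually_elim
          case (elim y)
          then have "norm y \<le> norm x + 1" using norm_triangle_ineq2[of y x] by (simp add: dist_norm)
          then show ?case by (intro L) auto
        qed
        have "((\<lambda>y. L * norm (y - x)) \<longlongrightarrow> L * norm (x - x)) (at x)" by (intro tendsto_intros)
        then show "((\<lambda>y. L * norm (y - x)) \<longlongrightarrow> 0) (at x)" by simp
      qed
      then show ?thesis unfolding isCont_def using LIM_zero_iff by blast
    qed
    then show ?thesis by (simp add: continuous_at_imp_continuous_on)
  qed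
  define F where "F t x = f (radial (R t) x)" for t x
  have F_cont: "continuous_on {0..} (\<lambda>t. F t (y t))" if y: "continuous_on {0..} y" for y
  proof -
    have "max (R t) (norm (y t)) \<noteq> 0" for t using R[of t] by simp
    then have "continuous_on {0..} (\<lambda>t. radial (R t) (y t))"
      unfolding radial_def by (intro continuous_intros y R_cont) auto
    then show "continuous_on {0..} (\<lambda>t. F t (y t))"
      unfolding F_def by (rule continuous_on_compose2[OF f_cont]) simp
  qed
  have F_lip: "\<exists>L>0. \<forall>t x y. 0 \<le> t \<longrightarrow> t \<le> T \<longrightarrow> norm (F t x - F t y) \<le> L * norm (x - y)" for T :: real
  proof -
    define \<rho> where "\<rho> = (norm x0 + 1) * exp (\<bar>C\<bar> * \<bar>T\<bar>)"
    obtain L where L: "\<And>u v. norm u \<le> \<rho> \<Longrightarrow> norm v \<le> \<rho> \<Longrightarrow> norm (f u - f v) \<le> L * norm (u - v)"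
      using lip[of \<rho>] by blast
    have "norm (F t u - F t v) \<le> (2 * \<bar>L\<bar> + 1) * norm (u - v)" if t: "0 \<le> t" "t \<le> T" for t u v
    proof -
      have "C * t \<le> \<bar>C\<bar> * \<bar>T\<bar>" using t by (metis abs_ge_self abs_ge_zero abs_mult abs_of_nonneg mult_mono order_trans)
      then have "R t \<le> \<rho>" unfolding R_def \<rho>_def by (intro mult_left_mono) auto
      then have "norm (F t u - F t v) \<le> L * norm (radial (R t) u - radial (R t) v)"
        unfolding F_def using order_trans[OF norm_radial(1)[OF R]] by (intro L)
      also have "\<dots> \<le> \<bar>L\<bar> * norm (radial (R t) u - radial (R t) v)" by (intro mult_right_mono) auto
      also have "\<dots> \<le> \<bar>L\<bar> * (2 * norm (u - v))"
        by (intro mult_left_mono radial_lipschitz R) auto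
      also have "\<dots> \<le> (2 * \<bar>L\<bar> + 1) * norm (u - v)" by (simp add: algebra_simps)
      finally show ?thesis .
    qed
    then show "\<exists>L>0. \<forall>t x y. 0 \<le> t \<longrightarrow> t \<le> T \<longrightarrow> norm (F t x - F t y) \<le> L * norm (x - y)"
      by (intro exI[of _ "2 * \<bar>L\<bar> + 1"]) (auto simp: add_nonneg_pos)
  qed
  obtain y where y: "continuous_on {0..} y" "\<And>t. t \<ge> 0 \<Longrightarrow> y t = x0 + integral {0..t} (\<lambda>s. F s (y s))"
    "\<And>t. t \<ge> 0 \<Longrightarrow> (y has_vector_derivative F t (y t)) (at t within {0..})"
    using picard_global[where f=F and ?x0.0=x0, OF F_cont F_lip] by blast
  have F_growth: "norm (F t x) \<le> C * norm x" for t x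
  proof -
    have "norm (F t x) \<le> C * norm (radial (R t) x)" unfolding F_def by (rule growth)
    also have "\<dots> \<le> C * norm x" using C norm_radial(2)[OF R, of t x] by (auto intro: mult_left_mono)
    finally show ?thesis .
  qed
  have bound: "norm (y t) \<le> norm x0 * exp (C * t)" if "t \<ge> 0" for t
  proof -
    define g where "g t = norm x0 + C * integral {0..t} (\<lambda>s. norm (y s))" for t
    have ny: "continuous_on {0..} (\<lambda>s. norm (y s))" by (intro continuous_intros y)
    have yg: "norm (y t) \<le> g t" if "t \<ge> 0" for t
    proof -
      have "continuous_on {0..t} (\<lambda>s. F s (y s))"
        by (rule continuous_on_subset[OF F_cont[OF y(1)]]) auto
      then have "norm (integral {0..t} (\<lambda>s. F s (y s))) \<le> integral {0..t} (\<lambda>s. C * norm (y s))"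
        using continuous_on_subset[OF y(1), of "{0..t}"]
        by (intro integral_norm_bound_integral F_growth integrable_continuous_real continuous_intros) auto
      then show ?thesis
        using y(2)[OF that] norm_triangle_ineq[of x0 "integral {0..t} (\<lambda>s. F s (y s))"] by (simp add: g_def)
    qed
    have g': "(g has_real_derivative C * norm (y t)) (at t within {0..})" if "t \<ge> 0" for t
      unfolding g_def
      using has_vector_derivative_integral_ray[OF ny that]
      by (auto intro!: derivative_eq_intros simp: has_real_derivative_iff_has_vector_derivative[symmetric])
    have "g t \<le> g 0 * exp (C * t)"
      by (rule gronwall[OF g' _ \<open>t \<ge> 0\<close>]) (use C yg in \<open>auto intro: mult_left_mono\<close>)
    then show ?thesis using yg[OF \<open>t \<ge> 0\<close>] by (simp add: g_def)
  qed
  have "F t (y t) = f (y t)" if "t \<ge> 0" for t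
  proof -
    have "norm x0 * exp (C * t) \<le> R t" by (simp add: R_def)
    then show ?thesis using bound[OF that] R[of t] by (simp add: F_def radial_id)
  qed
  then show ?thesis
    using that[of y] y(2)[of 0] y(3) bound by simp
qed

section \<open>The Lagrangian system\<close>

instance bcontfun :: (metric_space, banach) banach ..

type_synonym state = "real \<Rightarrow>\<^sub>C (complex \<times> complex)"

abbreviation V1 :: "state \<Rightarrow> real \<Rightarrow> complex" where "V1 v \<xi> \<equiv> fst (apply_bcontfun v \<xi>)"
abbreviation V2 :: "state \<Rightarrow> real \<Rightarrow> complex" where "V2 v \<xi> \<equiv> snd (apply_bcontfun v \<xi>)"

text \<open>
  Initial data in Lagrangian form: \<open>p = - \<partial>\<^sub>x u\<^sub>0 / 2\<close> and \<open>q = \<rho>\<^sub>0 / 2\<close>, so that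
  \<open>p + \<i> q\<close> is the initial value of the derivative of the complex curve \<open>y\<close> with
  \<open>\<bar>y\<bar>\<^sup>2 = J\<close> and \<open>y = 1\<close> initially. The number \<open>\<mu>\<close> is the mean velocity, and \<open>mean p = 0\<close> because
  \<open>u\<^sub>0\<close> is periodic. The fields are bounded everywhere and not only almost everywhere, since each
  label is followed individually.
\<close>

locale lagrangian_data =
  fixes p q :: "real \<Rightarrow> real" and \<mu> \<gamma> D \<beta> :: real
  assumes p_borel [measurable]: "p \<in> borel_measurable borel"
    and q_borel [measurable]: "q \<in> borel_measurable borel"
    and p_bound: "\<bar>p \<xi>\<bar> \<le> D" and q_bound: "\<bar>q \<xi>\<bar> \<le> D"
    and p_periodic: "p (\<xi> + 1) = p \<xi>" and q_periodic: "q (\<xi> + 1) = q \<xi>"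
    and \<beta>_pos: "\<beta> > 0" and q_ge: "\<beta> \<le> q \<xi>" and mean_p: "mean p = 0"
begin

text \<open>
  The conserved energy of the system is \<open>4 * e0\<close>, and \<open>c\<close> is the mean of the source of the nonlocal term.
  The bound \<open>B\<close> is the mean of \<open>jac + kin\<close>; it dominates the quantities that are truncated at \<open>B\<close>
  below, as long as the constraints hold.
\<close>

definition e0 :: real where "e0 = mean (\<lambda>\<xi>. (p \<xi>)\<^sup>2 + (q \<xi>)\<^sup>2)"
definition c :: real where "c = 2 * \<mu>\<^sup>2 + 2 * e0"
definition B :: real where "B = 1 + e0"

text \<open>
  The real-linear map taking \<open>1\<close> to \<open>1\<close> and \<open>\<i>\<close> to \<open>p \<xi> + \<i> q \<xi>\<close>. The equation \<open>y'' = a y\<close> has a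
  real coefficient, so the solution with initial values \<open>1\<close> and \<open>p \<xi> + \<i> q \<xi>\<close> is the image of
  the solution with initial values \<open>1\<close> and \<open>\<i>\<close>. The latter depends continuously on \<open>\<xi>\<close>; the
  jumps of the data are confined to the map.
\<close>

definition lag :: "real \<Rightarrow> complex \<Rightarrow> complex" where
  "lag \<xi> V = Complex (Re V + p \<xi> * Im V) (q \<xi> * Im V)"

text \<open>
  With \<open>y\<close> and \<open>y'\<close> for the two components mapped by \<open>lag\<close>, these are \<open>\<bar>y\<bar>\<^sup>2\<close>, its time derivative
  \<open>2 (y \<bullet> y')\<close>, and \<open>\<bar>y'\<bar>\<^sup>2\<close>.
\<close>

definition jac :: "state \<Rightarrow> real \<Rightarrow> real" where
  "jac v \<xi> = lag \<xi> (V1 v \<xi>) \<bullet> lag \<xi> (V1 v \<xi>)"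
definition vel :: "state \<Rightarrow> real \<Rightarrow> real" where
  "vel v \<xi> = 2 * (lag \<xi> (V1 v \<xi>) \<bullet> lag \<xi> (V2 v \<xi>))"
definition kin :: "state \<Rightarrow> real \<Rightarrow> real" where
  "kin v \<xi> = lag \<xi> (V2 v \<xi>) \<bullet> lag \<xi> (V2 v \<xi>)"

text \<open>
  The label derivative of the velocity along the flow is \<open>- vel\<close>. Hence the velocity is \<open>\<mu> - drift\<close> up
  to a constant, which \<open>corr\<close> fixes so that the velocity has mean \<open>\<mu>\<close> in space, that is, with weight
  \<open>jac\<close> in the label. The truncation \<open>cl\<close> makes the coefficient \<open>acc\<close> bounded, so that solutions
  exist for all times. The drift is constant outside the unit interval of labels; this makes
  \<open>uu\<close> a bounded continuous function on the whole line, as the state space demands.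
\<close>

definition drift :: "state \<Rightarrow> real \<Rightarrow> real" where
  "drift v \<xi> = mean (\<lambda>\<eta>. indicator {..\<xi>} \<eta> * vel v \<eta>)"
definition cl :: "real \<Rightarrow> real" where "cl x = max (- B) (min B x)"
definition corr :: "state \<Rightarrow> real" where "corr v = mean (\<lambda>\<xi>. cl (drift v \<xi>) * jac v \<xi>)"
definition uu :: "state \<Rightarrow> real \<Rightarrow> real" where "uu v \<xi> = \<mu> - cl (drift v \<xi>) + cl (corr v)"
definition acc :: "state \<Rightarrow> real \<Rightarrow> real" where "acc v \<xi> = \<mu> * uu v \<xi> - c / 2"
text \<open>
  The linear equation \<open>y'' = acc y\<close> at every label, as a first order system; the labels interact
  through the coefficient \<open>acc\<close> only.
\<close>

definition vfield :: "state \<Rightarrow> state" where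
  "vfield v = Bcontfun (\<lambda>\<xi>. (V2 v \<xi>, acc v \<xi> *\<^sub>R V1 v \<xi>))"

definition E :: real where "E = 1 + 2 * D"

lemma D_pos: "D > 0" using q_bound[of 0] q_ge[of 0] \<beta>_pos by linarith
lemma E_pos: "E > 0" using D_pos by (simp add: E_def)

lemma e0_nonneg: "e0 \<ge> 0"
  unfolding e0_def mean_def by (rule integral_nonneg_AE) auto

lemma B_pos: "B > 0" using e0_nonneg by (simp add: B_def)

lemma norm_lag: "norm (lag \<xi> V) \<le> E * norm V"
proof -
  have "norm (lag \<xi> V) \<le> \<bar>Re V + p \<xi> * Im V\<bar> + \<bar>q \<xi> * Im V\<bar>"
    using cmod_le[of "lag \<xi> V"] by (simp add: lag_def)
  also have "\<dots> \<le> \<bar>Re V\<bar> + \<bar>p \<xi>\<bar> * \<bar>Im V\<bar> + \<bar>q \<xi>\<bar> * \<bar>Im V\<bar>" by (simp add: abs_mult[symmetric])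
  also have "\<dots> \<le> norm V + D * norm V + D * norm V"
    using D_pos p_bound q_bound abs_Re_le_cmod abs_Im_le_cmod by (intro add_mono mult_mono) auto
  finally show ?thesis by (simp add: E_def algebra_simps)
qed

lemma bounded_linear_lag: "bounded_linear (lag \<xi>)"
  by (rule bounded_linear_intro[of _ E])
     (use norm_lag in \<open>auto simp: lag_def complex_eq_iff algebra_simps\<close>)

lemma lag_diff: "lag \<xi> V - lag \<xi> W = lag \<xi> (V - W)"
  by (simp add: lag_def complex_eq_iff algebra_simps)

lemma state_continuous [continuous_intros]:
  "continuous_on A (\<lambda>\<xi>. V1 v \<xi>)" "continuous_on A (\<lambda>\<xi>. V2 v \<xi>)"
  for v :: state
  by (intro continuous_intros continuous_on_apply_bcontfun)+

lemma state_bound: "norm (V1 v \<xi>) \<le> norm v" "norm (V2 v \<xi>) \<le> norm v"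
  for v :: state
  using norm_bounded[of v \<xi>] norm_fst_le[of "V1 v \<xi>" "V2 v \<xi>"] norm_snd_le[of "V2 v \<xi>" "V1 v \<xi>"]
  by auto

lemma state_diff_bound:
  fixes v w :: state
  shows "norm (V1 v \<xi> - V1 w \<xi>) \<le> norm (v - w)" "norm (V2 v \<xi> - V2 w \<xi>) \<le> norm (v - w)"
  using state_bound[of "v - w" \<xi>] by (auto simp: minus_bcontfun.rep_eq)

lemma lag_borel:
  assumes "continuous_on UNIV V"
  shows "(\<lambda>\<xi>. Re (lag \<xi> (V \<xi>))) \<in> borel_measurable borel" "(\<lambda>\<xi>. Im (lag \<xi> (V \<xi>))) \<in> borel_measurable borel"
proof -
  have [measurable]: "(\<lambda>\<xi>. Re (V \<xi>)) \<in> borel_measurable borel" "(\<lambda>\<xi>. Im (V \<xi>)) \<in> borel_measurable borel"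
    by (intro borel_measurable_continuous_onI continuous_intros assms)+
  show "(\<lambda>\<xi>. Re (lag \<xi> (V \<xi>))) \<in> borel_measurable borel" "(\<lambda>\<xi>. Im (lag \<xi> (V \<xi>))) \<in> borel_measurable borel"
    by (simp_all add: lag_def)
qed

lemma jac_borel [measurable]: "jac v \<in> borel_measurable borel"
  and vel_borel [measurable]: "vel v \<in> borel_measurable borel"
  and kin_borel [measurable]: "kin v \<in> borel_measurable borel"
proof -
  have f: "continuous_on UNIV (\<lambda>\<xi>. V1 v \<xi>)" and s: "continuous_on UNIV (\<lambda>\<xi>. V2 v \<xi>)"
    by (rule state_continuous)+
  note [measurable] = lag_borel[OF f] lag_borel[OF s]
  show "jac v \<in> borel_measurable borel" "vel v \<in> borel_measurable borel" "kin v \<in> borel_measurable borel"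
    unfolding jac_def[abs_def] vel_def[abs_def] kin_def[abs_def] inner_complex_def by measurable
qed

lemma jac_nonneg: "0 \<le> jac v \<xi>" and kin_nonneg: "0 \<le> kin v \<xi>"
  by (simp_all add: jac_def kin_def)

lemma inner_lag_bound:
  assumes "norm V \<le> R" "norm W \<le> R'"
  shows "\<bar>lag \<xi> V \<bullet> lag \<xi> W\<bar> \<le> E\<^sup>2 * R * R'"
proof -
  have R: "R \<ge> 0" using assms(1) norm_ge_zero[of V] by linarith
  have "\<bar>lag \<xi> V \<bullet> lag \<xi> W\<bar> \<le> norm (lag \<xi> V) * norm (lag \<xi> W)" by (rule Cauchy_Schwarz_ineq2)
  also have "\<dots> \<le> (E * R) * (E * R')"
    using order_trans[OF norm_lag mult_left_mono[OF assms(1)]]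
      order_trans[OF norm_lag mult_left_mono[OF assms(2)]] E_pos R
    by (intro mult_mono) (auto simp: mult_nonneg_nonneg less_imp_le)
  finally show ?thesis by (simp add: power2_eq_square mult_ac)
qed

lemma quadratic_bounds:
  assumes "norm v \<le> R"
  shows "\<bar>jac v \<xi>\<bar> \<le> E\<^sup>2 * R\<^sup>2" "\<bar>vel v \<xi>\<bar> \<le> 2 * E\<^sup>2 * R\<^sup>2" "\<bar>kin v \<xi>\<bar> \<le> E\<^sup>2 * R\<^sup>2"
proof -
  have R: "norm (V1 v \<xi>) \<le> R" "norm (V2 v \<xi>) \<le> R"
    using state_bound[of v \<xi>] assms by auto
  show "\<bar>jac v \<xi>\<bar> \<le> E\<^sup>2 * R\<^sup>2" "\<bar>vel v \<xi>\<bar> \<le> 2 * E\<^sup>2 * R\<^sup>2" "\<bar>kin v \<xi>\<bar> \<le> E\<^sup>2 * R\<^sup>2"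
    using inner_lag_bound[OF R(1) R(1), of \<xi>] inner_lag_bound[OF R(1) R(2), of \<xi>]
      inner_lag_bound[OF R(2) R(2), of \<xi>]
    unfolding jac_def vel_def kin_def by (simp_all add: abs_mult power2_eq_square mult_ac)
qed

lemma quadratic_lipschitz:
  assumes "norm v \<le> R" "norm w \<le> R"
  shows "\<bar>jac v \<xi> - jac w \<xi>\<bar> \<le> 4 * E\<^sup>2 * R * norm (v - w)" "\<bar>vel v \<xi> - vel w \<xi>\<bar> \<le> 4 * E\<^sup>2 * R * norm (v - w)"
proof -
  have R: "norm (V1 v \<xi>) \<le> R" "norm (V2 v \<xi>) \<le> R" "norm (V1 w \<xi>) \<le> R" "norm (V2 w \<xi>) \<le> R"
    using state_bound[of v \<xi>] state_bound[of w \<xi>] assms by auto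
  have R0: "R \<ge> 0" using assms(1) norm_ge_zero[of v] by linarith
  let ?d = "norm (v - w)"
  have dd: "E\<^sup>2 * R * ?d \<ge> 0" using R0 by simp
  have bil: "\<bar>lag \<xi> a \<bullet> lag \<xi> b - lag \<xi> a' \<bullet> lag \<xi> b'\<bar> \<le> 2 * E\<^sup>2 * R * ?d"
    if "norm (a - a') \<le> ?d" "norm (b - b') \<le> ?d" "norm b \<le> R" "norm a' \<le> R" for a b a' b'
  proof -
    have eq: "lag \<xi> a \<bullet> lag \<xi> b - lag \<xi> a' \<bullet> lag \<xi> b'
        = lag \<xi> (a - a') \<bullet> lag \<xi> b + lag \<xi> a' \<bullet> lag \<xi> (b - b')"
      by (simp add: lag_diff[symmetric] inner_diff_left inner_diff_right)
    have "\<bar>lag \<xi> a \<bullet> lag \<xi> b - lag \<xi> a' \<bullet> lag \<xi> b'\<bar>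
        \<le> \<bar>lag \<xi> (a - a') \<bullet> lag \<xi> b\<bar> + \<bar>lag \<xi> a' \<bullet> lag \<xi> (b - b')\<bar>"
      unfolding eq by (rule abs_triangle_ineq)
    also have "\<dots> \<le> E\<^sup>2 * ?d * R + E\<^sup>2 * R * ?d"
      by (rule add_mono[OF inner_lag_bound[OF that(1,3)] inner_lag_bound[OF that(4,2)]])
    finally show ?thesis by (simp add: mult_ac)
  qed
  show "\<bar>jac v \<xi> - jac w \<xi>\<bar> \<le> 4 * E\<^sup>2 * R * ?d"
    using bil[of "V1 v \<xi>" "V1 w \<xi>" "V1 v \<xi>" "V1 w \<xi>"] state_diff_bound[of v \<xi> w] R dd
    unfolding jac_def by linarith
  show "\<bar>vel v \<xi> - vel w \<xi>\<bar> \<le> 4 * E\<^sup>2 * R * ?d"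
    using bil[of "V1 v \<xi>" "V1 w \<xi>" "V2 v \<xi>" "V2 w \<xi>"] state_diff_bound[of v \<xi> w] R dd
    unfolding vel_def by linarith
qed

lemma ind_vel_borel [measurable]: "(\<lambda>\<eta>. indicator {..\<xi>} \<eta> * vel v \<eta>) \<in> borel_measurable borel"
  by measurable

text \<open>
  The drift is an indefinite integral of \<open>vel\<close> on the unit interval, which gives its continuity.
\<close>

lemma vel_primitive:
  obtains G where "primitive G (vel v)" "\<And>\<xi>. drift v \<xi> = G (max 0 (min 1 \<xi>)) - G 0"
proof -
  obtain G where G: "primitive G (vel v)"
    using primitive_exists[OF vel_borel locally_boundedI[OF quadratic_bounds(2)[OF order_refl]]] by blast
  have "drift v \<xi> = G (max 0 (min 1 \<xi>)) - G 0" for \<xi>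
  proof (cases "0 \<le> \<xi>")
    case True
    have "drift v \<xi> = (LINT \<eta>|lborel. indicator {0..1} \<eta> * (indicator {..\<xi>} \<eta> * vel v \<eta>))"
      unfolding drift_def by (rule mean_lborel) measurable
    also have "\<dots> = (LINT \<eta>|lborel. indicator {0..min 1 \<xi>} \<eta> * vel v \<eta>)"
      by (intro Bochner_Integration.integral_cong) (auto simp: indicator_def)
    also have "\<dots> = G (min 1 \<xi>) - G 0" by (rule primitive_integral_lborel(2)[OF G]) (use True in auto)
    finally show ?thesis using True by (simp add: max_absorb2)
  next
    case False
    have "drift v \<xi> = mean (\<lambda>\<eta>. 0)"
      unfolding drift_def by (rule mean_cong) (use False in \<open>auto simp: indicator_def\<close>)
    then show ?thesis using False by (simp add: max_absorb1)
  qed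
  then show ?thesis using that G by blast
qed

lemma drift_continuous: "continuous_on A (drift v)"
proof -
  obtain G where G: "primitive G (vel v)" "\<And>\<xi>. drift v \<xi> = G (max 0 (min 1 \<xi>)) - G 0"
    using vel_primitive by blast
  have "continuous_on A (\<lambda>\<xi>. G (max 0 (min 1 \<xi>)) - G 0)"
    by (intro continuous_intros continuous_on_compose2[OF primitive_continuous[OF G(1), of UNIV]]) auto
  then show ?thesis by (simp add: G(2)[abs_def])
qed

lemma drift_borel [measurable]: "drift v \<in> borel_measurable borel"
  by (rule borel_measurable_continuous_onI[OF drift_continuous])

lemma drift_lipschitz:
  assumes "norm v \<le> R" "norm w \<le> R"
  shows "\<bar>drift v \<xi> - drift w \<xi>\<bar> \<le> 4 * E\<^sup>2 * R * norm (v - w)"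
  unfolding drift_def
proof (rule mean_diff_bound)
  fix \<eta>
  show "\<bar>indicator {..\<xi>} \<eta> * vel v \<eta>\<bar> \<le> 2 * E\<^sup>2 * R\<^sup>2" "\<bar>indicator {..\<xi>} \<eta> * vel w \<eta>\<bar> \<le> 2 * E\<^sup>2 * R\<^sup>2"
    using quadratic_bounds(2)[OF assms(1), of \<eta>] quadratic_bounds(2)[OF assms(2), of \<eta>]
    by (auto simp: indicator_def)
  have "R \<ge> 0" using assms(1) norm_ge_zero[of v] by linarith
  then have "0 \<le> 4 * E\<^sup>2 * R * norm (v - w)" by simp
  then show "\<bar>indicator {..\<xi>} \<eta> * vel v \<eta> - indicator {..\<xi>} \<eta> * vel w \<eta>\<bar> \<le> 4 * E\<^sup>2 * R * norm (v - w)"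
    using quadratic_lipschitz(2)[OF assms, of \<eta>] by (simp add: indicator_def)
qed measurable

lemma cl_bound: "\<bar>cl x\<bar> \<le> B" using B_pos by (auto simp: cl_def)
lemma cl_lipschitz: "\<bar>cl x - cl y\<bar> \<le> \<bar>x - y\<bar>" by (auto simp: cl_def)
lemma cl_id: "\<bar>x\<bar> \<le> B \<Longrightarrow> cl x = x" by (auto simp: cl_def)
lemma cl_continuous: "continuous_on A cl" unfolding cl_def[abs_def] by (intro continuous_intros)
lemma cl_borel [measurable]: "cl \<in> borel_measurable borel"
  by (rule borel_measurable_continuous_onI[OF cl_continuous])

lemma corr_lipschitz:
  assumes "norm v \<le> R" "norm w \<le> R"
  shows "\<bar>corr v - corr w\<bar> \<le> (4 * E\<^sup>2 * R * (E\<^sup>2 * R\<^sup>2) + B * (4 * E\<^sup>2 * R)) * norm (v - w)"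
  unfolding corr_def
proof (rule mean_diff_bound)
  fix \<xi>
  show "\<bar>cl (drift v \<xi>) * jac v \<xi>\<bar> \<le> B * (E\<^sup>2 * R\<^sup>2)" "\<bar>cl (drift w \<xi>) * jac w \<xi>\<bar> \<le> B * (E\<^sup>2 * R\<^sup>2)"
    unfolding abs_mult using B_pos by (auto intro!: mult_mono cl_bound quadratic_bounds assms)
  let ?K = "4 * E\<^sup>2 * R * norm (v - w)"
  have "R \<ge> 0" using assms(1) norm_ge_zero[of v] by linarith
  then have K: "?K \<ge> 0" by simp
  have eq: "cl (drift v \<xi>) * jac v \<xi> - cl (drift w \<xi>) * jac w \<xi>
      = (cl (drift v \<xi>) - cl (drift w \<xi>)) * jac v \<xi> + cl (drift w \<xi>) * (jac v \<xi> - jac w \<xi>)"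
    by (simp add: algebra_simps)
  have "\<bar>cl (drift v \<xi>) * jac v \<xi> - cl (drift w \<xi>) * jac w \<xi>\<bar> \<le> ?K * (E\<^sup>2 * R\<^sup>2) + B * ?K"
    unfolding eq using order_trans[OF cl_lipschitz drift_lipschitz[OF assms, of \<xi>]] quadratic_bounds(1)[OF assms(1), of \<xi>]
      cl_bound[of "drift w \<xi>"] quadratic_lipschitz(1)[OF assms, of \<xi>] B_pos K
    by (intro order_trans[OF abs_triangle_ineq] add_mono) (auto simp: abs_mult intro!: mult_mono)
  then show "\<bar>cl (drift v \<xi>) * jac v \<xi> - cl (drift w \<xi>) * jac w \<xi>\<bar>
      \<le> (4 * E\<^sup>2 * R * (E\<^sup>2 * R\<^sup>2) + B * (4 * E\<^sup>2 * R)) * norm (v - w)"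
    by (simp add: algebra_simps)
qed measurable

lemma uu_lipschitz:
  "\<exists>L\<ge>0. \<forall>v w \<xi>. norm v \<le> R \<longrightarrow> norm w \<le> R \<longrightarrow> \<bar>uu v \<xi> - uu w \<xi>\<bar> \<le> L * norm (v - w)"
proof (intro exI conjI allI impI)
  let ?L = "\<bar>4 * E\<^sup>2 * R\<bar> + \<bar>4 * E\<^sup>2 * R * (E\<^sup>2 * R\<^sup>2) + B * (4 * E\<^sup>2 * R)\<bar>"
  show "0 \<le> ?L" by simp
  fix v w :: state and \<xi> assume R: "norm v \<le> R" "norm w \<le> R"
  have "\<bar>uu v \<xi> - uu w \<xi>\<bar> \<le> \<bar>drift v \<xi> - drift w \<xi>\<bar> + \<bar>corr v - corr w\<bar>"
    using cl_lipschitz[of "drift v \<xi>" "drift w \<xi>"] cl_lipschitz[of "corr v" "corr w"] by (simp add: uu_def)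
  also have "\<dots> \<le> 4 * E\<^sup>2 * R * norm (v - w) + (4 * E\<^sup>2 * R * (E\<^sup>2 * R\<^sup>2) + B * (4 * E\<^sup>2 * R)) * norm (v - w)"
    by (rule add_mono[OF drift_lipschitz[OF R] corr_lipschitz[OF R]])
  also have "\<dots> \<le> \<bar>4 * E\<^sup>2 * R\<bar> * norm (v - w)
      + \<bar>4 * E\<^sup>2 * R * (E\<^sup>2 * R\<^sup>2) + B * (4 * E\<^sup>2 * R)\<bar> * norm (v - w)"
    by (intro add_mono mult_right_mono abs_ge_self norm_ge_zero)
  also have "\<dots> = ?L * norm (v - w)" by (rule distrib_right[symmetric])
  finally show "\<bar>uu v \<xi> - uu w \<xi>\<bar> \<le> ?L * norm (v - w)" .
qed

lemma uu_bound: "\<bar>uu v \<xi>\<bar> \<le> \<bar>\<mu>\<bar> + 2 * B"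
  using cl_bound[of "drift v \<xi>"] cl_bound[of "corr v"] by (simp add: uu_def)

definition C0 :: real where "C0 = \<bar>\<mu>\<bar> * (\<bar>\<mu>\<bar> + 2 * B) + \<bar>c\<bar> / 2"

lemma acc_bound: "\<bar>acc v \<xi>\<bar> \<le> C0"
proof -
  have "\<bar>acc v \<xi>\<bar> \<le> \<bar>\<mu>\<bar> * \<bar>uu v \<xi>\<bar> + \<bar>c\<bar> / 2" by (simp add: acc_def abs_mult[symmetric])
  also have "\<dots> \<le> C0" unfolding C0_def using uu_bound[of v \<xi>] by (intro add_mono mult_left_mono) auto
  finally show ?thesis .
qed

lemma C0_nonneg: "C0 \<ge> 0" using B_pos by (simp add: C0_def)

lemma uu_continuous: "continuous_on A (uu v)"
  unfolding uu_def[abs_def]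
  by (intro continuous_intros continuous_on_compose2[OF cl_continuous[of UNIV] drift_continuous]) auto

lemma acc_continuous: "continuous_on A (acc v)"
  unfolding acc_def[abs_def] by (intro continuous_intros uu_continuous)

lemma apply_vfield: "apply_bcontfun (vfield v) \<xi> = (V2 v \<xi>, acc v \<xi> *\<^sub>R V1 v \<xi>)"
proof -
  have "(\<lambda>\<xi>. (V2 v \<xi>, acc v \<xi> *\<^sub>R V1 v \<xi>)) \<in> bcontfun"
  proof (rule bcontfun_normI)
    show "continuous_on UNIV (\<lambda>\<xi>. (V2 v \<xi>, acc v \<xi> *\<^sub>R V1 v \<xi>))"
      by (intro continuous_intros state_continuous acc_continuous)
    fix \<xi>
    have "norm (V2 v \<xi>, acc v \<xi> *\<^sub>R V1 v \<xi>) \<le> norm (V2 v \<xi>) + norm (acc v \<xi> *\<^sub>R V1 v \<xi>)"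
      by (rule norm_Pair_le)
    also have "\<dots> \<le> norm v + C0 * norm v"
      using state_bound[of v \<xi>] acc_bound[of v \<xi>] C0_nonneg by (auto intro!: add_mono mult_mono)
    finally show "norm (V2 v \<xi>, acc v \<xi> *\<^sub>R V1 v \<xi>) \<le> norm v + C0 * norm v" .
  qed
  then show ?thesis by (simp add: vfield_def Bcontfun_inverse)
qed

lemma vfield_growth: "norm (vfield v) \<le> (1 + C0) * norm v"
proof (rule norm_bound)
  fix \<xi>
  have "norm (apply_bcontfun (vfield v) \<xi>) \<le> norm (V2 v \<xi>) + norm (acc v \<xi> *\<^sub>R V1 v \<xi>)"
    unfolding apply_vfield by (rule norm_Pair_le)
  also have "\<dots> \<le> norm v + C0 * norm v"
    using state_bound[of v \<xi>] acc_bound[of v \<xi>] C0_nonneg by (auto intro!: add_mono mult_mono)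
  finally show "norm (apply_bcontfun (vfield v) \<xi>) \<le> (1 + C0) * norm v" by (simp add: algebra_simps)
qed

lemma vfield_lipschitz:
  "\<exists>L. \<forall>v w. norm v \<le> R \<longrightarrow> norm w \<le> R \<longrightarrow> norm (vfield v - vfield w) \<le> L * norm (v - w)"
proof -
  obtain L where L: "L \<ge> 0" "\<And>v w \<xi>. norm v \<le> R \<Longrightarrow> norm w \<le> R \<Longrightarrow> \<bar>uu v \<xi> - uu w \<xi>\<bar> \<le> L * norm (v - w)"
    using uu_lipschitz[of R] by blast
  have "norm (vfield v - vfield w) \<le> (1 + C0 + \<bar>\<mu>\<bar> * L * R) * norm (v - w)" if R: "norm v \<le> R" "norm w \<le> R" for v w
  proof (rule norm_bound)
    fix \<xi>
    let ?d = "norm (v - w)"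
    have acc: "\<bar>acc v \<xi> - acc w \<xi>\<bar> \<le> \<bar>\<mu>\<bar> * (L * ?d)"
    proof -
      have "acc v \<xi> - acc w \<xi> = \<mu> * (uu v \<xi> - uu w \<xi>)" by (simp add: acc_def algebra_simps)
      then show ?thesis using L(2)[OF R, of \<xi>] by (simp add: abs_mult mult_left_mono)
    qed
    have "apply_bcontfun (vfield v - vfield w) \<xi>
        = (V2 v \<xi> - V2 w \<xi>, acc v \<xi> *\<^sub>R (V1 v \<xi> - V1 w \<xi>) + (acc v \<xi> - acc w \<xi>) *\<^sub>R V1 w \<xi>)"
      by (simp add: minus_bcontfun.rep_eq apply_vfield algebra_simps)
    also have "norm \<dots> \<le> norm (V2 v \<xi> - V2 w \<xi>) +
        norm (acc v \<xi> *\<^sub>R (V1 v \<xi> - V1 w \<xi>) + (acc v \<xi> - acc w \<xi>) *\<^sub>R V1 w \<xi>)"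
      by (rule norm_Pair_le)
    also have "\<dots> \<le> ?d + (C0 * ?d + \<bar>\<mu>\<bar> * (L * ?d) * R)"
    proof (intro add_mono norm_triangle_le)
      show "norm (V2 v \<xi> - V2 w \<xi>) \<le> ?d" by (rule state_diff_bound)
      show "norm (acc v \<xi> *\<^sub>R (V1 v \<xi> - V1 w \<xi>)) \<le> C0 * ?d"
        using acc_bound[of v \<xi>] state_diff_bound[of v \<xi> w] C0_nonneg by (auto intro!: mult_mono)
      show "norm ((acc v \<xi> - acc w \<xi>) *\<^sub>R V1 w \<xi>) \<le> \<bar>\<mu>\<bar> * (L * ?d) * R"
        using acc L(1) state_bound(1)[of w \<xi>] R(2) by (auto intro!: mult_mono)
    qed
    finally show "norm (apply_bcontfun (vfield v - vfield w) \<xi>) \<le> (1 + C0 + \<bar>\<mu>\<bar> * L * R) * ?d"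
      by (simp add: algebra_simps)
  qed
  then show ?thesis by blast
qed

text \<open>
  The fundamental pair starts from the values \<open>1\<close> and \<open>\<i>\<close> at every label, so the initial state is
  constant and the initial data enter through the vector field alone.
\<close>

definition Z :: "real \<Rightarrow> state" where
  "Z = (SOME Z. Z 0 = const_bcontfun (1, \<i>) \<and>
     (\<forall>t\<ge>0. (Z has_vector_derivative vfield (Z t)) (at t within {0..})) \<and>
     (\<forall>t\<ge>0. norm (Z t) \<le> norm (const_bcontfun (1, \<i>) :: state) * exp ((1 + C0) * t)))"

lemma Z_props: "Z 0 = const_bcontfun (1, \<i>)"
  "t \<ge> 0 \<Longrightarrow> (Z has_vector_derivative vfield (Z t)) (at t within {0..})"
  "t \<ge> 0 \<Longrightarrow> norm (Z t) \<le> norm (const_bcontfun (1, \<i>) :: state) * exp ((1 + C0) * t)"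
proof -
  have C: "0 \<le> 1 + C0" using C0_nonneg by simp
  obtain Y where "Y 0 = const_bcontfun (1, \<i>)"
     "\<And>t. t \<ge> 0 \<Longrightarrow> (Y has_vector_derivative vfield (Y t)) (at t within {0..})"
     "\<And>t. t \<ge> 0 \<Longrightarrow> norm (Y t) \<le> norm (const_bcontfun (1, \<i>) :: state) * exp ((1 + C0) * t)"
    using ode_global[where f=vfield and ?x0.0="const_bcontfun (1, \<i>)", OF vfield_lipschitz vfield_growth C]
    by blast
  then have "\<exists>Z. Z 0 = const_bcontfun (1, \<i>) \<and>
     (\<forall>t\<ge>0. (Z has_vector_derivative vfield (Z t)) (at t within {0..})) \<and>
     (\<forall>t\<ge>0. norm (Z t) \<le> norm (const_bcontfun (1, \<i>) :: state) * exp ((1 + C0) * t))"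
    by blast
  note * = someI_ex[OF this, folded Z_def]
  show "Z 0 = const_bcontfun (1, \<i>)"
    "t \<ge> 0 \<Longrightarrow> (Z has_vector_derivative vfield (Z t)) (at t within {0..})"
    "t \<ge> 0 \<Longrightarrow> norm (Z t) \<le> norm (const_bcontfun (1, \<i>) :: state) * exp ((1 + C0) * t)"
    using * by auto
qed

definition rad :: "real \<Rightarrow> real" where
  "rad t = norm (const_bcontfun (1, \<i>) :: state) * exp ((1 + C0) * t)"

lemma rad_mono: "s \<le> t \<Longrightarrow> rad s \<le> rad t"
  unfolding rad_def using C0_nonneg by (intro mult_left_mono) (auto intro: mult_left_mono)

lemma Z_bound: "0 \<le> s \<Longrightarrow> s \<le> t \<Longrightarrow> norm (Z s) \<le> rad t"
  using Z_props(3)[of s] rad_mono[of s t] by (simp add: rad_def)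

lemma Z_continuous: "continuous_on {0..} Z"
  by (metis Z_props(2) atLeast_iff continuous_on_eq_continuous_within has_vector_derivative_continuous)

definition yy :: "real \<Rightarrow> real \<Rightarrow> complex" where "yy t \<xi> = lag \<xi> (V1 (Z t) \<xi>)"
definition zz :: "real \<Rightarrow> real \<Rightarrow> complex" where "zz t \<xi> = lag \<xi> (V2 (Z t) \<xi>)"

lemma Z_apply_deriv:
  assumes "t \<ge> 0"
  shows "((\<lambda>t. apply_bcontfun (Z t) \<xi>) has_vector_derivative (V2 (Z t) \<xi>, acc (Z t) \<xi> *\<^sub>R V1 (Z t) \<xi>)) (at t within {0..})"
proof -
  have "bounded_linear (\<lambda>v::state. apply_bcontfun v \<xi>)"
    by (rule bounded_linear_intro[of _ 1])
       (auto simp: plus_bcontfun.rep_eq scaleR_bcontfun.rep_eq norm_bounded)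
  from bounded_linear.has_vector_derivative[OF this Z_props(2)[OF assms]] show ?thesis
    by (simp add: apply_vfield)
qed

lemma yy_deriv:
  assumes "t \<ge> 0"
  shows "((\<lambda>t. yy t \<xi>) has_vector_derivative zz t \<xi>) (at t within {0..})"
  using bounded_linear.has_vector_derivative[OF bounded_linear_lag
      bounded_linear.has_vector_derivative[OF bounded_linear_fst Z_apply_deriv[OF assms]], of \<xi> \<xi>]
  by (simp add: yy_def[abs_def] zz_def)

lemma zz_deriv:
  assumes "t \<ge> 0"
  shows "((\<lambda>t. zz t \<xi>) has_vector_derivative acc (Z t) \<xi> *\<^sub>R yy t \<xi>) (at t within {0..})"
  using bounded_linear.has_vector_derivative[OF bounded_linear_lag
      bounded_linear.has_vector_derivative[OF bounded_linear_snd Z_apply_deriv[OF assms]], of \<xi> \<xi>]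
  by (simp add: yy_def zz_def[abs_def] linear_simps[OF bounded_linear_lag])

lemma yy_zz_0: "yy 0 \<xi> = 1" "zz 0 \<xi> = Complex (p \<xi>) (q \<xi>)"
  by (simp_all add: yy_def zz_def Z_props(1) lag_def complex_eq_iff)

lemma fields_yy_zz: "jac (Z t) \<xi> = yy t \<xi> \<bullet> yy t \<xi>" "vel (Z t) \<xi> = 2 * (yy t \<xi> \<bullet> zz t \<xi>)"
  "kin (Z t) \<xi> = zz t \<xi> \<bullet> zz t \<xi>"
  by (simp_all add: jac_def vel_def kin_def yy_def zz_def)

lemma jac_deriv:
  assumes "t \<ge> 0"
  shows "((\<lambda>t. jac (Z t) \<xi>) has_real_derivative vel (Z t) \<xi>) (at t within {0..})"
  using inner_deriv[OF yy_deriv[OF assms] yy_deriv[OF assms], of \<xi> \<xi>]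
  by (simp add: fields_yy_zz inner_commute)

lemma vel_deriv:
  assumes "t \<ge> 0"
  shows "((\<lambda>t. vel (Z t) \<xi>) has_real_derivative 2 * kin (Z t) \<xi> + 2 * acc (Z t) \<xi> * jac (Z t) \<xi>) (at t within {0..})"
  using DERIV_cmult[OF inner_deriv[OF yy_deriv[OF assms] zz_deriv[OF assms], of \<xi> \<xi>], of 2]
  by (simp add: fields_yy_zz algebra_simps)

lemma kin_deriv:
  assumes "t \<ge> 0"
  shows "((\<lambda>t. kin (Z t) \<xi>) has_real_derivative acc (Z t) \<xi> * vel (Z t) \<xi>) (at t within {0..})"
  using inner_deriv[OF zz_deriv[OF assms] zz_deriv[OF assms], of \<xi> \<xi>]
  by (simp add: fields_yy_zz algebra_simps inner_commute)

text \<open>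
  By Lagrange's identity \<open>4 jac kin - vel\<^sup>2\<close> is four times the square of the real Wronskian
  \<open>Im (cnj y * y')\<close>, which is conserved and initially equals \<open>q\<close>.
\<close>

lemma wronskian:
  assumes "t \<ge> 0"
  shows "(vel (Z t) \<xi>)\<^sup>2 + 4 * (q \<xi>)\<^sup>2 = 4 * jac (Z t) \<xi> * kin (Z t) \<xi>"
proof -
  let ?w = "\<lambda>t. (\<i> * yy t \<xi>) \<bullet> zz t \<xi>"
  have "(?w has_real_derivative 0) (at s within {0..t})" if "s \<in> {0..t}" for s
  proof -
    have s: "s \<ge> 0" using that by simp
    have "((\<lambda>t. \<i> * yy t \<xi>) has_vector_derivative \<i> * zz s \<xi>) (at s within {0..})"
      by (rule has_vector_derivative_mult_right[OF yy_deriv[OF s]])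
    from inner_deriv[OF this zz_deriv[OF s, of \<xi>]] have "(?w has_real_derivative 0) (at s within {0..})"
      by (simp add: inner_complex_def)
    then show ?thesis by (rule DERIV_subset) auto
  qed
  then obtain C where C: "\<And>s. s \<in> {0..t} \<Longrightarrow> ?w s = C"
    using has_field_derivative_zero_constant[of "{0..t}" ?w] by auto
  have "?w t = ?w 0" using C[of t] C[of 0] assms by simp
  then have q: "q \<xi> = Re (yy t \<xi>) * Im (zz t \<xi>) - Im (yy t \<xi>) * Re (zz t \<xi>)"
    by (simp add: yy_zz_0 inner_complex_def)
  show ?thesis
    unfolding fields_yy_zz inner_complex_def q by (simp add: power2_eq_square algebra_simps)
qed

section \<open>Conservation laws and the constraint\<close>

lemma Z_quadratic_bounds:
  assumes "0 \<le> s" "s \<le> t"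
  shows "\<bar>jac (Z s) \<xi>\<bar> \<le> E\<^sup>2 * (rad t)\<^sup>2" "\<bar>vel (Z s) \<xi>\<bar> \<le> 2 * E\<^sup>2 * (rad t)\<^sup>2" "\<bar>kin (Z s) \<xi>\<bar> \<le> E\<^sup>2 * (rad t)\<^sup>2"
  by (rule quadratic_bounds[OF Z_bound[OF assms]])+

lemma mean_jac_deriv:
  assumes "t \<ge> 0"
  shows "((\<lambda>t. mean (jac (Z t))) has_real_derivative mean (vel (Z t))) (at t within {0..})"
  by (rule has_real_derivative_mean[OF assms jac_borel jac_deriv Z_quadratic_bounds(1)[OF _ order_refl]
        Z_quadratic_bounds(2)])

lemma acc_times_bound: "\<bar>x\<bar> \<le> C \<Longrightarrow> \<bar>acc v \<xi> * x\<bar> \<le> C0 * C"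
  using acc_bound[of v \<xi>] C0_nonneg by (auto simp: abs_mult intro!: mult_mono)

lemma mean_vel_deriv:
  assumes "t \<ge> 0"
  shows "((\<lambda>t. mean (vel (Z t))) has_real_derivative
    mean (\<lambda>\<xi>. 2 * kin (Z t) \<xi> + 2 * acc (Z t) \<xi> * jac (Z t) \<xi>)) (at t within {0..})"
proof (rule has_real_derivative_mean[OF assms vel_borel vel_deriv Z_quadratic_bounds(2)[OF _ order_refl]])
  fix s \<xi> assume s: "0 \<le> s" "s \<le> t + 1"
  show "\<bar>2 * kin (Z s) \<xi> + 2 * acc (Z s) \<xi> * jac (Z s) \<xi>\<bar>
      \<le> 2 * (E\<^sup>2 * (rad (t + 1))\<^sup>2) + 2 * (C0 * (E\<^sup>2 * (rad (t + 1))\<^sup>2))"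
    using Z_quadratic_bounds(3)[OF s, of \<xi>] acc_times_bound[OF Z_quadratic_bounds(1)[OF s, of \<xi>], of "Z s" \<xi>]
    by linarith
qed

lemma mean_kin_deriv:
  assumes "t \<ge> 0"
  shows "((\<lambda>t. mean (kin (Z t))) has_real_derivative mean (\<lambda>\<xi>. acc (Z t) \<xi> * vel (Z t) \<xi>)) (at t within {0..})"
  by (rule has_real_derivative_mean[OF assms kin_borel kin_deriv Z_quadratic_bounds(3)[OF _ order_refl]
        acc_times_bound[OF Z_quadratic_bounds(2)]])

lemma acc_borel [measurable]: "acc v \<in> borel_measurable borel"
  by (rule borel_measurable_continuous_onI[OF acc_continuous])

lemma drift_1: "drift v 1 = mean (vel v)"
  unfolding drift_def by (rule mean_cong) (auto simp: indicator_def)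

text \<open>
  The coefficient \<open>acc\<close> depends on the label through the drift only.
\<close>

lemma mean_acc:
  assumes h: "h \<in> borel_measurable borel" "\<And>x. \<bar>h x\<bar> \<le> C"
  shows "mean (\<lambda>\<xi>. acc v \<xi> * h \<xi>)
    = (\<mu>\<^sup>2 + \<mu> * cl (corr v) - c / 2) * mean h - \<mu> * mean (\<lambda>\<xi>. cl (drift v \<xi>) * h \<xi>)"
proof -
  have [measurable]: "h \<in> borel_measurable borel" by fact
  have C: "C \<ge> 0" using h(2)[of 0] by linarith
  have b: "\<bar>cl (drift v \<xi>) * h \<xi>\<bar> \<le> B * C" for \<xi>
    unfolding abs_mult using B_pos C by (intro mult_mono cl_bound h) auto
  have "mean (\<lambda>\<xi>. acc v \<xi> * h \<xi>)
      = mean (\<lambda>\<xi>. (\<mu>\<^sup>2 + \<mu> * cl (corr v) - c / 2) * h \<xi> - \<mu> * (cl (drift v \<xi>) * h \<xi>))"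
    by (rule mean_cong) (simp add: acc_def uu_def algebra_simps power2_eq_square)
  also have "\<dots> = mean (\<lambda>\<xi>. (\<mu>\<^sup>2 + \<mu> * cl (corr v) - c / 2) * h \<xi>) - mean (\<lambda>\<xi>. \<mu> * (cl (drift v \<xi>) * h \<xi>))"
  proof (rule mean_add(2))
    show "\<bar>(\<mu>\<^sup>2 + \<mu> * cl (corr v) - c / 2) * h x\<bar> \<le> \<bar>\<mu>\<^sup>2 + \<mu> * cl (corr v) - c / 2\<bar> * C" for x
      unfolding abs_mult by (intro mult_left_mono h) auto
    show "\<bar>\<mu> * (cl (drift v x) * h x)\<bar> \<le> \<bar>\<mu>\<bar> * (B * C)" for x
      unfolding abs_mult[of \<mu>] by (intro mult_left_mono b) auto
  qed measurable
  finally show ?thesis by (simp add: mean_cmult)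
qed

text \<open>
  An average with weight \<open>jac\<close> of numbers of modulus at most \<open>B\<close>.
\<close>

lemma corr_bound: "\<bar>corr v\<bar> \<le> B * mean (jac v)"
proof -
  have b: "\<bar>jac v \<xi>\<bar> \<le> E\<^sup>2 * (norm v)\<^sup>2" for \<xi> by (rule quadratic_bounds) simp
  have b': "\<bar>cl (drift v \<xi>) * jac v \<xi>\<bar> \<le> B * jac v \<xi>" for \<xi>
    unfolding abs_mult using cl_bound[of "drift v \<xi>"] jac_nonneg[of v \<xi>] by (simp add: mult_right_mono)
  have b'': "\<bar>B * jac v \<xi>\<bar> \<le> B * (E\<^sup>2 * (norm v)\<^sup>2)" for \<xi>
    using b[of \<xi>] B_pos by (simp add: abs_mult)
  have b3: "\<bar>cl (drift v \<xi>) * jac v \<xi>\<bar> \<le> B * (E\<^sup>2 * (norm v)\<^sup>2)" for \<xi>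
    using b'[of \<xi>] b''[of \<xi>] by linarith
  have "mean (\<lambda>\<xi>. cl (drift v \<xi>) * jac v \<xi>) \<le> mean (\<lambda>\<xi>. B * jac v \<xi>)"
    using b' by (intro mean_mono[OF _ _ b3 b'']) (measurable, fastforce simp: abs_le_iff)
  moreover have "mean (\<lambda>\<xi>. (-1) * (B * jac v \<xi>)) \<le> mean (\<lambda>\<xi>. cl (drift v \<xi>) * jac v \<xi>)"
  proof (rule mean_mono[OF _ _ _ b3])
    show "\<bar>(-1) * (B * jac v \<xi>)\<bar> \<le> B * (E\<^sup>2 * (norm v)\<^sup>2)" for \<xi> using b''[of \<xi>] by simp
    show "(-1) * (B * jac v \<xi>) \<le> cl (drift v \<xi>) * jac v \<xi>" for \<xi> using b'[of \<xi>] by linarith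
  qed measurable
  ultimately show ?thesis unfolding corr_def mean_cmult by linarith
qed

text \<open>
  Since \<open>vel\<close> is the derivative of the drift, the integrand is the derivative of \<open>\<kappa> \<circ> drift\<close>, where
  \<open>\<kappa>\<close> is an antiderivative of the truncation. The total increment is \<open>\<kappa> (mean vel) - \<kappa> 0\<close>, and
  \<open>\<kappa>\<close> has Lipschitz constant \<open>B\<close>.
\<close>

lemma mean_cl_drift_vel: "\<bar>mean (\<lambda>\<xi>. cl (drift v \<xi>) * vel v \<xi>)\<bar> \<le> B * \<bar>mean (vel v)\<bar>"
proof -
  obtain \<kappa> where \<kappa>: "\<And>x. (\<kappa> has_real_derivative cl x) (at x)" "primitive \<kappa> cl"
    using continuous_antiderivative[OF cl_continuous] by blast
  obtain G where G: "primitive G (vel v)" "\<And>\<xi>. drift v \<xi> = G (max 0 (min 1 \<xi>)) - G 0"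
    using vel_primitive by blast
  have "primitive (\<lambda>x. G x - G 0) (vel v)"
    using primitive_diff[OF G(1) primitive_const[of "G 0"]] by simp
  from primitive_chain[OF this \<kappa>(1) cl_continuous]
  have "mean (\<lambda>x. cl (G x - G 0) * vel v x) = \<kappa> (G 1 - G 0) - \<kappa> (G 0 - G 0)"
    by (rule mean_primitive)
  moreover have "mean (\<lambda>x. cl (G x - G 0) * vel v x) = mean (\<lambda>\<xi>. cl (drift v \<xi>) * vel v \<xi>)"
    by (rule mean_cong) (simp add: G(2))
  moreover have "G 1 - G 0 = mean (vel v)" using drift_1[of v] G(2)[of 1] by simp
  ultimately have "mean (\<lambda>\<xi>. cl (drift v \<xi>) * vel v \<xi>) = \<kappa> (mean (vel v)) - \<kappa> 0" by simp
  then show ?thesis using primitive_lipschitz[OF \<kappa>(2) cl_bound, of "mean (vel v)" 0] by simp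
qed

text \<open>
  The deviations \<open>m\<close>, \<open>P\<close> and \<open>k\<close> of \<open>mean jac\<close>, \<open>mean vel\<close> and \<open>mean kin\<close> from \<open>1\<close>, \<open>0\<close> and \<open>e0\<close>
  vanish initially and obey a homogeneous system of differential inequalities
  \<open>m' = P\<close>, \<open>\<bar>k'\<bar> \<le> C1 \<bar>P\<bar>\<close>, \<open>\<bar>P'\<bar> \<le> 2 \<bar>k\<bar> + C2 \<bar>m\<bar>\<close>, so Gronwall's inequality for the sum of their
  squares forces them to vanish. The system closes in spite of the truncation, because the errors
  that the truncation causes are themselves controlled by \<open>m\<close> and \<open>P\<close>.
\<close>

lemma constraints:
  assumes "t \<ge> 0"
  shows "mean (jac (Z t)) = 1" "mean (vel (Z t)) = 0" "mean (kin (Z t)) = e0"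
proof -
  define m where "m s = mean (jac (Z s)) - 1" for s
  define k where "k s = mean (kin (Z s)) - e0" for s
  define P where "P s = mean (vel (Z s))" for s
  define C1 where "C1 = \<mu>\<^sup>2 + \<bar>\<mu>\<bar> * B + \<bar>c\<bar> / 2 + \<bar>\<mu>\<bar> * B"
  define C2 where "C2 = 2 * e0 + 4 * \<bar>\<mu>\<bar> * B"
  define k' where "k' s = mean (\<lambda>\<xi>. acc (Z s) \<xi> * vel (Z s) \<xi>)" for s
  define P' where "P' s = mean (\<lambda>\<xi>. 2 * kin (Z s) \<xi> + 2 * acc (Z s) \<xi> * jac (Z s) \<xi>)" for s
  have C12: "C1 \<ge> 0" "C2 \<ge> 0" using B_pos e0_nonneg by (simp_all add: C1_def C2_def)
  have k'_le: "\<bar>k' s\<bar> \<le> C1 * \<bar>P s\<bar>" if "s \<ge> 0" for s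
  proof -
    have "k' s = (\<mu>\<^sup>2 + \<mu> * cl (corr (Z s)) - c / 2) * P s - \<mu> * mean (\<lambda>\<xi>. cl (drift (Z s) \<xi>) * vel (Z s) \<xi>)"
      unfolding k'_def P_def by (rule mean_acc[OF vel_borel Z_quadratic_bounds(2)[OF that order_refl]])
    then have "\<bar>k' s\<bar> \<le> \<bar>\<mu>\<^sup>2 + \<mu> * cl (corr (Z s)) - c / 2\<bar> * \<bar>P s\<bar>
        + \<bar>\<mu>\<bar> * \<bar>mean (\<lambda>\<xi>. cl (drift (Z s) \<xi>) * vel (Z s) \<xi>)\<bar>"
      by (simp only: abs_mult[symmetric] abs_triangle_ineq4)
    also have "\<dots> \<le> (\<mu>\<^sup>2 + \<bar>\<mu>\<bar> * B + \<bar>c\<bar> / 2) * \<bar>P s\<bar> + \<bar>\<mu>\<bar> * (B * \<bar>P s\<bar>)"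
    proof (intro add_mono mult_right_mono mult_left_mono)
      have "\<bar>\<mu> * cl (corr (Z s))\<bar> \<le> \<bar>\<mu>\<bar> * B" unfolding abs_mult by (intro mult_left_mono cl_bound) auto
      moreover have "0 \<le> \<mu>\<^sup>2" by simp
      ultimately show "\<bar>\<mu>\<^sup>2 + \<mu> * cl (corr (Z s)) - c / 2\<bar> \<le> \<mu>\<^sup>2 + \<bar>\<mu>\<bar> * B + \<bar>c\<bar> / 2" by linarith
      show "\<bar>mean (\<lambda>\<xi>. cl (drift (Z s) \<xi>) * vel (Z s) \<xi>)\<bar> \<le> B * \<bar>P s\<bar>"
        unfolding P_def by (rule mean_cl_drift_vel)
    qed auto
    also have "\<dots> = C1 * \<bar>P s\<bar>" by (simp add: C1_def algebra_simps)
    finally show ?thesis .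
  qed
  have P'_le: "\<bar>P' s\<bar> \<le> 2 * \<bar>k s\<bar> + C2 * \<bar>m s\<bar>" if "s \<ge> 0" for s
  proof -
    let ?Q = "corr (Z s)" and ?M = "mean (jac (Z s))"
    have "P' s = mean (\<lambda>\<xi>. 2 * kin (Z s) \<xi>) + mean (\<lambda>\<xi>. 2 * (acc (Z s) \<xi> * jac (Z s) \<xi>))"
      unfolding P'_def mult.assoc
    proof (rule mean_add(1))
      show "\<bar>2 * kin (Z s) x\<bar> \<le> 2 * (E\<^sup>2 * (rad s)\<^sup>2)" for x
        using Z_quadratic_bounds(3)[OF that order_refl, of x] by linarith
      show "\<bar>2 * (acc (Z s) x * jac (Z s) x)\<bar> \<le> 2 * (C0 * (E\<^sup>2 * (rad s)\<^sup>2))" for x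
        using acc_times_bound[OF Z_quadratic_bounds(1)[OF that order_refl, of x], of "Z s" x] by linarith
    qed measurable
    also have "\<dots> = 2 * mean (kin (Z s)) + 2 * ((\<mu>\<^sup>2 + \<mu> * cl ?Q - c / 2) * ?M - \<mu> * ?Q)"
      unfolding mean_cmult using mean_acc[OF jac_borel Z_quadratic_bounds(1)[OF that order_refl], of "Z s"]
      by (simp add: corr_def)
    \<comment> \<open>The value of \<open>c\<close> makes the constant terms cancel.\<close>
    also have "\<dots> = 2 * k s - 2 * e0 * m s + 2 * \<mu> * (cl ?Q * m s + (cl ?Q - ?Q))"
      by (simp add: k_def m_def c_def algebra_simps)
    finally have P'1: "\<bar>P' s\<bar> \<le> 2 * \<bar>k s\<bar> + 2 * e0 * \<bar>m s\<bar> + 2 * \<bar>\<mu>\<bar> * \<bar>cl ?Q * m s + (cl ?Q - ?Q)\<bar>"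
      using e0_nonneg abs_triangle_ineq[of "2 * k s - 2 * e0 * m s" "2 * \<mu> * (cl ?Q * m s + (cl ?Q - ?Q))"]
        abs_triangle_ineq4[of "2 * k s" "2 * e0 * m s"]
      by (simp add: abs_mult)
    have "\<bar>cl ?Q * m s + (cl ?Q - ?Q)\<bar> \<le> B * \<bar>m s\<bar> + B * \<bar>m s\<bar>"
    proof (intro order_trans[OF abs_triangle_ineq] add_mono)
      show "\<bar>cl ?Q * m s\<bar> \<le> B * \<bar>m s\<bar>" unfolding abs_mult by (intro mult_right_mono cl_bound) auto
      \<comment> \<open>The truncation removes at most the excess of \<open>\<bar>?Q\<bar>\<close> over \<open>B\<close>.\<close>
      have "\<bar>?Q\<bar> \<le> B + B * m s" using corr_bound[of "Z s"] by (simp add: m_def algebra_simps)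
      moreover have "B * m s \<le> B * \<bar>m s\<bar>" "0 \<le> B * \<bar>m s\<bar>" using B_pos by (auto intro: mult_left_mono)
      ultimately show "\<bar>cl ?Q - ?Q\<bar> \<le> B * \<bar>m s\<bar>" unfolding cl_def by linarith
    qed
    then have "2 * \<bar>\<mu>\<bar> * \<bar>cl ?Q * m s + (cl ?Q - ?Q)\<bar> \<le> 2 * \<bar>\<mu>\<bar> * (B * \<bar>m s\<bar> + B * \<bar>m s\<bar>)"
      by (intro mult_left_mono) auto
    then show ?thesis using P'1 by (simp add: C2_def algebra_simps)
  qed
  define S where "S s = (m s)\<^sup>2 + (k s)\<^sup>2 + (P s)\<^sup>2" for s
  define S' where "S' s = 2 * m s * P s + 2 * k s * k' s + 2 * P s * P' s" for s
  have S_deriv: "(S has_real_derivative S' s) (at s within {0..})" if "s \<ge> 0" for s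
  proof -
    have d: "(m has_real_derivative P s) (at s within {0..})"
       "(k has_real_derivative k' s) (at s within {0..})" "(P has_real_derivative P' s) (at s within {0..})"
      using mean_jac_deriv[OF that] mean_kin_deriv[OF that] mean_vel_deriv[OF that]
      unfolding m_def[abs_def] k_def[abs_def] P_def[abs_def] k'_def P'_def
      by (auto intro!: derivative_eq_intros)
    show ?thesis
      unfolding S_def[abs_def] S'_def
      by (rule derivative_eq_intros d refl | simp)+
  qed
  have S'_le: "S' s \<le> (3 + C1 + C2) * S s" if "s \<ge> 0" for s
  proof -
    have prod: "2 * (\<bar>x\<bar> * \<bar>y\<bar>) \<le> x\<^sup>2 + y\<^sup>2" for x y :: real
      using sum_squares_bound[of "\<bar>x\<bar>" "\<bar>y\<bar>"] by simp
    have "S' s \<le> \<bar>S' s\<bar>" by simp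
    also have "\<dots> \<le> 2 * (\<bar>m s\<bar> * \<bar>P s\<bar>) + 2 * (\<bar>k s\<bar> * \<bar>k' s\<bar>) + 2 * (\<bar>P s\<bar> * \<bar>P' s\<bar>)"
      unfolding S'_def by (intro order_trans[OF abs_triangle_ineq] add_mono) (simp_all add: abs_mult)
    also have "\<dots> \<le> 2 * (\<bar>m s\<bar> * \<bar>P s\<bar>) + 2 * (\<bar>k s\<bar> * (C1 * \<bar>P s\<bar>)) + 2 * (\<bar>P s\<bar> * (2 * \<bar>k s\<bar> + C2 * \<bar>m s\<bar>))"
      using k'_le[OF that] P'_le[OF that] by (intro add_mono mult_left_mono) auto
    also have "\<dots> = (1 + C2) * (2 * (\<bar>m s\<bar> * \<bar>P s\<bar>)) + (C1 + 2) * (2 * (\<bar>k s\<bar> * \<bar>P s\<bar>))"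
      by (simp add: algebra_simps)
    also have "\<dots> \<le> (1 + C2) * S s + (C1 + 2) * S s"
    proof (intro add_mono mult_left_mono)
      show "2 * (\<bar>m s\<bar> * \<bar>P s\<bar>) \<le> S s" "2 * (\<bar>k s\<bar> * \<bar>P s\<bar>) \<le> S s"
        using prod[of "m s" "P s"] prod[of "k s" "P s"] zero_le_power2[of "k s"] zero_le_power2[of "m s"]
        unfolding S_def by linarith+
    qed (use C12 in auto)
    finally show ?thesis by (simp add: algebra_simps)
  qed
  have "S 0 = 0"
  proof -
    have "mean (jac (Z 0)) = mean (\<lambda>_. 1)" by (rule mean_cong) (simp add: fields_yy_zz yy_zz_0 inner_complex_def)
    moreover have "mean (vel (Z 0)) = mean (\<lambda>\<xi>. 2 * p \<xi>)"
      by (rule mean_cong) (simp add: fields_yy_zz yy_zz_0 inner_complex_def)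
    moreover have "mean (kin (Z 0)) = e0"
      unfolding e0_def by (rule mean_cong) (simp add: fields_yy_zz yy_zz_0 inner_complex_def power2_eq_square)
    ultimately show ?thesis by (simp add: S_def m_def k_def P_def mean_cmult mean_p)
  qed
  then have "S t \<le> 0" using gronwall[OF S_deriv S'_le assms] by simp
  moreover have "0 \<le> (m t)\<^sup>2" "0 \<le> (k t)\<^sup>2" "0 \<le> (P t)\<^sup>2" by auto
  ultimately have "(m t)\<^sup>2 = 0" "(k t)\<^sup>2 = 0" "(P t)\<^sup>2 = 0" unfolding S_def by linarith+
  then show "mean (jac (Z t)) = 1" "mean (vel (Z t)) = 0" "mean (kin (Z t)) = e0"
    by (simp_all add: m_def k_def P_def)
qed

text \<open>
  Young's inequality \<open>\<bar>2 (y \<bullet> y')\<bar> \<le> \<bar>y\<bar>\<^sup>2 + \<bar>y'\<bar>\<^sup>2\<close> bounds the drift by \<open>mean jac + mean kin\<close>, which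
  the constraints evaluate to \<open>B\<close>. So the truncation of the drift is never active, and by
  \<open>corr_bound\<close> neither is that of \<open>corr\<close>.
\<close>

lemma drift_bound:
  assumes "t \<ge> 0"
  shows "\<bar>drift (Z t) \<xi>\<bar> \<le> B"
proof -
  have vk: "\<bar>vel (Z t) \<eta>\<bar> \<le> jac (Z t) \<eta> + kin (Z t) \<eta>" for \<eta>
  proof -
    have "2 * \<bar>yy t \<eta> \<bullet> zz t \<eta>\<bar> \<le> 2 * (norm (yy t \<eta>) * norm (zz t \<eta>))"
      using Cauchy_Schwarz_ineq2[of "yy t \<eta>" "zz t \<eta>"] by simp
    also have "\<dots> \<le> (norm (yy t \<eta>))\<^sup>2 + (norm (zz t \<eta>))\<^sup>2"
      using sum_squares_bound[of "norm (yy t \<eta>)" "norm (zz t \<eta>)"] by simp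
    finally show ?thesis by (simp add: fields_yy_zz abs_mult power2_norm_eq_inner)
  qed
  let ?R = "E\<^sup>2 * (rad t)\<^sup>2"
  have jk: "\<bar>jac (Z t) x + kin (Z t) x\<bar> \<le> ?R + ?R" for x
    using Z_quadratic_bounds(1,3)[OF assms order_refl, of x] by linarith
  have b: "\<bar>indicator {..\<xi>} x * vel (Z t) x\<bar> \<le> jac (Z t) x + kin (Z t) x" for x
    using vk[of x] jac_nonneg[of "Z t" x] kin_nonneg[of "Z t" x] by (simp add: indicator_def)
  have sum: "mean (\<lambda>\<eta>. jac (Z t) \<eta> + kin (Z t) \<eta>) = B"
    using mean_add(1)[OF jac_borel kin_borel Z_quadratic_bounds(1)[OF assms order_refl]
        Z_quadratic_bounds(3)[OF assms order_refl]] constraints[OF assms] by (simp add: B_def)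
  have ib: "\<bar>indicator {..\<xi>} x * vel (Z t) x\<bar> \<le> ?R + ?R" for x using b[of x] jk[of x] by linarith
  have "drift (Z t) \<xi> \<le> B"
    unfolding drift_def sum[symmetric]
  proof (rule mean_mono[OF _ _ ib jk])
    show "indicator {..\<xi>} x * vel (Z t) x \<le> jac (Z t) x + kin (Z t) x" for x using b[of x] by linarith
  qed measurable
  moreover have "mean (\<lambda>\<eta>. (-1) * (jac (Z t) \<eta> + kin (Z t) \<eta>)) \<le> drift (Z t) \<xi>"
    unfolding drift_def
  proof (rule mean_mono[OF _ _ _ ib])
    show "\<bar>(-1) * (jac (Z t) x + kin (Z t) x)\<bar> \<le> ?R + ?R" for x using jk[of x] by simp
    show "(-1) * (jac (Z t) x + kin (Z t) x) \<le> indicator {..\<xi>} x * vel (Z t) x" for x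
      using abs_le_D2[OF b[of x]] by (simp only: mult_minus1)
  qed measurable
  ultimately show ?thesis unfolding mean_cmult sum by linarith
qed

lemma uu_eq:
  assumes "t \<ge> 0"
  shows "uu (Z t) \<xi> = \<mu> - drift (Z t) \<xi> + mean (\<lambda>\<xi>. drift (Z t) \<xi> * jac (Z t) \<xi>)"
proof -
  have "\<bar>corr (Z t)\<bar> \<le> B" using corr_bound[of "Z t"] constraints(1)[OF assms] by simp
  then show ?thesis using drift_bound[OF assms] by (simp add: uu_def cl_id corr_def)
qed

lemma mean_uu_jac:
  assumes "t \<ge> 0"
  shows "mean (\<lambda>\<xi>. uu (Z t) \<xi> * jac (Z t) \<xi>) = \<mu>"
proof -
  let ?Q = "mean (\<lambda>\<xi>. drift (Z t) \<xi> * jac (Z t) \<xi>)" and ?R = "E\<^sup>2 * (rad t)\<^sup>2"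
  have R: "\<bar>jac (Z t) x\<bar> \<le> ?R" for x by (rule Z_quadratic_bounds(1)[OF assms order_refl])
  have "mean (\<lambda>\<xi>. uu (Z t) \<xi> * jac (Z t) \<xi>) = mean (\<lambda>\<xi>. (\<mu> + ?Q) * jac (Z t) \<xi> - drift (Z t) \<xi> * jac (Z t) \<xi>)"
    by (rule mean_cong) (simp add: uu_eq[OF assms] algebra_simps)
  also have "\<dots> = mean (\<lambda>\<xi>. (\<mu> + ?Q) * jac (Z t) \<xi>) - ?Q"
  proof (rule mean_add(2))
    show "\<bar>(\<mu> + ?Q) * jac (Z t) x\<bar> \<le> \<bar>\<mu> + ?Q\<bar> * ?R" for x
      unfolding abs_mult by (intro mult_left_mono R) auto
    show "\<bar>drift (Z t) x * jac (Z t) x\<bar> \<le> B * ?R" for x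
      unfolding abs_mult using B_pos by (intro mult_mono R drift_bound[OF assms]) auto
  qed measurable
  also have "\<dots> = \<mu>" using constraints(1)[OF assms] by (simp add: mean_cmult)
  finally show ?thesis .
qed

end

section \<open>The periodic Lagrangian fields\<close>

lemma continuous_apply_bcontfun_curve:
  fixes c :: "real \<Rightarrow> state"
  assumes "continuous_on UNIV c"
  shows "continuous_on UNIV (\<lambda>x. apply_bcontfun (c (fst x)) (snd x))"
proof -
  have "isCont (\<lambda>x. apply_bcontfun (c (fst x)) (snd x)) (s, \<eta>)" for s \<eta>
  proof -
    have c: "((\<lambda>x. c (fst x)) \<longlongrightarrow> c s) (at (s, \<eta>))"
      using assms by (intro isCont_tendsto_compose[of _ c]) (auto simp: continuous_on_eq_continuous_at intro!: tendsto_eq_intros)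
    have "((\<lambda>x. apply_bcontfun (c (fst x)) (snd x) - apply_bcontfun (c s) (snd x)) \<longlongrightarrow> 0) (at (s, \<eta>))"
    proof (rule Lim_null_comparison)
      show "\<forall>\<^sub>F x in at (s, \<eta>). norm (apply_bcontfun (c (fst x)) (snd x) - apply_bcontfun (c s) (snd x)) \<le> norm (c (fst x) - c s)"
        using norm_bounded[of "c (fst x) - c s" "snd x" for x] by (auto simp: minus_bcontfun.rep_eq)
      show "((\<lambda>x. norm (c (fst x) - c s)) \<longlongrightarrow> 0) (at (s, \<eta>))" using c LIM_zero tendsto_norm_zero by blast
    qed
    moreover have "((\<lambda>x. apply_bcontfun (c s) (snd x)) \<longlongrightarrow> apply_bcontfun (c s) \<eta>) (at (s, \<eta>))"
    proof (rule isCont_tendsto_compose[of _ "apply_bcontfun (c s)"])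
      show "isCont (apply_bcontfun (c s)) \<eta>"
        using continuous_on_apply_bcontfun[of UNIV "c s"]
        unfolding continuous_on_eq_continuous_at[OF open_UNIV] by (rule bspec) simp
      show "(snd \<longlongrightarrow> \<eta>) (at (s, \<eta>))" by (auto intro!: tendsto_eq_intros)
    qed
    ultimately have "((\<lambda>x. (apply_bcontfun (c (fst x)) (snd x) - apply_bcontfun (c s) (snd x)) + apply_bcontfun (c s) (snd x))
        \<longlongrightarrow> 0 + apply_bcontfun (c s) \<eta>) (at (s, \<eta>))"
      by (rule tendsto_add)
    then show ?thesis by (simp add: isCont_def)
  qed
  then show ?thesis by (auto intro!: continuous_at_imp_continuous_on)
qed

context lagrangian_data
begin

text \<open>
  Times are extended constantly to the left of zero and labels periodically, so that every field is
  defined, and measurable, on the whole plane.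
\<close>

definition \<Z> :: "real \<Rightarrow> state" where "\<Z> t = Z (max 0 t)"
definition J :: "real \<Rightarrow> real \<Rightarrow> real" where "J t \<xi> = jac (\<Z> t) (frac \<xi>)"
definition N :: "real \<Rightarrow> real \<Rightarrow> real" where "N t \<xi> = vel (\<Z> t) (frac \<xi>)"
definition K :: "real \<Rightarrow> real \<Rightarrow> real" where "K t \<xi> = kin (\<Z> t) (frac \<xi>)"
definition U :: "real \<Rightarrow> real \<Rightarrow> real" where "U t \<xi> = uu (\<Z> t) (frac \<xi>)"
definition N' :: "real \<Rightarrow> real \<Rightarrow> real" where
  "N' t \<xi> = 2 * K t \<xi> + 2 * (\<mu> * U t \<xi> - c / 2) * J t \<xi>"

lemma fields_periodic:
  "J t (\<xi> + 1) = J t \<xi>" "N t (\<xi> + 1) = N t \<xi>" "K t (\<xi> + 1) = K t \<xi>" "U t (\<xi> + 1) = U t \<xi>"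
  "N' t (\<xi> + 1) = N' t \<xi>"
  by (simp_all add: J_def N_def K_def U_def N'_def frac_1_eq)

lemma \<Z>_continuous: "continuous_on UNIV \<Z>"
  unfolding \<Z>_def[abs_def]
  by (rule continuous_on_compose2[OF Z_continuous]) (auto intro!: continuous_intros)

lemma \<Z>_measurable:
  assumes [measurable]: "f \<in> borel_measurable M" "g \<in> borel_measurable M"
  shows "(\<lambda>\<omega>. Re (V1 (\<Z> (f \<omega>)) (g \<omega>))) \<in> borel_measurable M" "(\<lambda>\<omega>. Im (V1 (\<Z> (f \<omega>)) (g \<omega>))) \<in> borel_measurable M"
    "(\<lambda>\<omega>. Re (V2 (\<Z> (f \<omega>)) (g \<omega>))) \<in> borel_measurable M" "(\<lambda>\<omega>. Im (V2 (\<Z> (f \<omega>)) (g \<omega>))) \<in> borel_measurable M"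
proof -
  note c = continuous_apply_bcontfun_curve[OF \<Z>_continuous]
  show "(\<lambda>\<omega>. Re (V1 (\<Z> (f \<omega>)) (g \<omega>))) \<in> borel_measurable M"
    by (rule borel_measurable_continuous_Pair[where H="\<lambda>t x. Re (V1 (\<Z> t) x)"]) (measurable, intro continuous_intros c)
  show "(\<lambda>\<omega>. Im (V1 (\<Z> (f \<omega>)) (g \<omega>))) \<in> borel_measurable M"
    by (rule borel_measurable_continuous_Pair[where H="\<lambda>t x. Im (V1 (\<Z> t) x)"]) (measurable, intro continuous_intros c)
  show "(\<lambda>\<omega>. Re (V2 (\<Z> (f \<omega>)) (g \<omega>))) \<in> borel_measurable M"
    by (rule borel_measurable_continuous_Pair[where H="\<lambda>t x. Re (V2 (\<Z> t) x)"]) (measurable, intro continuous_intros c)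
  show "(\<lambda>\<omega>. Im (V2 (\<Z> (f \<omega>)) (g \<omega>))) \<in> borel_measurable M"
    by (rule borel_measurable_continuous_Pair[where H="\<lambda>t x. Im (V2 (\<Z> t) x)"]) (measurable, intro continuous_intros c)
qed

lemma fields_measurable [measurable (raw)]:
  assumes [measurable]: "f \<in> borel_measurable M" "g \<in> borel_measurable M"
  shows "(\<lambda>\<omega>. J (f \<omega>) (g \<omega>)) \<in> borel_measurable M" "(\<lambda>\<omega>. N (f \<omega>) (g \<omega>)) \<in> borel_measurable M"
    "(\<lambda>\<omega>. K (f \<omega>) (g \<omega>)) \<in> borel_measurable M"
proof -
  have [measurable]: "(\<lambda>\<omega>. frac (g \<omega>)) \<in> borel_measurable M" by measurable
  note [measurable] = \<Z>_measurable[of f M "\<lambda>\<omega>. frac (g \<omega>)"]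
  show "(\<lambda>\<omega>. J (f \<omega>) (g \<omega>)) \<in> borel_measurable M" "(\<lambda>\<omega>. N (f \<omega>) (g \<omega>)) \<in> borel_measurable M"
    "(\<lambda>\<omega>. K (f \<omega>) (g \<omega>)) \<in> borel_measurable M"
    unfolding J_def N_def K_def jac_def vel_def kin_def lag_def inner_complex_def by simp_all
qed

lemma uu_continuous_pair: "continuous_on UNIV (\<lambda>x. uu (\<Z> (fst x)) (snd x))"
proof -
  have "isCont (\<lambda>x. uu (\<Z> (fst x)) (snd x)) (s, \<eta>)" for s \<eta>
  proof -
    define R where "R = norm (\<Z> s) + 1"
    obtain L where L: "\<And>v w \<xi>. norm v \<le> R \<Longrightarrow> norm w \<le> R \<Longrightarrow> \<bar>uu v \<xi> - uu w \<xi>\<bar> \<le> L * norm (v - w)"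
      using uu_lipschitz[of R] by blast
    have c: "((\<lambda>x. \<Z> (fst x)) \<longlongrightarrow> \<Z> s) (at (s, \<eta>))"
      using \<Z>_continuous by (intro isCont_tendsto_compose[of _ \<Z>]) (auto simp: continuous_on_eq_continuous_at intro!: tendsto_eq_intros)
    then have "\<forall>\<^sub>F x in at (s, \<eta>). norm (\<Z> (fst x)) < R"
      using order_tendstoD(2)[OF tendsto_norm[OF c], of R] by (simp add: R_def)
    then have ev: "\<forall>\<^sub>F x in at (s, \<eta>). norm (uu (\<Z> (fst x)) (snd x) - uu (\<Z> s) (snd x)) \<le> L * norm (\<Z> (fst x) - \<Z> s)"
      by eventually_elim (auto intro!: L simp: R_def)
    have "((\<lambda>x. uu (\<Z> (fst x)) (snd x) - uu (\<Z> s) (snd x)) \<longlongrightarrow> 0) (at (s, \<eta>))"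
    proof (rule Lim_null_comparison[OF ev])
      have "((\<lambda>x. L * norm (\<Z> (fst x) - \<Z> s)) \<longlongrightarrow> L * norm (\<Z> s - \<Z> s)) (at (s, \<eta>))"
        by (intro tendsto_intros c)
      then show "((\<lambda>x. L * norm (\<Z> (fst x) - \<Z> s)) \<longlongrightarrow> 0) (at (s, \<eta>))" by simp
    qed
    moreover have "((\<lambda>x. uu (\<Z> s) (snd x)) \<longlongrightarrow> uu (\<Z> s) \<eta>) (at (s, \<eta>))"
      using uu_continuous[of UNIV "\<Z> s"]
      by (intro isCont_tendsto_compose[of _ "uu (\<Z> s)"]) (auto simp: continuous_on_eq_continuous_at intro!: tendsto_eq_intros)
    ultimately have "((\<lambda>x. (uu (\<Z> (fst x)) (snd x) - uu (\<Z> s) (snd x)) + uu (\<Z> s) (snd x))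
        \<longlongrightarrow> 0 + uu (\<Z> s) \<eta>) (at (s, \<eta>))"
      by (rule tendsto_add)
    then show ?thesis by (simp add: isCont_def)
  qed
  then show ?thesis by (auto intro!: continuous_at_imp_continuous_on)
qed

lemma U_measurable [measurable (raw)]:
  assumes [measurable]: "f \<in> borel_measurable M" "g \<in> borel_measurable M"
  shows "(\<lambda>\<omega>. U (f \<omega>) (g \<omega>)) \<in> borel_measurable M"
  unfolding U_def
  by (rule borel_measurable_continuous_Pair[where H="\<lambda>t x. uu (\<Z> t) x"]) (measurable, rule uu_continuous_pair)

lemma N'_measurable [measurable (raw)]:
  assumes [measurable]: "f \<in> borel_measurable M" "g \<in> borel_measurable M"
  shows "(\<lambda>\<omega>. N' (f \<omega>) (g \<omega>)) \<in> borel_measurable M"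
  unfolding N'_def by measurable

lemma N'_eq: "N' t \<xi> = 2 * kin (\<Z> t) (frac \<xi>) + 2 * acc (\<Z> t) (frac \<xi>) * jac (\<Z> t) (frac \<xi>)"
  by (simp add: N'_def K_def U_def J_def acc_def)

definition bnd :: "real \<Rightarrow> real" where "bnd T = 2 * E\<^sup>2 * (rad (max 0 T))\<^sup>2"
definition bnd' :: "real \<Rightarrow> real" where "bnd' T = 2 * bnd T + 2 * C0 * bnd T"

lemma bnd_nonneg: "0 \<le> bnd T" by (simp add: bnd_def)

lemma fields_bound:
  assumes "t \<le> T"
  shows "\<bar>J t \<xi>\<bar> \<le> bnd T" "\<bar>N t \<xi>\<bar> \<le> bnd T" "\<bar>K t \<xi>\<bar> \<le> bnd T" "\<bar>N' t \<xi>\<bar> \<le> bnd' T"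
proof -
  have t: "0 \<le> max 0 t" "max 0 t \<le> max 0 T" using assms by auto
  have nn: "0 \<le> E\<^sup>2 * (rad (max 0 T))\<^sup>2" by simp
  show b: "\<bar>J t \<xi>\<bar> \<le> bnd T" "\<bar>N t \<xi>\<bar> \<le> bnd T" "\<bar>K t \<xi>\<bar> \<le> bnd T"
    using Z_quadratic_bounds[OF t, of "frac \<xi>"] nn unfolding J_def N_def K_def \<Z>_def bnd_def by linarith+
  have "\<bar>N' t \<xi>\<bar> \<le> 2 * \<bar>K t \<xi>\<bar> + 2 * \<bar>acc (\<Z> t) (frac \<xi>) * J t \<xi>\<bar>"
    unfolding N'_eq J_def K_def by linarith
  also have "\<dots> \<le> 2 * bnd T + 2 * (C0 * bnd T)" using b acc_times_bound[OF b(1)] by (intro add_mono) auto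
  finally show "\<bar>N' t \<xi>\<bar> \<le> bnd' T" by (simp add: bnd'_def)
qed

lemma U_bound: "\<bar>U t \<xi>\<bar> \<le> \<bar>\<mu>\<bar> + 2 * B" unfolding U_def by (rule uu_bound)

lemma q_frac: "q (frac \<xi>) = q \<xi>" and p_frac: "p (frac \<xi>) = p \<xi>"
  using periodic_frac[of q] q_periodic periodic_frac[of p] p_periodic by auto

lemma lagrange_identity: "(N t \<xi>)\<^sup>2 + 4 * (q \<xi>)\<^sup>2 = 4 * J t \<xi> * K t \<xi>"
  using wronskian[of "max 0 t" "frac \<xi>"] by (simp add: J_def N_def K_def \<Z>_def q_frac)

lemma q_sq_le: "\<beta>\<^sup>2 \<le> J t \<xi> * K t \<xi>"
proof -
  have "\<beta>\<^sup>2 \<le> (q \<xi>)\<^sup>2" using q_ge[of \<xi>] \<beta>_pos by (intro power_mono) auto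
  then show ?thesis using lagrange_identity[of t \<xi>] zero_le_power2[of "N t \<xi>"] by linarith
qed

lemma J_nonneg: "0 \<le> J t \<xi>" and K_nonneg: "0 \<le> K t \<xi>"
  by (simp_all add: J_def K_def jac_nonneg kin_nonneg)

lemma bnd_pos: "0 < bnd T"
proof -
  have "0 < \<beta>\<^sup>2" using \<beta>_pos by simp
  then have "K T 0 \<noteq> 0" using q_sq_le[of T 0] by auto
  then show ?thesis using fields_bound(3)[of T T 0] K_nonneg[of T 0] by simp
qed

definition low :: "real \<Rightarrow> real" where "low T = \<beta>\<^sup>2 / bnd T"

lemma low_pos: "0 < low T" unfolding low_def using \<beta>_pos bnd_pos by simp

text \<open>
  This is where the lower bound on the density enters. The identity gives \<open>q\<^sup>2 \<le> J K\<close>, and \<open>K\<close> grows at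
  most exponentially, so \<open>J\<close> cannot reach zero and particles never collide.
\<close>

lemma J_ge_low:
  assumes "t \<le> T"
  shows "low T \<le> J t \<xi>"
proof -
  have "\<beta>\<^sup>2 \<le> J t \<xi> * K t \<xi>" by (rule q_sq_le)
  also have "\<dots> \<le> J t \<xi> * bnd T"
    using fields_bound(3)[OF assms, of \<xi>] J_nonneg by (intro mult_left_mono) auto
  finally show ?thesis unfolding low_def using bnd_pos[of T] by (simp add: divide_le_eq)
qed

lemma J_pos: "0 < J t \<xi>" using low_pos[of t] J_ge_low[of t t \<xi>] by simp

lemma J_deriv:
  assumes "t \<ge> 0"
  shows "((\<lambda>t. J t \<xi>) has_real_derivative N t \<xi>) (at t within {0..})"
  using deriv_ray_cong[OF jac_deriv[OF assms, of "frac \<xi>"] assms, of "\<lambda>t. J t \<xi>"] assms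
  by (simp add: J_def N_def \<Z>_def)

lemma N_deriv:
  assumes "t \<ge> 0"
  shows "((\<lambda>t. N t \<xi>) has_real_derivative N' t \<xi>) (at t within {0..})"
  using deriv_ray_cong[OF vel_deriv[OF assms, of "frac \<xi>"] assms, of "\<lambda>t. N t \<xi>"] assms
  by (simp add: N_def N'_eq \<Z>_def)

lemma mean_fields: "mean (J t) = 1" "mean (N t) = 0" "mean (K t) = e0" "mean (\<lambda>\<xi>. U t \<xi> * J t \<xi>) = \<mu>"
proof -
  have t: "0 \<le> max 0 t" by simp
  show "mean (J t) = 1" "mean (N t) = 0" "mean (K t) = e0"
    unfolding J_def[abs_def] N_def[abs_def] K_def[abs_def]
    using constraints[OF t] by (simp_all add: mean_frac \<Z>_def)
  have "(\<lambda>\<xi>. uu (\<Z> t) \<xi> * jac (\<Z> t) \<xi>) \<in> borel_measurable borel"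
    using borel_measurable_continuous_onI[OF uu_continuous[of UNIV "\<Z> t"]] by measurable
  from mean_frac[OF this] show "mean (\<lambda>\<xi>. U t \<xi> * J t \<xi>) = \<mu>"
    using mean_uu_jac[OF t] by (simp add: U_def J_def \<Z>_def)
qed

text \<open>
  Within one period this is the definition of the drift. It continues across the integers because
  the mean of \<open>N\<close> vanishes.
\<close>

lemma U_primitive: "primitive (U t) (\<lambda>\<xi>. - N t \<xi>)"
proof -
  have N_borel: "N t \<in> borel_measurable borel" by measurable
  obtain G where G: "primitive G (N t)"
    using primitive_exists[OF N_borel locally_boundedI[OF fields_bound(2)[OF order_refl]]] by blast
  have G_per: "G (x + 1) = G x" for x
    using primitive_period[OF G fields_periodic(2)] mean_fields(2) by simp
  have drift: "drift (\<Z> t) x = G x - G 0" if x: "0 \<le> x" "x < 1" for x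
  proof -
    have "drift (\<Z> t) x = (LINT \<eta>|lborel. indicator {0..1} \<eta> * (indicator {..x} \<eta> * vel (\<Z> t) \<eta>))"
      unfolding drift_def by (rule mean_lborel) measurable
    also have "\<dots> = (LINT \<eta>|lborel. indicator {0..x} \<eta> * N t \<eta>)"
      by (intro Bochner_Integration.integral_cong) (use x in \<open>auto simp: indicator_def N_def frac_eq\<close>)
    also have "\<dots> = G x - G 0" by (rule primitive_integral_lborel(2)[OF G x(1)])
    finally show ?thesis .
  qed
  define Q where "Q = mean (\<lambda>\<xi>. drift (\<Z> t) \<xi> * jac (\<Z> t) \<xi>)"
  have "U t \<xi> = (\<mu> + Q + G 0) - G \<xi>" for \<xi>
  proof -
    have "U t \<xi> = \<mu> - (G (frac \<xi>) - G 0) + Q"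
      using uu_eq[of "max 0 t" "frac \<xi>"] drift[of "frac \<xi>"] frac_ge_0[of \<xi>] frac_lt_1[of \<xi>]
      by (simp add: U_def \<Z>_def Q_def)
    then show ?thesis using periodic_frac[of G \<xi>, OF G_per] by simp
  qed
  then show ?thesis
    by (intro primitive_cong[OF primitive_diff[OF primitive_const[of "\<mu> + Q + G 0"] G]]) auto
qed

section \<open>The acceleration of the fluid particles\<close>

text \<open>
  The time derivatives of the drift and of \<open>U\<close>, obtained by formal differentiation of their definitions.
\<close>

definition dd :: "real \<Rightarrow> real \<Rightarrow> real" where
  "dd t x = mean (\<lambda>\<eta>. indicator {..x} \<eta> * (2 * kin (\<Z> t) \<eta> + 2 * acc (\<Z> t) \<eta> * jac (\<Z> t) \<eta>))"
definition G :: "real \<Rightarrow> real \<Rightarrow> real" where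
  "G t \<xi> = - dd t (frac \<xi>) + mean (\<lambda>\<eta>. dd t \<eta> * jac (\<Z> t) \<eta> + drift (\<Z> t) \<eta> * vel (\<Z> t) \<eta>)"

lemma vel'_bound:
  assumes "t \<le> T"
  shows "\<bar>2 * kin (\<Z> t) \<eta> + 2 * acc (\<Z> t) \<eta> * jac (\<Z> t) \<eta>\<bar> \<le> bnd' T"
    "\<bar>jac (\<Z> t) \<eta>\<bar> \<le> bnd T" "\<bar>vel (\<Z> t) \<eta>\<bar> \<le> bnd T"
proof -
  have t: "0 \<le> max 0 t" "max 0 t \<le> max 0 T" using assms by auto
  have nn: "0 \<le> E\<^sup>2 * (rad (max 0 T))\<^sup>2" by simp
  show b: "\<bar>jac (\<Z> t) \<eta>\<bar> \<le> bnd T" "\<bar>vel (\<Z> t) \<eta>\<bar> \<le> bnd T"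
    using Z_quadratic_bounds[OF t, of \<eta>] nn unfolding \<Z>_def bnd_def by linarith+
  have k: "\<bar>kin (\<Z> t) \<eta>\<bar> \<le> bnd T"
    using Z_quadratic_bounds[OF t, of \<eta>] nn unfolding \<Z>_def bnd_def by linarith
  have "\<bar>acc (\<Z> t) \<eta> * jac (\<Z> t) \<eta>\<bar> \<le> C0 * bnd T" by (rule acc_times_bound[OF b(1)])
  with k show "\<bar>2 * kin (\<Z> t) \<eta> + 2 * acc (\<Z> t) \<eta> * jac (\<Z> t) \<eta>\<bar> \<le> bnd' T"
    unfolding bnd'_def by linarith
qed

lemma bnd'_nonneg: "0 \<le> bnd' T"
  using vel'_bound(1)[of T T 0] by linarith

lemma dd_bound: "t \<le> T \<Longrightarrow> \<bar>dd t x\<bar> \<le> bnd' T"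
  unfolding dd_def using vel'_bound(1)[of t T] bnd'_nonneg[of T]
  by (intro mean_bound) (auto simp: indicator_def)

lemma drift_deriv:
  assumes "t \<ge> 0"
  shows "((\<lambda>t. drift (\<Z> t) x) has_real_derivative dd t x) (at t within {0..})"
  unfolding drift_def dd_def
proof (rule has_real_derivative_mean[OF assms, where C=bnd and C'="bnd' (t + 1)"])
  fix s \<eta> :: real assume s: "s \<ge> 0"
  have "((\<lambda>s. vel (\<Z> s) \<eta>) has_real_derivative 2 * kin (\<Z> s) \<eta> + 2 * acc (\<Z> s) \<eta> * jac (\<Z> s) \<eta>) (at s within {0..})"
    using deriv_ray_cong[OF vel_deriv[OF s, of \<eta>] s, of "\<lambda>t. vel (\<Z> t) \<eta>"] s by (simp add: \<Z>_def)
  from DERIV_cmult[OF this] show "((\<lambda>s. indicator {..x} \<eta> * vel (\<Z> s) \<eta>) has_real_derivative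
     indicator {..x} \<eta> * (2 * kin (\<Z> s) \<eta> + 2 * acc (\<Z> s) \<eta> * jac (\<Z> s) \<eta>)) (at s within {0..})" .
  show "\<bar>indicator {..x} \<eta> * vel (\<Z> s) \<eta>\<bar> \<le> bnd s"
    using vel'_bound(3)[of s s \<eta>] bnd_nonneg[of s] by (simp add: indicator_def)
next
  fix s \<eta> :: real assume "0 \<le> s" "s \<le> t + 1"
  then show "\<bar>indicator {..x} \<eta> * (2 * kin (\<Z> s) \<eta> + 2 * acc (\<Z> s) \<eta> * jac (\<Z> s) \<eta>)\<bar> \<le> bnd' (t + 1)"
    using vel'_bound(1)[of s "t + 1" \<eta>] bnd'_nonneg[of "t + 1"] by (simp add: indicator_def)
qed measurable

lemma \<Z>_drift_bound: "\<bar>drift (\<Z> t) x\<bar> \<le> B"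
  unfolding \<Z>_def by (rule drift_bound) simp

lemma dQ_bound:
  assumes "t \<le> T"
  shows "\<bar>dd t \<eta> * jac (\<Z> t) \<eta> + drift (\<Z> t) \<eta> * vel (\<Z> t) \<eta>\<bar> \<le> bnd' T * bnd T + B * bnd T"
proof -
  have "\<bar>dd t \<eta> * jac (\<Z> t) \<eta>\<bar> \<le> bnd' T * bnd T"
    unfolding abs_mult by (rule mult_mono[OF dd_bound[OF assms] vel'_bound(2)[OF assms] bnd'_nonneg abs_ge_zero])
  moreover have "\<bar>drift (\<Z> t) \<eta> * vel (\<Z> t) \<eta>\<bar> \<le> B * bnd T"
    unfolding abs_mult
    by (rule mult_mono[OF \<Z>_drift_bound vel'_bound(3)[OF assms] less_imp_le[OF B_pos] abs_ge_zero])
  ultimately show ?thesis by linarith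
qed

lemma U_deriv:
  assumes "t \<ge> 0"
  shows "((\<lambda>t. U t \<xi>) has_real_derivative G t \<xi>) (at t within {0..})"
proof -
  have "((\<lambda>t. mean (\<lambda>\<eta>. drift (\<Z> t) \<eta> * jac (\<Z> t) \<eta>)) has_real_derivative
      mean (\<lambda>\<eta>. dd t \<eta> * jac (\<Z> t) \<eta> + drift (\<Z> t) \<eta> * vel (\<Z> t) \<eta>)) (at t within {0..})"
  proof (rule has_real_derivative_mean[OF assms, where C="\<lambda>s. B * bnd s"])
    fix s \<eta> :: real assume s: "s \<ge> 0"
    have "((\<lambda>s. jac (\<Z> s) \<eta>) has_real_derivative vel (\<Z> s) \<eta>) (at s within {0..})"
      using deriv_ray_cong[OF jac_deriv[OF s, of \<eta>] s, of "\<lambda>t. jac (\<Z> t) \<eta>"] s by (simp add: \<Z>_def)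
    from DERIV_mult[OF drift_deriv[OF s] this]
    show "((\<lambda>s. drift (\<Z> s) \<eta> * jac (\<Z> s) \<eta>) has_real_derivative
        dd s \<eta> * jac (\<Z> s) \<eta> + drift (\<Z> s) \<eta> * vel (\<Z> s) \<eta>) (at s within {0..})"
      by (simp add: mult.commute)
    show "\<bar>drift (\<Z> s) \<eta> * jac (\<Z> s) \<eta>\<bar> \<le> B * bnd s"
      unfolding abs_mult using B_pos by (intro mult_mono \<Z>_drift_bound vel'_bound) auto
  next
    fix s \<eta> :: real assume "0 \<le> s" "s \<le> t + 1"
    then show "\<bar>dd s \<eta> * jac (\<Z> s) \<eta> + drift (\<Z> s) \<eta> * vel (\<Z> s) \<eta>\<bar> \<le> bnd' (t + 1) * bnd (t + 1) + B * bnd (t + 1)"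
      by (intro dQ_bound)
  qed measurable
  from DERIV_add[OF DERIV_minus[OF drift_deriv[OF assms, of "frac \<xi>"]] this]
  have "((\<lambda>t. - drift (\<Z> t) (frac \<xi>) + mean (\<lambda>\<eta>. drift (\<Z> t) \<eta> * jac (\<Z> t) \<eta>)) has_real_derivative G t \<xi>) (at t within {0..})"
    unfolding G_def .
  from DERIV_add[OF DERIV_const[of \<mu>] this] have
    "((\<lambda>t. \<mu> + (- drift (\<Z> t) (frac \<xi>) + mean (\<lambda>\<eta>. drift (\<Z> t) \<eta> * jac (\<Z> t) \<eta>))) has_real_derivative G t \<xi>) (at t within {0..})"
    by simp
  then show ?thesis
    by (rule deriv_ray_cong[OF _ assms]) (simp add: U_def \<Z>_def uu_eq)
qed

definition gbnd :: "real \<Rightarrow> real" where "gbnd T = bnd' T + (bnd' T * bnd T + B * bnd T)"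

lemma G_bound:
  assumes "t \<le> T"
  shows "\<bar>G t \<xi>\<bar> \<le> gbnd T"
proof -
  have "\<bar>mean (\<lambda>\<eta>. dd t \<eta> * jac (\<Z> t) \<eta> + drift (\<Z> t) \<eta> * vel (\<Z> t) \<eta>)\<bar> \<le> bnd' T * bnd T + B * bnd T"
    by (rule mean_bound[OF dQ_bound[OF assms]])
  then show ?thesis unfolding G_def gbnd_def using dd_bound[OF assms, of "frac \<xi>"] by linarith
qed

lemma fields_max: "J (max 0 t) = J t" "N (max 0 t) = N t" "K (max 0 t) = K t" "U (max 0 t) = U t" "G (max 0 t) = G t"
  by (auto simp: J_def N_def K_def U_def G_def dd_def \<Z>_def)

text \<open>
  A limit of difference quotients of the measurable field \<open>U\<close>.
\<close>

lemma G_measurable [measurable (raw)]: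
  assumes [measurable]: "f \<in> borel_measurable M" "g \<in> borel_measurable M"
  shows "(\<lambda>\<omega>. G (f \<omega>) (g \<omega>)) \<in> borel_measurable M"
proof (rule borel_measurable_LIMSEQ_real)
  let ?h = "\<lambda>n t \<xi>. (U (max 0 t + 1 / real (Suc n)) \<xi> - U (max 0 t) \<xi>) / (1 / real (Suc n))"
  show "(\<lambda>\<omega>. ?h n (f \<omega>) (g \<omega>)) \<in> borel_measurable M" for n by measurable
  have "(\<lambda>n. ?h n t \<xi>) \<longlonglongrightarrow> G t \<xi>" for t \<xi>
  proof -
    have "((\<lambda>s. (U s \<xi> - U (max 0 t) \<xi>) / (s - max 0 t)) \<longlongrightarrow> G t \<xi>) (at (max 0 t) within {0..})"
      using U_deriv[of "max 0 t" \<xi>] unfolding has_field_derivative_iff by (simp add: fields_max)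
    moreover have "(\<lambda>n. max 0 t + 1 / real (Suc n)) \<longlonglongrightarrow> max 0 t"
      using tendsto_add[OF tendsto_const[of "max 0 t"] LIMSEQ_inverse_real_of_nat] by (simp add: inverse_eq_divide)
    ultimately show ?thesis
      unfolding tendsto_at_iff_sequentially by (auto simp: o_def dest!: spec[of _ "\<lambda>n. max 0 t + 1 / real (Suc n)"])
  qed
  then show "\<And>\<omega>. \<omega> \<in> space M \<Longrightarrow> (\<lambda>n. ?h n (f \<omega>) (g \<omega>)) \<longlonglongrightarrow> G (f \<omega>) (g \<omega>)" by blast
qed

text \<open>Differentiate in time the relation between the increments of \<open>U\<close> and the integrals of \<open>N\<close>.\<close>

lemma G_primitive: "primitive (G t) (\<lambda>\<xi>. - N' t \<xi>)"
proof -
  define s where "s = max 0 t"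
  have s: "s \<ge> 0" by (simp add: s_def)
  have Gs: "G s = G t" "N' s = N' t" using fields_max[of t] by (auto simp: s_def N'_def)
  have m: "(\<lambda>\<xi>. - N' s \<xi>) \<in> borel_measurable borel" by measurable
  have "locally_bounded (\<lambda>\<xi>. - N' s \<xi>)"
    by (rule locally_boundedI[of _ "bnd' s"]) (use fields_bound(4)[of s s] in simp)
  then obtain H where H: "primitive H (\<lambda>\<xi>. - N' s \<xi>)" using primitive_exists[OF m] by blast
  have "G s b - G s a = H b - H a" if "a \<le> b" for a b
  proof -
    have fin: "finite_measure (lebesgue_on {a..b})"
      by (rule finite_measureI) (simp add: emeasure_restrict_space emeasure_lborel_Icc_eq)
    have "((\<lambda>s. LINT \<xi>|lebesgue_on {a..b}. - N s \<xi>) has_real_derivative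
        (LINT \<xi>|lebesgue_on {a..b}. - N' s \<xi>)) (at s within {0..})"
    proof (rule has_real_derivative_integral[OF fin s])
      show "(\<lambda>\<xi>. - N r \<xi>) \<in> borel_measurable (lebesgue_on {a..b})" for r
      proof -
        have "(\<lambda>\<xi>. - N r \<xi>) \<in> borel_measurable borel" by measurable
        then show ?thesis by (simp add: measurable_completion measurable_restrict_space1)
      qed
      show "((\<lambda>s. - N s x) has_real_derivative - N' r x) (at r within {0..})" if "r \<ge> 0" for r x
        by (rule DERIV_minus[OF N_deriv[OF that]])
      show "\<exists>C. \<forall>x. \<bar>- N r x\<bar> \<le> C" for r using fields_bound(2)[of r r] by auto
      show "\<exists>C. \<forall>r x. 0 \<le> r \<longrightarrow> r \<le> s + 1 \<longrightarrow> \<bar>- N' r x\<bar> \<le> C"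
        using fields_bound(4)[of _ "s + 1"] by auto
    qed
    then have "((\<lambda>s. U s b - U s a) has_real_derivative H b - H a) (at s within {0..})"
      using primitive_integral_on[OF U_primitive that] primitive_integral_on[OF H that] by simp
    moreover have "((\<lambda>s. U s b - U s a) has_real_derivative G s b - G s a) (at s within {0..})"
      by (intro DERIV_diff U_deriv s)
    ultimately show ?thesis using deriv_ray_unique s by blast
  qed
  then have "primitive (G s) (\<lambda>\<xi>. - N' s \<xi>)" using H unfolding primitive_def by auto
  then show ?thesis by (simp add: Gs)
qed

lemma mean_U_N: "mean (\<lambda>\<xi>. U t \<xi> * N t \<xi>) = 0"
proof -
  have "mean (\<lambda>\<xi>. - N t \<xi> * U t \<xi> + U t \<xi> * - N t \<xi>) = U t 1 * U t 1 - U t 0 * U t 0"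
    by (rule mean_primitive[OF primitive_mult[OF U_primitive U_primitive]])
  also have "\<dots> = 0" using fields_periodic(4)[of t 0] by simp
  also have "(\<lambda>\<xi>. - N t \<xi> * U t \<xi> + U t \<xi> * - N t \<xi>) = (\<lambda>\<xi>. (-2) * (U t \<xi> * N t \<xi>))" by auto
  finally show ?thesis unfolding mean_cmult by simp
qed

text \<open>
  Differentiate \<open>mean (U J) = \<mu>\<close> in time. The term with \<open>J' = N\<close> drops out, because \<open>- 2 U N\<close> is the label
  derivative of the periodic function \<open>U\<^sup>2\<close>.
\<close>

lemma mean_G_J: "mean (\<lambda>\<xi>. G t \<xi> * J t \<xi>) = 0"
proof -
  define s where "s = max 0 t"
  have s: "s \<ge> 0" by (simp add: s_def)
  have UB: "0 \<le> \<bar>\<mu>\<bar> + 2 * B" using B_pos by simp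
  have gb: "0 \<le> gbnd T" for T using G_bound[of T T 0] by simp
  have b: "\<bar>G r x * J r x\<bar> \<le> gbnd T * bnd T" "\<bar>U r x * N r x\<bar> \<le> (\<bar>\<mu>\<bar> + 2 * B) * bnd T" if "r \<le> T" for r x T
    unfolding abs_mult using UB gb by (auto intro!: mult_mono G_bound fields_bound U_bound that)
  have "((\<lambda>s. mean (\<lambda>\<xi>. U s \<xi> * J s \<xi>)) has_real_derivative mean (\<lambda>\<xi>. G s \<xi> * J s \<xi> + U s \<xi> * N s \<xi>)) (at s within {0..})"
  proof (rule has_real_derivative_mean[OF s, where C="\<lambda>r. (\<bar>\<mu>\<bar> + 2 * B) * bnd r"])
    show "((\<lambda>s. U s x * J s x) has_real_derivative G r x * J r x + U r x * N r x) (at r within {0..})" if "r \<ge> 0" for r x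
      using DERIV_mult[OF U_deriv[OF that] J_deriv[OF that], of x x] by (simp add: mult.commute)
    show "\<bar>U r x * J r x\<bar> \<le> (\<bar>\<mu>\<bar> + 2 * B) * bnd r" for r x
      unfolding abs_mult using UB by (intro mult_mono fields_bound U_bound) auto
    show "\<bar>G r x * J r x + U r x * N r x\<bar> \<le> gbnd (s + 1) * bnd (s + 1) + (\<bar>\<mu>\<bar> + 2 * B) * bnd (s + 1)"
      if "0 \<le> r" "r \<le> s + 1" for r x
      using b[OF that(2), of x] by linarith
  qed measurable
  then have "((\<lambda>s. \<mu>) has_real_derivative mean (\<lambda>\<xi>. G s \<xi> * J s \<xi> + U s \<xi> * N s \<xi>)) (at s within {0..})"
    by (simp add: mean_fields)
  moreover have "((\<lambda>s. \<mu>) has_real_derivative 0) (at s within {0..})" by simp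
  ultimately have "mean (\<lambda>\<xi>. G s \<xi> * J s \<xi> + U s \<xi> * N s \<xi>) = 0"
    by (rule deriv_ray_unique[OF _ _ s])
  moreover have "mean (\<lambda>\<xi>. G s \<xi> * J s \<xi> + U s \<xi> * N s \<xi>) = mean (\<lambda>\<xi>. G s \<xi> * J s \<xi>) + mean (\<lambda>\<xi>. U s \<xi> * N s \<xi>)"
    by (rule mean_add(1)[OF _ _ b(1)[OF order_refl] b(2)[OF order_refl]]) measurable
  ultimately show ?thesis using mean_U_N[of s] fields_max[of t] by (simp add: s_def)
qed

lemma fields_0: "J 0 \<xi> = 1" "N 0 \<xi> = 2 * p \<xi>"
  by (simp_all add: J_def N_def \<Z>_def fields_yy_zz yy_zz_0 inner_complex_def p_frac)

end

context lagrangian_data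
begin

section \<open>The flow map\<close>

text \<open>
  The characteristics of the transport operator \<open>\<partial>\<^sub>t - (u + \<gamma>) \<partial>\<^sub>x\<close>, which move with velocity
  \<open>- (u + \<gamma>)\<close>. The velocity along them is already known as \<open>U\<close>, so they are plain time integrals.
\<close>

definition \<phi> :: "real \<Rightarrow> real \<Rightarrow> real" where
  "\<phi> t \<xi> = \<xi> - integral {0..max 0 t} (\<lambda>s. U s \<xi> + \<gamma>)"

definition ub :: real where "ub = \<bar>\<mu>\<bar> + 2 * B + \<bar>\<gamma>\<bar>"

lemma ub_nonneg: "0 \<le> ub" using B_pos by (simp add: ub_def)

lemma U_continuous_time: "continuous_on {0..} (\<lambda>s. U s \<xi>)"
  by (rule DERIV_continuous_on[of _ _ "\<lambda>s. G s \<xi>"]) (use U_deriv in auto)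

lemma \<phi>_deriv:
  assumes "t \<ge> 0"
  shows "((\<lambda>t. \<phi> t \<xi>) has_real_derivative - (U t \<xi> + \<gamma>)) (at t within {0..})"
proof (rule deriv_ray_cong[OF _ assms])
  have "continuous_on {0..} (\<lambda>s. U s \<xi> + \<gamma>)" by (intro continuous_intros U_continuous_time)
  from has_vector_derivative_integral_ray[OF this assms]
  have "((\<lambda>t. integral {0..t} (\<lambda>s. U s \<xi> + \<gamma>)) has_real_derivative U t \<xi> + \<gamma>) (at t within {0..})"
    by (simp add: has_real_derivative_iff_has_vector_derivative)
  from DERIV_diff[OF DERIV_const[of \<xi>] this]
  show "((\<lambda>t. \<xi> - integral {0..t} (\<lambda>s. U s \<xi> + \<gamma>)) has_real_derivative - (U t \<xi> + \<gamma>)) (at t within {0..})" by simp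
qed (simp add: \<phi>_def)

lemma \<phi>_0: "\<phi> 0 \<xi> = \<xi>" by (simp add: \<phi>_def)

lemma \<phi>_max: "\<phi> (max 0 t) = \<phi> t" by (auto simp: \<phi>_def)

lemma \<phi>_lipschitz_time: "\<bar>\<phi> s \<xi> - \<phi> t \<xi>\<bar> \<le> ub * \<bar>s - t\<bar>"
proof -
  have "\<bar>\<phi> (max 0 s) \<xi> - \<phi> (max 0 t) \<xi>\<bar> \<le> ub * \<bar>max 0 s - max 0 t\<bar>"
  proof (rule lipschitz_ray[OF \<phi>_deriv, where T="max (max 0 s) (max 0 t)"])
    show "\<bar>- (U r \<xi> + \<gamma>)\<bar> \<le> ub" for r using U_bound[of r \<xi>] by (simp add: ub_def)
  qed auto
  also have "\<dots> \<le> ub * \<bar>s - t\<bar>" using ub_nonneg by (intro mult_left_mono) auto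
  finally show ?thesis by (simp add: \<phi>_max)
qed

text \<open>
  The increment of \<open>\<phi> t\<close> over an interval of labels and the integral of \<open>J t\<close> over it have the same time
  derivative, namely minus the increment of \<open>U t\<close>, and agree at time zero.
\<close>

lemma \<phi>_primitive: "primitive (\<phi> t) (J t)"
proof -
  define s where "s = max 0 t"
  have s: "s \<ge> 0" by (simp add: s_def)
  have Jm: "J r \<in> borel_measurable borel" for r by measurable
  have Jb: "locally_bounded (J r)" for r by (rule locally_boundedI[OF fields_bound(1)[OF order_refl]])
  obtain H where H: "primitive H (J s)" using primitive_exists[OF Jm Jb] by blast
  have "\<phi> s b - \<phi> s a = H b - H a" if "a \<le> b" for a b
  proof -
    have fin: "finite_measure (lebesgue_on {a..b})"
      by (rule finite_measureI) (simp add: emeasure_restrict_space emeasure_lborel_Icc_eq)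
    let ?I = "\<lambda>r. LINT \<xi>|lebesgue_on {a..b}. J r \<xi>"
    have "(?I has_real_derivative (LINT \<xi>|lebesgue_on {a..b}. N r \<xi>)) (at r within {0..})" if "r \<ge> 0" for r
    proof (rule has_real_derivative_integral[OF fin that])
      show "J r \<in> borel_measurable (lebesgue_on {a..b})" for r
        using Jm by (simp add: measurable_completion measurable_restrict_space1)
      show "\<exists>C. \<forall>x. \<bar>J r x\<bar> \<le> C" for r using fields_bound(1)[of r r] by auto
      show "\<exists>C. \<forall>r' x. 0 \<le> r' \<longrightarrow> r' \<le> r + 1 \<longrightarrow> \<bar>N r' x\<bar> \<le> C"
        using fields_bound(2)[of _ "r + 1"] by auto
    qed (rule J_deriv)
    moreover have "(LINT \<xi>|lebesgue_on {a..b}. N r \<xi>) = - (U r b - U r a)" for r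
      using primitive_integral_on[OF primitive_uminus[OF U_primitive[of r]] that] by simp
    ultimately have I: "(?I has_real_derivative - (U r b - U r a)) (at r within {0..})" if "r \<ge> 0" for r
      using that by simp
    have "((\<lambda>r. (\<phi> r b - \<phi> r a) - ?I r) has_real_derivative 0) (at r within {0..})" if "r \<ge> 0" for r
      using DERIV_diff[OF DERIV_diff[OF \<phi>_deriv[OF that, of b] \<phi>_deriv[OF that, of a]] I[OF that]] by simp
    from DERIV_zero_ray_const[OF this s]
    have "(\<phi> s b - \<phi> s a) - ?I s = b - a - ?I 0" by (simp add: \<phi>_0)
    moreover have "?I s = H b - H a" by (rule primitive_integral_on[OF H that])
    moreover have "?I 0 = b - a"
      using primitive_integral_on[OF primitive_ident that] by (simp add: fields_0)
    ultimately show ?thesis by simp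
  qed
  then have "primitive (\<phi> s) (J s)" using H unfolding primitive_def by auto
  then show ?thesis by (simp add: s_def \<phi>_max fields_max)
qed

lemma \<phi>_period: "\<phi> t (\<xi> + 1) = \<phi> t \<xi> + 1"
  by (simp add: \<phi>_def fields_periodic)

lemma J_bounds: "t \<le> T \<Longrightarrow> low T \<le> J t \<xi>" "t \<le> T \<Longrightarrow> J t \<xi> \<le> bnd T"
  using J_ge_low fields_bound(1)[of t T \<xi>] by auto

lemmas \<phi>_change = integral_change_of_variables[OF \<phi>_primitive J_bounds(1)[OF order_refl] J_bounds(2)[OF order_refl] low_pos]
lemmas \<phi>_bi = inverse_bi_lipschitz[OF \<phi>_primitive J_bounds(1)[OF order_refl] J_bounds(2)[OF order_refl] low_pos]

lemma mean_\<phi>: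
  assumes "f \<in> borel_measurable borel" "\<And>x. \<bar>f x\<bar> \<le> C" "\<And>x. f (x + 1) = f x"
  shows "mean f = mean (\<lambda>\<xi>. J t \<xi> * f (\<phi> t \<xi>))"
  by (rule mean_change_of_variables[OF \<phi>_primitive J_bounds(1)[OF order_refl] J_bounds(2)[OF order_refl] low_pos])
     (use assms in \<open>auto simp: fields_periodic mean_fields intro: locally_boundedI\<close>)

definition X :: "real \<Rightarrow> real \<Rightarrow> real" where "X t = inv (\<phi> t)"

lemma \<phi>_X [simp]: "\<phi> t (X t x) = x"
  using \<phi>_bi(2) unfolding X_def by (simp add: bij_is_surj surj_f_inv_f)

lemma X_\<phi> [simp]: "X t (\<phi> t \<xi>) = \<xi>"
  using \<phi>_bi(2) unfolding X_def by (simp add: bij_is_inj)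

lemma X_0: "X 0 x = x" using X_\<phi>[of 0 x] by (simp only: \<phi>_0)

lemma X_period: "X t (x + 1) = X t x + 1"
  using X_\<phi>[of t "X t x + 1"] by (simp add: \<phi>_period)

text \<open>
  The map \<open>\<phi> t\<close> expands distances at least by the factor \<open>low T\<close>, and the characteristics move with
  speed at most \<open>ub\<close>.
\<close>

lemma X_lipschitz:
  assumes "t \<le> T"
  shows "\<bar>X t x - X s y\<bar> \<le> (\<bar>x - y\<bar> + ub * \<bar>t - s\<bar>) / low T"
proof -
  have "low T * \<bar>X t x - X s y\<bar> \<le> \<bar>\<phi> t (X t x) - \<phi> t (X s y)\<bar>"
    by (rule inverse_bi_lipschitz(3)[OF \<phi>_primitive J_bounds[OF assms] low_pos])
  also have "\<dots> = \<bar>(x - y) + (\<phi> s (X s y) - \<phi> t (X s y))\<bar>" by simp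
  also have "\<dots> \<le> \<bar>x - y\<bar> + ub * \<bar>t - s\<bar>"
    using \<phi>_lipschitz_time[of s "X s y" t] by (simp add: abs_minus_commute)
  finally show ?thesis using low_pos[of T] by (simp add: pos_le_divide_eq mult.commute)
qed

lemma X_continuous: "continuous_on UNIV (\<lambda>z. X (fst z) (snd z))"
proof -
  have "isCont (\<lambda>z. X (fst z) (snd z)) (s, y)" for s y
  proof -
    have "((\<lambda>z. X (fst z) (snd z) - X s y) \<longlongrightarrow> 0) (at (s, y))"
    proof (rule Lim_null_comparison)
      have "((\<lambda>z::real \<times> real. fst z) \<longlongrightarrow> s) (at (s, y))" by (auto intro!: tendsto_eq_intros)
      then have "\<forall>\<^sub>F z in at (s, y). fst z < s + 1" by (rule order_tendstoD(2)) simp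
      then show "\<forall>\<^sub>F z in at (s, y). norm (X (fst z) (snd z) - X s y)
          \<le> (\<bar>snd z - y\<bar> + ub * \<bar>fst z - s\<bar>) / low (s + 1)"
        by eventually_elim (use X_lipschitz in auto)
      have "isCont (\<lambda>z. (\<bar>snd z - y\<bar> + ub * \<bar>fst z - s\<bar>) / low (s + 1)) (s, y)"
        using low_pos[of "s + 1"] by (intro continuous_intros) auto
      then show "((\<lambda>z. (\<bar>snd z - y\<bar> + ub * \<bar>fst z - s\<bar>) / low (s + 1)) \<longlongrightarrow> 0) (at (s, y))" by (simp add: isCont_def)
    qed
    then show ?thesis unfolding isCont_def using LIM_zero_iff by fastforce
  qed
  then show ?thesis by (auto intro!: continuous_at_imp_continuous_on)
qed

lemma \<phi>_continuous: "continuous_on UNIV (\<lambda>z. \<phi> (fst z) (snd z))"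
proof -
  have "isCont (\<lambda>z. \<phi> (fst z) (snd z)) (s, \<eta>)" for s \<eta>
  proof -
    have "((\<lambda>z. \<phi> (fst z) (snd z) - \<phi> s \<eta>) \<longlongrightarrow> 0) (at (s, \<eta>))"
    proof (rule Lim_null_comparison)
      show "\<forall>\<^sub>F z in at (s, \<eta>). norm (\<phi> (fst z) (snd z) - \<phi> s \<eta>)
          \<le> ub * \<bar>fst z - s\<bar> + bnd s * \<bar>snd z - \<eta>\<bar>"
      proof (rule always_eventually, rule allI)
        fix z
        show "norm (\<phi> (fst z) (snd z) - \<phi> s \<eta>) \<le> ub * \<bar>fst z - s\<bar> + bnd s * \<bar>snd z - \<eta>\<bar>"
          using \<phi>_lipschitz_time[of "fst z" "snd z" s]
            primitive_lipschitz[OF \<phi>_primitive fields_bound(1)[OF order_refl], of s "snd z" \<eta>] by simp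
      qed
      have "isCont (\<lambda>z. ub * \<bar>fst z - s\<bar> + bnd s * \<bar>snd z - \<eta>\<bar>) (s, \<eta>)"
        by (intro continuous_intros)
      then show "((\<lambda>z. ub * \<bar>fst z - s\<bar> + bnd s * \<bar>snd z - \<eta>\<bar>) \<longlongrightarrow> 0) (at (s, \<eta>))" by (simp add: isCont_def)
    qed
    then show ?thesis unfolding isCont_def using LIM_zero_iff by fastforce
  qed
  then show ?thesis by (auto intro!: continuous_at_imp_continuous_on)
qed

lemma X_measurable [measurable (raw)]:
  assumes [measurable]: "f \<in> borel_measurable M" "g \<in> borel_measurable M"
  shows "(\<lambda>\<omega>. X (f \<omega>) (g \<omega>)) \<in> borel_measurable M"
  by (rule borel_measurable_continuous_Pair[where H=X]) (measurable, rule X_continuous)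

lemma \<phi>_measurable [measurable (raw)]:
  assumes [measurable]: "f \<in> borel_measurable M" "g \<in> borel_measurable M"
  shows "(\<lambda>\<omega>. \<phi> (f \<omega>) (g \<omega>)) \<in> borel_measurable M"
  by (rule borel_measurable_continuous_Pair[where H=\<phi>]) (measurable, rule \<phi>_continuous)

section \<open>The Eulerian solution\<close>

text \<open>
  Velocity, its space derivative, and density. The last is the conserved mass \<open>2 q\<close> of a particle
  divided by its dilation \<open>J\<close>; likewise \<open>U\<close> has label derivative \<open>- N\<close>, hence space derivative \<open>- N / J\<close>.
\<close>

definition u :: "real \<Rightarrow> real \<Rightarrow> real" where "u t x = U t (X t x)"
definition w :: "real \<Rightarrow> real \<Rightarrow> real" where "w t x = - N t (X t x) / J t (X t x)"
definition \<rho> :: "real \<Rightarrow> real \<Rightarrow> real" where "\<rho> t x = 2 * q (X t x) / J t (X t x)"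

lemma euler_measurable [measurable (raw)]:
  assumes [measurable]: "f \<in> borel_measurable M" "g \<in> borel_measurable M"
  shows "(\<lambda>\<omega>. u (f \<omega>) (g \<omega>)) \<in> borel_measurable M" "(\<lambda>\<omega>. w (f \<omega>) (g \<omega>)) \<in> borel_measurable M"
    "(\<lambda>\<omega>. \<rho> (f \<omega>) (g \<omega>)) \<in> borel_measurable M"
  unfolding u_def w_def \<rho>_def by measurable

lemma euler_periodic: "u t (x + 1) = u t x" "w t (x + 1) = w t x" "\<rho> t (x + 1) = \<rho> t x"
  by (simp_all add: u_def w_def \<rho>_def X_period fields_periodic q_periodic)

lemma euler_bound:
  assumes "t \<le> T"
  shows "\<bar>u t x\<bar> \<le> ub" "\<bar>w t x\<bar> \<le> bnd T / low T" "\<bar>\<rho> t x\<bar> \<le> 2 * D / low T"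
proof -
  let ?\<xi> = "X t x"
  have J: "low T \<le> \<bar>J t ?\<xi>\<bar>" using J_ge_low[OF assms, of ?\<xi>] low_pos[of T] by simp
  show "\<bar>u t x\<bar> \<le> ub" using U_bound[of t ?\<xi>] by (simp add: u_def ub_def)
  show "\<bar>w t x\<bar> \<le> bnd T / low T"
    using frac_le[OF bnd_nonneg fields_bound(2)[OF assms, of ?\<xi>] low_pos J] by (simp add: w_def)
  show "\<bar>\<rho> t x\<bar> \<le> 2 * D / low T"
  proof -
    have "0 \<le> 2 * D" "2 * \<bar>q ?\<xi>\<bar> \<le> 2 * D" using q_bound[of ?\<xi>] D_pos by simp_all
    from frac_le[OF this low_pos J] show ?thesis by (simp add: \<rho>_def abs_mult)
  qed
qed

lemma u_primitive: "primitive (u t) (w t)"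
proof -
  have wm: "w t \<in> borel_measurable borel" by measurable
  obtain H where H: "primitive H (w t)"
    using primitive_exists[OF wm locally_boundedI[OF euler_bound(2)[OF order_refl]]] by blast
  have "u t b - u t a = H b - H a" if "a \<le> b" for a b
  proof -
    have sm: "strict_mono (\<phi> t)" by (rule \<phi>_bi(1))
    have le: "X t a \<le> \<xi> \<longleftrightarrow> a \<le> \<phi> t \<xi>" "\<xi> \<le> X t b \<longleftrightarrow> \<phi> t \<xi> \<le> b" for \<xi>
      using strict_mono_less_eq[OF sm, of "X t a" \<xi>] strict_mono_less_eq[OF sm, of \<xi> "X t b"] by simp_all
    have ab: "X t a \<le> X t b" using le(1)[of "X t b"] that by simp
    have "H b - H a = (LINT x|lborel. indicator {a..b} x * w t x)"
      by (rule primitive_integral_lborel(2)[OF H that, symmetric])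
    also have "\<dots> = (LINT \<xi>|lborel. J t \<xi> * (indicator {a..b} (\<phi> t \<xi>) * w t (\<phi> t \<xi>)))"
      by (rule \<phi>_change) measurable
    also have "\<dots> = (LINT \<xi>|lborel. indicator {X t a..X t b} \<xi> * - N t \<xi>)"
      using J_pos[of t] by (intro Bochner_Integration.integral_cong) (auto simp: indicator_def w_def le less_imp_neq[THEN not_sym])
    also have "\<dots> = U t (X t b) - U t (X t a)" by (rule primitive_integral_lborel(2)[OF U_primitive ab])
    finally show ?thesis by (simp add: u_def)
  qed
  then show ?thesis using H unfolding primitive_def by auto
qed

lemma u_weak_deriv: "is_weak_deriv (u t) (w t)"
  by (rule is_weak_deriv_primitive[OF u_primitive euler_bound(2)[OF order_refl]]) (rule euler_periodic)+

lemma mean_u: "mean (u t) = \<mu>"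
proof -
  have "mean (u t) = mean (\<lambda>\<xi>. J t \<xi> * u t (\<phi> t \<xi>))"
    by (rule mean_\<phi>[OF _ euler_bound(1)[OF order_refl]]) (measurable, rule euler_periodic)
  then show ?thesis using mean_fields(4)[of t] by (simp add: u_def mult.commute)
qed

text \<open>
  In Lagrangian coordinates the energy density is \<open>J (w\<^sup>2 + \<rho>\<^sup>2) = (N\<^sup>2 + 4 q\<^sup>2) / J\<close>, which is \<open>4 K\<close> by Lagrange's
  identity. So the conservation of \<open>mean K\<close> is the conservation of energy.
\<close>

lemma energy: "mean (\<lambda>x. (w t x)\<^sup>2) + mean (\<lambda>x. (\<rho> t x)\<^sup>2) = 4 * e0"
proof -
  have sq: "x\<^sup>2 \<le> C\<^sup>2" if "\<bar>x\<bar> \<le> C" for x C :: real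
    using that by (metis abs_ge_zero power2_abs power_mono)
  have b: "\<bar>(w t x)\<^sup>2\<bar> \<le> (bnd t / low t)\<^sup>2" "\<bar>(\<rho> t x)\<^sup>2\<bar> \<le> (2 * D / low t)\<^sup>2" for x
    using sq[OF euler_bound(2)[OF order_refl]] sq[OF euler_bound(3)[OF order_refl]] by auto
  have b': "\<bar>(w t x)\<^sup>2 + (\<rho> t x)\<^sup>2\<bar> \<le> (bnd t / low t)\<^sup>2 + (2 * D / low t)\<^sup>2" for x
    using b[of x] by linarith
  have "mean (\<lambda>x. (w t x)\<^sup>2) + mean (\<lambda>x. (\<rho> t x)\<^sup>2) = mean (\<lambda>x. (w t x)\<^sup>2 + (\<rho> t x)\<^sup>2)"
    by (rule mean_add(1)[OF _ _ b, symmetric]) measurable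
  also have "\<dots> = mean (\<lambda>\<xi>. J t \<xi> * ((w t (\<phi> t \<xi>))\<^sup>2 + (\<rho> t (\<phi> t \<xi>))\<^sup>2))"
    by (rule mean_\<phi>[OF _ b']) (measurable, simp add: euler_periodic)
  also have "\<dots> = mean (\<lambda>\<xi>. 4 * K t \<xi>)"
  proof (rule mean_cong)
    fix \<xi>
    have J0: "J t \<xi> \<noteq> 0" using J_pos[of t \<xi>] by simp
    have "J t \<xi> * ((w t (\<phi> t \<xi>))\<^sup>2 + (\<rho> t (\<phi> t \<xi>))\<^sup>2) = ((N t \<xi>)\<^sup>2 + 4 * (q \<xi>)\<^sup>2) / J t \<xi>"
      using J0 by (simp add: w_def \<rho>_def field_simps power2_eq_square)
    also have "\<dots> = 4 * K t \<xi>" using J0 by (simp add: lagrange_identity)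
    finally show "J t \<xi> * ((w t (\<phi> t \<xi>))\<^sup>2 + (\<rho> t (\<phi> t \<xi>))\<^sup>2) = 4 * K t \<xi>" .
  qed
  also have "\<dots> = 4 * e0" using mean_fields(3)[of t] by (simp add: mean_cmult)
  finally show ?thesis .
qed

section \<open>The nonlocal term\<close>

text \<open>
  The source of the nonlocal term per label, that is, multiplied by the Jacobian: by Lagrange's
  identity \<open>J (w\<^sup>2 + \<rho>\<^sup>2) / 2 = 2 K\<close>.
\<close>

definition H :: "real \<Rightarrow> real \<Rightarrow> real" where "H t \<xi> = 2 * \<mu> * (U t \<xi> * J t \<xi>) + 2 * K t \<xi>"

lemma H_measurable [measurable (raw)]:
  assumes [measurable]: "f \<in> borel_measurable M" "g \<in> borel_measurable M"
  shows "(\<lambda>\<omega>. H (f \<omega>) (g \<omega>)) \<in> borel_measurable M"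
  unfolding H_def by measurable

lemma H_bound: "\<bar>H t \<xi>\<bar> \<le> 2 * \<bar>\<mu>\<bar> * (ub * bnd t) + 2 * bnd t"
proof -
  have "\<bar>U t \<xi> * J t \<xi>\<bar> \<le> ub * bnd t"
    unfolding abs_mult using U_bound[of t \<xi>] fields_bound(1)[of t t \<xi>] ub_nonneg
    by (intro mult_mono) (auto simp: ub_def)
  then have "2 * \<bar>\<mu>\<bar> * \<bar>U t \<xi> * J t \<xi>\<bar> \<le> 2 * \<bar>\<mu>\<bar> * (ub * bnd t)" by (intro mult_left_mono) auto
  moreover have "\<bar>H t \<xi>\<bar> \<le> 2 * \<bar>\<mu>\<bar> * \<bar>U t \<xi> * J t \<xi>\<bar> + 2 * \<bar>K t \<xi>\<bar>"
    unfolding H_def by (intro order_trans[OF abs_triangle_ineq] add_mono) (simp_all add: abs_mult)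
  ultimately show ?thesis using fields_bound(3)[of t t \<xi>] by linarith
qed

lemma H_periodic: "H t (\<xi> + 1) = H t \<xi>" by (simp add: H_def fields_periodic)

lemma mean_H: "mean (H t) = c"
proof -
  have b: "\<bar>2 * \<mu> * (U t \<xi> * J t \<xi>)\<bar> \<le> 2 * \<bar>\<mu>\<bar> * (ub * bnd t)" "\<bar>2 * K t \<xi>\<bar> \<le> 2 * bnd t" for \<xi>
  proof -
    have "\<bar>U t \<xi> * J t \<xi>\<bar> \<le> ub * bnd t"
      unfolding abs_mult using U_bound[of t \<xi>] fields_bound(1)[of t t \<xi>] ub_nonneg
      by (intro mult_mono) (auto simp: ub_def)
    then have "2 * \<bar>\<mu>\<bar> * \<bar>U t \<xi> * J t \<xi>\<bar> \<le> 2 * \<bar>\<mu>\<bar> * (ub * bnd t)" by (intro mult_left_mono) auto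
    then show "\<bar>2 * \<mu> * (U t \<xi> * J t \<xi>)\<bar> \<le> 2 * \<bar>\<mu>\<bar> * (ub * bnd t)" by (simp add: abs_mult)
    show "\<bar>2 * K t \<xi>\<bar> \<le> 2 * bnd t" using fields_bound(3)[of t t \<xi>] by simp
  qed
  have "mean (H t) = mean (\<lambda>\<xi>. 2 * \<mu> * (U t \<xi> * J t \<xi>)) + mean (\<lambda>\<xi>. 2 * K t \<xi>)"
    unfolding H_def[abs_def] by (rule mean_add(1)[OF _ _ b]) measurable
  then show ?thesis by (simp add: mean_cmult mean_fields c_def power2_eq_square)
qed

lemma green_deriv:
  assumes "z \<notin> \<int>"
  shows "deriv green z = frac z - 1 / 2"
proof -
  have ev: "\<forall>\<^sub>F x in nhds z. green x = 1/2 * (x - \<lfloor>z\<rfloor>) * (x - \<lfloor>z\<rfloor> - 1) + 13/12"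
  proof -
    have "real_of_int \<lfloor>z\<rfloor> \<noteq> z" using assms by (metis Ints_of_int)
    then have z: "\<lfloor>z\<rfloor> < z" "z < \<lfloor>z\<rfloor> + 1" using floor_correct[of z] by linarith+
    have "\<forall>\<^sub>F x in nhds z. x \<in> {real_of_int \<lfloor>z\<rfloor> <..< \<lfloor>z\<rfloor> + 1}"
      using z by (intro eventually_nhds_in_open) auto
    then show ?thesis
    proof eventually_elim
      case (elim x)
      then have "\<lfloor>x\<rfloor> = \<lfloor>z\<rfloor>" by (intro floor_unique) auto
      then show ?case by (simp add: green_def frac_def)
    qed
  qed
  have "((\<lambda>x. 1/2 * (x - \<lfloor>z\<rfloor>) * (x - \<lfloor>z\<rfloor> - 1) + 13/12) has_real_derivative frac z - 1/2) (at z)"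
    by (auto intro!: derivative_eq_intros simp: frac_def)
  then have "(green has_real_derivative frac z - 1/2) (at z)"
    using DERIV_cong_ev[OF refl ev refl] by blast
  then show ?thesis by (rule DERIV_imp_deriv)
qed

text \<open>
  The kernel \<open>deriv green\<close> is the periodic sawtooth. Its argument is \<open>x\<close> minus the position of the
  particle, and over the period of labels that ends at the label \<open>\<xi>\<close> of \<open>x\<close> this runs once through
  \<open>[0,1]\<close>, so there the sawtooth is a single affine function.
\<close>

lemma conv_lagrangian:
  "conv (deriv green) (source \<mu> (u t) (\<rho> t)) (\<phi> t \<xi>)
    = (LINT \<eta>|lborel. indicator {\<xi> - 1..\<xi>} \<eta> * ((\<phi> t \<xi> - \<phi> t \<eta> - 1/2) * H t \<eta>))"
proof -
  define x where "x = \<phi> t \<xi>"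
  define h where "h y = 2 * \<mu> * u t y + 1/2 * (w t y)\<^sup>2 + 1/2 * (\<rho> t y)\<^sup>2" for y
  define f where "f y = (frac (x - y) - 1/2) * h y" for y
  have [measurable]: "h \<in> borel_measurable borel" unfolding h_def by measurable
  have fm [measurable]: "f \<in> borel_measurable borel" unfolding f_def by measurable
  have h_per: "h (y + 1) = h y" for y by (simp add: h_def euler_periodic)
  have f_per: "f (y + 1) = f y" for y
  proof -
    have "frac (x - (y + 1)) = frac (x - y)" using frac_1_eq[of "x - y - 1"] by (simp add: algebra_simps)
    then show ?thesis by (simp add: f_def h_per)
  qed
  define C where "C = 2 * \<bar>\<mu>\<bar> * ub + (bnd t / low t)\<^sup>2 + (2 * D / low t)\<^sup>2"
  have h_b: "\<bar>h y\<bar> \<le> C" for y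
  proof -
    have sq: "z\<^sup>2 \<le> K\<^sup>2" if "\<bar>z\<bar> \<le> K" for z K :: real
      using that by (metis abs_ge_zero power2_abs power_mono)
    have "\<bar>2 * \<mu> * u t y\<bar> \<le> 2 * \<bar>\<mu>\<bar> * ub"
      using euler_bound(1)[of t t y] by (simp add: abs_mult mult_left_mono)
    then show ?thesis
      using sq[OF euler_bound(2)[of t t y]] sq[OF euler_bound(3)[of t t y]]
        zero_le_power2[of "w t y"] zero_le_power2[of "\<rho> t y"]
      unfolding h_def C_def by (simp only: abs_le_iff) linarith
  qed
  have f_b: "\<bar>f y\<bar> \<le> 1 * C" for y
  proof -
    have "\<bar>frac (x - y) - 1/2\<bar> \<le> 1" using frac_ge_0[of "x - y"] frac_lt_1[of "x - y"] by linarith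
    then show ?thesis unfolding f_def abs_mult by (intro mult_mono h_b) auto
  qed
  \<comment> \<open>Replace the sawtooth at its jumps, and the chosen weak derivative by \<open>w\<close>; both changes concern
    null sets.\<close>
  have "conv (deriv green) (source \<mu> (u t) (\<rho> t)) x = (LINT y|circle. f y)"
    unfolding conv_def
  proof (rule integral_cong_AE)
    have fin: "finite {y \<in> {0..1}. x - y \<in> \<int>}"
    proof -
      have "{y \<in> {0..1}. x - y \<in> \<int>} \<subseteq> (\<lambda>n::int. x - of_int n) ` {\<lfloor>x\<rfloor> - 1..\<lceil>x\<rceil>}"
      proof
        fix y assume "y \<in> {y \<in> {0..1}. x - y \<in> \<int>}"
        then obtain n :: int where y: "0 \<le> y" "y \<le> 1" "x - y = of_int n" by (auto elim: Ints_cases)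
        then have "\<lfloor>x\<rfloor> - 1 \<le> n" "n \<le> \<lceil>x\<rceil>" by linarith+
        then show "y \<in> (\<lambda>n::int. x - of_int n) ` {\<lfloor>x\<rfloor> - 1..\<lceil>x\<rceil>}"
          using y by (intro image_eqI[of _ _ n]) auto
      qed
      then show ?thesis by (rule finite_subset) simp
    qed
    have wd: "AE y in lebesgue. weak_deriv (u t) y = w t y" by (rule weak_deriv_AE_lebesgue[OF u_weak_deriv])
    have "AE y in lebesgue. y \<notin> {y \<in> {0..1}. x - y \<in> \<int>}"
      by (rule AE_not_in) (use negligible_finite[OF fin] negligible_iff_null_sets in blast)
    with wd have "AE y in lebesgue. y \<in> {0..1} \<longrightarrow> deriv green (x - y) * source \<mu> (u t) (\<rho> t) y = f y"
      by eventually_elim (auto simp: green_deriv f_def source_def h_def)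
    then show ae: "AE y in circle. deriv green (x - y) * source \<mu> (u t) (\<rho> t) y = f y"
      by (subst AE_restrict_space_iff) auto
    show fc: "(\<lambda>y. f y) \<in> borel_measurable circle" by (rule borel_measurable_circle[OF fm])
    have "AE y in lebesgue. (if y \<in> {0..1} then f y else 0) =
        (if y \<in> {0..1} then deriv green (x - y) * source \<mu> (u t) (\<rho> t) y else 0)"
      using \<open>AE y in lebesgue. y \<in> {0..1} \<longrightarrow> _ y\<close> by eventually_elim simp
    moreover have "(\<lambda>y. if y \<in> {0..1} then f y else 0) \<in> borel_measurable lebesgue"
      using fc by (subst borel_measurable_if) auto
    ultimately have "(\<lambda>y. if y \<in> {0..1} then deriv green (x - y) * source \<mu> (u t) (\<rho> t) y else 0) \<in> borel_measurable lebesgue"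
      by (rule borel_measurable_AE[rotated])
    then show "(\<lambda>y. deriv green (x - y) * source \<mu> (u t) (\<rho> t) y) \<in> borel_measurable circle"
      by (subst (asm) borel_measurable_if) auto
  qed
  also have "\<dots> = mean f" by (simp add: mean_def)
  also have "\<dots> = mean (\<lambda>\<eta>. J t \<eta> * f (\<phi> t \<eta>))" by (rule mean_\<phi>[OF fm f_b f_per])
  also have "\<dots> = (LINT \<eta>|lborel. indicator {\<xi> - 1..(\<xi> - 1) + 1} \<eta> * (J t \<eta> * f (\<phi> t \<eta>)))"
  proof (rule mean_shift[symmetric])
    show "(\<lambda>\<eta>. J t \<eta> * f (\<phi> t \<eta>)) \<in> borel_measurable borel" by measurable
    show "locally_bounded (\<lambda>\<eta>. J t \<eta> * f (\<phi> t \<eta>))"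
      by (intro locally_bounded_mult locally_boundedI[OF fields_bound(1)[OF order_refl]] locally_boundedI[of "\<lambda>\<eta>. f (\<phi> t \<eta>)" "1 * C"] f_b)
    show "J t (\<eta> + 1) * f (\<phi> t (\<eta> + 1)) = J t \<eta> * f (\<phi> t \<eta>)" for \<eta>
      by (simp add: fields_periodic \<phi>_period f_per)
  qed
  also have "\<dots> = (LINT \<eta>|lborel. indicator {\<xi> - 1..\<xi>} \<eta> * ((\<phi> t \<xi> - \<phi> t \<eta> - 1/2) * H t \<eta>))"
  proof (rule integral_cong_AE)
    have "AE \<eta> in lborel. \<eta> \<noteq> \<xi> - 1" by (rule AE_lborel_singleton)
    then show "AE \<eta> in lborel. indicator {\<xi> - 1..(\<xi> - 1) + 1} \<eta> * (J t \<eta> * f (\<phi> t \<eta>)) =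
        indicator {\<xi> - 1..\<xi>} \<eta> * ((\<phi> t \<xi> - \<phi> t \<eta> - 1/2) * H t \<eta>)"
    proof eventually_elim
      case (elim \<eta>)
      show ?case
      proof (cases "\<eta> \<in> {\<xi> - 1..\<xi>}")
        case True
        have "\<phi> t \<eta> \<le> \<phi> t \<xi>" using True strict_mono_less_eq[OF \<phi>_bi(1)] by simp
        moreover have "\<phi> t (\<xi> - 1) < \<phi> t \<eta>" using True elim strict_mono_less[OF \<phi>_bi(1)] by simp
        moreover have "\<phi> t \<xi> = \<phi> t (\<xi> - 1) + 1" using \<phi>_period[of t "\<xi> - 1"] by simp
        ultimately have "frac (x - \<phi> t \<eta>) = \<phi> t \<xi> - \<phi> t \<eta>" unfolding x_def by (intro frac_eq[THEN iffD2]) auto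
        moreover have "J t \<eta> * h (\<phi> t \<eta>) = H t \<eta>"
        proof -
          have J0: "J t \<eta> \<noteq> 0" using J_pos[of t \<eta>] by simp
          have "J t \<eta> * h (\<phi> t \<eta>) = 2 * \<mu> * (U t \<eta> * J t \<eta>) + ((N t \<eta>)\<^sup>2 + 4 * (q \<eta>)\<^sup>2) / (2 * J t \<eta>)"
            using J0 by (simp add: h_def u_def w_def \<rho>_def field_simps power2_eq_square)
          also have "((N t \<eta>)\<^sup>2 + 4 * (q \<eta>)\<^sup>2) / (2 * J t \<eta>) = 2 * K t \<eta>"
            unfolding lagrange_identity using J0 by simp
          finally show ?thesis by (simp add: H_def)
        qed
        ultimately show ?thesis using True by (simp add: f_def mult.left_commute)
      qed simp
    qed
  qed measurable
  finally show ?thesis by (simp add: x_def)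
qed

text \<open>
  The nonlocal force is the acceleration of the particles. Both have the label derivative
  \<open>c J - H\<close>, which for the force is the Green's function equation \<open>\<partial>\<^sub>x\<^sup>2 g * h = mean h - h\<close> in
  Lagrangian form. So they differ by a constant, and the constant is zero because both have mean
  zero with weight \<open>J\<close>.
\<close>

lemma conv_eq_G: "conv (deriv green) (source \<mu> (u t) (\<rho> t)) x = G t (X t x)"
proof -
  have Hm: "H t \<in> borel_measurable borel" by measurable
  have Hb: "locally_bounded (H t)" by (rule locally_boundedI[OF H_bound])
  obtain A where A: "primitive A (H t)" using primitive_exists[OF Hm Hb] by blast
  have \<phi>H: "(\<lambda>\<eta>. \<phi> t \<eta> * H t \<eta>) \<in> borel_measurable borel" by measurable
  have "locally_bounded (\<lambda>\<eta>. \<phi> t \<eta> * H t \<eta>)"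
    by (intro locally_bounded_mult Hb locally_bounded_continuous primitive_continuous[OF \<phi>_primitive])
  then obtain P where P: "primitive P (\<lambda>\<eta>. \<phi> t \<eta> * H t \<eta>)" using primitive_exists[OF \<phi>H] by blast
  \<comment> \<open>The integral of \<open>\<phi> H\<close> over the period that ends at \<open>\<xi>\<close>. Its derivative is \<open>H\<close>, since \<open>\<phi>\<close> increases
    by one over a period.\<close>
  define \<Delta> where "\<Delta> \<xi> = P \<xi> - P (\<xi> + - 1)" for \<xi>
  have \<Delta>: "primitive \<Delta> (H t)"
  proof (rule primitive_cong[OF primitive_diff[OF P primitive_shift[OF P, of "-1"]]])
    show "\<phi> t \<xi> * H t \<xi> - \<phi> t (\<xi> + - 1) * H t (\<xi> + - 1) = H t \<xi>" for \<xi>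
      using \<phi>_period[of t "\<xi> - 1"] H_periodic[of t "\<xi> - 1"] by (simp add: left_diff_distrib[symmetric])
  qed (simp add: \<Delta>_def)
  \<comment> \<open>The force at label \<open>\<xi>\<close>, once the affine kernel is integrated against \<open>H\<close>.\<close>
  define \<Gamma> where "\<Gamma> \<xi> = c * (\<phi> t \<xi> - 1/2) - \<Delta> \<xi>" for \<xi>
  have conv: "conv (deriv green) (source \<mu> (u t) (\<rho> t)) (\<phi> t \<xi>) = \<Gamma> \<xi>" for \<xi>
  proof -
    have p: "primitive (\<lambda>\<eta>. (\<phi> t \<xi> - 1/2) * A \<eta> - P \<eta>) (\<lambda>\<eta>. (\<phi> t \<xi> - 1/2) * H t \<eta> - \<phi> t \<eta> * H t \<eta>)"
      by (intro primitive_diff primitive_cmult A P)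
    have "conv (deriv green) (source \<mu> (u t) (\<rho> t)) (\<phi> t \<xi>)
        = (LINT \<eta>|lborel. indicator {\<xi> - 1..\<xi>} \<eta> * ((\<phi> t \<xi> - 1/2) * H t \<eta> - \<phi> t \<eta> * H t \<eta>))"
      unfolding conv_lagrangian by (intro Bochner_Integration.integral_cong) (auto simp: algebra_simps)
    also have "\<dots> = (\<phi> t \<xi> - 1/2) * (A \<xi> - A (\<xi> - 1)) - \<Delta> \<xi>"
      unfolding primitive_integral_lborel(2)[OF p, of "\<xi> - 1" \<xi>, simplified] by (simp add: \<Delta>_def algebra_simps)
    also have "A \<xi> - A (\<xi> - 1) = c" using primitive_period[OF A H_periodic, of "\<xi> - 1"] mean_H[of t] by simp
    finally show ?thesis by (simp add: \<Gamma>_def mult.commute)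
  qed
  have \<Gamma>: "primitive \<Gamma> (\<lambda>\<xi>. - N' t \<xi>)"
  proof (rule primitive_cong[OF primitive_diff[OF primitive_cmult[OF primitive_diff[OF \<phi>_primitive primitive_const[of "1/2"]], of c] \<Delta>]])
    show "c * (J t \<xi> - 0) - H t \<xi> = - N' t \<xi>" for \<xi> by (simp add: H_def N'_def algebra_simps)
  qed (simp add: \<Gamma>_def)
  define \<phi>0 where "\<phi>0 = \<phi> t 0"
  have \<phi>1: "\<phi> t 1 = \<phi>0 + 1" using \<phi>_period[of t 0] by (simp add: \<phi>0_def)
  have \<Delta>1: "\<Delta> 1 = mean (\<lambda>\<eta>. \<phi> t \<eta> * H t \<eta>)" using mean_primitive[OF P] by (simp add: \<Delta>_def)
  have \<Delta>0: "\<Delta> 0 = \<Delta> 1 - c" using mean_primitive[OF \<Delta>] mean_H[of t] by simp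
  have mean_\<Gamma>: "mean (\<lambda>\<xi>. J t \<xi> * \<Gamma> \<xi>) = 0"
  proof -
    \<comment> \<open>Integration by parts of \<open>J \<Delta>\<close>; the boundary terms cancel against those of the quadratic part.\<close>
    have p1: "primitive (\<lambda>\<xi>. \<phi> t \<xi> * \<Delta> \<xi> - P \<xi>) (\<lambda>\<xi>. J t \<xi> * \<Delta> \<xi> + \<phi> t \<xi> * H t \<xi> - \<phi> t \<xi> * H t \<xi>)"
      by (intro primitive_diff primitive_mult \<phi>_primitive \<Delta> P)
    have p2: "primitive (\<lambda>\<xi>. c / 2 * (\<phi> t \<xi> * \<phi> t \<xi>) - c / 2 * \<phi> t \<xi>)
       (\<lambda>\<xi>. c / 2 * (J t \<xi> * \<phi> t \<xi> + \<phi> t \<xi> * J t \<xi>) - c / 2 * J t \<xi>)"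
      by (intro primitive_diff primitive_cmult primitive_mult \<phi>_primitive)
    have "mean (\<lambda>\<xi>. J t \<xi> * \<Gamma> \<xi>) = mean (\<lambda>\<xi>. (c / 2 * (J t \<xi> * \<phi> t \<xi> + \<phi> t \<xi> * J t \<xi>) - c / 2 * J t \<xi>)
        - (J t \<xi> * \<Delta> \<xi> + \<phi> t \<xi> * H t \<xi> - \<phi> t \<xi> * H t \<xi>))"
      by (rule mean_cong) (simp add: \<Gamma>_def algebra_simps)
    also have "\<dots> = ((c / 2 * (\<phi> t 1 * \<phi> t 1) - c / 2 * \<phi> t 1) - (\<phi> t 1 * \<Delta> 1 - P 1))
        - ((c / 2 * (\<phi> t 0 * \<phi> t 0) - c / 2 * \<phi> t 0) - (\<phi> t 0 * \<Delta> 0 - P 0))"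
      by (rule mean_primitive[OF primitive_diff[OF p2 p1]])
    also have "\<dots> = 0"
      using mean_primitive[OF P] \<Delta>1 unfolding \<phi>1 \<phi>0_def[symmetric] \<Delta>0 by (simp add: field_simps)
    finally show ?thesis .
  qed
  have const: "G t \<xi> = \<Gamma> \<xi> + (G t 0 - \<Gamma> 0)" for \<xi>
    using primitive_unique[OF G_primitive \<Gamma>, of \<xi> 0] by simp
  obtain C where C: "\<And>x. \<bar>x\<bar> \<le> 1 \<Longrightarrow> \<bar>\<Gamma> x\<bar> \<le> C"
    using locally_boundedE[OF locally_bounded_continuous[OF primitive_continuous[OF \<Gamma>]]] by metis
  have [measurable]: "\<Gamma> \<in> borel_measurable borel" by (rule primitive_borel_fun[OF \<Gamma>])
  have "mean (\<lambda>\<xi>. G t \<xi> * J t \<xi>) = mean (\<lambda>\<xi>. J t \<xi> * \<Gamma> \<xi> + (G t 0 - \<Gamma> 0) * J t \<xi>)"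
    by (rule mean_cong) (subst const, simp add: algebra_simps)
  also have "\<dots> = mean (\<lambda>\<xi>. J t \<xi> * \<Gamma> \<xi>) + mean (\<lambda>\<xi>. (G t 0 - \<Gamma> 0) * J t \<xi>)"
  proof (rule mean_add(1))
    show "\<bar>J t x * \<Gamma> x\<bar> \<le> bnd t * C" if "x \<in> {0..1}" for x
      unfolding abs_mult using that bnd_nonneg by (intro mult_mono fields_bound C) auto
    show "\<bar>(G t 0 - \<Gamma> 0) * J t x\<bar> \<le> \<bar>G t 0 - \<Gamma> 0\<bar> * bnd t" for x
      unfolding abs_mult by (intro mult_left_mono fields_bound) auto
  qed measurable
  finally have "G t 0 - \<Gamma> 0 = 0" using mean_G_J[of t] mean_\<Gamma> by (simp add: mean_cmult mean_fields)
  then show ?thesis using conv[of "X t x"] const[of "X t x"] by simp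
qed

end

section \<open>Test functions in space-time\<close>

lemma integral_lebesgue_lborel:
  fixes f :: "real \<Rightarrow> real"
  assumes "f \<in> borel_measurable borel"
  shows "(LINT x|lebesgue. f x) = (LINT x|lborel. f x)"
  by (rule integral_completion) (use assms in simp)

lemma test_fun_real:
  fixes \<psi> :: "real \<Rightarrow> real"
  assumes "test_fun UNIV \<psi>"
  obtains R L where "0 \<le> R" "0 \<le> L" "\<And>x. R < \<bar>x\<bar> \<Longrightarrow> \<psi> x = 0" "\<And>x y. \<bar>\<psi> x - \<psi> y\<bar> \<le> L * \<bar>x - y\<bar>"
    "continuous_on UNIV \<psi>" "integrable lborel (\<lambda>x. \<bar>\<psi> x\<bar>)"
proof -
  define S where "S = closure {x. \<psi> x \<noteq> 0}"
  have sm: "smooth \<psi>" and S: "compact S" using assms by (auto simp: test_fun_def S_def)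
  obtain R0 where R0: "\<And>x. x \<in> S \<Longrightarrow> norm x \<le> R0" using compact_imp_bounded[OF S] unfolding bounded_iff by blast
  define R where "R = \<bar>R0\<bar>"
  have zero: "\<psi> x = 0" if "R < \<bar>x\<bar>" for x
    using R0[of x] that closure_subset[of "{x. \<psi> x \<noteq> 0}"] unfolding R_def S_def by force
  note d = smooth_real_deriv[OF sm]
  obtain L where L: "L > 0" "\<And>x. \<bar>x\<bar> \<le> R \<Longrightarrow> \<bar>deriv \<psi> x\<bar> \<le> L"
    using locally_boundedE[OF locally_bounded_continuous[OF d(2)]] by metis
  have dL: "\<bar>deriv \<psi> x\<bar> \<le> L" for x
  proof (cases "\<bar>x\<bar> \<le> R")
    case False
    have "open {x. R < \<bar>x\<bar>}" by (intro open_Collect_less continuous_intros)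
    then have "\<forall>\<^sub>F y in nhds x. R < \<bar>y\<bar>" using False by (intro eventually_nhds_in_open[THEN eventually_mono]) auto
    then have "\<forall>\<^sub>F y in nhds x. \<psi> y = 0" by eventually_elim (rule zero)
    then have "(\<psi> has_real_derivative 0) (at x)" using DERIV_cong_ev[OF refl _ refl, of \<psi> "\<lambda>_. 0" x 0] by simp
    then show ?thesis using DERIV_imp_deriv L(1) by fastforce
  qed (rule L(2))
  have lip: "\<bar>\<psi> x - \<psi> y\<bar> \<le> L * \<bar>x - y\<bar>" for x y
    using field_differentiable_bound[of UNIV \<psi> "deriv \<psi>" L x y] d(1) dL by simp
  have c: "continuous_on UNIV \<psi>" using d(1) by (meson DERIV_continuous_on has_field_derivative_at_within)
  then have [measurable]: "\<psi> \<in> borel_measurable borel" by (rule borel_measurable_continuous_onI)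
  have "integrable lborel (\<lambda>x. \<bar>\<psi> x\<bar>)"
  proof -
    have am: "(\<lambda>x. \<bar>\<psi> x\<bar>) \<in> borel_measurable borel" by measurable
    have "locally_bounded (\<lambda>x. \<bar>\<psi> x\<bar>)" by (intro locally_bounded_continuous continuous_intros c)
    then obtain P where P: "primitive P (\<lambda>x. \<bar>\<psi> x\<bar>)" using primitive_exists[OF am] by blast
    have "(\<lambda>x. \<bar>\<psi> x\<bar>) = (\<lambda>x. indicator {-R..R} x * \<bar>\<psi> x\<bar>)"
    proof
      fix x show "\<bar>\<psi> x\<bar> = indicator {-R..R} x * \<bar>\<psi> x\<bar>" using zero[of x] by (cases "R < \<bar>x\<bar>") (auto simp: indicator_def)
    qed
    then show ?thesis using primitive_integral_lborel(1)[OF P, of "-R" R] by (simp add: R_def)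
  qed
  then show ?thesis using that[of R L] zero lip c L(1) by (simp add: R_def)
qed

lemma test_fun_derivative:
  fixes \<psi> :: "real \<times> real \<Rightarrow> real"
  assumes "test_fun \<Omega> \<psi>"
  shows "(\<psi> has_derivative frechet_derivative \<psi> (at z)) (at z)"
    "frechet_derivative \<psi> (at z) (h, k) = h * dt \<psi> z + k * dx \<psi> z"
    "continuous_on UNIV \<psi>" "continuous_on UNIV (dt \<psi>)" "continuous_on UNIV (dx \<psi>)"
proof -
  have ck: "Ck (Suc 0) \<psi>" "Ck 0 \<psi>" using assms unfolding test_fun_def smooth_def by blast+
  have diff: "\<forall>z. \<psi> differentiable (at z)" and c1: "\<forall>v. Ck 0 (\<lambda>x. frechet_derivative \<psi> (at x) v)"
    using ck(1) unfolding Ck.simps(2) by blast+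
  have c: "continuous_on UNIV (\<lambda>x. frechet_derivative \<psi> (at x) v)" for v
    using c1 unfolding Ck.simps(1) by blast
  show d: "(\<psi> has_derivative frechet_derivative \<psi> (at z)) (at z)"
    using diff frechet_derivative_works by blast
  interpret bounded_linear "frechet_derivative \<psi> (at z)" using d by (rule has_derivative_bounded_linear)
  have "frechet_derivative \<psi> (at z) (h *\<^sub>R (1, 0) + k *\<^sub>R (0, 1)) = h * dt \<psi> z + k * dx \<psi> z"
    by (simp only: add scaleR dt_def dx_def real_scaleR_def)
  then show "frechet_derivative \<psi> (at z) (h, k) = h * dt \<psi> z + k * dx \<psi> z" by simp
  show "continuous_on UNIV \<psi>" using ck(2) unfolding Ck.simps(1) .
  show "continuous_on UNIV (dt \<psi>)" "continuous_on UNIV (dx \<psi>)"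
    unfolding dt_def[abs_def] dx_def[abs_def] by (rule c)+
qed

lemma test_fun_zero_outside:
  fixes \<psi> :: "real \<times> real \<Rightarrow> real"
  assumes "z \<notin> closure {p. \<psi> p \<noteq> 0}"
  shows "\<psi> z = 0" "dt \<psi> z = 0" "dx \<psi> z = 0"
proof -
  let ?O = "- closure {p. \<psi> p \<noteq> 0}"
  have zero: "\<psi> y = 0" if "y \<in> ?O" for y
    using that closure_subset[of "{p. \<psi> p \<noteq> 0}"] by blast
  have zO: "z \<in> ?O" using assms by blast
  show "\<psi> z = 0" by (rule zero[OF zO])
  have "(\<psi> has_derivative (\<lambda>_. 0)) (at z)"
    by (rule has_derivative_transform_within_open[OF has_derivative_const open_Compl[OF closed_closure] zO])
       (rule zero[symmetric])
  from frechet_derivative_at[OF this, symmetric] show "dt \<psi> z = 0" "dx \<psi> z = 0"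
    by (simp_all add: dt_def dx_def)
qed

lemma test_fun_box:
  fixes \<psi> :: "real \<times> real \<Rightarrow> real"
  assumes "test_fun ({0<..} \<times> UNIV) \<psi>"
  obtains a b R C where "0 < a" "a \<le> b" "0 \<le> R" 
    "\<And>t x. \<not> (t \<in> {a..b} \<and> \<bar>x\<bar> \<le> R) \<Longrightarrow> \<psi> (t, x) = 0 \<and> dt \<psi> (t, x) = 0 \<and> dx \<psi> (t, x) = 0"
    "\<And>z. \<bar>\<psi> z\<bar> \<le> C" "\<And>z. \<bar>dt \<psi> z\<bar> \<le> C" "\<And>z. \<bar>dx \<psi> z\<bar> \<le> C"
proof -
  define S where "S = closure {p. \<psi> p \<noteq> 0}"
  have S: "compact S" "S \<subseteq> {0<..} \<times> UNIV" using assms by (auto simp: test_fun_def S_def)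
  obtain R where R: "\<And>z. z \<in> S \<Longrightarrow> norm z \<le> R" using compact_imp_bounded[OF S(1)] unfolding bounded_iff by blast
  obtain a where a: "0 < a" "\<And>z. z \<in> S \<Longrightarrow> a \<le> fst z"
  proof (cases "S = {}")
    case True then show ?thesis using that[of 1] by simp
  next
    case False
    have "compact (fst ` S)" by (intro compact_continuous_image continuous_intros S)
    then obtain z where "z \<in> S" "\<And>y. y \<in> S \<Longrightarrow> fst z \<le> fst y"
      using compact_attains_inf[of "fst ` S"] False by auto
    then show ?thesis using that[of "fst z"] S(2) by auto
  qed
  have box: "\<psi> (t, x) = 0 \<and> dt \<psi> (t, x) = 0 \<and> dx \<psi> (t, x) = 0"
    if "\<not> (t \<in> {a..\<bar>R\<bar> + a} \<and> \<bar>x\<bar> \<le> \<bar>R\<bar>)" for t x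
  proof -
    have "(t, x) \<notin> S"
    proof
      assume *: "(t, x) \<in> S"
      have "\<bar>t\<bar> \<le> R" "\<bar>x\<bar> \<le> R"
        using R[OF *] norm_fst_le[of t x] norm_snd_le[of x t] by auto
      then show False using that a(2)[OF *] a(1) by auto
    qed
    then show ?thesis using test_fun_zero_outside[of "(t, x)" \<psi>] by (auto simp: S_def)
  qed
  have bound: "\<exists>C. \<forall>z. \<bar>\<theta> z\<bar> \<le> C" if "continuous_on UNIV \<theta>" "\<And>z. z \<notin> S \<Longrightarrow> \<theta> z = 0" for \<theta> :: "real \<times> real \<Rightarrow> real"
  proof -
    have "compact (\<theta> ` S)" by (intro compact_continuous_image continuous_on_subset[OF that(1)] S) auto
    then obtain C where C: "\<And>z. z \<in> S \<Longrightarrow> \<bar>\<theta> z\<bar> \<le> C"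
      using compact_imp_bounded[of "\<theta> ` S"] unfolding bounded_iff by auto
    have "\<bar>\<theta> z\<bar> \<le> \<bar>C\<bar>" for z using C[of z] that(2)[of z] by (cases "z \<in> S") auto
    then show ?thesis by blast
  qed
  note cont = test_fun_derivative(3-5)[OF assms]
  obtain C1 C2 C3 where C: "\<And>z. \<bar>\<psi> z\<bar> \<le> C1" "\<And>z. \<bar>dt \<psi> z\<bar> \<le> C2" "\<And>z. \<bar>dx \<psi> z\<bar> \<le> C3"
    using bound[OF cont(1)] bound[OF cont(2)] bound[OF cont(3)] test_fun_zero_outside[of _ \<psi>] unfolding S_def by meson
  show ?thesis
  proof (rule that[of a "\<bar>R\<bar> + a" "\<bar>R\<bar>" "max C1 (max C2 C3)"])
    show "\<bar>\<psi> z\<bar> \<le> max C1 (max C2 C3)" "\<bar>dt \<psi> z\<bar> \<le> max C1 (max C2 C3)" "\<bar>dx \<psi> z\<bar> \<le> max C1 (max C2 C3)" for z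
      using C[of z] by auto
  qed (use a box in auto)
qed

text \<open>
  The fundamental theorem of calculus when \<open>A\<close> is integrable; otherwise its Bochner integral is zero by
  convention.
\<close>

lemma time_integral_zero:
  fixes g A :: "real \<Rightarrow> real"
  assumes "\<And>t. t \<ge> 0 \<Longrightarrow> (g has_real_derivative A t) (at t within {0..})"
    and "0 < a" "a \<le> b" and zero: "\<And>t. t \<notin> {a..b} \<Longrightarrow> g t = 0 \<and> A t = 0"
  shows "(LINT t|lborel. A t) = 0"
proof (cases "integrable lborel A")
  case True
  have "(A has_integral (g (b + 1) - g 0)) {0..b + 1}"
  proof (rule fundamental_theorem_of_calculus)
    show "(g has_vector_derivative A t) (at t within {0..b + 1})" if "t \<in> {0..b + 1}" for t
      using DERIV_subset[OF assms(1)[of t], of "{0..b + 1}"] that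
      by (auto simp: has_real_derivative_iff_has_vector_derivative)
  qed (use assms(2,3) in simp)
  moreover have "g (b + 1) = 0" "g 0 = 0" using zero[of "b + 1"] zero[of 0] assms(2) by simp_all
  ultimately have "(A has_integral 0) {0..b + 1}" by simp
  then have "(A has_integral 0) UNIV"
  proof (rule has_integral_on_superset)
    show "A t = 0" if "t \<notin> {0..b + 1}" for t
    proof -
      have "t \<notin> {a..b}" using that assms(2) by auto
      then show ?thesis using zero by blast
    qed
  qed simp
  then show ?thesis using has_integral_integral_lborel[OF True] has_integral_unique by blast
qed (simp add: not_integrable_integral_eq)

lemma space_integral_zero:
  assumes F: "primitive F f" and zero: "\<And>x. R \<le> \<bar>x\<bar> \<Longrightarrow> F x = 0 \<and> f x = 0" and "0 \<le> R"
  shows "integrable lborel f" "(LINT x|lborel. f x) = 0"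
proof -
  have eq: "f = (\<lambda>x. indicator {-R..R} x * f x)"
  proof
    fix x
    show "f x = indicator {-R..R} x * f x"
    proof (cases "R \<le> \<bar>x\<bar>")
      case True then show ?thesis using zero by simp
    next
      case False then have "x \<in> {-R..R}" by auto
      then show ?thesis by simp
    qed
  qed
  show "integrable lborel f" by (subst eq, rule primitive_integral_lborel(1)[OF F]) (use assms in auto)
  have "(LINT x|lborel. f x) = (LINT x|lborel. indicator {-R..R} x * f x)" using eq by simp
  also have "\<dots> = F R - F (- R)" by (rule primitive_integral_lborel(2)[OF F]) (use assms in auto)
  finally show "(LINT x|lborel. f x) = 0" using zero[of R] zero[of "-R"] assms(3) by simp
qed

lemma snd_fst_measurable [measurable]:
  "(fst :: real \<times> real \<Rightarrow> real) \<in> borel_measurable borel" "(snd :: real \<times> real \<Rightarrow> real) \<in> borel_measurable borel"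
  by (auto intro!: borel_measurable_continuous_onI continuous_intros)

lemma test_slice_measurable:
  assumes "continuous_on UNIV (\<theta> :: real \<times> real \<Rightarrow> real)"
  shows "(\<lambda>x. \<theta> (t, x)) \<in> borel_measurable borel"
  by (intro borel_measurable_continuous_onI continuous_on_compose2[OF assms]) (auto intro!: continuous_intros)

context lagrangian_data
begin

section \<open>The equations in the sense of distributions\<close>

lemma \<phi>_near: "\<bar>\<phi> t \<xi> - \<xi>\<bar> \<le> ub * \<bar>t\<bar>"
  using \<phi>_lipschitz_time[of t \<xi> 0] by (simp add: \<phi>_0)

lemma test_along_flow_time:
  assumes "test_fun \<Omega> \<psi>" "t \<ge> 0"
  shows "((\<lambda>t. \<psi> (t, \<phi> t \<xi>)) has_real_derivative
    dt \<psi> (t, \<phi> t \<xi>) - (U t \<xi> + \<gamma>) * dx \<psi> (t, \<phi> t \<xi>)) (at t within {0..})"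
proof -
  have "((\<lambda>t. \<phi> t \<xi>) has_vector_derivative - (U t \<xi> + \<gamma>)) (at t within {0..})"
    using \<phi>_deriv[OF assms(2)] by (simp add: has_real_derivative_iff_has_vector_derivative)
  then have "((\<lambda>t. (t, \<phi> t \<xi>)) has_vector_derivative (1, - (U t \<xi> + \<gamma>))) (at t within {0..})"
    by (intro has_vector_derivative_Pair has_vector_derivative_id)
  then have c: "((\<lambda>t. (t, \<phi> t \<xi>)) has_derivative (\<lambda>h. h *\<^sub>R (1, - (U t \<xi> + \<gamma>)))) (at t within {0..})"
    by (simp add: has_vector_derivative_def)
  have "((\<lambda>t. \<psi> (t, \<phi> t \<xi>)) has_derivative
      (\<lambda>h. frechet_derivative \<psi> (at (t, \<phi> t \<xi>)) (h *\<^sub>R (1, - (U t \<xi> + \<gamma>))))) (at t within {0..})"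
    by (rule has_derivative_compose[OF c test_fun_derivative(1)[OF assms(1)]])
  also have "(\<lambda>h. frechet_derivative \<psi> (at (t, \<phi> t \<xi>)) (h *\<^sub>R (1, - (U t \<xi> + \<gamma>))))
      = (*) (dt \<psi> (t, \<phi> t \<xi>) - (U t \<xi> + \<gamma>) * dx \<psi> (t, \<phi> t \<xi>))"
  proof
    fix h
    have "h *\<^sub>R (1, - (U t \<xi> + \<gamma>)) = (h, h * - (U t \<xi> + \<gamma>))" by simp
    then show "frechet_derivative \<psi> (at (t, \<phi> t \<xi>)) (h *\<^sub>R (1, - (U t \<xi> + \<gamma>)))
        = (dt \<psi> (t, \<phi> t \<xi>) - (U t \<xi> + \<gamma>) * dx \<psi> (t, \<phi> t \<xi>)) * h"
      by (simp only: test_fun_derivative(2)[OF assms(1)]) (simp add: algebra_simps)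
  qed
  finally show ?thesis by (simp add: has_field_derivative_def)
qed

lemma test_along_flow_space:
  assumes "test_fun \<Omega> \<psi>"
  shows "primitive (\<lambda>\<xi>. \<psi> (t, \<phi> t \<xi>)) (\<lambda>\<xi>. dx \<psi> (t, \<phi> t \<xi>) * J t \<xi>)"
proof (rule primitive_chain[OF \<phi>_primitive])
  show "((\<lambda>x. \<psi> (t, x)) has_real_derivative dx \<psi> (t, x)) (at x)" for x
  proof -
    have "((\<lambda>x. (t, x)) has_derivative (\<lambda>h. (0, h))) (at x)" by (auto intro!: derivative_eq_intros)
    from has_derivative_compose[OF this test_fun_derivative(1)[OF assms]]
    have "((\<lambda>x. \<psi> (t, x)) has_derivative (\<lambda>h. frechet_derivative \<psi> (at (t, x)) (0, h))) (at x)" .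
    moreover have "(\<lambda>h. frechet_derivative \<psi> (at (t, x)) (0, h)) = (*) (dx \<psi> (t, x))"
      by (auto simp: test_fun_derivative(2)[OF assms] mult.commute)
    ultimately show ?thesis by (simp add: has_field_derivative_def)
  qed
  show "continuous_on UNIV (\<lambda>x. dx \<psi> (t, x))"
    by (rule continuous_on_compose2[OF test_fun_derivative(5)[OF assms]]) (auto intro!: continuous_intros)
qed

text \<open>
  The characteristics have finite speed, so a function that is supported in a bounded set of positions
  is supported in a bounded set of labels as well.
\<close>

lemma flow_fubini:
  fixes A :: "real \<Rightarrow> real \<Rightarrow> real"
  assumes meas: "(\<lambda>z. A (fst z) (snd z)) \<in> borel_measurable borel"
    and bound: "\<And>t \<xi>. t \<in> {a..b} \<Longrightarrow> \<bar>A t \<xi>\<bar> \<le> C"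
    and supp: "\<And>t \<xi>. \<not> (t \<in> {a..b} \<and> \<bar>\<phi> t \<xi>\<bar> \<le> R) \<Longrightarrow> A t \<xi> = 0" and "0 < a"
  shows "integrable lborel (\<lambda>t. LINT \<xi>|lborel. A t \<xi>)"
    "(LINT t|lborel. LINT \<xi>|lborel. A t \<xi>) = (LINT \<xi>|lborel. LINT t|lborel. A t \<xi>)"
    "integrable lborel (A t)"
proof -
  have meas': "case_prod A \<in> borel_measurable borel" using meas by (simp add: case_prod_beta')
  have bound': "\<bar>A t \<xi>\<bar> \<le> \<bar>C\<bar>" for t \<xi>
    using bound[of t \<xi>] supp[of t \<xi>] by (cases "t \<in> {a..b}") auto
  have sup: "t \<in> {a..b} \<and> \<xi> \<in> {- (R + ub * b)..R + ub * b}" if "A t \<xi> \<noteq> 0" for t \<xi>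
  proof -
    have tx: "t \<in> {a..b}" "\<bar>\<phi> t \<xi>\<bar> \<le> R" using supp[of t \<xi>] that by auto
    have "\<bar>\<xi>\<bar> \<le> R + ub * \<bar>t\<bar>" using \<phi>_near[of t \<xi>] tx(2) by linarith
    also have "\<dots> \<le> R + ub * b" using tx(1) \<open>0 < a\<close> ub_nonneg by (intro add_left_mono mult_left_mono) auto
    finally show ?thesis using tx(1) by auto
  qed
  show "integrable lborel (\<lambda>t. LINT \<xi>|lborel. A t \<xi>)"
    "(LINT t|lborel. LINT \<xi>|lborel. A t \<xi>) = (LINT \<xi>|lborel. LINT t|lborel. A t \<xi>)"
    "integrable lborel (A t)"
    using fubini_bounded[OF meas' bound' sup] by auto
qed

lemma test_flow_measurable:
  assumes "continuous_on UNIV (\<theta> :: real \<times> real \<Rightarrow> real)"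
  shows "(\<lambda>z. \<theta> (fst z, \<phi> (fst z) (snd z))) \<in> borel_measurable borel"
proof -
  have "continuous_on UNIV (\<lambda>z. \<theta> (fst z, \<phi> (fst z) (snd z)))"
    by (rule continuous_on_compose2[OF assms]) (auto intro!: continuous_intros \<phi>_continuous)
  then show ?thesis by (rule borel_measurable_continuous_onI)
qed

text \<open>
  Multiplied by the Jacobian, the density becomes the time-independent \<open>2 q\<close>, and the equation says that
  \<open>2 q\<close> times the time derivative of the test function along each characteristic integrates to zero.
\<close>

lemma continuity_equation:
  assumes \<psi>: "test_fun ({0<..} \<times> UNIV) \<psi>"
  shows "(LINT t|lebesgue. LINT x|lebesgue. - \<rho> t x * dt \<psi> (t, x) + \<rho> t x * u t x * dx \<psi> (t, x))
    = (LINT t|lebesgue. LINT x|lebesgue. - \<gamma> * \<rho> t x * dx \<psi> (t, x))"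
proof -
  note cont = test_fun_derivative(3-5)[OF \<psi>]
  note [measurable] = test_slice_measurable[OF cont(1)] test_slice_measurable[OF cont(2)] test_slice_measurable[OF cont(3)]
    test_flow_measurable[OF cont(1)] test_flow_measurable[OF cont(2)] test_flow_measurable[OF cont(3)]
  obtain a b R C where box: "0 < a" "a \<le> b" "0 \<le> R"
    "\<And>t x. \<not> (t \<in> {a..b} \<and> \<bar>x\<bar> \<le> R) \<Longrightarrow> \<psi> (t, x) = 0 \<and> dt \<psi> (t, x) = 0 \<and> dx \<psi> (t, x) = 0"
    "\<And>z. \<bar>\<psi> z\<bar> \<le> C" "\<And>z. \<bar>dt \<psi> z\<bar> \<le> C" "\<And>z. \<bar>dx \<psi> z\<bar> \<le> C"
    using test_fun_box[OF \<psi>] by metis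
  have C: "0 \<le> C" using box(5)[of 0] by linarith
  \<comment> \<open>The total time derivative, and the part that makes up the right-hand side.\<close>
  define A where "A t \<xi> = 2 * q \<xi> * (dt \<psi> (t, \<phi> t \<xi>) - (U t \<xi> + \<gamma>) * dx \<psi> (t, \<phi> t \<xi>))" for t \<xi>
  define Q where "Q t \<xi> = - \<gamma> * (2 * q \<xi>) * dx \<psi> (t, \<phi> t \<xi>)" for t \<xi>
  have q2: "\<bar>2 * q \<xi>\<bar> \<le> 2 * D" for \<xi> using q_bound[of \<xi>] by simp
  have U\<gamma>: "\<bar>U t \<xi> + \<gamma>\<bar> \<le> ub" for t \<xi> using U_bound[of t \<xi>] by (simp add: ub_def)
  have A: "integrable lborel (\<lambda>t. LINT \<xi>|lborel. A t \<xi>)"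
      "(LINT t|lborel. LINT \<xi>|lborel. A t \<xi>) = (LINT \<xi>|lborel. LINT t|lborel. A t \<xi>)"
      "integrable lborel (A t)" for t
  proof -
    have m: "(\<lambda>z. A (fst z) (snd z)) \<in> borel_measurable borel" unfolding A_def by measurable
    have bd: "\<bar>A t \<xi>\<bar> \<le> 2 * D * (C + ub * C)" for t \<xi>
    proof -
      have "\<bar>dt \<psi> (t, \<phi> t \<xi>) - (U t \<xi> + \<gamma>) * dx \<psi> (t, \<phi> t \<xi>)\<bar> \<le> C + ub * C"
        using box(6)[of "(t, \<phi> t \<xi>)"] mult_mono[OF U\<gamma> box(7)[of "(t, \<phi> t \<xi>)"] ub_nonneg abs_ge_zero, of t \<xi>]
        by (simp only: abs_mult[symmetric])
      then show ?thesis unfolding A_def abs_mult[of "2 * q \<xi>"] using D_pos by (intro mult_mono q2) auto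
    qed
    have sp: "A t \<xi> = 0" if "\<not> (t \<in> {a..b} \<and> \<bar>\<phi> t \<xi>\<bar> \<le> R)" for t \<xi>
      using box(4)[OF that] by (simp add: A_def)
    show "integrable lborel (\<lambda>t. LINT \<xi>|lborel. A t \<xi>)"
      "(LINT t|lborel. LINT \<xi>|lborel. A t \<xi>) = (LINT \<xi>|lborel. LINT t|lborel. A t \<xi>)" "integrable lborel (A t)"
      using flow_fubini[OF m bd sp box(1)] by auto
  qed
  have Q: "integrable lborel (\<lambda>t. LINT \<xi>|lborel. Q t \<xi>)" "integrable lborel (Q t)" for t
  proof -
    have m: "(\<lambda>z. Q (fst z) (snd z)) \<in> borel_measurable borel" unfolding Q_def by measurable
    have bd: "\<bar>Q t \<xi>\<bar> \<le> (\<bar>\<gamma>\<bar> * (2 * D)) * C" for t \<xi>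
      unfolding Q_def abs_mult[of "- \<gamma> * (2 * q \<xi>)"] abs_mult[of "- \<gamma>"] abs_minus_cancel
      using D_pos by (intro mult_mono mult_left_mono q2 box(7)) auto
    have sp: "Q t \<xi> = 0" if "\<not> (t \<in> {a..b} \<and> \<bar>\<phi> t \<xi>\<bar> \<le> R)" for t \<xi>
      using box(4)[OF that] by (simp add: Q_def)
    show "integrable lborel (\<lambda>t. LINT \<xi>|lborel. Q t \<xi>)" "integrable lborel (Q t)"
      using flow_fubini[OF m bd sp box(1)] by auto
  qed
  have lhs: "(LINT x|lebesgue. - \<rho> t x * dt \<psi> (t, x) + \<rho> t x * u t x * dx \<psi> (t, x))
      = (LINT \<xi>|lborel. Q t \<xi>) - (LINT \<xi>|lborel. A t \<xi>)" for t
  proof -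
    have "(LINT x|lebesgue. - \<rho> t x * dt \<psi> (t, x) + \<rho> t x * u t x * dx \<psi> (t, x))
        = (LINT x|lborel. - \<rho> t x * dt \<psi> (t, x) + \<rho> t x * u t x * dx \<psi> (t, x))"
      by (rule integral_lebesgue_lborel) measurable
    also have "\<dots> = (LINT \<xi>|lborel. J t \<xi> * (- \<rho> t (\<phi> t \<xi>) * dt \<psi> (t, \<phi> t \<xi>) + \<rho> t (\<phi> t \<xi>) * u t (\<phi> t \<xi>) * dx \<psi> (t, \<phi> t \<xi>)))"
      by (rule \<phi>_change) measurable
    also have "\<dots> = (LINT \<xi>|lborel. Q t \<xi> - A t \<xi>)"
    proof (rule Bochner_Integration.integral_cong[OF refl])
      fix \<xi>
      have "J t \<xi> \<noteq> 0" using J_pos[of t \<xi>] by simp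
      then show "J t \<xi> * (- \<rho> t (\<phi> t \<xi>) * dt \<psi> (t, \<phi> t \<xi>) + \<rho> t (\<phi> t \<xi>) * u t (\<phi> t \<xi>) * dx \<psi> (t, \<phi> t \<xi>))
          = Q t \<xi> - A t \<xi>"
        by (simp add: \<rho>_def u_def A_def Q_def field_simps)
    qed
    finally show ?thesis using A(3) Q(2) by simp
  qed
  have rhs: "(LINT x|lebesgue. - \<gamma> * \<rho> t x * dx \<psi> (t, x)) = (LINT \<xi>|lborel. Q t \<xi>)" for t
  proof -
    have "(LINT x|lebesgue. - \<gamma> * \<rho> t x * dx \<psi> (t, x)) = (LINT x|lborel. - \<gamma> * \<rho> t x * dx \<psi> (t, x))"
      by (rule integral_lebesgue_lborel) measurable
    also have "\<dots> = (LINT \<xi>|lborel. J t \<xi> * (- \<gamma> * \<rho> t (\<phi> t \<xi>) * dx \<psi> (t, \<phi> t \<xi>)))"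
      by (rule \<phi>_change) measurable
    also have "\<dots> = (LINT \<xi>|lborel. Q t \<xi>)"
    proof (rule Bochner_Integration.integral_cong[OF refl])
      fix \<xi>
      have "J t \<xi> \<noteq> 0" using J_pos[of t \<xi>] by simp
      then show "J t \<xi> * (- \<gamma> * \<rho> t (\<phi> t \<xi>) * dx \<psi> (t, \<phi> t \<xi>)) = Q t \<xi>"
        by (simp add: \<rho>_def Q_def)
    qed
    finally show ?thesis .
  qed
  have "(LINT t|lborel. A t \<xi>) = 0" for \<xi>
  proof (rule time_integral_zero[of "\<lambda>t. 2 * q \<xi> * \<psi> (t, \<phi> t \<xi>)", OF _ box(1,2)])
    show "((\<lambda>t. 2 * q \<xi> * \<psi> (t, \<phi> t \<xi>)) has_real_derivative A t \<xi>) (at t within {0..})" if "t \<ge> 0" for t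
      unfolding A_def by (rule DERIV_cmult[OF test_along_flow_time[OF \<psi> that]])
    show "2 * q \<xi> * \<psi> (t, \<phi> t \<xi>) = 0 \<and> A t \<xi> = 0" if "t \<notin> {a..b}" for t
      using box(4)[of t "\<phi> t \<xi>"] that by (auto simp: A_def)
  qed
  then have A0: "(LINT t|lborel. LINT \<xi>|lborel. A t \<xi>) = 0" using A(2) by simp
  have "(LINT t|lebesgue. LINT x|lebesgue. - \<rho> t x * dt \<psi> (t, x) + \<rho> t x * u t x * dx \<psi> (t, x))
      = (LINT t|lborel. (LINT \<xi>|lborel. Q t \<xi>) - (LINT \<xi>|lborel. A t \<xi>))"
    unfolding lhs by (rule integral_lebesgue_lborel) (use Q(1) A(1) in auto)
  also have "\<dots> = (LINT t|lborel. LINT \<xi>|lborel. Q t \<xi>)"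
    using A0 Bochner_Integration.integral_diff[OF Q(1) A(1)] by simp
  also have "\<dots> = (LINT t|lebesgue. LINT \<xi>|lborel. Q t \<xi>)"
    by (rule integral_lebesgue_lborel[symmetric]) (use Q(1) in auto)
  finally show ?thesis unfolding rhs .
qed

text \<open>
  In Lagrangian coordinates the left-hand side becomes \<open>Q - A - S\<close>, where \<open>Q\<close> is the force term of the
  right-hand side by \<open>conv_eq_G\<close>, \<open>A\<close> is the time derivative of \<open>J U \<psi>\<close> along the flow, and \<open>S\<close> is the
  label derivative of \<open>U (U + \<gamma>) \<psi>\<close>. The last two have bounded support and integrate to zero.
\<close>

lemma momentum_equation:
  assumes \<psi>: "test_fun ({0<..} \<times> UNIV) \<psi>"
  shows "(LINT t|lebesgue. LINT x|lebesgue. - u t x * dt \<psi> (t, x) - (u t x + \<gamma>) * weak_deriv (u t) x * \<psi> (t, x))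
    = (LINT t|lebesgue. LINT x|lebesgue. conv (deriv green) (source \<mu> (u t) (\<rho> t)) x * \<psi> (t, x))"
proof -
  note cont = test_fun_derivative(3-5)[OF \<psi>]
  note [measurable] = test_slice_measurable[OF cont(1)] test_slice_measurable[OF cont(2)] test_slice_measurable[OF cont(3)]
    test_flow_measurable[OF cont(1)] test_flow_measurable[OF cont(2)] test_flow_measurable[OF cont(3)]
  obtain a b R C where box: "0 < a" "a \<le> b" "0 \<le> R"
    "\<And>t x. \<not> (t \<in> {a..b} \<and> \<bar>x\<bar> \<le> R) \<Longrightarrow> \<psi> (t, x) = 0 \<and> dt \<psi> (t, x) = 0 \<and> dx \<psi> (t, x) = 0"
    "\<And>z. \<bar>\<psi> z\<bar> \<le> C" "\<And>z. \<bar>dt \<psi> z\<bar> \<le> C" "\<And>z. \<bar>dx \<psi> z\<bar> \<le> C"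
    using test_fun_box[OF \<psi>] by metis
  have C: "0 \<le> C" using box(5)[of 0] by linarith
  define g where "g t \<xi> = J t \<xi> * U t \<xi> * \<psi> (t, \<phi> t \<xi>)" for t \<xi>
  define A where "A t \<xi> = N t \<xi> * U t \<xi> * \<psi> (t, \<phi> t \<xi>) + J t \<xi> * G t \<xi> * \<psi> (t, \<phi> t \<xi>)
    + J t \<xi> * U t \<xi> * (dt \<psi> (t, \<phi> t \<xi>) - (U t \<xi> + \<gamma>) * dx \<psi> (t, \<phi> t \<xi>))" for t \<xi>
  \<comment> \<open>The product rule in the form of \<open>primitive_mult\<close>; the summand \<open>0\<close> is the derivative of \<open>\<gamma>\<close>.\<close>
  define S where "S t \<xi> = (- N t \<xi> * (U t \<xi> + \<gamma>) + U t \<xi> * (- N t \<xi> + 0)) * \<psi> (t, \<phi> t \<xi>)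
    + U t \<xi> * (U t \<xi> + \<gamma>) * (dx \<psi> (t, \<phi> t \<xi>) * J t \<xi>)" for t \<xi>
  define Q where "Q t \<xi> = J t \<xi> * G t \<xi> * \<psi> (t, \<phi> t \<xi>)" for t \<xi>
  have U\<gamma>: "\<bar>U t \<xi> + \<gamma>\<bar> \<le> ub" and Ub: "\<bar>U t \<xi>\<bar> \<le> ub" for t \<xi>
    using U_bound[of t \<xi>] by (simp_all add: ub_def)
  have gb: "0 \<le> gbnd T" for T using G_bound[of T T 0] by simp
  have prod3: "\<bar>x * y * z\<bar> \<le> X * Y * W" if "\<bar>x\<bar> \<le> X" "\<bar>y\<bar> \<le> Y" "\<bar>z\<bar> \<le> W" for x y z X Y W :: real
  proof -
    have "0 \<le> X" "0 \<le> Y" using that by linarith+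
    then show ?thesis unfolding abs_mult using that by (intro mult_mono mult_nonneg_nonneg) auto
  qed
  have A: "integrable lborel (\<lambda>t. LINT \<xi>|lborel. A t \<xi>)"
      "(LINT t|lborel. LINT \<xi>|lborel. A t \<xi>) = (LINT \<xi>|lborel. LINT t|lborel. A t \<xi>)"
      "integrable lborel (A t)" for t
  proof -
    have m: "(\<lambda>z. A (fst z) (snd z)) \<in> borel_measurable borel" unfolding A_def by measurable
    have bd: "\<bar>A t \<xi>\<bar> \<le> bnd b * ub * C + bnd b * gbnd b * C + bnd b * ub * (C + ub * C)" if "t \<in> {a..b}" for t \<xi>
    proof -
      have t: "t \<le> b" using that by simp
      have d: "\<bar>dt \<psi> (t, \<phi> t \<xi>) - (U t \<xi> + \<gamma>) * dx \<psi> (t, \<phi> t \<xi>)\<bar> \<le> C + ub * C"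
        using box(6)[of "(t, \<phi> t \<xi>)"] mult_mono[OF U\<gamma> box(7)[of "(t, \<phi> t \<xi>)"] ub_nonneg abs_ge_zero, of t \<xi>]
        by (simp only: abs_mult[symmetric])
      show ?thesis
        using prod3[OF fields_bound(2)[OF t, of \<xi>] Ub[of t \<xi>] box(5)[of "(t, \<phi> t \<xi>)"]]
          prod3[OF fields_bound(1)[OF t, of \<xi>] G_bound[OF t, of \<xi>] box(5)[of "(t, \<phi> t \<xi>)"]]
          prod3[OF fields_bound(1)[OF t, of \<xi>] Ub[of t \<xi>] d]
        unfolding A_def by linarith
    qed
    have sp: "A t \<xi> = 0" if "\<not> (t \<in> {a..b} \<and> \<bar>\<phi> t \<xi>\<bar> \<le> R)" for t \<xi>
      using box(4)[OF that] by (simp add: A_def)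
    show "integrable lborel (\<lambda>t. LINT \<xi>|lborel. A t \<xi>)"
      "(LINT t|lborel. LINT \<xi>|lborel. A t \<xi>) = (LINT \<xi>|lborel. LINT t|lborel. A t \<xi>)" "integrable lborel (A t)"
      by (rule flow_fubini[where a=a and b=b and R=R, OF m bd sp box(1)]; assumption)+
  qed
  have Q: "integrable lborel (\<lambda>t. LINT \<xi>|lborel. Q t \<xi>)" "integrable lborel (Q t)" for t
  proof -
    have m: "(\<lambda>z. Q (fst z) (snd z)) \<in> borel_measurable borel" unfolding Q_def by measurable
    have bd: "\<bar>Q t \<xi>\<bar> \<le> bnd b * gbnd b * C" if "t \<in> {a..b}" for t \<xi>
      unfolding Q_def using that by (intro prod3 fields_bound G_bound box(5)) auto
    have sp: "Q t \<xi> = 0" if "\<not> (t \<in> {a..b} \<and> \<bar>\<phi> t \<xi>\<bar> \<le> R)" for t \<xi>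
      using box(4)[OF that] by (simp add: Q_def)
    show "integrable lborel (\<lambda>t. LINT \<xi>|lborel. Q t \<xi>)" "integrable lborel (Q t)"
      by (rule flow_fubini[where a=a and b=b and R=R, OF m bd sp box(1)]; assumption)+
  qed
  have S: "integrable lborel (S t)" "(LINT \<xi>|lborel. S t \<xi>) = 0" for t
  proof -
    have p: "primitive (\<lambda>\<xi>. U t \<xi> * (U t \<xi> + \<gamma>) * \<psi> (t, \<phi> t \<xi>)) (S t)"
      unfolding S_def[abs_def]
      by (intro primitive_mult primitive_add U_primitive primitive_const test_along_flow_space[OF \<psi>])
    have zr: "U t x * (U t x + \<gamma>) * \<psi> (t, \<phi> t x) = 0 \<and> S t x = 0" if "R + ub * \<bar>b\<bar> + 1 \<le> \<bar>x\<bar>" for x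
    proof -
      have "\<not> (t \<in> {a..b} \<and> \<bar>\<phi> t x\<bar> \<le> R)"
      proof
        assume *: "t \<in> {a..b} \<and> \<bar>\<phi> t x\<bar> \<le> R"
        have "ub * \<bar>t\<bar> \<le> ub * \<bar>b\<bar>" using * box(1) ub_nonneg by (intro mult_left_mono) auto
        then show False using \<phi>_near[of t x] * that by linarith
      qed
      then show ?thesis using box(4)[of t "\<phi> t x"] by (simp add: S_def)
    qed
    have r: "0 \<le> R + ub * \<bar>b\<bar> + 1" using box(3) ub_nonneg by simp
    show "integrable lborel (S t)" "(LINT \<xi>|lborel. S t \<xi>) = 0"
      by (rule space_integral_zero[OF p zr r]; assumption)+
  qed
  have lhs: "(LINT x|lebesgue. - u t x * dt \<psi> (t, x) - (u t x + \<gamma>) * weak_deriv (u t) x * \<psi> (t, x))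
      = (LINT \<xi>|lborel. Q t \<xi>) - (LINT \<xi>|lborel. A t \<xi>)" for t
  proof -
    let ?f = "\<lambda>x. - u t x * dt \<psi> (t, x) - (u t x + \<gamma>) * w t x * \<psi> (t, x)"
    have fm: "?f \<in> borel_measurable borel" by measurable
    then have fm': "?f \<in> borel_measurable lebesgue" by (simp add: measurable_completion)
    have ae: "AE x in lebesgue. ?f x = - u t x * dt \<psi> (t, x) - (u t x + \<gamma>) * weak_deriv (u t) x * \<psi> (t, x)"
      using weak_deriv_AE_lebesgue[OF u_weak_deriv[of t]] by eventually_elim simp
    have "(LINT x|lebesgue. - u t x * dt \<psi> (t, x) - (u t x + \<gamma>) * weak_deriv (u t) x * \<psi> (t, x)) = (LINT x|lebesgue. ?f x)"
    proof (rule integral_cong_AE)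
      show "(\<lambda>x. - u t x * dt \<psi> (t, x) - (u t x + \<gamma>) * weak_deriv (u t) x * \<psi> (t, x)) \<in> borel_measurable lebesgue"
        by (rule borel_measurable_AE[OF fm' ae])
      show "AE x in lebesgue. - u t x * dt \<psi> (t, x) - (u t x + \<gamma>) * weak_deriv (u t) x * \<psi> (t, x) = ?f x"
        using ae by eventually_elim (rule sym)
    qed (rule fm')
    also have "\<dots> = (LINT x|lborel. ?f x)" by (rule integral_lebesgue_lborel[OF fm])
    also have "\<dots> = (LINT \<xi>|lborel. J t \<xi> * ?f (\<phi> t \<xi>))" by (rule \<phi>_change[OF fm])
    also have "\<dots> = (LINT \<xi>|lborel. (Q t \<xi> - A t \<xi>) - S t \<xi>)"
    proof (rule Bochner_Integration.integral_cong[OF refl])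
      fix \<xi>
      have "J t \<xi> \<noteq> 0" using J_pos[of t \<xi>] by simp
      then show "J t \<xi> * ?f (\<phi> t \<xi>) = (Q t \<xi> - A t \<xi>) - S t \<xi>"
        by (simp add: u_def w_def A_def Q_def S_def field_simps)
    qed
    finally show ?thesis using A(3)[of t] Q(2)[of t] S[of t] by simp
  qed
  have rhs: "(LINT x|lebesgue. conv (deriv green) (source \<mu> (u t) (\<rho> t)) x * \<psi> (t, x)) = (LINT \<xi>|lborel. Q t \<xi>)" for t
  proof -
    have "(LINT x|lebesgue. conv (deriv green) (source \<mu> (u t) (\<rho> t)) x * \<psi> (t, x)) = (LINT x|lebesgue. G t (X t x) * \<psi> (t, x))"
      by (simp only: conv_eq_G)
    also have "\<dots> = (LINT x|lborel. G t (X t x) * \<psi> (t, x))"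
      by (rule integral_lebesgue_lborel) measurable
    also have "\<dots> = (LINT \<xi>|lborel. J t \<xi> * (G t (X t (\<phi> t \<xi>)) * \<psi> (t, \<phi> t \<xi>)))"
      by (rule \<phi>_change) measurable
    also have "\<dots> = (LINT \<xi>|lborel. Q t \<xi>)" by (simp add: Q_def mult.assoc)
    finally show ?thesis .
  qed
  have "(LINT t|lborel. A t \<xi>) = 0" for \<xi>
  proof (rule time_integral_zero[of "\<lambda>t. g t \<xi>", OF _ box(1,2)])
    show "((\<lambda>t. g t \<xi>) has_real_derivative A t \<xi>) (at t within {0..})" if "t \<ge> 0" for t
      using DERIV_mult[OF DERIV_mult[OF J_deriv[OF that, of \<xi>] U_deriv[OF that, of \<xi>]] test_along_flow_time[OF \<psi> that, of \<xi>]]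
      unfolding g_def A_def by (simp add: algebra_simps)
    show "g t \<xi> = 0 \<and> A t \<xi> = 0" if "t \<notin> {a..b}" for t
      using box(4)[of t "\<phi> t \<xi>"] that by (auto simp: A_def g_def)
  qed
  then have A0: "(LINT t|lborel. LINT \<xi>|lborel. A t \<xi>) = 0" using A(2) by simp
  have "(LINT t|lebesgue. LINT x|lebesgue. - u t x * dt \<psi> (t, x) - (u t x + \<gamma>) * weak_deriv (u t) x * \<psi> (t, x))
      = (LINT t|lborel. (LINT \<xi>|lborel. Q t \<xi>) - (LINT \<xi>|lborel. A t \<xi>))"
    unfolding lhs by (rule integral_lebesgue_lborel) (use Q(1) A(1) in auto)
  also have "\<dots> = (LINT t|lborel. LINT \<xi>|lborel. Q t \<xi>)"
    using A0 Bochner_Integration.integral_diff[OF Q(1) A(1)] by simp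
  also have "\<dots> = (LINT t|lebesgue. LINT \<xi>|lborel. Q t \<xi>)"
    by (rule integral_lebesgue_lborel[symmetric]) (use Q(1) in auto)
  finally show ?thesis unfolding rhs .
qed

end

section \<open>Functions of time\<close>

text \<open>
  A continuous curve is the limit of the step functions that sample it on finer and finer grids, with
  grid points up to \<open>n\<close> at stage \<open>n\<close> to make the range finite.
\<close>

lemma C_into_strongly_measurable:
  assumes z: "z \<in> C_into {0..} X N" and N0: "N 0 = 0" and I: "I \<in> sets borel" "I \<subseteq> {0..}"
  shows "strongly_measurable I X N z"
  unfolding strongly_measurable_def
proof (intro exI conjI allI AE_I2)
  define k where "k n t = min (n * Suc n) (nat \<lfloor>t * real (Suc n)\<rfloor>)" for n :: nat and t :: real
  define d where "d n t = real (k n t) / real (Suc n)" for n t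
  have d0: "d n t \<ge> 0" for n t by (simp add: d_def)
  fix n
  have fin: "(\<lambda>t. z (d n t)) ` I \<subseteq> (\<lambda>j. z (real j / real (Suc n))) ` {..n * Suc n}"
    by (auto simp: d_def k_def)
  show "finite ((\<lambda>t. z (d n t)) ` I)" by (rule finite_subset[OF fin]) simp
  show "(\<lambda>t. z (d n t)) ` I \<subseteq> X" using z d0 by (auto simp: C_into_def)
  show "{t \<in> I. z (d n t) = a} \<in> sets lebesgue" for a
  proof -
    have [measurable]: "k n \<in> measurable borel (count_space UNIV)" unfolding k_def[abs_def] by measurable
    have "k n -` {j. z (real j / real (Suc n)) = a} \<inter> space borel \<in> sets borel"
      by (rule measurable_sets[of _ _ "count_space UNIV"]) auto
    moreover have "{t \<in> I. z (d n t) = a} = I \<inter> (k n -` {j. z (real j / real (Suc n)) = a} \<inter> space borel)"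
      by (auto simp: d_def)
    ultimately have "{t \<in> I. z (d n t) = a} \<in> sets borel" using I(1) by simp
    then show ?thesis by simp
  qed
next
  fix t assume "t \<in> space (lebesgue_on I)"
  then have t: "t \<ge> 0" using I(2) by auto
  define k where "k n t = min (n * Suc n) (nat \<lfloor>t * real (Suc n)\<rfloor>)" for n :: nat and t :: real
  define d where "d n t = real (k n t) / real (Suc n)" for n t
  have d0: "d n t \<ge> 0" for n t by (simp add: d_def)
  have close: "\<bar>d n t - t\<bar> \<le> 1 / real (Suc n)" if "t \<le> real n" for n
  proof -
    have fl: "real (nat \<lfloor>t * real (Suc n)\<rfloor>) \<le> t * real (Suc n)" "t * real (Suc n) \<le> real (nat \<lfloor>t * real (Suc n)\<rfloor>) + 1"
      using t by (auto simp: of_nat_nat)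
    have "t * real (Suc n) \<le> real n * real (Suc n)" using that by (intro mult_right_mono) auto
    then have "real (nat \<lfloor>t * real (Suc n)\<rfloor>) \<le> real (n * Suc n)" using fl(1) by (simp only: of_nat_mult)
    then have "k n t = nat \<lfloor>t * real (Suc n)\<rfloor>" unfolding k_def by (simp only: of_nat_le_iff min_absorb2)
    then have "\<bar>real (k n t) - t * real (Suc n)\<bar> \<le> 1" using fl by linarith
    moreover have "d n t - t = (real (k n t) - t * real (Suc n)) / real (Suc n)"
      by (simp add: d_def diff_divide_distrib del: of_nat_Suc)
    ultimately show ?thesis by (simp add: divide_right_mono del: of_nat_Suc)
  qed
  have lim: "((\<lambda>s. N (z s - z t)) \<longlongrightarrow> 0) (at t within {0..})" using z t by (auto simp: C_into_def)
  have "(\<lambda>n. N (z (d n t) - z t)) \<longlonglongrightarrow> 0"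
  proof (rule tendstoI)
    fix e :: real assume "e > 0"
    from tendstoD[OF lim this] obtain \<delta> where \<delta>: "\<delta> > 0"
      "\<And>s. s \<in> {0..} \<Longrightarrow> s \<noteq> t \<Longrightarrow> dist s t < \<delta> \<Longrightarrow> dist (N (z s - z t)) 0 < e"
      unfolding eventually_at by auto
    have "dist (N (z s - z t)) 0 < e" if "s \<ge> 0" "\<bar>s - t\<bar> < \<delta>" for s
      using \<delta>(2)[of s] that N0 \<open>e > 0\<close> by (cases "s = t") (auto simp: dist_real_def)
    note near = this
    obtain m where m: "1 / real (Suc m) < \<delta>" using \<delta>(1) nat_approx_posE by blast
    show "\<forall>\<^sub>F n in sequentially. dist (N (z (d n t) - z t)) 0 < e"
      unfolding eventually_sequentially
    proof (intro exI allI impI)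
      fix n assume n: "max m (nat \<lceil>t\<rceil>) \<le> n"
      then have "t \<le> real n" by linarith
      from close[OF this] have "\<bar>d n t - t\<bar> \<le> 1 / real (Suc n)" .
      also have "\<dots> \<le> 1 / real (Suc m)" using n by (intro divide_left_mono) auto
      finally show "dist (N (z (d n t) - z t)) 0 < e" using m by (intro near d0) auto
    qed
  qed
  then show "(\<lambda>n. N (z (real (min (n * Suc n) (nat \<lfloor>t * real (Suc n)\<rfloor>)) / real (Suc n)) - z t)) \<longlonglongrightarrow> 0"
    by (simp add: d_def k_def)
qed

lemma locally_ess_boundedI:
  assumes "\<And>T. \<exists>M. \<forall>t\<in>I. t \<le> T \<longrightarrow> h t \<le> M"
  shows "locally_ess_bounded I h"
  unfolding locally_ess_bounded_def
proof (intro allI impI)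
  fix K :: "real set" assume K: "compact K \<and> K \<subseteq> I"
  then obtain T where T: "\<And>t. t \<in> K \<Longrightarrow> norm t \<le> T" using compact_imp_bounded bounded_iff by metis
  obtain M where M: "\<And>t. t \<in> I \<Longrightarrow> t \<le> T \<Longrightarrow> h t \<le> M" using assms by blast
  have "h t \<le> M" if "t \<in> K" for t using M[of t] T[OF that] K that by auto
  then show "\<exists>M. AE t in lebesgue_on K. h t \<le> M" by (intro exI[of _ M] AE_I2) auto
qed

text \<open>
  Fubini's theorem, once the integrable function that is paired with \<open>f\<close> is replaced by a Borel version.
\<close>

lemma weakstar_measurableI:
  assumes f: "(\<lambda>z. f (fst z) (snd z)) \<in> borel_measurable borel"
  shows "weakstar_measurable I f"
  unfolding weakstar_measurable_def
proof
  fix \<phi> assume "\<phi> \<in> L1"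
  then have \<phi>m: "\<phi> \<in> borel_measurable circle" by (auto simp: L1_def)
  then have "(\<lambda>x. if x \<in> {0..1} then \<phi> x else 0) \<in> borel_measurable lebesgue"
    by (subst borel_measurable_if) auto
  then obtain h where h: "h \<in> borel_measurable lborel" "AE x in lborel. (if x \<in> {0..1} then \<phi> x else 0) = h x"
    using completion_ex_borel_measurable_real by blast
  have [measurable]: "h \<in> borel_measurable borel" using h(1) by simp
  have "AE x in lebesgue. (if x \<in> {0..1} then \<phi> x else 0) = h x" using h(2) AE_completion by blast
  then have "AE x in lebesgue. x \<in> {0..1} \<longrightarrow> \<phi> x = h x" by eventually_elim auto
  then have ae: "AE x in circle. \<phi> x = h x" by (subst AE_restrict_space_iff) auto
  have fm [measurable]: "(\<lambda>z. f (fst z) (snd z)) \<in> borel_measurable (borel \<Otimes>\<^sub>M borel)"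
    using f by (simp add: borel_prod)
  have ft: "f t \<in> borel_measurable borel" for t
    using measurable_compose[OF measurable_Pair1'[of t borel borel] fm] by simp
  have "(LINT x|circle. f t x * \<phi> x) = (LINT x|lborel. indicator {0..1} x * (f t x * h x))" for t
  proof -
    have "(LINT x|circle. f t x * \<phi> x) = (LINT x|circle. f t x * h x)"
    proof (rule integral_cong_AE)
      show "(\<lambda>x. f t x * \<phi> x) \<in> borel_measurable circle" "(\<lambda>x. f t x * h x) \<in> borel_measurable circle"
        using borel_measurable_circle[OF ft] \<phi>m borel_measurable_circle[of h] by (auto intro!: borel_measurable_times)
      show "AE x in circle. f t x * \<phi> x = f t x * h x" using ae by eventually_elim simp
    qed
    also have "\<dots> = mean (\<lambda>x. f t x * h x)" by (simp add: mean_def)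
    also have "\<dots> = (LINT x|lborel. indicator {0..1} x * (f t x * h x))"
      by (rule mean_lborel) (use ft in measurable)
    finally show ?thesis .
  qed
  moreover have "(\<lambda>t. LINT x|lborel. indicator {0..1} x * (f t x * h x)) \<in> borel_measurable borel"
  proof (rule lborel.borel_measurable_lebesgue_integral)
    have "(\<lambda>z. indicator {0..1} (snd z) * (f (fst z) (snd z) * h (snd z))) \<in> borel_measurable (borel \<Otimes>\<^sub>M borel)"
      by measurable
    then show "(\<lambda>(t, x). indicator {0..1} x * (f t x * h x)) \<in> borel_measurable (borel \<Otimes>\<^sub>M lborel)"
      by (simp add: case_prod_beta' cong: measurable_cong_sets)
  qed
  ultimately show "(\<lambda>t. LINT x|circle. f t x * \<phi> x) \<in> borel_measurable (lebesgue_on I)"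
    by (simp add: measurable_completion measurable_restrict_space1)
qed

lemma weakstar_measurable_cong:
  assumes "weakstar_measurable I f" "\<And>t. AE x in circle. f t x = g t x"
    "\<And>t. f t \<in> borel_measurable circle" "\<And>t. g t \<in> borel_measurable circle"
  shows "weakstar_measurable I g"
  unfolding weakstar_measurable_def
proof
  fix \<phi> assume \<phi>: "\<phi> \<in> L1"
  then have [measurable]: "\<phi> \<in> borel_measurable circle" by (auto simp: L1_def)
  have eq: "(LINT x|circle. f t x * \<phi> x) = (LINT x|circle. g t x * \<phi> x)" for t
  proof (rule integral_cong_AE)
    show "(\<lambda>x. f t x * \<phi> x) \<in> borel_measurable circle" "(\<lambda>x. g t x * \<phi> x) \<in> borel_measurable circle"
      using assms(3,4) by (auto intro!: borel_measurable_times)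
    show "AE x in circle. f t x * \<phi> x = g t x * \<phi> x" using assms(2)[of t] by eventually_elim simp
  qed
  show "(\<lambda>t. LINT x|circle. g t x * \<phi> x) \<in> borel_measurable (lebesgue_on I)"
    using bspec[OF assms(1)[unfolded weakstar_measurable_def] \<phi>] by (simp only: eq)
qed

lemma norm_L2_sq: "(norm_L2 f)\<^sup>2 = mean (\<lambda>x. (f x)\<^sup>2)"
proof -
  have "0 \<le> (LINT x|circle. (f x)\<^sup>2)" by (rule integral_nonneg_AE) auto
  then show ?thesis by (simp add: norm_L2_def mean_def)
qed

lemma norm_H1_L2_zero: "norm_H1_L2 0 = 0"
proof -
  have wd: "is_weak_deriv (0 :: real \<Rightarrow> real) 0"
    by (simp add: is_weak_deriv_def L1_def periodic_fun_simple'_def zero_fun_def)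
  have z: "norm_L2 (0 :: real \<Rightarrow> real) = 0" by (simp add: norm_L2_def)
  have "norm_L2 (weak_deriv (0 :: real \<Rightarrow> real)) = norm_L2 (0 :: real \<Rightarrow> real)"
    by (rule norm_L2_cong_AE[OF weak_deriv_circle[OF wd] _ weak_deriv_AE[OF wd]]) (simp add: zero_fun_def)
  then show ?thesis using z by (simp add: norm_H1_L2_def norm_H1_def)
qed

lemma norm_L2_nonneg: "0 \<le> norm_L2 f"
proof -
  have "0 \<le> (LINT x|circle. (f x)\<^sup>2)" by (rule integral_nonneg_AE) auto
  then show ?thesis by (simp add: norm_L2_def)
qed

text \<open>
  Bounded Borel functions are limits of continuous functions with the same bound, almost everywhere
  and hence in the mean square on bounded intervals.
\<close>

lemma continuous_L2_approximation:
  fixes h :: "real \<Rightarrow> real"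
  assumes h: "h \<in> borel_measurable borel" "\<And>x. \<bar>h x\<bar> \<le> C" and "\<eta> > 0"
  obtains g where "continuous_on UNIV g" "\<And>x. \<bar>g x\<bar> \<le> C"
    "(LINT x|lborel. indicator {-R..R} x * (h x - g x)\<^sup>2) < \<eta>"
proof -
  have C: "0 \<le> C" using h(2)[of 0] by linarith
  have "h \<in> borel_measurable lebesgue" using h(1) by (simp add: measurable_completion)
  then have "h measurable_on UNIV" by (rule lebesgue_measurable_imp_measurable_on) simp
  then obtain S g where S: "negligible S" and g: "\<And>n. continuous_on UNIV (g n)"
    "\<And>x. x \<notin> S \<Longrightarrow> (\<lambda>n. g n x) \<longlonglongrightarrow> h x"
    unfolding measurable_on_def by auto
  define k where "k n x = max (- C) (min C (g n x))" for n :: nat and x :: real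
  have k_cont: "continuous_on UNIV (k n)" for n unfolding k_def by (intro continuous_intros g)
  have k_bound: "\<bar>k n x\<bar> \<le> C" for n x using C by (auto simp: k_def)
  have [measurable]: "h \<in> borel_measurable borel" "k n \<in> borel_measurable borel" for n
    using h(1) borel_measurable_continuous_onI[OF k_cont] by auto
  have "(\<lambda>n. LINT x|lborel. indicator {-R..R} x * (h x - k n x)\<^sup>2) \<longlonglongrightarrow> (LINT x::real|lborel. 0)"
  proof (rule integral_dominated_convergence[where w="\<lambda>x. indicator {-R..R} x * (2 * C)\<^sup>2"])
    show "integrable lborel (\<lambda>x. indicator {-R..R} x * (2 * C)\<^sup>2)"
      by (intro integrable_mult_left integrable_real_indicator) (auto simp: emeasure_lborel_Icc_eq)
    show "AE x in lborel. norm (indicator {-R..R} x * (h x - k n x)\<^sup>2) \<le> indicator {-R..R} x * (2 * C)\<^sup>2" for n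
    proof (rule AE_I2)
      fix x
      have "\<bar>h x - k n x\<bar> \<le> 2 * C" using h(2)[of x] k_bound[of n x] by linarith
      then have "(h x - k n x)\<^sup>2 \<le> (2 * C)\<^sup>2" by (metis abs_ge_zero power2_abs power_mono)
      then show "norm (indicator {-R..R} x * (h x - k n x)\<^sup>2) \<le> indicator {-R..R} x * (2 * C)\<^sup>2"
        by (simp add: indicator_def)
    qed
    have "AE x in lebesgue. x \<notin> S" using S by (intro AE_not_in) (simp add: negligible_iff_null_sets)
    then have "AE x in lborel. x \<notin> S" by (simp add: AE_completion_iff)
    then show "AE x in lborel. (\<lambda>n. indicator {-R..R} x * (h x - k n x)\<^sup>2) \<longlonglongrightarrow> 0"
    proof eventually_elim
      case (elim x)
      have "(\<lambda>n. k n x) \<longlonglongrightarrow> max (- C) (min C (h x))"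
        unfolding k_def by (intro tendsto_intros g(2)[OF elim])
      also have "max (- C) (min C (h x)) = h x" using h(2)[of x] by (auto simp: abs_le_iff)
      finally have "(\<lambda>n. indicator {-R..R} x * (h x - k n x)\<^sup>2) \<longlonglongrightarrow> indicator {-R..R} x * (h x - h x)\<^sup>2"
        by (intro tendsto_intros)
      then show ?case by simp
    qed
  qed measurable
  then have "(\<lambda>n. LINT x|lborel. indicator {-R..R} x * (h x - k n x)\<^sup>2) \<longlonglongrightarrow> 0" by simp
  from order_tendstoD(2)[OF this \<open>\<eta> > 0\<close>] obtain n where
    "(LINT x|lborel. indicator {-R..R} x * (h x - k n x)\<^sup>2) < \<eta>"
    unfolding eventually_sequentially by blast
  then show ?thesis using that[of "k n"] k_cont k_bound by blast
qed

context lagrangian_data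
begin

section \<open>Strong continuity in time\<close>

lemma X_near: "\<bar>X t x - x\<bar> \<le> ub * \<bar>t\<bar>"
  using \<phi>_near[of t "X t x"] by (simp add: abs_minus_commute)

text \<open>
  A square integral at time \<open>s\<close> is controlled by one over labels, uniformly in \<open>s\<close>: the Jacobian is at
  most \<open>bnd T\<close>, and the labels of the particles that are in the unit interval at time \<open>s\<close> have moved by
  at most \<open>ub * T\<close>.
\<close>

lemma mean_X_le:
  assumes k: "k \<in> borel_measurable borel" "\<And>\<xi>. 0 \<le> k \<xi>" "\<And>\<xi>. k \<xi> \<le> C"
    and s: "0 \<le> s" "s \<le> T"
  shows "mean (\<lambda>x. k (X s x)) \<le> bnd T * (LINT \<xi>|lborel. indicator {- (1 + ub * T)..1 + ub * T} \<xi> * k \<xi>)"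
proof -
  let ?R = "1 + ub * T"
  have [measurable]: "k \<in> borel_measurable borel" by fact
  have "mean (\<lambda>x. k (X s x)) = (LINT x|lborel. indicator {0..1} x * k (X s x))"
    by (rule mean_lborel) measurable
  also have "\<dots> = (LINT \<xi>|lborel. J s \<xi> * (indicator {0..1} (\<phi> s \<xi>) * k (X s (\<phi> s \<xi>))))"
    by (rule \<phi>_change) measurable
  also have "\<dots> \<le> (LINT \<xi>|lborel. bnd T * (indicator {- ?R..?R} \<xi> * k \<xi>))"
  proof (rule integral_mono')
    have "integrable lborel (\<lambda>\<xi>. indicator {- ?R..?R} \<xi> * k \<xi>)"
    proof (rule Bochner_Integration.integrable_bound[where f="\<lambda>\<xi>. indicator {- ?R..?R} \<xi> * C"])
      show "integrable lborel (\<lambda>\<xi>. indicator {- ?R..?R} \<xi> * C)"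
        by (intro integrable_mult_left integrable_real_indicator) (auto simp: emeasure_lborel_Icc_eq)
      show "AE x in lborel. norm (indicator {- ?R..?R} x * k x) \<le> norm (indicator {- ?R..?R} x * C)"
      proof (rule AE_I2)
        fix x
        have "\<bar>k x\<bar> \<le> \<bar>C\<bar>" using k(2)[of x] k(3)[of x] by linarith
        then show "norm (indicator {- ?R..?R} x * k x) \<le> norm (indicator {- ?R..?R} x * C)"
          by (simp add: indicator_def)
      qed
    qed measurable
    then show "integrable lborel (\<lambda>\<xi>. bnd T * (indicator {- ?R..?R} \<xi> * k \<xi>))" by simp
    fix \<xi>
    show "0 \<le> bnd T * (indicator {- ?R..?R} \<xi> * k \<xi>)" using bnd_nonneg k(2) by simp
    show "J s \<xi> * (indicator {0..1} (\<phi> s \<xi>) * k (X s (\<phi> s \<xi>))) \<le> bnd T * (indicator {- ?R..?R} \<xi> * k \<xi>)"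
    proof (cases "\<phi> s \<xi> \<in> {0..1}")
      case True
      have "ub * \<bar>s\<bar> \<le> ub * T" using s ub_nonneg by (intro mult_left_mono) auto
      then have "\<bar>\<xi>\<bar> \<le> ?R" using \<phi>_near[of s \<xi>] True by auto
      then have "\<xi> \<in> {- ?R..?R}" by auto
      moreover have "J s \<xi> * k \<xi> \<le> bnd T * k \<xi>" using J_bounds(2)[OF s(2)] k(2) by (intro mult_right_mono) auto
      ultimately show ?thesis using True by simp
    next
      case False
      then show ?thesis using bnd_nonneg k(2) by simp
    qed
  qed
  finally show ?thesis by simp
qed

text \<open>
  Two things change between the times \<open>t\<close> and \<open>s\<close>: the field, which is uniformly Lipschitz in time, and
  the label at a given point. The field may jump in the label, so at the time \<open>t\<close> it is replaced by a
  continuous function \<open>g\<close>; the error is small in the mean square at both times by \<open>mean_X_le\<close>.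
\<close>

lemma transported_L2_continuous:
  fixes f :: "real \<Rightarrow> real \<Rightarrow> real"
  assumes fm: "\<And>s. f s \<in> borel_measurable borel"
    and fb: "\<And>s T \<xi>. 0 \<le> s \<Longrightarrow> s \<le> T \<Longrightarrow> \<bar>f s \<xi>\<bar> \<le> C T"
    and fl: "\<And>s t T \<xi>. 0 \<le> s \<Longrightarrow> s \<le> T \<Longrightarrow> 0 \<le> t \<Longrightarrow> t \<le> T \<Longrightarrow> \<bar>f s \<xi> - f t \<xi>\<bar> \<le> L T * \<bar>s - t\<bar>"
    and t: "0 \<le> t"
  shows "((\<lambda>s. norm_L2 (\<lambda>x. f s (X s x) - f t (X t x))) \<longlongrightarrow> 0) (at t within {0..})"
proof -
  define T where "T = t + 1"
  define R where "R = 1 + ub * T"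
  note [measurable] = fm
  have tT: "0 \<le> t" "t \<le> T" using t by (auto simp: T_def)
  have "((\<lambda>s. mean (\<lambda>x. (f s (X s x) - f t (X t x))\<^sup>2)) \<longlongrightarrow> 0) (at t within {0..})"
  proof (rule tendstoI)
    fix e :: real assume e: "e > 0"
    \<comment> \<open>The difference is split into four summands, so its square is at most four times the sum of their
      squares. Two of these are at most \<open>\<kappa>\<^sup>2 = e / 64\<close>, and two have mean at most \<open>e / 32\<close>; the total
      is \<open>3 e / 8\<close>.\<close>
    define \<eta> where "\<eta> = e / (32 * bnd T)"
    have \<eta>: "\<eta> > 0" using e bnd_pos[of T] by (simp add: \<eta>_def)
    obtain g where g: "continuous_on UNIV g" "\<And>x. \<bar>g x\<bar> \<le> C T"
      "(LINT x|lborel. indicator {-R..R} x * (f t x - g x)\<^sup>2) < \<eta>"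
      using continuous_L2_approximation[OF fm fb[OF tT] \<eta>] by blast
    have [measurable]: "g \<in> borel_measurable borel" by (rule borel_measurable_continuous_onI[OF g(1)])
    define k where "k \<xi> = (f t \<xi> - g \<xi>)\<^sup>2" for \<xi>
    have km [measurable]: "k \<in> borel_measurable borel" unfolding k_def by measurable
    have k0: "0 \<le> k \<xi>" for \<xi> by (simp add: k_def)
    have kb: "k \<xi> \<le> (2 * C T)\<^sup>2" for \<xi>
    proof -
      have "\<bar>f t \<xi> - g \<xi>\<bar> \<le> 2 * C T" using fb[OF tT, of \<xi>] g(2)[of \<xi>] by linarith
      then show ?thesis unfolding k_def by (metis abs_ge_zero power2_abs power_mono)
    qed
    have k_mean: "mean (\<lambda>x. k (X s x)) \<le> e / 32" if "0 \<le> s" "s \<le> T" for s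
    proof -
      have "mean (\<lambda>x. k (X s x)) \<le> bnd T * (LINT \<xi>|lborel. indicator {-R..R} \<xi> * k \<xi>)"
        unfolding R_def by (rule mean_X_le[OF km k0 kb that])
      also have "\<dots> \<le> bnd T * \<eta>" using g(3) bnd_nonneg by (intro mult_left_mono) (auto simp: k_def)
      finally show ?thesis using bnd_pos[of T] by (simp add: \<eta>_def)
    qed
    define \<kappa> where "\<kappa> = sqrt e / 8"
    have \<kappa>: "\<kappa> > 0" "\<kappa>\<^sup>2 = e / 64" using e by (auto simp: \<kappa>_def power_divide)
    have "uniformly_continuous_on {-R..R} g"
      by (rule compact_uniformly_continuous[OF continuous_on_subset[OF g(1)]]) auto
    then obtain \<delta> where \<delta>: "\<delta> > 0" "\<And>x y. x \<in> {-R..R} \<Longrightarrow> y \<in> {-R..R} \<Longrightarrow> \<bar>x - y\<bar> < \<delta> \<Longrightarrow> \<bar>g x - g y\<bar> < \<kappa>"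
      unfolding uniformly_continuous_on_def dist_real_def using \<kappa>(1) by metis
    define r where "r = min 1 (min (\<delta> * low T / (ub + 1)) (\<kappa> / (\<bar>L T\<bar> + 1)))"
    have r: "r > 0" using \<delta>(1) \<kappa>(1) low_pos[of T] ub_nonneg by (simp add: r_def add_nonneg_pos)
    have main: "mean (\<lambda>x. (f s (X s x) - f t (X t x))\<^sup>2) < e" if s: "0 \<le> s" "\<bar>s - t\<bar> < r" for s
    proof -
      have "\<bar>s - t\<bar> < 1" using s(2) by (simp add: r_def)
      then have sT: "s \<le> T" unfolding T_def by linarith
      have XR: "X s' x \<in> {-R..R}" if "0 \<le> s'" "s' \<le> T" "x \<in> {0..1}" for s' x
      proof -
        have "ub * \<bar>s'\<bar> \<le> ub * T" using that ub_nonneg by (intro mult_left_mono) auto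
        then have "\<bar>X s' x\<bar> \<le> R" using X_near[of s' x] that(3) unfolding R_def by auto
        then show ?thesis by auto
      qed
      have Xc: "\<bar>X s x - X t x\<bar> < \<delta>" for x
      proof -
        have "\<bar>s - t\<bar> < \<delta> * low T / (ub + 1)" using s(2) by (simp add: r_def)
        then have "\<bar>s - t\<bar> * (ub + 1) < \<delta> * low T" using ub_nonneg by (simp add: pos_less_divide_eq)
        moreover have "ub * \<bar>s - t\<bar> \<le> \<bar>s - t\<bar> * (ub + 1)" by (simp add: algebra_simps)
        ultimately have "ub * \<bar>s - t\<bar> / low T < \<delta>" using low_pos[of T] by (simp add: pos_divide_less_eq)
        then show ?thesis using X_lipschitz[OF sT, of x t x] by simp
      qed
      have Lk: "L T * \<bar>s - t\<bar> \<le> \<kappa>"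
      proof -
        have "L T * \<bar>s - t\<bar> \<le> (\<bar>L T\<bar> + 1) * \<bar>s - t\<bar>" by (intro mult_right_mono) auto
        also have "\<dots> \<le> (\<bar>L T\<bar> + 1) * (\<kappa> / (\<bar>L T\<bar> + 1))"
          using s(2) by (intro mult_left_mono) (auto simp: r_def)
        also have "\<dots> = \<kappa>" by simp
        finally show ?thesis .
      qed
      have pt: "(f s (X s x) - f t (X t x))\<^sup>2 \<le> (4 * \<kappa>\<^sup>2 + 4 * \<kappa>\<^sup>2) + (4 * k (X s x) + 4 * k (X t x))"
        if x: "x \<in> {0..1}" for x
      proof -
        let ?a = "f s (X s x) - f t (X s x)" and ?b = "f t (X s x) - g (X s x)"
        let ?c = "g (X s x) - g (X t x)" and ?d = "g (X t x) - f t (X t x)"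
        have sq: "z\<^sup>2 \<le> \<kappa>\<^sup>2" if "\<bar>z\<bar> \<le> \<kappa>" for z using that by (metis abs_ge_zero power2_abs power_mono)
        have "\<bar>?a\<bar> \<le> \<kappa>" using fl[OF s(1) sT tT] Lk by (meson order_trans)
        moreover have "\<bar>?c\<bar> \<le> \<kappa>" using \<delta>(2)[OF XR[OF s(1) sT x] XR[OF tT x] Xc] by simp
        ultimately have ac: "?a\<^sup>2 \<le> \<kappa>\<^sup>2" "?c\<^sup>2 \<le> \<kappa>\<^sup>2" using sq by blast+
        have "(?a + ?b + ?c + ?d)\<^sup>2 \<le> 4 * (?a\<^sup>2 + ?b\<^sup>2 + ?c\<^sup>2 + ?d\<^sup>2)"
        proof -
          have "0 \<le> (?a - ?b)\<^sup>2 + (?a - ?c)\<^sup>2 + (?a - ?d)\<^sup>2 + (?b - ?c)\<^sup>2 + (?b - ?d)\<^sup>2 + (?c - ?d)\<^sup>2"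
            by (intro add_nonneg_nonneg zero_le_power2)
          then show ?thesis by (simp add: power2_eq_square algebra_simps)
        qed
        moreover have "?a + ?b + ?c + ?d = f s (X s x) - f t (X t x)" by simp
        moreover have "?d\<^sup>2 = k (X t x)" by (simp add: k_def power2_commute)
        ultimately show ?thesis using ac by (simp add: k_def)
      qed
      have kb': "\<bar>4 * k (X s' x)\<bar> \<le> 4 * (2 * C T)\<^sup>2" for s' x using kb[of "X s' x"] k0[of "X s' x"] by simp
      have kb2: "\<bar>4 * k (X s x) + 4 * k (X t x)\<bar> \<le> 4 * (2 * C T)\<^sup>2 + 4 * (2 * C T)\<^sup>2" for x
        using kb'[of s x] kb'[of t x] by linarith
      have fb2: "\<bar>(f s (X s x) - f t (X t x))\<^sup>2\<bar> \<le> (2 * C T)\<^sup>2" for x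
      proof -
        have "\<bar>f s (X s x) - f t (X t x)\<bar> \<le> 2 * C T"
          using fb[OF s(1) sT, of "X s x"] fb[OF tT, of "X t x"] by linarith
        then have "(f s (X s x) - f t (X t x))\<^sup>2 \<le> (2 * C T)\<^sup>2" by (metis abs_ge_zero power2_abs power_mono)
        then show ?thesis by simp
      qed
      have tot: "\<bar>(4 * \<kappa>\<^sup>2 + 4 * \<kappa>\<^sup>2) + (4 * k (X s x) + 4 * k (X t x))\<bar>
          \<le> \<bar>4 * \<kappa>\<^sup>2 + 4 * \<kappa>\<^sup>2\<bar> + (4 * (2 * C T)\<^sup>2 + 4 * (2 * C T)\<^sup>2)" for x
        using kb2[of x] by linarith
      have "mean (\<lambda>x. (f s (X s x) - f t (X t x))\<^sup>2)
          \<le> mean (\<lambda>x. (4 * \<kappa>\<^sup>2 + 4 * \<kappa>\<^sup>2) + (4 * k (X s x) + 4 * k (X t x)))"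
        by (rule mean_mono[OF _ _ fb2 tot pt]) measurable
      also have "\<dots> = mean (\<lambda>x. 4 * \<kappa>\<^sup>2 + 4 * \<kappa>\<^sup>2) + mean (\<lambda>x. 4 * k (X s x) + 4 * k (X t x))"
        by (rule mean_add(1)[OF _ _ order_refl kb2]) measurable
      also have "mean (\<lambda>x. 4 * k (X s x) + 4 * k (X t x)) = mean (\<lambda>x. 4 * k (X s x)) + mean (\<lambda>x. 4 * k (X t x))"
        by (rule mean_add(1)[OF _ _ kb' kb']) measurable
      finally have "mean (\<lambda>x. (f s (X s x) - f t (X t x))\<^sup>2)
          \<le> (4 * \<kappa>\<^sup>2 + 4 * \<kappa>\<^sup>2) + (4 * mean (\<lambda>x. k (X s x)) + 4 * mean (\<lambda>x. k (X t x)))"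
        by (simp only: mean_cmult mean_const)
      also have "\<dots> \<le> (4 * \<kappa>\<^sup>2 + 4 * \<kappa>\<^sup>2) + (4 * (e / 32) + 4 * (e / 32))"
        using k_mean[OF s(1) sT] k_mean[OF tT] by (intro add_mono mult_left_mono) auto
      also have "\<dots> < e" using e unfolding \<kappa>(2) by simp
      finally show ?thesis .
    qed
    show "\<forall>\<^sub>F s in at t within {0..}. dist (mean (\<lambda>x. (f s (X s x) - f t (X t x))\<^sup>2)) 0 < e"
      unfolding eventually_at
    proof (intro exI[of _ r] conjI ballI impI r)
      fix s assume "s \<in> {0..}" "s \<noteq> t \<and> dist s t < r"
      then have "mean (\<lambda>x. (f s (X s x) - f t (X t x))\<^sup>2) < e" by (intro main) (auto simp: dist_real_def)
      moreover have "0 \<le> mean (\<lambda>x. (f s (X s x) - f t (X t x))\<^sup>2)"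
        using zero_le_power2[of "norm_L2 (\<lambda>x. f s (X s x) - f t (X t x))"] unfolding norm_L2_sq .
      ultimately show "dist (mean (\<lambda>x. (f s (X s x) - f t (X t x))\<^sup>2)) 0 < e" by (simp add: dist_real_def)
    qed
  qed
  from tendsto_real_sqrt[OF this] show ?thesis by (simp add: norm_L2_def mean_def)
qed

lemma u_L2_continuous:
  assumes "0 \<le> t"
  shows "((\<lambda>s. norm_L2 (\<lambda>x. u s x - u t x)) \<longlongrightarrow> 0) (at t within {0..})"
  unfolding u_def
proof (rule transported_L2_continuous[of U "\<lambda>_. ub" gbnd, OF _ _ _ assms])
  show "\<bar>U s \<xi>\<bar> \<le> ub" for s \<xi> using U_bound[of s \<xi>] by (simp add: ub_def)
  show "\<bar>U s \<xi> - U t \<xi>\<bar> \<le> gbnd T * \<bar>s - t\<bar>" if "0 \<le> s" "s \<le> T" "0 \<le> t" "t \<le> T" for s t T \<xi>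
    by (rule lipschitz_ray[OF U_deriv G_bound that])
qed measurable

lemma quotient_bound:
  assumes "r \<le> T" "\<bar>x\<bar> \<le> A"
  shows "\<bar>x / (J r \<xi> * J r \<xi>)\<bar> \<le> A / (low T * low T)"
proof -
  have "low T * low T \<le> J r \<xi> * J r \<xi>"
    using J_ge_low[OF assms(1), of \<xi>] low_pos[of T] by (intro mult_mono) auto
  moreover have "0 < low T * low T" using low_pos[of T] by simp
  moreover have "0 \<le> A" using assms(2) by linarith
  ultimately have "\<bar>x\<bar> / (J r \<xi> * J r \<xi>) \<le> A / (low T * low T)" using assms(2) by (intro frac_le) auto
  then show ?thesis by (simp add: abs_mult)
qed

lemma w_L2_continuous:
  assumes "0 \<le> t"
  shows "((\<lambda>s. norm_L2 (\<lambda>x. w s x - w t x)) \<longlongrightarrow> 0) (at t within {0..})"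
  unfolding w_def
proof (rule transported_L2_continuous[of "\<lambda>s \<xi>. - N s \<xi> / J s \<xi>" "\<lambda>T. bnd T / low T"
      "\<lambda>T. (bnd' T * bnd T + bnd T * bnd T) / (low T * low T)", OF _ _ _ assms])
  show "\<bar>- N s \<xi> / J s \<xi>\<bar> \<le> bnd T / low T" if "s \<le> T" for s T \<xi>
    using euler_bound(2)[OF that, of "\<phi> s \<xi>"] by (simp add: w_def)
  show "\<bar>- N s \<xi> / J s \<xi> - - N t \<xi> / J t \<xi>\<bar> \<le> (bnd' T * bnd T + bnd T * bnd T) / (low T * low T) * \<bar>s - t\<bar>"
    if "0 \<le> s" "s \<le> T" "0 \<le> t" "t \<le> T" for s t T \<xi>
  proof (rule lipschitz_ray[OF _ _ that])
    show "((\<lambda>r. - N r \<xi> / J r \<xi>) has_real_derivative (- N' r \<xi> * J r \<xi> - - N r \<xi> * N r \<xi>) / (J r \<xi> * J r \<xi>)) (at r within {0..})"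
      if "0 \<le> r" for r
      using J_pos[of r \<xi>] by (intro DERIV_divide DERIV_minus N_deriv J_deriv that) auto
    show "\<bar>(- N' r \<xi> * J r \<xi> - - N r \<xi> * N r \<xi>) / (J r \<xi> * J r \<xi>)\<bar> \<le> (bnd' T * bnd T + bnd T * bnd T) / (low T * low T)"
      if "r \<le> T" for r
    proof (rule quotient_bound[OF that])
      have "\<bar>N' r \<xi> * J r \<xi>\<bar> \<le> bnd' T * bnd T" "\<bar>N r \<xi> * N r \<xi>\<bar> \<le> bnd T * bnd T"
        unfolding abs_mult using bnd_nonneg bnd'_nonneg by (intro mult_mono fields_bound that; simp)+
      then show "\<bar>- N' r \<xi> * J r \<xi> - - N r \<xi> * N r \<xi>\<bar> \<le> bnd' T * bnd T + bnd T * bnd T" by linarith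
    qed
  qed
qed measurable

lemma \<rho>_L2_continuous:
  assumes "0 \<le> t"
  shows "((\<lambda>s. norm_L2 (\<lambda>x. \<rho> s x - \<rho> t x)) \<longlongrightarrow> 0) (at t within {0..})"
  unfolding \<rho>_def
proof (rule transported_L2_continuous[of "\<lambda>s \<xi>. 2 * q \<xi> / J s \<xi>" "\<lambda>T. 2 * D / low T"
      "\<lambda>T. (2 * D * bnd T) / (low T * low T)", OF _ _ _ assms])
  show "\<bar>2 * q \<xi> / J s \<xi>\<bar> \<le> 2 * D / low T" if "s \<le> T" for s T \<xi>
    using euler_bound(3)[OF that, of "\<phi> s \<xi>"] by (simp add: \<rho>_def)
  show "\<bar>2 * q \<xi> / J s \<xi> - 2 * q \<xi> / J t \<xi>\<bar> \<le> (2 * D * bnd T) / (low T * low T) * \<bar>s - t\<bar>"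
    if "0 \<le> s" "s \<le> T" "0 \<le> t" "t \<le> T" for s t T \<xi>
  proof (rule lipschitz_ray[OF _ _ that])
    show "((\<lambda>r. 2 * q \<xi> / J r \<xi>) has_real_derivative (0 * J r \<xi> - 2 * q \<xi> * N r \<xi>) / (J r \<xi> * J r \<xi>)) (at r within {0..})"
      if "0 \<le> r" for r
      using J_pos[of r \<xi>] by (intro DERIV_divide DERIV_const J_deriv that) auto
    show "\<bar>(0 * J r \<xi> - 2 * q \<xi> * N r \<xi>) / (J r \<xi> * J r \<xi>)\<bar> \<le> (2 * D * bnd T) / (low T * low T)"
      if "r \<le> T" for r
    proof (rule quotient_bound[OF that])
      have "\<bar>2 * q \<xi>\<bar> \<le> 2 * D" using q_bound[of \<xi>] by simp
      then have "\<bar>2 * q \<xi> * N r \<xi>\<bar> \<le> 2 * D * bnd T"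
        unfolding abs_mult[of "2 * q \<xi>"] using D_pos by (intro mult_mono fields_bound that) auto
      then show "\<bar>0 * J r \<xi> - 2 * q \<xi> * N r \<xi>\<bar> \<le> 2 * D * bnd T" by simp
    qed
  qed
qed measurable

end

context lagrangian_data
begin

section \<open>Regularity of the solution\<close>

lemma euler_spaces: "u t \<in> L2" "u t \<in> Linf" "w t \<in> L2" "w t \<in> Linf" "\<rho> t \<in> L2" "\<rho> t \<in> Linf"
proof -
  have m: "u t \<in> borel_measurable borel" "w t \<in> borel_measurable borel" "\<rho> t \<in> borel_measurable borel"
    by measurable
  show "u t \<in> L2" "u t \<in> Linf"
    by (rule bounded_periodic_spaces[OF m(1) euler_bound(1)[OF order_refl]], rule euler_periodic)+
  show "w t \<in> L2" "w t \<in> Linf"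
    by (rule bounded_periodic_spaces[OF m(2) euler_bound(2)[OF order_refl]], rule euler_periodic)+
  show "\<rho> t \<in> L2" "\<rho> t \<in> Linf"
    by (rule bounded_periodic_spaces[OF m(3) euler_bound(3)[OF order_refl]], rule euler_periodic)+
qed

lemma w_circle: "w t \<in> borel_measurable circle"
  by (rule borel_measurable_circle) measurable

lemma norm_weak_deriv_u:
  "norm_L2 (weak_deriv (u t)) = norm_L2 (w t)" "norm_Linf (weak_deriv (u t)) = norm_Linf (w t)"
  using norm_L2_cong_AE[OF weak_deriv_circle[OF u_weak_deriv] w_circle weak_deriv_AE[OF u_weak_deriv]]
    norm_Linf_cong_AE[OF weak_deriv_circle[OF u_weak_deriv] w_circle weak_deriv_AE[OF u_weak_deriv]] by auto

lemma energy_norms: "(norm_L2 (weak_deriv (u t)))\<^sup>2 + (norm_L2 (\<rho> t))\<^sup>2 = 4 * e0"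
  unfolding norm_weak_deriv_u norm_L2_sq by (rule energy)

lemma z_in_space: "(u t, \<rho> t) \<in> H1 \<times> L2"
proof -
  have "u t \<in> H1" unfolding H1_def using euler_spaces(1,3) u_weak_deriv by blast
  then show ?thesis using euler_spaces(5) by simp
qed

lemma z_C_into: "(\<lambda>t. (u t, \<rho> t)) \<in> C_into {0..} (H1 \<times> L2) norm_H1_L2"
  unfolding C_into_def
proof (intro CollectI ballI conjI z_in_space)
  fix t :: real assume "t \<in> {0..}"
  then have t: "0 \<le> t" by simp
  have eq: "norm_H1_L2 ((u s, \<rho> s) - (u t, \<rho> t)) =
      sqrt ((norm_L2 (\<lambda>x. u s x - u t x))\<^sup>2 + (norm_L2 (\<lambda>x. w s x - w t x))\<^sup>2 + (norm_L2 (\<lambda>x. \<rho> s x - \<rho> t x))\<^sup>2)" for s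
  proof -
    note wd = is_weak_deriv_diff[OF u_weak_deriv[of s] u_weak_deriv[of t]]
    have "norm_L2 (weak_deriv (u s - u t)) = norm_L2 (w s - w t)"
      by (rule norm_L2_cong_AE[OF weak_deriv_circle[OF wd] _ weak_deriv_AE[OF wd]])
         (use w_circle[of s] w_circle[of t] in \<open>simp add: fun_diff_def\<close>)
    then show ?thesis
      by (simp add: norm_H1_L2_def norm_H1_def fun_diff_def)
  qed
  have "((\<lambda>s. sqrt ((norm_L2 (\<lambda>x. u s x - u t x))\<^sup>2 + (norm_L2 (\<lambda>x. w s x - w t x))\<^sup>2 + (norm_L2 (\<lambda>x. \<rho> s x - \<rho> t x))\<^sup>2))
      \<longlongrightarrow> sqrt (0\<^sup>2 + 0\<^sup>2 + 0\<^sup>2)) (at t within {0..})"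
    by (intro tendsto_intros u_L2_continuous w_L2_continuous \<rho>_L2_continuous t)
  then show "((\<lambda>s. norm_H1_L2 ((u s, \<rho> s) - (u t, \<rho> t))) \<longlongrightarrow> 0) (at t within {0..})"
    unfolding eq by simp
qed

lemma z_bounded: "norm_H1_L2 (u t, \<rho> t) \<le> sqrt (ub\<^sup>2 + 4 * e0)"
proof -
  have "norm_L2 (u t) \<le> ub"
    by (rule bounded_periodic_spaces(5)[OF _ euler_bound(1)[OF order_refl]]) (measurable, rule euler_periodic)
  then have "(norm_L2 (u t))\<^sup>2 \<le> ub\<^sup>2" using norm_L2_nonneg by (intro power_mono)
  then show ?thesis using energy_norms[of t] by (simp add: norm_H1_L2_def norm_H1_def)
qed

lemma z_strongly_measurable:
  "I \<in> sets borel \<Longrightarrow> I \<subseteq> {0..} \<Longrightarrow> strongly_measurable I (H1 \<times> L2) norm_H1_L2 (\<lambda>t. (u t, \<rho> t))"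
  by (rule C_into_strongly_measurable[OF z_C_into norm_H1_L2_zero])

lemma z_Linf_into: "(\<lambda>t. (u t, \<rho> t)) \<in> Linf_into {0..} (H1 \<times> L2) norm_H1_L2"
  unfolding Linf_into_def using z_in_space z_strongly_measurable[of "{0..}"] z_bounded
  by (auto intro!: exI[of _ "sqrt (ub\<^sup>2 + 4 * e0)"] AE_I2)

lemma z_Linf_loc_into: "(\<lambda>t. (u t, \<rho> t)) \<in> Linf_loc_into {0<..} (H1 \<times> L2) norm_H1_L2"
proof -
  have "locally_ess_bounded {0<..} (\<lambda>t. norm_H1_L2 (u t, \<rho> t))"
    by (rule locally_ess_boundedI) (use z_bounded in blast)
  moreover have "strongly_measurable {0<..} (H1 \<times> L2) norm_H1_L2 (\<lambda>t. (u t, \<rho> t))"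
    by (rule z_strongly_measurable) auto
  ultimately show ?thesis using z_in_space by (auto simp: Linf_loc_into_def)
qed

lemma u_Linf_loc_W1inf: "u \<in> Linf_loc_W1inf {0..}"
  unfolding Linf_loc_W1inf_def
proof (intro CollectI conjI ballI)
  show "u t \<in> W1inf" for t unfolding W1inf_def using euler_spaces(2,4) u_weak_deriv by blast
  show "weakstar_measurable {0..} u" by (rule weakstar_measurableI) measurable
  show "weakstar_measurable {0..} (\<lambda>t. weak_deriv (u t))"
  proof (rule weakstar_measurable_cong[of _ w])
    show "weakstar_measurable {0..} w" by (rule weakstar_measurableI) measurable
    show "AE x in circle. w t x = weak_deriv (u t) x" for t
      using weak_deriv_AE[OF u_weak_deriv] by eventually_elim (rule sym)
  qed (rule w_circle, rule weak_deriv_circle[OF u_weak_deriv])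
  show "locally_ess_bounded {0..} (\<lambda>t. norm_W1inf (u t))"
  proof (rule locally_ess_boundedI)
    fix T
    have "norm_W1inf (u t) \<le> ub + bnd T / low T" if "t \<le> T" for t
    proof -
      have "norm_Linf (u t) \<le> ub"
        by (rule bounded_periodic_spaces(4)[OF _ euler_bound(1)[OF that]]) (measurable, rule euler_periodic)
      moreover have "norm_Linf (w t) \<le> bnd T / low T"
        by (rule bounded_periodic_spaces(4)[OF _ euler_bound(2)[OF that]]) (measurable, rule euler_periodic)
      ultimately show ?thesis by (simp add: norm_W1inf_def norm_weak_deriv_u)
    qed
    then show "\<exists>M. \<forall>t\<in>{0..}. t \<le> T \<longrightarrow> norm_W1inf (u t) \<le> M" by blast
  qed
qed

lemma \<rho>_Linf_loc_Linf: "\<rho> \<in> Linf_loc_Linf {0..}"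
  unfolding Linf_loc_Linf_def
proof (intro CollectI conjI ballI)
  show "\<rho> t \<in> Linf" for t by (rule euler_spaces)
  show "weakstar_measurable {0..} \<rho>" by (rule weakstar_measurableI) measurable
  show "locally_ess_bounded {0..} (\<lambda>t. norm_Linf (\<rho> t))"
  proof (rule locally_ess_boundedI)
    fix T
    have "norm_Linf (\<rho> t) \<le> 2 * D / low T" if "t \<le> T" for t
      by (rule bounded_periodic_spaces(4)[OF _ euler_bound(3)[OF that]]) (measurable, rule euler_periodic)
    then show "\<exists>M. \<forall>t\<in>{0..}. t \<le> T \<longrightarrow> norm_Linf (\<rho> t) \<le> M" by blast
  qed
qed

section \<open>The initial values\<close>

text \<open>
  Both the velocity along a characteristic and the label at a given point are Lipschitz in time, and the
  initial velocity is Lipschitz in the label. So \<open>u t\<close> converges uniformly.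
\<close>

lemma tends_u:
  assumes u0: "AE x in circle. u\<^sub>0 x = u 0 x" and per: "\<And>x. u\<^sub>0 (x + 1) = u\<^sub>0 x"
  shows "tends_distributionally u u\<^sub>0"
  unfolding tends_distributionally_def
proof (intro allI impI)
  fix \<psi> :: "real \<Rightarrow> real" assume "test_fun UNIV \<psi>"
  then obtain R L where \<psi>: "0 \<le> R" "0 \<le> L" "\<And>x. R < \<bar>x\<bar> \<Longrightarrow> \<psi> x = 0" "\<And>x y. \<bar>\<psi> x - \<psi> y\<bar> \<le> L * \<bar>x - y\<bar>"
    "continuous_on UNIV \<psi>" "integrable lborel (\<lambda>x. \<bar>\<psi> x\<bar>)" using test_fun_real by metis
  have m\<psi> [measurable]: "\<psi> \<in> borel_measurable borel" by (rule borel_measurable_continuous_onI[OF \<psi>(5)])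
  then have i\<psi>: "integrable lborel \<psi>" using \<psi>(6) integrable_abs_iff[of \<psi> lborel] by simp
  have I: "integrable lborel (\<lambda>x. u t x * \<psi> x)" for t
    using integrable_mult_bounded[OF i\<psi>, of "u t" ub] euler_bound(1)[OF order_refl] by (simp add: mult.commute)
  have lb: "(LINT x|lebesgue. u t x * \<psi> x) = (LINT x|lborel. u t x * \<psi> x)" for t
    by (rule integral_lebesgue_lborel) measurable
  have ae: "AE x in lebesgue. u\<^sub>0 x = u 0 x"
    by (rule AE_circle_imp_AE_lebesgue[OF u0]) (simp add: per euler_periodic)
  have init: "(LINT x|lebesgue. u\<^sub>0 x * \<psi> x) = (LINT x|lborel. u 0 x * \<psi> x)"
  proof -
    have um: "(\<lambda>x. u 0 x * \<psi> x) \<in> borel_measurable lebesgue" by (rule measurable_completion) measurable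
    have ae': "AE x in lebesgue. u 0 x * \<psi> x = u\<^sub>0 x * \<psi> x" using ae by eventually_elim simp
    have "(LINT x|lebesgue. u\<^sub>0 x * \<psi> x) = (LINT x|lebesgue. u 0 x * \<psi> x)"
    proof (rule integral_cong_AE[OF borel_measurable_AE[OF um ae'] um])
      show "AE x in lebesgue. u\<^sub>0 x * \<psi> x = u 0 x * \<psi> x" using ae by eventually_elim simp
    qed
    then show ?thesis using lb by simp
  qed
  define C where "C = gbnd 1 + bnd 0 * ub"
  have diff: "\<bar>u t x - u 0 x\<bar> \<le> C * t" if "0 \<le> t" "t \<le> 1" for t x
  proof -
    have "\<bar>U t (X t x) - U 0 (X t x)\<bar> \<le> gbnd 1 * \<bar>t - 0\<bar>"
      by (rule lipschitz_ray[OF U_deriv G_bound]) (use that in auto)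
    moreover have "\<bar>U 0 (X t x) - U 0 x\<bar> \<le> bnd 0 * \<bar>X t x - x\<bar>"
      by (rule primitive_lipschitz[OF U_primitive]) (use fields_bound(2)[of 0 0] in simp)
    moreover have "bnd 0 * \<bar>X t x - x\<bar> \<le> bnd 0 * (ub * t)"
      using X_near[of t x] that bnd_nonneg by (intro mult_left_mono) auto
    ultimately show ?thesis using that by (simp add: u_def X_0 C_def algebra_simps)
  qed
  have "((\<lambda>t. (LINT x|lborel. u t x * \<psi> x) - (LINT x|lborel. u 0 x * \<psi> x)) \<longlongrightarrow> 0) (at_right 0)"
  proof (rule Lim_null_comparison)
    show "\<forall>\<^sub>F t in at_right 0. norm ((LINT x|lborel. u t x * \<psi> x) - (LINT x|lborel. u 0 x * \<psi> x))
        \<le> C * t * (LINT x|lborel. \<bar>\<psi> x\<bar>)"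
    proof (rule eventually_at_rightI[of 0 1])
      fix t :: real assume t: "t \<in> {0<..<1}"
      have eq: "(LINT x|lborel. u t x * \<psi> x) - (LINT x|lborel. u 0 x * \<psi> x) = (LINT x|lborel. (u t x - u 0 x) * \<psi> x)"
        using I by (simp add: left_diff_distrib)
      have "norm ((LINT x|lborel. u t x * \<psi> x) - (LINT x|lborel. u 0 x * \<psi> x)) \<le> (LINT x|lborel. norm ((u t x - u 0 x) * \<psi> x))"
        unfolding eq by (rule integral_norm_bound)
      also have "\<dots> \<le> (LINT x|lborel. C * t * \<bar>\<psi> x\<bar>)"
      proof (rule integral_mono')
        show "integrable lborel (\<lambda>x. C * t * \<bar>\<psi> x\<bar>)" using \<psi>(6) by simp
        show "norm ((u t x - u 0 x) * \<psi> x) \<le> C * t * \<bar>\<psi> x\<bar>" for x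
          using diff[of t x] t by (simp add: abs_mult mult_right_mono)
        show "0 \<le> C * t * \<bar>\<psi> x\<bar>" for x
        proof (rule mult_nonneg_nonneg)
          show "0 \<le> C * t" using order_trans[OF abs_ge_zero diff[of t x]] t by simp
        qed simp
      qed
      finally show "norm ((LINT x|lborel. u t x * \<psi> x) - (LINT x|lborel. u 0 x * \<psi> x)) \<le> C * t * (LINT x|lborel. \<bar>\<psi> x\<bar>)"
        by simp
    qed simp
    have "((\<lambda>t. C * t * (LINT x|lborel. \<bar>\<psi> x\<bar>)) \<longlongrightarrow> C * 0 * (LINT x|lborel. \<bar>\<psi> x\<bar>)) (at_right 0)"
      by (intro tendsto_intros)
    then show "((\<lambda>t. C * t * (LINT x|lborel. \<bar>\<psi> x\<bar>)) \<longlongrightarrow> 0) (at_right 0)" by simp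
  qed
  then show "((\<lambda>t. LINT x|lebesgue. u t x * \<psi> x) \<longlongrightarrow> (LINT x|lebesgue. u\<^sub>0 x * \<psi> x)) (at_right 0)"
    unfolding lb init by (rule LIM_zero_cancel)
qed

text \<open>
  In Lagrangian coordinates the integral against a test function \<open>\<psi>\<close> is that of \<open>2 q\<close> against \<open>\<psi> \<circ> \<phi> t\<close>,
  where only the second, Lipschitz, factor depends on time.
\<close>

lemma tends_\<rho>:
  assumes \<rho>0: "AE x in circle. \<rho>\<^sub>0 x = 2 * q x" and per: "\<And>x. \<rho>\<^sub>0 (x + 1) = \<rho>\<^sub>0 x"
  shows "tends_distributionally \<rho> \<rho>\<^sub>0"
  unfolding tends_distributionally_def
proof (intro allI impI)
  fix \<psi> :: "real \<Rightarrow> real" assume "test_fun UNIV \<psi>"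
  then obtain R L where \<psi>: "0 \<le> R" "0 \<le> L" "\<And>x. R < \<bar>x\<bar> \<Longrightarrow> \<psi> x = 0" "\<And>x y. \<bar>\<psi> x - \<psi> y\<bar> \<le> L * \<bar>x - y\<bar>"
    "continuous_on UNIV \<psi>" "integrable lborel (\<lambda>x. \<bar>\<psi> x\<bar>)" using test_fun_real by metis
  have m\<psi> [measurable]: "\<psi> \<in> borel_measurable borel" by (rule borel_measurable_continuous_onI[OF \<psi>(5)])
  have ae: "AE x in lebesgue. \<rho>\<^sub>0 x = 2 * q x"
    by (rule AE_circle_imp_AE_lebesgue[OF \<rho>0]) (simp add: per q_periodic)
  have init: "(LINT x|lebesgue. \<rho>\<^sub>0 x * \<psi> x) = (LINT x|lborel. 2 * q x * \<psi> x)"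
  proof -
    have um: "(\<lambda>x. 2 * q x * \<psi> x) \<in> borel_measurable lebesgue" by (rule measurable_completion) measurable
    have ae': "AE x in lebesgue. 2 * q x * \<psi> x = \<rho>\<^sub>0 x * \<psi> x" using ae by eventually_elim simp
    have "(LINT x|lebesgue. \<rho>\<^sub>0 x * \<psi> x) = (LINT x|lebesgue. 2 * q x * \<psi> x)"
    proof (rule integral_cong_AE[OF borel_measurable_AE[OF um ae'] um])
      show "AE x in lebesgue. \<rho>\<^sub>0 x * \<psi> x = 2 * q x * \<psi> x" using ae by eventually_elim simp
    qed
    also have "\<dots> = (LINT x|lborel. 2 * q x * \<psi> x)" by (rule integral_lebesgue_lborel) measurable
    finally show ?thesis .
  qed
  have lb: "(LINT x|lebesgue. \<rho> t x * \<psi> x) = (LINT \<xi>|lborel. 2 * q \<xi> * \<psi> (\<phi> t \<xi>))" for t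
  proof -
    have "(LINT x|lebesgue. \<rho> t x * \<psi> x) = (LINT x|lborel. \<rho> t x * \<psi> x)" by (rule integral_lebesgue_lborel) measurable
    also have "\<dots> = (LINT \<xi>|lborel. J t \<xi> * (\<rho> t (\<phi> t \<xi>) * \<psi> (\<phi> t \<xi>)))" by (rule \<phi>_change) measurable
    also have "\<dots> = (LINT \<xi>|lborel. 2 * q \<xi> * \<psi> (\<phi> t \<xi>))"
    proof (rule Bochner_Integration.integral_cong[OF refl])
      fix \<xi>
      have "J t \<xi> \<noteq> 0" using J_pos[of t \<xi>] by simp
      then show "J t \<xi> * (\<rho> t (\<phi> t \<xi>) * \<psi> (\<phi> t \<xi>)) = 2 * q \<xi> * \<psi> (\<phi> t \<xi>)" by (simp add: \<rho>_def)
    qed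
    finally show ?thesis .
  qed
  \<comment> \<open>Up to time one no characteristic moves farther than \<open>ub\<close>.\<close>
  define R' where "R' = R + ub"
  have near: "\<bar>2 * q \<xi> * \<psi> (\<phi> t \<xi>) - 2 * q \<xi> * \<psi> \<xi>\<bar> \<le> indicator {-R'..R'} \<xi> * (2 * D * (L * (ub * t)))"
    if t: "0 \<le> t" "t \<le> 1" for t \<xi>
  proof (cases "\<xi> \<in> {-R'..R'}")
    case True
    have "\<bar>\<psi> (\<phi> t \<xi>) - \<psi> \<xi>\<bar> \<le> L * (ub * t)"
      using order_trans[OF \<psi>(4) mult_left_mono[OF \<phi>_near \<psi>(2)], of t \<xi>] t by simp
    then have "\<bar>2 * q \<xi>\<bar> * \<bar>\<psi> (\<phi> t \<xi>) - \<psi> \<xi>\<bar> \<le> 2 * D * (L * (ub * t))"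
      using q_bound[of \<xi>] D_pos by (intro mult_mono) auto
    then show ?thesis using True by (simp add: abs_mult[symmetric] right_diff_distrib)
  next
    case False
    then have "R' < \<bar>\<xi>\<bar>" by auto
    moreover have "ub * \<bar>t\<bar> \<le> ub * 1" using t ub_nonneg by (intro mult_left_mono) auto
    ultimately have "R < \<bar>\<phi> t \<xi>\<bar>" "R < \<bar>\<xi>\<bar>" using \<phi>_near[of t \<xi>] ub_nonneg unfolding R'_def by linarith+
    then show ?thesis using \<psi>(3) False by simp
  qed
  have I: "integrable lborel (\<lambda>\<xi>. 2 * q \<xi> * \<psi> (\<phi> t \<xi>))" if t: "0 \<le> t" "t \<le> 1" for t
  proof -
    have "integrable lborel \<psi>" using \<psi>(6) integrable_abs_iff[of \<psi> lborel] by simp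
    then have i0: "integrable lborel (\<lambda>\<xi>. 2 * q \<xi> * \<psi> \<xi>)"
      using integrable_mult_bounded[of lborel \<psi> "\<lambda>\<xi>. 2 * q \<xi>" "2 * D"] q_bound by (simp add: mult.commute abs_mult)
    have "integrable lborel (\<lambda>\<xi>. 2 * q \<xi> * \<psi> (\<phi> t \<xi>) - 2 * q \<xi> * \<psi> \<xi>)"
    proof (rule Bochner_Integration.integrable_bound[where f="\<lambda>\<xi>. indicator {-R'..R'} \<xi> * (2 * D * (L * (ub * t)))"])
      show "integrable lborel (\<lambda>\<xi>. indicator {-R'..R'} \<xi> * (2 * D * (L * (ub * t))))"
        by (intro integrable_mult_left integrable_real_indicator) (auto simp: emeasure_lborel_Icc_eq)
      show "AE \<xi> in lborel. norm (2 * q \<xi> * \<psi> (\<phi> t \<xi>) - 2 * q \<xi> * \<psi> \<xi>) \<le> norm (indicator {-R'..R'} \<xi> * (2 * D * (L * (ub * t))))"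
        using near[OF t] by (intro AE_I2) (simp, meson abs_ge_self order_trans)
    qed measurable
    from Bochner_Integration.integrable_add[OF this i0] show ?thesis by simp
  qed
  have "((\<lambda>t. (LINT \<xi>|lborel. 2 * q \<xi> * \<psi> (\<phi> t \<xi>)) - (LINT \<xi>|lborel. 2 * q \<xi> * \<psi> \<xi>)) \<longlongrightarrow> 0) (at_right 0)"
  proof (rule Lim_null_comparison)
    let ?b = "\<lambda>t. (LINT \<xi>|lborel. indicator {-R'..R'} \<xi>) * (2 * D * (L * (ub * t)))"
    show "\<forall>\<^sub>F t in at_right 0. norm ((LINT \<xi>|lborel. 2 * q \<xi> * \<psi> (\<phi> t \<xi>)) - (LINT \<xi>|lborel. 2 * q \<xi> * \<psi> \<xi>)) \<le> ?b t"
    proof (rule eventually_at_rightI[of 0 1])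
      fix t :: real assume "t \<in> {0<..<1}"
      then have t: "0 \<le> t" "t \<le> 1" by auto
      have eq: "(LINT \<xi>|lborel. 2 * q \<xi> * \<psi> (\<phi> t \<xi>)) - (LINT \<xi>|lborel. 2 * q \<xi> * \<psi> \<xi>)
          = (LINT \<xi>|lborel. 2 * q \<xi> * \<psi> (\<phi> t \<xi>) - 2 * q \<xi> * \<psi> \<xi>)"
        using I[OF t] I[of 0] by (simp add: \<phi>_0)
      have "norm ((LINT \<xi>|lborel. 2 * q \<xi> * \<psi> (\<phi> t \<xi>)) - (LINT \<xi>|lborel. 2 * q \<xi> * \<psi> \<xi>))
          \<le> (LINT \<xi>|lborel. norm (2 * q \<xi> * \<psi> (\<phi> t \<xi>) - 2 * q \<xi> * \<psi> \<xi>))"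
        unfolding eq by (rule integral_norm_bound)
      also have "\<dots> \<le> (LINT \<xi>|lborel. indicator {-R'..R'} \<xi> * (2 * D * (L * (ub * t))))"
      proof (rule integral_mono')
        show "integrable lborel (\<lambda>\<xi>. indicator {-R'..R'} \<xi> * (2 * D * (L * (ub * t))))"
          by (intro integrable_mult_left integrable_real_indicator) (auto simp: emeasure_lborel_Icc_eq)
        show "norm (2 * q \<xi> * \<psi> (\<phi> t \<xi>) - 2 * q \<xi> * \<psi> \<xi>) \<le> indicator {-R'..R'} \<xi> * (2 * D * (L * (ub * t)))" for \<xi>
          using near[OF t] by simp
        show "0 \<le> indicator {-R'..R'} \<xi> * (2 * D * (L * (ub * t)))" for \<xi>
          by (rule order_trans[OF abs_ge_zero near[OF t]])
      qed
      finally show "norm ((LINT \<xi>|lborel. 2 * q \<xi> * \<psi> (\<phi> t \<xi>)) - (LINT \<xi>|lborel. 2 * q \<xi> * \<psi> \<xi>)) \<le> ?b t" by simp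
    qed simp
    have "(?b \<longlongrightarrow> (LINT \<xi>|lborel. indicator {-R'..R'} \<xi>) * (2 * D * (L * (ub * 0)))) (at_right 0)"
      by (intro tendsto_intros)
    then show "(?b \<longlongrightarrow> 0) (at_right 0)" by simp
  qed
  then show "((\<lambda>t. LINT x|lebesgue. \<rho> t x * \<psi> x) \<longlongrightarrow> (LINT x|lebesgue. \<rho>\<^sub>0 x * \<psi> x)) (at_right 0)"
    unfolding lb init by (rule LIM_zero_cancel)
qed

lemma w_0: "w 0 x = - 2 * p x"
  by (simp add: w_def X_0 fields_0)

end

section \<open>Existence of admissible weak solutions\<close>

lemma Linf_AE_bound:
  assumes "f \<in> Linf"
  obtains C where "0 \<le> C" "AE x in circle. \<bar>f x\<bar> \<le> C"
proof -
  obtain r where r: "esssup circle (\<lambda>x. ereal \<bar>f x\<bar>) \<le> ereal r"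
    using assms unfolding Linf_def by (cases "esssup circle (\<lambda>x. ereal \<bar>f x\<bar>)") (auto intro: that)
  have "AE x in circle. \<bar>f x\<bar> \<le> \<bar>r\<bar>"
    using esssup_AE[of "\<lambda>x. ereal \<bar>f x\<bar>" circle]
  proof eventually_elim
    case (elim x)
    then have "ereal \<bar>f x\<bar> \<le> ereal r" using r by (rule order_trans)
    then show ?case by simp
  qed
  then show ?thesis using that[of "\<bar>r\<bar>"] by simp
qed

theorem theorem1p1:
  fixes \<gamma> :: real and u\<^sub>0 \<rho>\<^sub>0 :: "real \<Rightarrow> real"
  assumes "u\<^sub>0 \<in> W1inf" and "\<rho>\<^sub>0 \<in> Linf"
    and "\<exists>\<alpha>>0. AE x in circle. \<rho>\<^sub>0 x \<ge> \<alpha>"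
  shows "\<exists>u \<rho> :: real \<Rightarrow> real \<Rightarrow> real.
    admissible_weak_solution \<gamma> u\<^sub>0 \<rho>\<^sub>0 u \<rho> \<and>
    (\<lambda>t. (u t, \<rho> t)) \<in> C_into {0..} (H1 \<times> L2) norm_H1_L2 \<inter> Linf_into {0..} (H1 \<times> L2) norm_H1_L2 \<and>
    u \<in> Linf_loc_W1inf {0..} \<and>
    \<rho> \<in> Linf_loc_Linf {0..}"
proof -
  obtain g where g: "g \<in> Linf" "is_weak_deriv u\<^sub>0 g" using assms(1) by (auto simp: W1inf_def)
  obtain \<alpha> where \<alpha>: "\<alpha> > 0" "AE x in circle. \<rho>\<^sub>0 x \<ge> \<alpha>" using assms(3) by blast
  obtain C1 where C1: "0 \<le> C1" "AE x in circle. \<bar>g x\<bar> \<le> C1" using Linf_AE_bound[OF g(1)] by blast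
  obtain C2 where C2: "0 \<le> C2" "AE x in circle. \<bar>\<rho>\<^sub>0 x\<bar> \<le> C2" using Linf_AE_bound[OF assms(2)] by blast
  have gm: "g \<in> borel_measurable circle" and \<rho>m: "\<rho>\<^sub>0 \<in> borel_measurable circle"
    and \<rho>per: "periodic_fun_simple' \<rho>\<^sub>0" and uper: "periodic_fun_simple' u\<^sub>0"
    using g(1) assms(1,2) by (auto simp: Linf_def W1inf_def)
  have "AE x in circle. - C1 \<le> g x \<and> g x \<le> C1" using C1(2) by eventually_elim auto
  moreover have "- C1 \<le> C1" using C1(1) by simp
  ultimately have g_le: "AE x in circle. - C1 \<le> g x \<and> g x \<le> C1" "- C1 \<le> C1" by blast+
  obtain g' where g': "g' \<in> borel_measurable borel" "\<And>x. g' (x + 1) = g' x" "\<And>x. - C1 \<le> g' x" "\<And>x. g' x \<le> C1"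
    "AE x in circle. g x = g' x"
    using bounded_borel_representative[OF gm g_le] by blast
  have \<rho>_le: "AE x in circle. \<alpha> \<le> \<rho>\<^sub>0 x \<and> \<rho>\<^sub>0 x \<le> max \<alpha> C2"
    using \<alpha>(2) C2(2) by eventually_elim auto
  obtain r where r: "r \<in> borel_measurable borel" "\<And>x. r (x + 1) = r x" "\<And>x. \<alpha> \<le> r x" "\<And>x. r x \<le> max \<alpha> C2"
    "AE x in circle. \<rho>\<^sub>0 x = r x"
    using bounded_borel_representative[OF \<rho>m \<rho>_le max.cobounded1] by blast
  \<comment> \<open>At time zero \<open>J = 1\<close> and \<open>N = 2 p\<close>, so that \<open>w = - 2 p\<close> and \<open>\<rho> = 2 q\<close>.\<close>
  define p where "p x = - g' x / 2" for x
  define q where "q x = r x / 2" for x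
  define D where "D = max C1 (max \<alpha> C2)"
  have mean_g': "mean g' = 0"
  proof -
    \<comment> \<open>Test the weak derivative with a constant function.\<close>
    have "smooth (\<lambda>x::real. 1)" "periodic_fun_simple' (\<lambda>x::real. 1::real)"
      using trig_smooth[OF trig.const] by (auto simp: periodic_fun_simple'_def)
    from is_weak_derivD[OF g(2) this] have "(LINT x|circle. g x) = 0" by simp
    moreover have "(LINT x|circle. g x) = (LINT x|circle. g' x)"
      by (rule integral_cong_AE[OF gm borel_measurable_circle[OF g'(1)] g'(5)])
    ultimately show ?thesis by (simp add: mean_def)
  qed
  interpret lagrangian_data p q "mean u\<^sub>0" \<gamma> D "\<alpha> / 2"
  proof
    show "p \<in> borel_measurable borel" "q \<in> borel_measurable borel"
      unfolding p_def q_def using g'(1) r(1) by measurable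
    show "\<bar>p x\<bar> \<le> D" "\<bar>q x\<bar> \<le> D" for x
      using g'(3)[of x] g'(4)[of x] r(3)[of x] r(4)[of x] \<alpha>(1) C1(1) by (auto simp: p_def q_def D_def)
    show "p (x + 1) = p x" "q (x + 1) = q x" "\<alpha> / 2 \<le> q x" for x
      using g'(2) r(2,3) by (simp_all add: p_def q_def)
    show "mean p = 0" using mean_cmult[of "- 1/2" g'] mean_g' by (simp add: p_def[abs_def])
  qed (use \<alpha> in simp)
  have w0: "w 0 x = g' x" for x by (simp add: w_0 p_def)
  have "AE x in circle. g x = w 0 x" using g'(5) by (simp add: w0)
  \<comment> \<open>The constructed velocity has the right derivative at time zero and the right mean.\<close>
  from weak_deriv_mean_unique[OF g(2) u_weak_deriv this] have u0: "AE x in circle. u\<^sub>0 x = u 0 x"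
    by (simp add: mean_u)
  have \<rho>0: "AE x in circle. \<rho>\<^sub>0 x = 2 * q x" using r(5) by (simp add: q_def)
  have "(norm_L2 (weak_deriv u\<^sub>0))\<^sup>2 + (norm_L2 \<rho>\<^sub>0)\<^sup>2 = 4 * e0"
  proof -
    have "AE x in circle. weak_deriv u\<^sub>0 x = w 0 x"
      using weak_deriv_AE[OF g(2)] \<open>AE x in circle. g x = w 0 x\<close> by eventually_elim simp
    then have "norm_L2 (weak_deriv u\<^sub>0) = norm_L2 (w 0)"
      by (rule norm_L2_cong_AE[OF weak_deriv_circle[OF g(2)] w_circle])
    moreover have "norm_L2 \<rho>\<^sub>0 = norm_L2 (\<rho> 0)"
    proof (rule norm_L2_cong_AE[OF \<rho>m])
      show "\<rho> 0 \<in> borel_measurable circle" by (rule borel_measurable_circle) measurable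
      show "AE x in circle. \<rho>\<^sub>0 x = \<rho> 0 x" using \<rho>0 by (simp add: \<rho>_def X_0 fields_0)
    qed
    ultimately show ?thesis using energy[of 0] by (simp add: norm_L2_sq)
  qed
  then have "admissible_weak_solution \<gamma> u\<^sub>0 \<rho>\<^sub>0 u \<rho>"
    unfolding admissible_weak_solution_def solves_distributionally_def
    using z_Linf_loc_into mean_u momentum_equation continuity_equation energy_norms
      tends_u[OF u0 periodicD[OF uper]] tends_\<rho>[OF \<rho>0 periodicD[OF \<rho>per]] by simp
  then show ?thesis using z_C_into z_Linf_into u_Linf_loc_W1inf \<rho>_Linf_loc_Linf by blast
qed

end
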